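(* Let $\nu>0$, $\alpha>1/2$, $T>0$ and $s>3/2$. Let $\{\mu_n\}_{n\in\mathbb{N}}$ be a sequence of positive numbers with $\lim_{n\to\infty}\mu_n=0$. Assume that $\phi^{\mu_n}\in L_2(-\mu_n,0,V^{1+\alpha})$ with $\sup_{n\in\mathbb{N}}\|\phi^{\mu_n}\|_{L_2(-\mu_n,0,V^{1+\alpha})}<\infty$. Let $\{u_0^{\mu_n}\}_{n\in\mathbb{N}}\subset V^\alpha$ converge weakly in $V^0$ to $u_0\in V^0$, and let $f\in V^{\alpha-1}$. Let $u^{\mu_n}$ denote the weak solution on $[-\mu_n,T]$ of the 3D Navier-Stokes equations with constant delay $\mu_n$ (in the sense defined in the context) with $u^{\mu_n}(0)=u_0^{\mu_n}$ and $u^{\mu_n}(t)=\phi^{\mu_n}(t)$ for almost all $t\in[-\mu_n,0)$. Then one can extract a subsequence of $(u^{\mu_n})$ that converges in $L_2(0,T,V^0)\cap C([0,T],V^{-s})$ to a limit $u$. Moreover, $u$ is a weak solution of the 3D Navier-Stokes equations with $u(0)=u_0$, namely, for any $v\in V^1$ and any test function $\varphi\in C_0^\infty([0,T])$, $$-\int_0^T\langle u(r),v\rangle\varphi'(r)\,dr+\nu\int_0^T\langle A^{1/2}u(r),A^{1/2}v\rangle\varphi(r)\,dr+\int_0^T\langle B(u(r),u(r)),v\rangle\varphi(r)\,dr=\int_0^T\langle f,v\rangle\varphi(r)\,dr.$$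
   Context: Function spaces. Fix $L>0$ and let $\mathbb{T}^3_L$ be the three-dimensional torus of side length $L$. For $s\in\mathbb{R}$, $V^s$ is the space of real $L$-periodic divergence-free vector fields (distributions) $u=\sum_{\zeta}e^{i(x,\zeta)}\hat u(\zeta)$, $\zeta\in\frac{2\pi}{L}\mathbb{Z}^3$, with $\hat u(0)=0$, $\hat u(-\zeta)=\overline{\hat u(\zeta)}$, and finite norm $\|u\|_s=\big(L^3\sum_{\zeta\neq0}|\zeta|^{2s}|\hat u(\zeta)|^2\big)^{1/2}$. $(\cdot,\cdot)$ is the scalar product of $V^0$ (the $L_2$ scalar product). The Stokes operator is $A=-\Delta$, so $\|u\|_s=\|A^{s/2}u\|_0$. $V^{-s}$ is the dual of $V^s$, and $\langle\cdot,\cdot\rangle$ denotes the duality pairing between $V^s$ and $V^{-s}$ (extending $(\cdot,\cdot)$) for any $s$. Nonlinearity. $b(u,v,w)=\sum_{i,j=1}^3\int_{\mathbb{T}^3_L}u_j\frac{\partial v_i}{\partial x_j}w_i\,dx$, extended by continuity from trigonometric polynomials to $V^{s_1}\times V^{s_2+1}\times V^{s_3}$ whenever either $s_i+s_j\ge0$ for $i\ne j$ and $s_1+s_2+s_3>3/2$, or $s_i+s_j>0$ for $i\neq j$ and $s_1+s_2+s_3\ge3/2$. $B:V^{s_1}\times V^{s_2+1}\to V^{-s_3}$ is defined by $\langle B(u,v),w\rangle=b(u,v,w)$. Weak solution of the delay equation. For $\mu>0$, $u_0\in V^\alpha$, $\phi\in L_2(-\mu,0,V^{1+\alpha})$, $f\in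 V^{\alpha-1}$, the equation is $u'(t)+\nu Au(t)+B(u(t-\mu),u(t))=f$ for $t\ge0$, with $u(t)=\phi(t)$ for $t\in[-\mu,0)$ and $u(0)=u_0$. A weak solution on $[-\mu,T]$ is a function $u^\mu\in L_2(-\mu,T,V^{1+\alpha})$ with $u^\mu(0)=u_0$, $u^\mu(t)=\phi(t)$ for (almost all) $t\in[-\mu,0)$, such that for every $v\in V^{\alpha+1}$ and every test function $\varphi\in C_0^\infty([0,T])$ (smooth, compactly supported in $(0,T)$), $$-\int_0^T\langle u^\mu(r),v\rangle\varphi'(r)\,dr+\nu\int_0^T\langle A^{1/2}u^\mu(r),A^{1/2}v\rangle\varphi(r)\,dr+\int_0^T\langle B(u^\mu(r-\mu),u^\mu(r)),v\rangle\varphi(r)\,dr=\int_0^T\langle f,v\rangle\varphi(r)\,dr.$$ Such a weak solution exists and is unique, and its restriction to $[0,T]$ has a representative in $C([0,T],V^\alpha)$, to which $u^\mu(0)=u_0$ refers. Weak solution of the 3D Navier-Stokes equations. Being a weak solution includes $u\in L_2(0,T,V^1)$, so that all terms in the identity of the claim are meaningful. *)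

theory Defs
  imports "HOL-Analysis.Analysis"
begin

section \<open>The spaces \<open>V\<^sup>s\<close>\<close>

text \<open>A periodic (distributional) vector field \<open>\<Sum>\<^sub>\<zeta> e\<^bsup>i(x,\<zeta>)\<^esup> c(\<zeta>)\<close> is represented by its family \<open>c\<close> of
  Fourier coefficients, where the frequency \<open>\<zeta> = (2\<pi>/L) k\<close> is indexed by \<open>k \<in> \<int>\<^sup>3\<close>.\<close>

type_synonym coeffs = "int ^ 3 \<Rightarrow> complex ^ 3"

definition freq :: "real \<Rightarrow> int ^ 3 \<Rightarrow> real ^ 3" where
  "freq L k = (\<chi> i. 2 * pi / L * real_of_int (k $ i))"

text \<open>Mean zero, real-valued, divergence free.\<close>

definition solenoidal :: "real \<Rightarrow> coeffs \<Rightarrow> bool" where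
  "solenoidal L u \<longleftrightarrow>
     u 0 = 0 \<and>
     (\<forall>k i. u (- k) $ i = cnj (u k $ i)) \<and>
     (\<forall>k. (\<Sum>i\<in>UNIV. complex_of_real (freq L k $ i) * u k $ i) = 0)"

definition V :: "real \<Rightarrow> real \<Rightarrow> coeffs set" where
  "V L s = {u. solenoidal L u \<and>
     (\<lambda>k. norm (freq L k) powr (2 * s) * (norm (u k))\<^sup>2) summable_on (- {0})}"

definition Vnorm :: "real \<Rightarrow> real \<Rightarrow> coeffs \<Rightarrow> real" where
  "Vnorm L s u =
     sqrt (L ^ 3 * (\<Sum>\<^sub>\<infinity>k\<in>- {0}. norm (freq L k) powr (2 * s) * (norm (u k))\<^sup>2))"

text \<open>The duality pairing between \<open>V\<^sup>s\<close> and \<open>V\<^sup>-\<^sup>s\<close>, which for \<open>s = 0\<close> is the scalar product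
  belonging to the norm of \<open>V\<^sup>0\<close>. The real inner product on \<^typ>\<open>complex ^ 3\<close> is the real part of
  the Hermitian one; the imaginary parts cancel in the sum for real fields.\<close>

definition pairing :: "real \<Rightarrow> coeffs \<Rightarrow> coeffs \<Rightarrow> real" where
  "pairing L u v = L ^ 3 * (\<Sum>\<^sub>\<infinity>k\<in>- {0}. u k \<bullet> v k)"

text \<open>Weak convergence in the Hilbert space \<open>V\<^sup>0\<close>, whose dual is \<open>V\<^sup>0\<close> itself.\<close>

definition weakly_converges_V0 :: "real \<Rightarrow> (nat \<Rightarrow> coeffs) \<Rightarrow> coeffs \<Rightarrow> bool" where
  "weakly_converges_V0 L U u \<longleftrightarrow>
     (\<forall>n. U n \<in> V L 0) \<and> u \<in> V L 0 \<and>
     (\<forall>w \<in> V L 0. (\<lambda>n. pairing L (U n) w) \<longlonglongrightarrow> pairing L u w)"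

text \<open>The power \<open>A\<^sup>\<sigma>\<close> of the Stokes operator \<open>A = -\<Delta>\<close>, which is the Fourier multiplier \<open>\<bar>\<zeta>\<bar>\<^sup>2\<close>.\<close>

definition stokes_pow :: "real \<Rightarrow> real \<Rightarrow> coeffs \<Rightarrow> coeffs" where
  "stokes_pow L \<sigma> u = (\<lambda>k. (norm (freq L k) powr (2 * \<sigma>)) *\<^sub>R u k)"


section \<open>The nonlinearity\<close>

definition trig_poly :: "real \<Rightarrow> coeffs set" where
  "trig_poly L = {u. solenoidal L u \<and> finite {k. u k \<noteq> 0}}"

text \<open>The vector field on \<open>\<real>\<^sup>3\<close> with given (finitely many) Fourier coefficients; for coefficients
  in \<^const>\<open>trig_poly\<close> the sum is real.\<close>

definition field_of :: "real \<Rightarrow> coeffs \<Rightarrow> real ^ 3 \<Rightarrow> real ^ 3" where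
  "field_of L u x = (\<chi> i. Re (\<Sum>k | u k \<noteq> 0. cis (x \<bullet> freq L k) * u k $ i))"

definition partial_deriv :: "3 \<Rightarrow> (real ^ 3 \<Rightarrow> real) \<Rightarrow> real ^ 3 \<Rightarrow> real" where
  "partial_deriv j g x = frechet_derivative g (at x) (axis j 1)"

definition b_trig :: "real \<Rightarrow> coeffs \<Rightarrow> coeffs \<Rightarrow> coeffs \<Rightarrow> real" where
  "b_trig L u v w =
     (\<Sum>i\<in>UNIV. \<Sum>j\<in>UNIV.
        LINT x:cbox 0 (\<chi> _. L)|lborel.
          field_of L u x $ j * partial_deriv j (\<lambda>y. field_of L v y $ i) x * field_of L w x $ i)"

text \<open>The extension of \<^const>\<open>b_trig\<close> by continuity to \<open>V\<^sup>s\<^sup>1 \<times> V\<^sup>s\<^sup>2\<^sup>+\<^sup>1 \<times> V\<^sup>s\<^sup>3\<close>. It exists for exponents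
  with \<open>s\<^sub>i + s\<^sub>j \<ge> 0\<close> for \<open>i \<noteq> j\<close> and \<open>s\<^sub>1 + s\<^sub>2 + s\<^sub>3 > 3/2\<close>, or \<open>s\<^sub>i + s\<^sub>j > 0\<close> for \<open>i \<noteq> j\<close> and
  \<open>s\<^sub>1 + s\<^sub>2 + s\<^sub>3 \<ge> 3/2\<close>; for other exponents the description may be meaningless.\<close>

definition b_ext ::
  "real \<Rightarrow> real \<Rightarrow> real \<Rightarrow> real \<Rightarrow> coeffs \<Rightarrow> coeffs \<Rightarrow> coeffs \<Rightarrow> real" where
  "b_ext L s1 s2 s3 u v w = (THE c.
     \<forall>un vn wn.
       (\<forall>n::nat. un n \<in> trig_poly L \<and> vn n \<in> trig_poly L \<and> wn n \<in> trig_poly L) \<longrightarrow>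
       (\<lambda>n. Vnorm L s1 (un n - u)) \<longlonglongrightarrow> 0 \<longrightarrow>
       (\<lambda>n. Vnorm L (s2 + 1) (vn n - v)) \<longlonglongrightarrow> 0 \<longrightarrow>
       (\<lambda>n. Vnorm L s3 (wn n - w)) \<longlonglongrightarrow> 0 \<longrightarrow>
       (\<lambda>n. b_trig L (un n) (vn n) (wn n)) \<longlonglongrightarrow> c)"

text \<open>\<open>B : V\<^sup>s\<^sup>1 \<times> V\<^sup>s\<^sup>2\<^sup>+\<^sup>1 \<rightarrow> V\<^sup>-\<^sup>s\<^sup>3\<close>.\<close>

definition B_op ::
  "real \<Rightarrow> real \<Rightarrow> real \<Rightarrow> real \<Rightarrow> coeffs \<Rightarrow> coeffs \<Rightarrow> coeffs" where
  "B_op L s1 s2 s3 u v = (THE g. g \<in> V L (- s3) \<and>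
     (\<forall>w \<in> V L s3. pairing L g w = b_ext L s1 s2 s3 u v w))"


section \<open>Functions of time with values in \<open>V\<^sup>s\<close>\<close>

text \<open>Strong (Bochner) measurability: \<open>u\<close> is almost everywhere the \<open>V\<^sup>s\<close>-limit of simple functions.
  Membership in \<open>L2_time\<close> and \<open>L2_time_norm\<close> only depend on \<open>u\<close> up to null sets.\<close>

definition strongly_measurable :: "real \<Rightarrow> real \<Rightarrow> real measure \<Rightarrow> (real \<Rightarrow> coeffs) \<Rightarrow> bool" where
  "strongly_measurable L s M u \<longleftrightarrow>
     (AE t in M. u t \<in> V L s) \<and>
     (\<exists>g. (\<forall>n::nat. simple_function M (g n) \<and> (\<forall>t\<in>space M. g n t \<in> V L s)) \<and>
          (AE t in M. (\<lambda>n. Vnorm L s (g n t - u t)) \<longlonglongrightarrow> 0))"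

definition L2_time :: "real \<Rightarrow> real \<Rightarrow> real \<Rightarrow> real \<Rightarrow> (real \<Rightarrow> coeffs) set" where
  "L2_time L a b s = {u.
     strongly_measurable L s (lebesgue_on {a..b}) u \<and>
     integrable (lebesgue_on {a..b}) (\<lambda>t. (Vnorm L s (u t))\<^sup>2)}"

definition L2_time_norm :: "real \<Rightarrow> real \<Rightarrow> real \<Rightarrow> real \<Rightarrow> (real \<Rightarrow> coeffs) \<Rightarrow> real" where
  "L2_time_norm L a b s u = sqrt (LINT t|lebesgue_on {a..b}. (Vnorm L s (u t))\<^sup>2)"

definition C_time :: "real \<Rightarrow> real \<Rightarrow> real \<Rightarrow> real \<Rightarrow> (real \<Rightarrow> coeffs) set" where
  "C_time L a b s = {u. \<forall>t\<in>{a..b}. u t \<in> V L s \<and>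
     ((\<lambda>r. Vnorm L s (u r - u t)) \<longlongrightarrow> 0) (at t within {a..b})}"

definition C_representative ::
  "real \<Rightarrow> real \<Rightarrow> real \<Rightarrow> real \<Rightarrow> (real \<Rightarrow> coeffs) \<Rightarrow> (real \<Rightarrow> coeffs) \<Rightarrow> bool" where
  "C_representative L a b s u w \<longleftrightarrow>
     w \<in> C_time L a b s \<and> (AE t in lebesgue_on {a..b}. u t = w t)"

definition converges_L2_time ::
  "real \<Rightarrow> real \<Rightarrow> real \<Rightarrow> real \<Rightarrow> (nat \<Rightarrow> real \<Rightarrow> coeffs) \<Rightarrow> (real \<Rightarrow> coeffs) \<Rightarrow> bool" where
  "converges_L2_time L a b s U u \<longleftrightarrow>
     (\<forall>n. U n \<in> L2_time L a b s) \<and> u \<in> L2_time L a b s \<and>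
     (\<lambda>n. L2_time_norm L a b s (\<lambda>t. U n t - u t)) \<longlonglongrightarrow> 0"

text \<open>The \<open>U n\<close> are only given up to null sets; convergence in \<open>C([a,b],V\<^sup>s)\<close> means uniform convergence
  of their (unique) continuous representatives.\<close>

definition converges_C_time ::
  "real \<Rightarrow> real \<Rightarrow> real \<Rightarrow> real \<Rightarrow> (nat \<Rightarrow> real \<Rightarrow> coeffs) \<Rightarrow> (real \<Rightarrow> coeffs) \<Rightarrow> bool" where
  "converges_C_time L a b s U u \<longleftrightarrow>
     u \<in> C_time L a b s \<and>
     (\<exists>W. (\<forall>n. C_representative L a b s (U n) (W n)) \<and>
          uniform_limit {a..b} (\<lambda>n t. Vnorm L s (W n t - u t)) (\<lambda>_. 0) sequentially)"


section \<open>Weak solutions\<close>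

definition test_functions :: "real \<Rightarrow> (real \<Rightarrow> real) set" where
  "test_functions T = {\<psi>.
     (\<forall>m x. (deriv ^^ m) \<psi> differentiable (at x)) \<and>
     closure {x. \<psi> x \<noteq> 0} \<subseteq> {0<..<T}}"

text \<open>The initial value \<open>u0\<close> is that of the representative in \<open>C([0,T],V\<^sup>\<alpha>)\<close>. With exponents
  \<open>(1 + \<alpha>, \<alpha>, 1 + \<alpha>)\<close> the operator \<^const>\<open>B_op\<close> maps \<open>V\<^sup>1\<^sup>+\<^sup>\<alpha> \<times> V\<^sup>1\<^sup>+\<^sup>\<alpha>\<close> to \<open>V\<^sup>-\<^sup>(\<^sup>1\<^sup>+\<^sup>\<alpha>\<^sup>)\<close>; with \<open>(1, 0, 1)\<close>
  it maps \<open>V\<^sup>1 \<times> V\<^sup>1\<close> to \<open>V\<^sup>-\<^sup>1\<close>.\<close>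

definition delay_weak_solution ::
  "real \<Rightarrow> real \<Rightarrow> real \<Rightarrow> coeffs \<Rightarrow> real \<Rightarrow> real \<Rightarrow> (real \<Rightarrow> coeffs) \<Rightarrow> coeffs \<Rightarrow>
     (real \<Rightarrow> coeffs) \<Rightarrow> bool" where
  "delay_weak_solution L \<nu> \<alpha> f T \<mu> \<phi> u0 u \<longleftrightarrow>
     u \<in> L2_time L (- \<mu>) T (1 + \<alpha>) \<and>
     (\<exists>w. C_representative L 0 T \<alpha> u w \<and> w 0 = u0) \<and>
     (AE t in lebesgue_on {- \<mu>..<0}. u t = \<phi> t) \<and>
     (\<forall>v \<in> V L (\<alpha> + 1). \<forall>\<psi> \<in> test_functions T.
        - (LINT r|lebesgue_on {0..T}. pairing L (u r) v * deriv \<psi> r)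
        + \<nu> * (LINT r|lebesgue_on {0..T}.
                 pairing L (stokes_pow L (1/2) (u r)) (stokes_pow L (1/2) v) * \<psi> r)
        + (LINT r|lebesgue_on {0..T}.
             pairing L (B_op L (1 + \<alpha>) \<alpha> (1 + \<alpha>) (u (r - \<mu>)) (u r)) v * \<psi> r)
        = (LINT r|lebesgue_on {0..T}. pairing L f v * \<psi> r))"

definition ns_weak_solution ::
  "real \<Rightarrow> real \<Rightarrow> coeffs \<Rightarrow> real \<Rightarrow> (real \<Rightarrow> coeffs) \<Rightarrow> bool" where
  "ns_weak_solution L \<nu> f T u \<longleftrightarrow>
     u \<in> L2_time L 0 T 1 \<and>
     (\<forall>v \<in> V L 1. \<forall>\<psi> \<in> test_functions T.
        - (LINT r|lebesgue_on {0..T}. pairing L (u r) v * deriv \<psi> r)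
        + \<nu> * (LINT r|lebesgue_on {0..T}.
                 pairing L (stokes_pow L (1/2) (u r)) (stokes_pow L (1/2) v) * \<psi> r)
        + (LINT r|lebesgue_on {0..T}.
             pairing L (B_op L 1 0 1 (u r) (u r)) v * \<psi> r)
        = (LINT r|lebesgue_on {0..T}. pairing L f v * \<psi> r))"

end

theory Submission
  imports Defs "HOL-Complex_Analysis.Great_Picard"
begin

text \<open>
  Everything is done mode by mode on the Fourier side. On coefficients the nonlinearity is the convolution \<open>Bf\<close>;
  Cauchy-Schwarz and \<open>\<Sum> \<bar>\<zeta>\<bar>\<^sup>-\<^sup>4 < \<infinity>\<close> give \<open>\<parallel>B(u,v)\<parallel>\<^sub>-\<^sub>1 \<le> C \<parallel>u\<parallel>\<^sub>p \<parallel>v\<parallel>\<^sub>q\<close> for \<open>p + q = 2\<close>. With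
  \<open>p = 3/2\<close>, \<open>q = 1/2\<close> this makes \<open>\<langle>B(u(t-\<mu>),u(t)),u(t)\<rangle>\<close> integrable, so the energy equality holds and bounds \<open>u\<^sup>\<mu>\<close> in
  \<open>L\<^sub>\<infinity>(V\<^sup>0) \<inter> L\<^sub>2(V\<^sup>1)\<close> uniformly in \<open>\<mu>\<close>. Each Fourier coefficient is then equicontinuous in time, and a diagonal subsequence
  converges uniformly in every mode. The bound in \<open>V\<^sup>0\<close> upgrades this to \<open>C(V\<^sup>-\<^sup>s)\<close> and the bound in \<open>L\<^sub>2(V\<^sup>1)\<close> to \<open>L\<^sub>2(V\<^sup>0)\<close>,
  which is enough to pass to the limit in the equation for every mode; on \<open>[0,\<mu>]\<close>, where only the bound on \<open>\<phi>\<close> in \<open>L\<^sub>2\<close>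
  is available, the shifted function is small in \<open>L\<^sub>1(V\<^sup>0)\<close>.
\<close>

section \<open>Square-summable families and frequencies\<close>

text \<open>The V^\<alpha> regularity of a delayed solution comes with no bound uniform in the
  delay, so it is used only qualitatively: it supplies an integrable majorant under which the
  truncated nonlinear energy transfer tends to 0. The resulting constant \<open>E0\<close> contains
  only the initial energy, T, \<nu> and f, because B(v,w) is orthogonal to w for every solenoidal v,
  whatever the delay makes of v. That the initial energies are bounded is itself a theorem: weak
  convergence in V^0 is an assumption on functionals, and uniform boundedness turns it into a bound
  on norms.

  Testing the weak equation with a field supported on one frequency pair gives an integral equation
  for one vector-valued function of time. Thus compactness in time is plain Arzela-Ascoli for each
  mode, and the spectral gap between V^1 and V^0 does the work of a compact embedding.

  \<open>b_ext\<close> and \<open>B_op\<close> are definite descriptions and can be used only after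
  it is shown that something satisfies them and nothing else does. The identification with
  \<open>Bf\<close> holds for the exponents of both equations, so delayed and limit equation are
  compared through one formula.\<close>

definition l2 :: "'a set \<Rightarrow> ('a \<Rightarrow> real) \<Rightarrow> bool" where
  "l2 A f \<longleftrightarrow> (\<lambda>x. (f x)\<^sup>2) summable_on A"

definition l2n :: "'a set \<Rightarrow> ('a \<Rightarrow> real) \<Rightarrow> real" where
  "l2n A f = sqrt (\<Sum>\<^sub>\<infinity>x\<in>A. (f x)\<^sup>2)"

lemma l2n_nonneg [simp]: "l2n A f \<ge> 0"
  unfolding l2n_def by (simp add: infsum_nonneg)

lemma l2n_sq: "(l2n A f)\<^sup>2 = (\<Sum>\<^sub>\<infinity>x\<in>A. (f x)\<^sup>2)"
  unfolding l2n_def by (simp add: infsum_nonneg)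

lemma L2_set_sq: "(L2_set f F)\<^sup>2 = (\<Sum>x\<in>F. (f x)\<^sup>2)"
  unfolding L2_set_def by (simp add: sum_nonneg)

lemma L2_set_le_l2n:
  assumes "l2 A f" "finite F" "F \<subseteq> A"
  shows "L2_set f F \<le> l2n A f"
  unfolding L2_set_def l2n_def using assms
  by (intro real_sqrt_le_mono finite_sum_le_infsum) (auto simp: l2_def)

text \<open>One uniform bound on finite partial sums yields both summability and the bound on the
  norm. Through it the inequalities for \<open>L2_set\<close> pass to infinite families.\<close>

lemma l2_bound:
  assumes "\<And>F. finite F \<Longrightarrow> F \<subseteq> A \<Longrightarrow> L2_set f F \<le> b"
  shows "l2 A f" "l2n A f \<le> b"
proof -
  have b: "b \<ge> 0" using assms[of "{}"] by simp
  have *: "(\<Sum>x\<in>F. (f x)\<^sup>2) \<le> b\<^sup>2" if "finite F" "F \<subseteq> A" for F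
    using power_mono[OF assms[OF that], of 2] by (simp add: L2_set_sq)
  show "l2 A f" unfolding l2_def
    by (rule nonneg_bounded_partial_sums_imp_summable_on[where C="b\<^sup>2"])
       (use * in \<open>auto intro: eventually_finite_subsets_at_top_weakI\<close>)
  then have "(\<Sum>\<^sub>\<infinity>x\<in>A. (f x)\<^sup>2) \<le> b\<^sup>2"
    by (intro infsum_le_finite_sums) (auto simp: l2_def *)
  then show "l2n A f \<le> b" unfolding l2n_def using b by (simp add: real_le_lsqrt infsum_nonneg)
qed

lemma l2_le:
  assumes "l2 A g" "\<And>x. x \<in> A \<Longrightarrow> \<bar>f x\<bar> \<le> \<bar>g x\<bar>"
  shows "l2 A f" "l2n A f \<le> l2n A g"
proof -
  have "L2_set f F \<le> l2n A g" if "finite F" "F \<subseteq> A" for F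
  proof -
    have "L2_set f F \<le> L2_set g F"
      unfolding L2_set_def using assms(2) that
      by (intro real_sqrt_le_mono sum_mono) (auto simp: abs_le_square_iff)
    then show ?thesis using L2_set_le_l2n[OF assms(1) that] by linarith
  qed
  from l2_bound[OF this] show "l2 A f" "l2n A f \<le> l2n A g" by simp_all
qed

lemma l2_add:
  assumes "l2 A f" "l2 A g"
  shows "l2 A (\<lambda>x. f x + g x)" "l2n A (\<lambda>x. f x + g x) \<le> l2n A f + l2n A g"
proof -
  have "L2_set (\<lambda>x. f x + g x) F \<le> l2n A f + l2n A g" if "finite F" "F \<subseteq> A" for F
    using L2_set_triangle_ineq[of f g F] L2_set_le_l2n[OF assms(1) that] L2_set_le_l2n[OF assms(2) that]
    by linarith
  from l2_bound[OF this] show "l2 A (\<lambda>x. f x + g x)" "l2n A (\<lambda>x. f x + g x) \<le> l2n A f + l2n A g"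
    by simp_all
qed

lemma l2_cmult:
  assumes "l2 A f"
  shows "l2 A (\<lambda>x. c * f x)" "l2n A (\<lambda>x. c * f x) = \<bar>c\<bar> * l2n A f"
proof -
  show "l2 A (\<lambda>x. c * f x)"
    using assms unfolding l2_def power_mult_distrib by (rule summable_on_cmult_right)
  show "l2n A (\<lambda>x. c * f x) = \<bar>c\<bar> * l2n A f"
    unfolding l2n_def power_mult_distrib by (simp add: infsum_cmult_right' real_sqrt_mult)
qed

lemma l2_mult:
  assumes "l2 A f" "l2 A g"
  shows "(\<lambda>x. \<bar>f x * g x\<bar>) summable_on A" "(\<Sum>\<^sub>\<infinity>x\<in>A. \<bar>f x * g x\<bar>) \<le> l2n A f * l2n A g"
proof -
  have *: "(\<Sum>x\<in>F. \<bar>f x * g x\<bar>) \<le> l2n A f * l2n A g" if "finite F" "F \<subseteq> A" for F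
  proof -
    have "(\<Sum>x\<in>F. \<bar>f x * g x\<bar>) \<le> L2_set f F * L2_set g F"
      using L2_set_mult_ineq[of f g F] by (simp add: abs_mult)
    also have "\<dots> \<le> l2n A f * l2n A g"
      by (intro mult_mono L2_set_le_l2n assms that) auto
    finally show ?thesis .
  qed
  show s: "(\<lambda>x. \<bar>f x * g x\<bar>) summable_on A"
    by (rule nonneg_bounded_partial_sums_imp_summable_on[where C="l2n A f * l2n A g"])
       (use * in \<open>auto intro: eventually_finite_subsets_at_top_weakI\<close>)
  show "(\<Sum>\<^sub>\<infinity>x\<in>A. \<bar>f x * g x\<bar>) \<le> l2n A f * l2n A g"
    by (intro infsum_le_finite_sums s *)
qed

lemma infsum_norm_le:
  fixes f :: "'a \<Rightarrow> 'b::banach"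
  assumes "g summable_on A" "\<And>x. x \<in> A \<Longrightarrow> norm (f x) \<le> g x"
  shows "f summable_on A" "norm (infsum f A) \<le> infsum g A"
proof -
  have s: "(\<lambda>x. norm (f x)) summable_on A"
    by (rule summable_on_comparison_test[OF assms(1)]) (use assms(2) in auto)
  then show "f summable_on A" by (rule abs_summable_summable)
  have "norm (infsum f A) \<le> (\<Sum>\<^sub>\<infinity>x\<in>A. norm (f x))" by (rule norm_infsum_bound[OF s])
  also have "\<dots> \<le> infsum g A" by (intro infsum_mono s assms)
  finally show "norm (infsum f A) \<le> infsum g A" .
qed

lemma summable_on_product_nonneg:
  fixes f :: "'a \<Rightarrow> real" and g :: "'b \<Rightarrow> real"
  assumes "f summable_on A" "g summable_on B" "\<And>x. x \<in> A \<Longrightarrow> f x \<ge> 0" "\<And>y. y \<in> B \<Longrightarrow> g y \<ge> 0"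
  shows "(\<lambda>(x, y). f x * g y) summable_on A \<times> B"
proof (rule summable_on_SigmaI[where g="\<lambda>x. f x * infsum g B"])
  show "((\<lambda>y. case (x, y) of (x, y) \<Rightarrow> f x * g y) has_sum f x * infsum g B) B" for x
    using has_sum_cmult_right[OF has_sum_infsum[OF assms(2)]] by simp
  show "(\<lambda>x. f x * infsum g B) summable_on A" using assms(1) by (rule summable_on_cmult_left)
qed (use assms in auto)

section \<open>Frequencies, and finite cubes exhausting the lattice\<close>

lemma freq_add: "freq L (k + l) = freq L k + freq L l"
  by (simp add: freq_def vec_eq_iff distrib_left)

lemma freq_minus: "freq L (- k) = - freq L k"
  by (simp add: freq_def vec_eq_iff)

lemma freq_diff: "freq L (k - l) = freq L k - freq L l"
  by (simp add: freq_def vec_eq_iff right_diff_distrib)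

lemma freq_0 [simp]: "freq L 0 = 0"
  by (simp add: freq_def vec_eq_iff)

locale torus =
  fixes L :: real
  assumes L_pos: "L > 0"
begin

definition lam :: "int ^ 3 \<Rightarrow> real" where "lam k = norm (freq L k)"

definition lam0 :: real where "lam0 = 2 * pi / L"

lemma lam0_pos: "lam0 > 0" using L_pos by (simp add: lam0_def)

lemma lam_0 [simp]: "lam 0 = 0" by (simp add: lam_def)
lemma lam_nonneg [simp]: "lam k \<ge> 0" by (simp add: lam_def)
lemma lam_minus [simp]: "lam (- k) = lam k" by (simp add: lam_def freq_minus)

lemma lam_ge_comp: "lam k \<ge> lam0 * \<bar>real_of_int (k $ i)\<bar>"
  using component_le_norm_cart[of "freq L k" i] L_pos
  by (simp add: lam_def freq_def lam0_def abs_mult)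

lemma lam_ge: assumes "k \<noteq> 0" shows "lam k \<ge> lam0"
proof -
  obtain i where "k $ i \<noteq> 0" using assms by (auto simp: vec_eq_iff)
  then have "\<bar>real_of_int (k $ i)\<bar> \<ge> 1" by linarith
  then have "lam0 * 1 \<le> lam0 * \<bar>real_of_int (k $ i)\<bar>" using lam0_pos by (intro mult_left_mono) auto
  then show ?thesis using lam_ge_comp[of k i] by linarith
qed

lemma lam_pos: "k \<noteq> 0 \<Longrightarrow> lam k > 0" using lam_ge lam0_pos by fastforce

text \<open>Cubes are finite, increasing and symmetric under \<open>k\<close> to \<open>- k\<close>,
  so truncating to them keeps a field real and solenoidal. The zero mode is left out from the
  start.\<close>

definition modes :: "nat \<Rightarrow> (int ^ 3) set" where
  "modes N = {k. k \<noteq> 0 \<and> (\<forall>i. \<bar>k $ i\<bar> \<le> int N)}"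

lemma finite_int_box: "finite {k :: int ^ 3. \<forall>i. \<bar>k $ i\<bar> \<le> int N}"
proof -
  have "{k :: int ^ 3. \<forall>i. \<bar>k $ i\<bar> \<le> int N} \<subseteq> (\<lambda>(a, b, c). vector [a, b, c]) ` ({- int N..int N} \<times> {- int N..int N} \<times> {- int N..int N})"
  proof
    fix k :: "int ^ 3" assume "k \<in> {k. \<forall>i. \<bar>k $ i\<bar> \<le> int N}"
    then have "\<bar>k $ i\<bar> \<le> int N" for i by simp
    then have "- int N \<le> k $ i \<and> k $ i \<le> int N" for i by (metis abs_le_iff minus_le_iff)
    then show "k \<in> (\<lambda>(a, b, c). vector [a, b, c]) ` ({- int N..int N} \<times> {- int N..int N} \<times> {- int N..int N})"
      by (intro image_eqI[of _ _ "(k $ 1, k $ 2, k $ 3)"]) (auto simp: vec_eq_iff forall_3)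
  qed
  then show ?thesis by (rule finite_subset) auto
qed

lemma finite_modes [simp]: "finite (modes N)"
  by (rule finite_subset[OF _ finite_int_box[of N]]) (auto simp: modes_def)

lemma modes_sub [simp]: "modes N \<subseteq> - {0}" by (auto simp: modes_def)

lemma modes_mono: "N \<le> M \<Longrightarrow> modes N \<subseteq> modes M"
  by (auto simp: modes_def intro: order_trans[of _ "int N"])

lemma modes_minus [simp]: "- k \<in> modes N \<longleftrightarrow> k \<in> modes N" by (simp add: modes_def)

lemma ex_modes: assumes "k \<noteq> 0" shows "\<exists>N. k \<in> modes N"
proof -
  have "\<bar>k $ i\<bar> \<le> int (\<Sum>i\<in>UNIV. nat \<bar>k $ i\<bar>)" for i
  proof -
    have "nat \<bar>k $ i\<bar> \<le> (\<Sum>i\<in>UNIV. nat \<bar>k $ i\<bar>)" by (rule member_le_sum) auto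
    then show ?thesis by linarith
  qed
  then show ?thesis using assms unfolding modes_def by blast
qed

lemma lam_outside: assumes "k \<noteq> 0" "k \<notin> modes N" shows "lam k \<ge> lam0 * real (Suc N)"
proof -
  obtain i where "\<bar>k $ i\<bar> > int N" using assms by (auto simp: modes_def not_le)
  then have "\<bar>real_of_int (k $ i)\<bar> \<ge> real (Suc N)" by linarith
  then have "lam0 * real (Suc N) \<le> lam0 * \<bar>real_of_int (k $ i)\<bar>"
    using lam0_pos by (intro mult_left_mono) auto
  then show ?thesis using lam_ge_comp[of k i] by linarith
qed

text \<open>Every finite set of nonzero frequencies lies in some cube. Unconditional sums thereby
  become limits of sequences, the form in which dominated convergence and measurability of limits
  apply.\<close>

lemma filterlim_modes: "filterlim modes (finite_subsets_at_top (- {0})) sequentially"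
  unfolding filterlim_finite_subsets_at_top
proof (intro allI impI)
  fix X :: "(int ^ 3) set" assume X: "finite X \<and> X \<subseteq> - {0}"
  have "\<exists>N. X \<subseteq> modes N" using X
  proof (induction X rule: infinite_finite_induct)
    case (insert x F)
    then obtain N M where "F \<subseteq> modes N" "x \<in> modes M" using ex_modes[of x] by auto
    then show ?case using modes_mono[of N "max N M"] modes_mono[of M "max N M"] by (intro exI[of _ "max N M"]) auto
  qed auto
  then obtain N where N: "X \<subseteq> modes N" by blast
  show "\<forall>\<^sub>F M in sequentially. finite (modes M) \<and> X \<subseteq> modes M \<and> modes M \<subseteq> - {0}"
    using eventually_ge_at_top[of N] by eventually_elim (use N modes_mono in \<open>meson finite_modes modes_sub order_trans\<close>)
qed

lemma infsum_modes:
  fixes f :: "int ^ 3 \<Rightarrow> 'a::{comm_monoid_add, t2_space}"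
  assumes "f summable_on - {0}"
  shows "(\<lambda>N. sum f (modes N)) \<longlonglongrightarrow> infsum f (- {0})"
proof -
  have "(sum f \<longlongrightarrow> infsum f (- {0})) (finite_subsets_at_top (- {0}))"
    using has_sum_infsum[OF assms] by (simp add: has_sum_def)
  from filterlim_compose[OF this filterlim_modes] show ?thesis by simp
qed

text \<open>The exponent is one third of -2: the product of three such factors, one per coordinate,
  has to dominate the power -2 of 1 + \<bar>k\<bar>^2. Each factor decays like the power -4/3, which
  is still summable in one dimension.\<close>

lemma summable_int_powr:
  "(\<lambda>k::int. (1 + (real_of_int k)\<^sup>2) powr (-2/3)) summable_on UNIV"
proof -
  have s: "(\<lambda>n::nat. (1 + (real n)\<^sup>2) powr (-2/3)) summable_on UNIV"
  proof -
    have "summable (\<lambda>n::nat. real n powr (-4/3))" by (subst summable_real_powr_iff) auto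
    then have "summable (\<lambda>n::nat. (1 + (real n)\<^sup>2) powr (-2/3))"
    proof (rule summable_comparison_test'[where N=1])
      fix n :: nat assume "n \<ge> 1"
      have "(1 + (real n)\<^sup>2) powr (-2/3) \<le> ((real n)\<^sup>2) powr (-2/3)"
        using \<open>n \<ge> 1\<close> by (intro powr_mono2') auto
      also have "((real n)\<^sup>2) powr (-2/3) = real n powr (-4/3)"
        using \<open>n \<ge> 1\<close> by (simp add: powr_powr flip: powr_numeral)
      finally show "norm ((1 + (real n)\<^sup>2) powr (-2/3)) \<le> real n powr (-4/3)" by simp
    qed
    then show ?thesis by (subst summable_on_UNIV_nonneg_real_iff) auto
  qed
  have a: "(\<lambda>k::int. (1 + (real_of_int k)\<^sup>2) powr (-2/3)) summable_on (int ` UNIV)"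
    using s by (subst summable_on_reindex) (auto simp: o_def)
  have b: "(\<lambda>k::int. (1 + (real_of_int k)\<^sup>2) powr (-2/3)) summable_on ((\<lambda>n. - int n) ` UNIV)"
    using s by (subst summable_on_reindex) (auto simp: o_def inj_on_def)
  have "UNIV = (int ` UNIV) \<union> ((\<lambda>n. - int n) ` UNIV)"
  proof (intro equalityI subsetI)
    fix x :: int assume "x \<in> UNIV"
    show "x \<in> int ` UNIV \<union> (\<lambda>n. - int n) ` UNIV" by (cases x rule: int_cases2) auto
  qed simp
  then show ?thesis using summable_on_union[OF a b] by simp
qed

text \<open>The sum over the lattice is compared with a product of three one-dimensional sums: each
  coordinate satisfies \<open>k_i\<close>^2 \<le> \<bar>k\<bar>^2, so a negative power of 1 +
  \<bar>k\<bar>^2 splits into coordinate factors.\<close>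

lemma summable_lam4: "(\<lambda>k. lam k powr (-4)) summable_on - {0}"
proof -
  define g where "g k = (1 + (real_of_int k)\<^sup>2) powr (-2/3)" for k :: int
  have g0: "g k \<ge> 0" for k by (simp add: g_def)
  have g: "g summable_on UNIV" unfolding g_def by (rule summable_int_powr)
  have g2: "(\<lambda>(a, b). g a * g b) summable_on (UNIV \<times> UNIV)"
    using summable_on_product_nonneg[OF g g] g0 by simp
  have g3: "(\<lambda>(a, b). g a * (case b of (b, c) \<Rightarrow> g b * g c)) summable_on (UNIV \<times> (UNIV \<times> UNIV))"
    using summable_on_product_nonneg[OF g g2] g0 by (simp add: split_beta)
  have inj: "inj (\<lambda>k::int^3. (k $ 1, k $ 2, k $ 3))"
    by (auto simp: inj_on_def vec_eq_iff forall_3)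
  have "(\<lambda>(a, b). g a * (case b of (b, c) \<Rightarrow> g b * g c)) summable_on ((\<lambda>k::int^3. (k $ 1, k $ 2, k $ 3)) ` UNIV)"
    by (rule summable_on_subset_banach[OF g3]) auto
  then have "(\<lambda>k::int^3. g (k $ 1) * (g (k $ 2) * g (k $ 3))) summable_on UNIV"
    by (subst (asm) summable_on_reindex) (auto simp: inj o_def)
  then have "(\<lambda>k::int^3. g (k $ 1) * (g (k $ 2) * g (k $ 3))) summable_on -{0}"
    by (rule summable_on_subset_banach) auto
  then have S: "(\<lambda>k::int^3. 4 * lam0 powr (-4) * (g (k $ 1) * (g (k $ 2) * g (k $ 3)))) summable_on -{0}"
    by (rule summable_on_cmult_right)
  show ?thesis
  proof (rule summable_on_comparison_test[OF S])
    fix k :: "int ^ 3" assume "k \<in> - {0}"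
    then have k: "k \<noteq> 0" by simp
    define r where "r = (\<Sum>i\<in>UNIV. (real_of_int (k $ i))\<^sup>2)"
    have l2r: "(lam k)\<^sup>2 = lam0\<^sup>2 * r"
      by (simp add: lam_def norm_vec_def L2_set_sq freq_def r_def lam0_def power_mult_distrib power_divide sum_distrib_left)
    have r1: "r \<ge> 1"
    proof -
      have "lam0\<^sup>2 \<le> (lam k)\<^sup>2" using lam_ge[OF k] lam0_pos by (intro power_mono) auto
      then show ?thesis using l2r lam0_pos by simp
    qed

    have m: "(1 + r) powr (-2/3) \<le> g (k $ i)" for i :: 3
    proof -
      have "(real_of_int (k $ i))\<^sup>2 \<le> r" unfolding r_def by (rule member_le_sum) auto
      then show ?thesis unfolding g_def by (intro powr_mono2') (auto simp: add_pos_nonneg)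
    qed
    have eq: "lam k powr (-4) = lam0 powr (-4) * r powr (-2)"
    proof -
    have "lam k powr (-4) = ((lam k)\<^sup>2) powr (-2)"
      using lam_pos[OF k] by (simp add: powr_powr flip: powr_numeral)
    also have "\<dots> = lam0 powr (-4) * r powr (-2)"
      using lam0_pos r1 by (simp add: l2r powr_mult powr_powr flip: powr_numeral)
    finally show ?thesis .
    qed
    \<comment> \<open>As r is at least 1, it is at least the mean of 1 and r; this trades r for 1 +
      r at the price of the factor 4.\<close>
    have "r powr (-2) \<le> ((1 + r) / 2) powr (-2)" using r1 by (intro powr_mono2') auto
    also have "((1 + r) / 2) powr (-2) = 4 * (1 + r) powr (-2)"
      using r1 by (simp add: powr_divide powr_minus field_simps)
    also have "(1 + r) powr (-2) = (1 + r) powr (-2/3) * ((1 + r) powr (-2/3) * (1 + r) powr (-2/3))"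
      using r1 by (simp flip: powr_add)
    also have "\<dots> \<le> g (k $ 1) * (g (k $ 2) * g (k $ 3))"
      by (intro mult_mono m) (auto simp: g0)
    finally have "r powr (-2) \<le> 4 * (g (k $ 1) * (g (k $ 2) * g (k $ 3)))" by simp
    from mult_left_mono[OF this, of "lam0 powr (-4)"]
    show "lam k powr (-4) \<le> 4 * lam0 powr (-4) * (g (k $ 1) * (g (k $ 2) * g (k $ 3)))"
      by (simp add: eq mult_ac)
  qed auto
qed

end

section \<open>Fourier modes and Sobolev norms\<close>

lemma infsum_diff:
  fixes f g :: "'a \<Rightarrow> 'b::real_normed_vector"
  assumes "f summable_on A" "g summable_on A"
  shows "(\<Sum>\<^sub>\<infinity>x\<in>A. f x - g x) = infsum f A - infsum g A"
proof -
  have "(\<Sum>\<^sub>\<infinity>x\<in>A. f x + - g x) = infsum f A + (\<Sum>\<^sub>\<infinity>x\<in>A. - g x)"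
    by (rule infsum_add) (use assms in \<open>auto simp: summable_on_uminus\<close>)
  then show ?thesis by (simp add: infsum_uminus)
qed

lemma powr_sq: "((x::real) powr s)\<^sup>2 = x powr (2 * s)"
  by (simp add: power2_eq_square flip: powr_add)

section \<open>Complex vectors and the Leray projection at one frequency\<close>

definition cvec :: "real ^ 'n \<Rightarrow> complex ^ 'n" where "cvec \<xi> = (\<chi> i. complex_of_real (\<xi> $ i))"
definition cnjv :: "complex ^ 'n \<Rightarrow> complex ^ 'n" where "cnjv z = (\<chi> i. cnj (z $ i))"
definition cdot :: "real ^ 'n \<Rightarrow> complex ^ 'n \<Rightarrow> complex" where
  "cdot \<xi> z = (\<Sum>i\<in>UNIV. complex_of_real (\<xi> $ i) * z $ i)"

lemma norm_cscale: "norm (c *s (z :: complex ^ 'n)) = cmod c * norm z"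
proof -
  have "norm (c *s z) = L2_set (\<lambda>i. cmod c * cmod (z $ i)) UNIV"
    by (simp add: norm_vec_def norm_mult)
  then show ?thesis by (simp add: L2_set_right_distrib norm_vec_def)
qed

lemma norm_cnjv [simp]: "norm (cnjv z) = norm z"
  by (simp add: norm_vec_def cnjv_def)

lemma cnjv_cnjv [simp]: "cnjv (cnjv z) = z" by (simp add: cnjv_def vec_eq_iff)

lemma cnjv_0 [simp]: "cnjv 0 = 0" by (simp add: cnjv_def vec_eq_iff)

lemma norm_cdot: "cmod (cdot \<xi> z) \<le> norm \<xi> * norm z"
proof -
  have "cmod (cdot \<xi> z) \<le> (\<Sum>i\<in>UNIV. \<bar>\<xi> $ i\<bar> * \<bar>cmod (z $ i)\<bar>)"
    unfolding cdot_def by (rule order_trans[OF norm_sum]) (simp add: norm_mult)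
  also have "\<dots> \<le> L2_set (\<lambda>i. \<xi> $ i) UNIV * L2_set (\<lambda>i. cmod (z $ i)) UNIV"
    by (rule L2_set_mult_ineq)
  also have "\<dots> = norm \<xi> * norm z" by (simp add: norm_vec_def L2_set_def)
  finally show ?thesis .
qed

lemma cdot_add: "cdot \<xi> (z + w) = cdot \<xi> z + cdot \<xi> w"
  by (simp add: cdot_def distrib_left sum.distrib)
lemma cdot_diff: "cdot \<xi> (z - w) = cdot \<xi> z - cdot \<xi> w"
  by (simp add: cdot_def right_diff_distrib sum_subtractf)
lemma cdot_0 [simp]: "cdot \<xi> 0 = 0" by (simp add: cdot_def)
lemma cdot_scale: "cdot \<xi> (c *s z) = c * cdot \<xi> z"
  by (simp add: cdot_def sum_distrib_left mult_ac)
lemma cdot_scaleR: "cdot \<xi> (c *\<^sub>R z) = c *\<^sub>R cdot \<xi> z"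
  by (simp add: cdot_def scaleR_sum_right)
lemma cdot_cnjv: "cdot \<xi> (cnjv z) = cnj (cdot \<xi> z)"
  by (simp add: cdot_def cnjv_def)
lemma cdot_minus_left: "cdot (- \<xi>) z = - cdot \<xi> z"
  by (simp add: cdot_def sum_negf)
lemma cdot_diff_left: "cdot (\<xi> - \<eta>) z = cdot \<xi> z - cdot \<eta> z"
  by (simp add: cdot_def left_diff_distrib sum_subtractf)
lemma cdot_cvec: "cdot \<xi> (cvec \<xi>) = complex_of_real ((norm \<xi>)\<^sup>2)"
proof -
  have "(norm \<xi>)\<^sup>2 = (\<Sum>i\<in>UNIV. (\<xi> $ i)\<^sup>2)" by (simp add: norm_vec_def L2_set_sq)
  then show ?thesis by (simp add: cdot_def cvec_def power2_eq_square)
qed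

lemma linear_cdot: "linear (cdot \<xi>)"
  by (rule linearI) (simp_all add: cdot_add cdot_scaleR)

lemma inner_cvec: "inner (z :: complex ^ 'n) w = Re (\<Sum>i\<in>UNIV. z $ i * cnj (w $ i))"
  by (simp add: inner_vec_def inner_complex_def)

lemma inner_cvec_orth:
  assumes "cdot \<xi> w = 0"
  shows "inner (c *s cvec \<xi>) w = 0"
proof -
  have "(\<Sum>i\<in>UNIV. (c *s cvec \<xi>) $ i * cnj (w $ i)) = c * cnj (cdot \<xi> w)"
    by (simp add: cdot_def cvec_def sum_distrib_left mult_ac)
  then show ?thesis using assms by (simp add: inner_cvec)
qed

lemma inner_cnjv [simp]: "inner (cnjv z) (cnjv w) = inner z w"
  by (simp add: inner_vec_def inner_complex_def cnjv_def)

lemma bounded_linear_cnjv: "bounded_linear cnjv"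
  by (rule linear_conv_bounded_linear[THEN iffD1], rule linearI)
     (simp_all add: cnjv_def vec_eq_iff)

text \<open>The orthogonal projection onto the complement of \<open>\<xi>\<close>, i.e. one Fourier mode of the Leray projection.\<close>

definition leray :: "real ^ 3 \<Rightarrow> complex ^ 3 \<Rightarrow> complex ^ 3" where
  "leray \<xi> z = z - (cdot \<xi> z / complex_of_real ((norm \<xi>)\<^sup>2)) *s cvec \<xi>"

lemma cdot_leray: "\<xi> \<noteq> 0 \<Longrightarrow> cdot \<xi> (leray \<xi> z) = 0"
  by (simp add: leray_def cdot_diff cdot_scale cdot_cvec)

text \<open>The projection only removes a multiple of \<xi>, which a vector orthogonal to \<xi> does
  not see. For this reason no pressure term appears when testing with solenoidal fields.\<close>

lemma inner_leray: "cdot \<xi> w = 0 \<Longrightarrow> inner (leray \<xi> z) w = inner z w"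
  by (simp add: leray_def inner_diff_left inner_cvec_orth)

lemma leray_id: "cdot \<xi> z = 0 \<Longrightarrow> leray \<xi> z = z"
  by (simp add: leray_def vec_eq_iff)

lemma leray_0 [simp]: "leray \<xi> 0 = 0"
  by (simp add: leray_id)

text \<open>The square of the projected norm is the inner product of z with its projection, so
  Cauchy-Schwarz cancels one factor.\<close>

lemma norm_leray: assumes "\<xi> \<noteq> 0" shows "norm (leray \<xi> z) \<le> norm z"
proof -
  have "(norm (leray \<xi> z))\<^sup>2 = inner z (leray \<xi> z)"
    using inner_leray[OF cdot_leray[OF assms], of z z] by (simp add: power2_norm_eq_inner)
  also have "\<dots> \<le> norm z * norm (leray \<xi> z)" by (rule norm_cauchy_schwarz)
  finally show ?thesis by (cases "leray \<xi> z = 0") (simp_all add: power2_eq_square)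
qed

lemma leray_add: "leray \<xi> (z + w) = leray \<xi> z + leray \<xi> w"
  by (simp add: leray_def cdot_add vec_eq_iff add_divide_distrib distrib_right)
lemma leray_diff: "leray \<xi> (z - w) = leray \<xi> z - leray \<xi> w"
  by (simp add: leray_def cdot_diff vec_eq_iff diff_divide_distrib left_diff_distrib)
lemma leray_cnjv: "leray \<xi> (cnjv z) = cnjv (leray \<xi> z)"
  by (simp add: leray_def cdot_cnjv) (simp add: cnjv_def cvec_def vec_eq_iff)
lemma leray_minus_freq: "leray (- \<xi>) z = leray \<xi> z"
  by (simp add: leray_def cdot_minus_left) (simp add: cvec_def vec_eq_iff)

lemma linear_leray: "linear (leray \<xi>)"
  by (rule linearI) (simp_all add: leray_add, simp add: leray_def cdot_scaleR vec_eq_iff, simp add: scaleR_conv_of_real algebra_simps)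

lemma linear_cscale: "linear (\<lambda>z :: complex ^ 'n. c *s z)"
  by (rule linearI) (simp_all add: vec_eq_iff algebra_simps)

lemma solenoidalD:
  assumes "solenoidal L u"
  shows "u 0 = 0" "u (- k) = cnjv (u k)" "cdot (freq L k) (u k) = 0"
  using assms by (auto simp: solenoidal_def cnjv_def vec_eq_iff cdot_def)

lemma solenoidalI:
  assumes "u 0 = 0" "\<And>k. u (- k) = cnjv (u k)" "\<And>k. cdot (freq L k) (u k) = 0"
  shows "solenoidal L u"
  using assms by (auto simp: solenoidal_def cnjv_def vec_eq_iff cdot_def)

lemma solenoidal_diff: "solenoidal L u \<Longrightarrow> solenoidal L v \<Longrightarrow> solenoidal L (u - v)"
  by (auto intro!: solenoidalI simp: solenoidalD cdot_diff) (auto simp: cnjv_def vec_eq_iff)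

lemma solenoidal_add: "solenoidal L u \<Longrightarrow> solenoidal L v \<Longrightarrow> solenoidal L (\<lambda>k. u k + v k)"
  by (auto intro!: solenoidalI simp: solenoidalD cdot_add) (auto simp: cnjv_def vec_eq_iff)

lemma solenoidal_scaleR: "solenoidal L u \<Longrightarrow> solenoidal L (\<lambda>k. c *\<^sub>R u k)"
  by (auto intro!: solenoidalI simp: solenoidalD cdot_scaleR) (auto simp: cnjv_def vec_eq_iff)

lemma solenoidal_0: "solenoidal L (\<lambda>_. 0)"
  by (auto intro!: solenoidalI)

section \<open>Weighted norms, truncation and duality for coefficient families\<close>

context torus
begin

definition coef :: "real \<Rightarrow> coeffs \<Rightarrow> int ^ 3 \<Rightarrow> real" where
  "coef s u k = lam k powr s * norm (u k)"

text \<open>Finiteness of the norm is kept apart from \<open>solenoidal\<close>, so that norm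
  estimates can be stated for arbitrary coefficient families. \<open>nrm\<close> drops the volume
  factor of \<open>Vnorm\<close>.\<close>

definition hs :: "real \<Rightarrow> coeffs \<Rightarrow> bool" where "hs s u \<longleftrightarrow> l2 (- {0}) (coef s u)"
definition nrm :: "real \<Rightarrow> coeffs \<Rightarrow> real" where "nrm s u = l2n (- {0}) (coef s u)"

lemma coef_nonneg [simp]: "coef s u k \<ge> 0" by (simp add: coef_def)

lemma nrm_nonneg [simp]: "nrm s u \<ge> 0" by (simp add: nrm_def)

lemma coef_sq: "(coef s u k)\<^sup>2 = norm (freq L k) powr (2 * s) * (norm (u k))\<^sup>2"
  by (simp add: coef_def power_mult_distrib powr_sq lam_def)

lemma V_iff: "u \<in> V L s \<longleftrightarrow> solenoidal L u \<and> hs s u"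
  by (simp add: V_def hs_def l2_def coef_sq)

lemma Vnorm_eq: "Vnorm L s u = sqrt (L ^ 3) * nrm s u"
  by (simp add: Vnorm_def nrm_def l2n_def coef_sq real_sqrt_mult)

text \<open>A zero base gives 0 under \<open>powr\<close> even with exponent 0. The weight of order
  0 therefore annihilates the zero mode instead of being 1 there.\<close>

lemma coef_0: "coef 0 u k = (if k = 0 then 0 else norm (u k))"
  using lam_pos[of k] by (auto simp: coef_def)

lemma norm_le_nrm: assumes "hs s u" "k \<noteq> 0" shows "coef s u k \<le> nrm s u"
  using L2_set_le_l2n[of "- {0}" "coef s u" "{k}"] assms by (simp add: hs_def nrm_def)

lemma norm_le_nrm0: assumes "hs 0 u" "u 0 = 0" shows "norm (u k) \<le> nrm 0 u"
  using norm_le_nrm[OF assms(1), of k] assms(2) by (cases "k = 0") (auto simp: coef_0)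

lemma hs_le:
  assumes "hs t v" "\<And>k. k \<noteq> 0 \<Longrightarrow> coef s u k \<le> coef t v k"
  shows "hs s u" "nrm s u \<le> nrm t v"
  using l2_le[of "- {0}" "coef t v" "coef s u"] assms by (auto simp: hs_def nrm_def)

lemma hs_add:
  assumes "hs s u" "hs s v"
  shows "hs s (\<lambda>k. u k + v k)" "nrm s (\<lambda>k. u k + v k) \<le> nrm s u + nrm s v"
proof -
  have *: "\<bar>coef s (\<lambda>k. u k + v k) k\<bar> \<le> \<bar>coef s u k + coef s v k\<bar>" for k
    using mult_left_mono[OF norm_triangle_ineq[of "u k" "v k"], of "lam k powr s"]
    by (simp add: coef_def distrib_left)
  note l = l2_add[of "- {0}" "coef s u" "coef s v"]
  from l2_le[OF l(1) *] l(2) assms show "hs s (\<lambda>k. u k + v k)" "nrm s (\<lambda>k. u k + v k) \<le> nrm s u + nrm s v"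
    by (auto simp: hs_def nrm_def)
qed

lemma hs_scaleR:
  assumes "hs s u"
  shows "hs s (\<lambda>k. c *\<^sub>R u k)" "nrm s (\<lambda>k. c *\<^sub>R u k) = \<bar>c\<bar> * nrm s u"
proof -
  have "coef s (\<lambda>k. c *\<^sub>R u k) = (\<lambda>k. \<bar>c\<bar> * coef s u k)" by (simp add: coef_def fun_eq_iff)
  then show "hs s (\<lambda>k. c *\<^sub>R u k)" "nrm s (\<lambda>k. c *\<^sub>R u k) = \<bar>c\<bar> * nrm s u"
    using l2_cmult[of "- {0}" "coef s u" "\<bar>c\<bar>"] assms by (auto simp: hs_def nrm_def)
qed

lemma nrm_minus: "nrm s (u - v) = nrm s (v - u)"
  unfolding nrm_def coef_def by (simp add: norm_minus_commute[of "u _"])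

lemma hs_diff:
  assumes "hs s u" "hs s v"
  shows "hs s (u - v)" "nrm s (u - v) \<le> nrm s u + nrm s v"
proof -
  have "u - v = (\<lambda>k. u k + (-1) *\<^sub>R v k)" by (simp add: fun_eq_iff)
  then show "hs s (u - v)" "nrm s (u - v) \<le> nrm s u + nrm s v"
    using hs_add[OF assms(1) hs_scaleR(1)[OF assms(2), of "-1"]] hs_scaleR(2)[OF assms(2), of "-1"] by auto
qed

lemma nrm_triangle:
  assumes "hs s (u - v)" "hs s v"
  shows "hs s u" "nrm s u \<le> nrm s (u - v) + nrm s v"
  using hs_add[OF assms] by auto

text \<open>The Poincare inequality: nonzero frequencies are bounded below by \<open>lam0\<close>,
  hence the lower-order weight is at most a constant times the higher-order one.\<close>

lemma hs_mono:
  assumes "hs t u" "s \<le> t"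
  shows "hs s u" "nrm s u \<le> lam0 powr (s - t) * nrm t u"
proof -
  have *: "\<bar>coef s u k\<bar> \<le> \<bar>lam0 powr (s - t) * coef t u k\<bar>" if "k \<in> - {0}" for k
  proof -
    have "lam k powr s = lam k powr (s - t) * lam k powr t"
      using lam_pos[of k] that by (simp flip: powr_add)
    also have "\<dots> \<le> lam0 powr (s - t) * lam k powr t"
      using lam_ge[of k] that lam0_pos assms by (intro mult_right_mono powr_mono2') auto
    finally have "lam k powr s * norm (u k) \<le> lam0 powr (s - t) * lam k powr t * norm (u k)"
      by (rule mult_right_mono) auto
    then show ?thesis by (simp add: coef_def abs_mult mult_ac)
  qed
  note l = l2_cmult[of "- {0}" "coef t u" "lam0 powr (s - t)"]
  from l2_le[OF l(1) *] l(2) assms show "hs s u" "nrm s u \<le> lam0 powr (s - t) * nrm t u"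
    by (auto simp: hs_def nrm_def)
qed

lemma V_mono: "u \<in> V L t \<Longrightarrow> s \<le> t \<Longrightarrow> u \<in> V L s"
  by (auto simp: V_iff hs_mono)

definition proj :: "nat \<Rightarrow> coeffs \<Rightarrow> coeffs" where
  "proj N u = (\<lambda>k. if k \<in> modes N then u k else 0)"

lemma solenoidal_proj: "solenoidal L u \<Longrightarrow> solenoidal L (proj N u)"
  by (intro solenoidalI) (simp_all add: proj_def solenoidalD)

lemma trig_poly_proj: "solenoidal L u \<Longrightarrow> proj N u \<in> trig_poly L"
  unfolding trig_poly_def using finite_subset[OF _ finite_modes[of N], of "{k. proj N u k \<noteq> 0}"]
  by (auto simp: solenoidal_proj) (auto simp: proj_def)

lemma zero_modes [simp]: "0 \<notin> modes N" by (simp add: modes_def)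

lemma l2_finite_support:
  assumes "finite F" "F \<subseteq> A" "\<And>k. k \<in> A \<Longrightarrow> k \<notin> F \<Longrightarrow> f k = 0"
  shows "l2 A f" "l2n A f = L2_set f F"
proof -
  have "((\<lambda>x. (f x)\<^sup>2) has_sum (\<Sum>x\<in>F. (f x)\<^sup>2)) A"
    by (rule has_sum_finite_neutralI) (use assms in auto)
  then show "l2 A f" "l2n A f = L2_set f F"
    by (auto simp: l2_def l2n_def L2_set_def summable_on_def infsumI)
qed

lemma hs_trig: assumes "u \<in> trig_poly L" shows "hs s u"
  unfolding hs_def
  by (rule l2_finite_support[of "{k. u k \<noteq> 0}"])
     (use assms in \<open>auto simp: trig_poly_def solenoidal_def coef_def\<close>)

lemma trig_V: "u \<in> trig_poly L \<Longrightarrow> u \<in> V L s"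
  by (auto simp: V_iff hs_trig) (auto simp: trig_poly_def)

lemma hs_proj: "hs s (proj N u)" and nrm_proj: "nrm s (proj N u) = L2_set (coef s u) (modes N)"
proof -
  have *: "coef s (proj N u) k = 0" if "k \<notin> modes N" for k using that by (simp add: coef_def proj_def)
  show "hs s (proj N u)" unfolding hs_def by (rule l2_finite_support[of "modes N"]) (simp_all add: *)
  have "nrm s (proj N u) = L2_set (coef s (proj N u)) (modes N)"
    unfolding nrm_def by (rule l2_finite_support[of "modes N"]) (simp_all add: *)
  then show "nrm s (proj N u) = L2_set (coef s u) (modes N)"
    by (simp add: coef_def proj_def L2_set_def)
qed

lemma nrm_tail_le: "hs s u \<Longrightarrow> hs s (u - proj N u) \<and> nrm s (u - proj N u) \<le> nrm s u"
  using hs_le[of s u s "u - proj N u"] by (auto simp: coef_def proj_def)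

lemma nrm_sq_modes: "hs s u \<Longrightarrow> (\<lambda>N. \<Sum>k\<in>modes N. (coef s u k)\<^sup>2) \<longlonglongrightarrow> (nrm s u)\<^sup>2"
  unfolding nrm_def l2n_sq by (rule infsum_modes) (simp add: hs_def l2_def)

lemma sum_modes_le: "hs s u \<Longrightarrow> (\<Sum>k\<in>modes N. (coef s u k)\<^sup>2) \<le> (nrm s u)\<^sup>2"
  unfolding nrm_def l2n_sq by (rule finite_sum_le_infsum) (auto simp: hs_def l2_def)

text \<open>The cubes are cofinal among finite sets, so bounds on truncated norms suffice.
  Membership in a space is obtained this way from energy estimates that are only known for
  truncations.\<close>

lemma hs_modesI:
  assumes "\<And>N. (\<Sum>k\<in>modes N. (coef s u k)\<^sup>2) \<le> b\<^sup>2" "b \<ge> 0"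
  shows "hs s u" "nrm s u \<le> b"
proof -
  have "L2_set (coef s u) F \<le> b" if F: "finite F" "F \<subseteq> - {0}" for F
  proof -
    obtain N where "F \<subseteq> modes N"
      using filterlim_modes[unfolded filterlim_finite_subsets_at_top, rule_format, of F] F
      by (auto simp: eventually_sequentially)
    then have "(\<Sum>k\<in>F. (coef s u k)\<^sup>2) \<le> b\<^sup>2"
      using sum_mono2[of "modes N" F "\<lambda>k. (coef s u k)\<^sup>2"] assms(1)[of N] by fastforce
    then show ?thesis unfolding L2_set_def by (simp add: real_le_lsqrt assms(2))
  qed
  then show "hs s u" "nrm s u \<le> b" unfolding hs_def nrm_def by (fact l2_bound)+
qed

text \<open>The square of the tail norm is the full square minus the partial sum over the cube,
  which converges to the full square.\<close>

lemma nrm_tail: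
  assumes "hs s u" shows "(\<lambda>N. nrm s (u - proj N u)) \<longlonglongrightarrow> 0"
proof -
  have eq: "(nrm s (u - proj N u))\<^sup>2 = (nrm s u)\<^sup>2 - (\<Sum>k\<in>modes N. (coef s u k)\<^sup>2)" for N
  proof -
    have "(nrm s u)\<^sup>2 = (\<Sum>\<^sub>\<infinity>k\<in>- {0} - modes N \<union> modes N. (coef s u k)\<^sup>2)"
      unfolding nrm_def l2n_sq by (rule infsum_cong_neutral) (auto simp: modes_def)
    also have "\<dots> = (\<Sum>\<^sub>\<infinity>k\<in>- {0} - modes N. (coef s u k)\<^sup>2) + (\<Sum>\<^sub>\<infinity>k\<in>modes N. (coef s u k)\<^sup>2)"
      by (rule infsum_Un_disjoint)
         (use assms in \<open>auto simp: hs_def l2_def intro: summable_on_subset_banach\<close>)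
    also have "(\<Sum>\<^sub>\<infinity>k\<in>- {0} - modes N. (coef s u k)\<^sup>2) = (nrm s (u - proj N u))\<^sup>2"
      unfolding nrm_def l2n_sq by (rule infsum_cong_neutral) (auto simp: coef_def proj_def)
    finally show ?thesis by simp
  qed
  have "(\<lambda>N. (nrm s (u - proj N u))\<^sup>2) \<longlonglongrightarrow> (nrm s u)\<^sup>2 - (nrm s u)\<^sup>2"
    unfolding eq by (intro tendsto_intros nrm_sq_modes assms)
  then have "(\<lambda>N. sqrt ((nrm s (u - proj N u))\<^sup>2)) \<longlonglongrightarrow> sqrt 0" by (intro tendsto_real_sqrt) simp
  then show ?thesis by simp
qed

text \<open>Quantitative compactness of the embedding of V^t in V^s: outside the cube some component
  is at least N + 1, so lowering the order by t - s gains that negative power of the cutoff,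
  uniformly on bounded sets of V^t.\<close>

lemma nrm_tail_gap:
  assumes "hs t u" "s \<le> t"
  shows "nrm s (u - proj N u) \<le> (lam0 * real (Suc N)) powr (s - t) * nrm t u"
proof -
  have *: "\<bar>coef s (u - proj N u) k\<bar> \<le> \<bar>(lam0 * real (Suc N)) powr (s - t) * coef t u k\<bar>" if "k \<in> - {0}" for k
  proof (cases "k \<in> modes N")
    case True then show ?thesis by (simp add: coef_def proj_def)
  next
    case False
    have "lam k powr s = lam k powr (s - t) * lam k powr t"
      using lam_pos[of k] that by (simp flip: powr_add)
    also have "\<dots> \<le> (lam0 * real (Suc N)) powr (s - t) * lam k powr t"
      using lam_outside[of k N] that False lam0_pos assms by (intro mult_right_mono powr_mono2') auto
    finally have "lam k powr s * norm (u k) \<le> (lam0 * real (Suc N)) powr (s - t) * lam k powr t * norm (u k)"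
      by (rule mult_right_mono) auto
    then show ?thesis using False by (simp add: coef_def abs_mult mult_ac proj_def del: of_nat_Suc)
  qed
  note l = l2_cmult[of "- {0}" "coef t u" "(lam0 * real (Suc N)) powr (s - t)"]
  from l2_le[OF l(1) *] l(2) assms show ?thesis
    by (auto simp: hs_def nrm_def simp del: of_nat_Suc)
qed

lemma nrm_split:
  assumes "hs s u"
  shows "nrm s u \<le> nrm s (proj N u) + nrm s (u - proj N u)"
  using nrm_triangle(2)[of s u "proj N u"] nrm_tail_le[OF assms, of N] hs_proj[of s N u] by simp

text \<open>The weights \<open>\<bar>\<zeta>\<bar>\<^sup>-\<^sup>s\<close> and \<open>\<bar>\<zeta>\<bar>\<^sup>s\<close> cancel mode by mode.\<close>

lemma pairing_sum:
  assumes "hs (- s) u" "hs s v"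
  shows "(\<lambda>k. norm (u k) * norm (v k)) summable_on - {0}"
    "(\<Sum>\<^sub>\<infinity>k\<in>- {0}. norm (u k) * norm (v k)) \<le> nrm (- s) u * nrm s v"
    "(\<lambda>k. u k \<bullet> v k) summable_on - {0}"
proof -
  have eq: "\<bar>coef (- s) u k * coef s v k\<bar> = norm (u k) * norm (v k)" if "k \<in> - {0}" for k
    using lam_pos[of k] that by (simp add: coef_def powr_minus abs_mult)
  note l = l2_mult[OF assms[unfolded hs_def]]
  show s: "(\<lambda>k. norm (u k) * norm (v k)) summable_on - {0}"
    using l(1) by (rule summable_on_cong[THEN iffD1, rotated]) (rule eq)
  have "(\<Sum>\<^sub>\<infinity>k\<in>- {0}. \<bar>coef (- s) u k * coef s v k\<bar>) = (\<Sum>\<^sub>\<infinity>k\<in>- {0}. norm (u k) * norm (v k))"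
    by (rule infsum_cong) (rule eq)
  then show "(\<Sum>\<^sub>\<infinity>k\<in>- {0}. norm (u k) * norm (v k)) \<le> nrm (- s) u * nrm s v"
    using l(2) by (simp add: nrm_def)
  show "(\<lambda>k. u k \<bullet> v k) summable_on - {0}"
    by (rule infsum_norm_le(1)[OF s]) (simp add: Cauchy_Schwarz_ineq2)
qed

lemma pairing_le:
  assumes "hs (- s) u" "hs s v"
  shows "\<bar>pairing L u v\<bar> \<le> L ^ 3 * (nrm (- s) u * nrm s v)"
proof -
  have "norm (\<Sum>\<^sub>\<infinity>k\<in>- {0}. u k \<bullet> v k) \<le> (\<Sum>\<^sub>\<infinity>k\<in>- {0}. norm (u k) * norm (v k))"
    by (rule infsum_norm_le(2)[OF pairing_sum(1)[OF assms]]) (simp add: Cauchy_Schwarz_ineq2)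
  then show ?thesis using pairing_sum(2)[OF assms] L_pos by (simp add: pairing_def abs_mult)
qed

lemma pairing_diff_left:
  assumes "hs (- s) u" "hs (- s) u'" "hs s v"
  shows "pairing L (u - u') v = pairing L u v - pairing L u' v"
proof -
  have "(\<Sum>\<^sub>\<infinity>k\<in>- {0}. (u - u') k \<bullet> v k) = (\<Sum>\<^sub>\<infinity>k\<in>- {0}. u k \<bullet> v k - u' k \<bullet> v k)"
    by (simp add: inner_diff_left)
  also have "\<dots> = (\<Sum>\<^sub>\<infinity>k\<in>- {0}. u k \<bullet> v k) - (\<Sum>\<^sub>\<infinity>k\<in>- {0}. u' k \<bullet> v k)"
    by (rule infsum_diff) (use assms pairing_sum(3) in auto)
  finally show ?thesis by (simp add: pairing_def right_diff_distrib)
qed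

lemma pairing_commute: "pairing L u v = pairing L v u"
  by (simp add: pairing_def inner_commute)

lemma pairing_diff_right:
  assumes "hs (- s) u" "hs s v" "hs s v'"
  shows "pairing L u (v - v') = pairing L u v - pairing L u v'"
  using pairing_diff_left[of "- s" v v' u] assms by (simp add: pairing_commute)

lemma pairing_finite:
  assumes "finite F" "F \<subseteq> - {0}" "\<And>k. k \<noteq> 0 \<Longrightarrow> k \<notin> F \<Longrightarrow> v k = 0"
  shows "pairing L u v = L ^ 3 * (\<Sum>k\<in>F. u k \<bullet> v k)"
proof -
  have "((\<lambda>k. u k \<bullet> v k) has_sum (\<Sum>k\<in>F. u k \<bullet> v k)) (- {0})"
    by (rule has_sum_finite_neutralI) (use assms in auto)
  then show ?thesis by (simp add: pairing_def infsumI)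
qed

lemma pairing_modes:
  assumes "hs (- s) u" "hs s v"
  shows "(\<lambda>N. L ^ 3 * (\<Sum>k\<in>modes N. u k \<bullet> v k)) \<longlonglongrightarrow> pairing L u v"
  unfolding pairing_def by (intro tendsto_intros infsum_modes pairing_sum(3)[OF assms])

text \<open>Test fields that isolate one Fourier coefficient. Reality forces the conjugate amplitude
  at \<open>- k\<close>; the complex amplitude \<open>z\<close> ranges over the directions
  orthogonal to the frequency.\<close>

definition single :: "int ^ 3 \<Rightarrow> complex ^ 3 \<Rightarrow> coeffs" where
  "single k z = (\<lambda>l. if l = k then z else if l = - k then cnjv z else 0)"

lemma neg_neq: "k \<noteq> 0 \<Longrightarrow> - k \<noteq> (k :: int ^ 3)"
  by (auto simp: vec_eq_iff)

lemma single_trig: assumes "k \<noteq> 0" "cdot (freq L k) z = 0" shows "single k z \<in> trig_poly L"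
proof -
  have "solenoidal L (single k z)"
  proof (rule solenoidalI)
    show "single k z (- l) = cnjv (single k z l)" for l
      using neg_neq[OF assms(1)] by (auto simp: single_def cnjv_cnjv minus_equation_iff[of l])
  qed (use assms in \<open>auto simp: single_def freq_minus cdot_minus_left cdot_cnjv\<close>)
  moreover have "finite {l. single k z l \<noteq> 0}"
    by (rule finite_subset[of _ "{k, - k}"]) (auto simp: single_def split: if_splits)
  ultimately show ?thesis by (simp add: trig_poly_def)
qed

text \<open>The modes \<open>k\<close> and \<open>- k\<close> are distinct and contribute equally,
  hence the factor 2.\<close>

lemma pairing_single:
  assumes "k \<noteq> 0" "solenoidal L u"
  shows "pairing L u (single k z) = 2 * L ^ 3 * (u k \<bullet> z)"
proof -
  have "pairing L u (single k z) = L ^ 3 * (\<Sum>l\<in>{k, - k}. u l \<bullet> single k z l)"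
    by (rule pairing_finite) (use assms in \<open>auto simp: single_def\<close>)
  then show ?thesis using neg_neq[OF assms(1)] assms by (simp add: single_def solenoidalD)
qed

end

section \<open>The bilinear operator on Fourier coefficients\<close>

lemma has_sum_sum:
  fixes f :: "'a \<Rightarrow> 'b \<Rightarrow> 'c::{topological_comm_monoid_add}"
  assumes "finite F" "\<And>k. k \<in> F \<Longrightarrow> (f k has_sum g k) A"
  shows "((\<lambda>x. \<Sum>k\<in>F. f k x) has_sum (\<Sum>k\<in>F. g k)) A"
  using assms by (induction F) (auto intro: has_sum_add has_sum_0)

lemma l2_shift:
  fixes f :: "'a::ab_group_add \<Rightarrow> real"
  assumes "l2 UNIV f"
  shows "l2 UNIV (\<lambda>l. f (k - l))" "l2n UNIV (\<lambda>l. f (k - l)) = l2n UNIV f"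
proof -
  have b: "bij (\<lambda>l. k - l)" by (rule bij_betw_byWitness[of _ "\<lambda>l. k - l"]) auto
  show "l2 UNIV (\<lambda>l. f (k - l))"
    using assms summable_on_reindex_bij_betw[OF b, of "\<lambda>x. (f x)\<^sup>2"] by (simp add: l2_def)
  show "l2n UNIV (\<lambda>l. f (k - l)) = l2n UNIV f"
    using infsum_reindex_bij_betw[OF b, of "\<lambda>x. (f x)\<^sup>2"] by (simp add: l2n_def)
qed

lemma l2_UNIV:
  assumes "f 0 = 0"
  shows "l2 UNIV f \<longleftrightarrow> l2 (- {0}) f" "l2n UNIV f = l2n (- {0}) f"
proof -
  show "l2 UNIV f \<longleftrightarrow> l2 (- {0}) f"
    unfolding l2_def by (rule summable_on_cong_neutral) (use assms in auto)
  have "(\<Sum>\<^sub>\<infinity>x\<in>UNIV. (f x)\<^sup>2) = (\<Sum>\<^sub>\<infinity>x\<in>- {0}. (f x)\<^sup>2)"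
    by (rule infsum_cong_neutral) (use assms in auto)
  then show "l2n UNIV f = l2n (- {0}) f" by (simp add: l2n_def)
qed

text \<open>Replacing the larger of x and y by the smaller one only increases the product of
  negative powers, and the exponents add up to -4.\<close>

lemma powr_mult_le_powr4:
  fixes x y p q :: real
  assumes "x > 0" "y > 0" "p \<ge> 0" "q \<ge> 0" "p + q = 4"
  shows "x powr (- p) * y powr (- q) \<le> x powr (- 4) + y powr (- 4)"
proof -
have eq: "- p - q = - 4" using assms by simp
show ?thesis
proof (cases "x \<le> y")
  case True
  have "x powr (- p) * y powr (- q) \<le> x powr (- p) * x powr (- q)"
    using True assms by (intro mult_left_mono powr_mono2') auto
  also have "\<dots> = x powr (- 4)" using assms(5) by (simp flip: powr_add) (simp add: eq)
  finally show ?thesis by (simp add: add_increasing2)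
next
  case False
  have "x powr (- p) * y powr (- q) \<le> y powr (- p) * y powr (- q)"
    using False assms by (intro mult_right_mono powr_mono2') auto
  also have "\<dots> = y powr (- 4)" using assms(5) by (simp flip: powr_add) (simp add: eq)
  finally show ?thesis by (simp add: add_increasing)
qed
qed

context torus
begin

definition Bsym :: "coeffs \<Rightarrow> coeffs \<Rightarrow> int ^ 3 \<Rightarrow> int ^ 3 \<Rightarrow> complex ^ 3" where
  "Bsym u v k l = cdot (freq L k) (u (k - l)) *s v l"

text \<open>The Fourier coefficients of the Leray projection of \<open>(u \<cdot> \<nabla>) v\<close>. As \<open>u\<close> is divergence free, the frequency
  \<open>\<zeta>\<^sub>l\<close> of the gradient may be replaced by \<open>\<zeta>\<^sub>k\<close>.\<close>

definition Bf :: "coeffs \<Rightarrow> coeffs \<Rightarrow> coeffs" where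
  "Bf u v k = (if k = 0 then 0 else leray (freq L k) (\<i> *s (\<Sum>\<^sub>\<infinity>l\<in>- {0}. Bsym u v k l)))"

text \<open>The squared weight used for the convolution is dominated by the sum of two copies of the
  fourth inverse powers, one of them translated and reflected. Both have the same total, which
  explains the 2 under the root.\<close>

definition KB :: real where "KB = sqrt (2 * (\<Sum>\<^sub>\<infinity>k\<in>- {0}. lam k powr (- 4)))"

lemma KB_nonneg [simp]: "KB \<ge> 0" by (simp add: KB_def infsum_nonneg)

lemma norm_Bsym: "norm (Bsym u v k l) \<le> lam k * (norm (u (k - l)) * norm (v l))"
  using mult_right_mono[OF norm_cdot[of "freq L k" "u (k - l)"], of "norm (v l)"]
  by (simp add: Bsym_def norm_cscale lam_def mult_ac)

lemma l2_coef0: "hs 0 u \<Longrightarrow> u 0 = 0 \<Longrightarrow> l2 UNIV (\<lambda>k. norm (u k))"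
  and l2n_coef0: "hs 0 u \<Longrightarrow> u 0 = 0 \<Longrightarrow> l2n UNIV (\<lambda>k. norm (u k)) = nrm 0 u"
proof -
  assume a: "hs 0 u" "u 0 = 0"
  then have "coef 0 u = (\<lambda>k. norm (u k))" by (auto simp: coef_0)
  then show "l2 UNIV (\<lambda>k. norm (u k))" "l2n UNIV (\<lambda>k. norm (u k)) = nrm 0 u"
    using a l2_UNIV[of "\<lambda>k. norm (u k)"] by (auto simp: hs_def nrm_def)
qed

lemma conv0:
  assumes "hs 0 u" "u 0 = 0" "hs 0 v" "v 0 = 0"
  shows "(\<lambda>l. norm (u (k - l)) * norm (v l)) summable_on UNIV"
    "(\<Sum>\<^sub>\<infinity>l\<in>UNIV. norm (u (k - l)) * norm (v l)) \<le> nrm 0 u * nrm 0 v"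
  using l2_mult[OF l2_shift(1)[OF l2_coef0[OF assms(1,2)], of k] l2_coef0[OF assms(3,4)]]
  by (simp_all add: l2_shift(2)[OF l2_coef0[OF assms(1,2)], of k] l2n_coef0 assms)

text \<open>With the gradient frequency moved from \<open>l\<close> to \<open>k\<close>, the factor
  \<open>lam k\<close> leaves the sum and the rest is a convolution of two square-summable families.
  So the series of \<open>Bf\<close> converges for fields that are merely in V^0.\<close>

lemma Bsym_summable:
  assumes "hs 0 u" "u 0 = 0" "hs 0 v" "v 0 = 0"
  shows "Bsym u v k summable_on - {0}"
    "norm (\<Sum>\<^sub>\<infinity>l\<in>- {0}. Bsym u v k l) \<le> lam k * (\<Sum>\<^sub>\<infinity>l\<in>UNIV. norm (u (k - l)) * norm (v l))"
proof -
  have eq: "(\<Sum>\<^sub>\<infinity>l\<in>- {0}. Bsym u v k l) = (\<Sum>\<^sub>\<infinity>l\<in>UNIV. Bsym u v k l)"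
    by (rule infsum_cong_neutral) (use assms in \<open>auto simp: Bsym_def\<close>)
  have s: "(\<lambda>l. lam k * (norm (u (k - l)) * norm (v l))) summable_on UNIV"
    by (intro summable_on_cmult_right conv0 assms)
  have "norm (Bsym u v k l) \<le> lam k * (norm (u (k - l)) * norm (v l))" for l by (rule norm_Bsym)
  note l = infsum_norm_le[OF s this]
  show "Bsym u v k summable_on - {0}"
    by (rule summable_on_subset_banach[OF l(1)]) auto
  show "norm (\<Sum>\<^sub>\<infinity>l\<in>- {0}. Bsym u v k l) \<le> lam k * (\<Sum>\<^sub>\<infinity>l\<in>UNIV. norm (u (k - l)) * norm (v l))"
    unfolding eq using l(2) by (simp add: infsum_cmult_right')
qed

lemma norm_Bf_le:
  assumes "hs 0 u" "u 0 = 0" "hs 0 v" "v 0 = 0"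
  shows "norm (Bf u v k) \<le> lam k * (\<Sum>\<^sub>\<infinity>l\<in>UNIV. norm (u (k - l)) * norm (v l))"
proof (cases "k = 0")
  case False
  then have "freq L k \<noteq> 0" using lam_pos[OF False] by (auto simp: lam_def)
  then have "norm (Bf u v k) \<le> norm (\<i> *s (\<Sum>\<^sub>\<infinity>l\<in>- {0}. Bsym u v k l))"
    using False by (simp add: Bf_def norm_leray)
  also have "\<dots> \<le> lam k * (\<Sum>\<^sub>\<infinity>l\<in>UNIV. norm (u (k - l)) * norm (v l))"
    using Bsym_summable(2)[OF assms] by (simp add: norm_cscale)
  finally show ?thesis .
qed (simp add: Bf_def)

text \<open>A bound for one fixed mode by V^0 norms alone. It is what makes the passage to the limit
  possible mode by mode, where L2 convergence in V^0 is available but no convergence in V^1.\<close>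

lemma norm_Bf_le0:
  assumes "hs 0 u" "u 0 = 0" "hs 0 v" "v 0 = 0"
  shows "norm (Bf u v k) \<le> lam k * (nrm 0 u * nrm 0 v)"
  by (rule order_trans[OF norm_Bf_le[OF assms] mult_left_mono[OF conv0(2)[OF assms]]]) simp

text \<open>By Cauchy-Schwarz with weight \<open>\<bar>\<zeta>\<^sub>k\<^sub>-\<^sub>l\<bar>\<^sup>-\<^sup>p \<bar>\<zeta>\<^sub>l\<bar>\<^sup>-\<^sup>q\<close>, whose square has a sum over \<open>l\<close> that is bounded uniformly in \<open>k\<close>.\<close>

lemma conv_pq:
  assumes p: "p \<ge> 0" "q \<ge> 0" "p + q = 2"
    and u: "hs p u" "u 0 = 0" and v: "hs q v" "v 0 = 0"
  defines "c \<equiv> \<lambda>k. \<Sum>\<^sub>\<infinity>l\<in>UNIV. norm (u (k - l)) * norm (v l)"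
  shows "l2 UNIV c" "l2n UNIV c \<le> KB * (nrm p u * nrm q v)"
proof -
  define \<alpha> where "\<alpha> = coef p u"
  define \<beta> where "\<beta> = coef q v"
  have \<alpha>0: "\<alpha> 0 = 0" and \<beta>0: "\<beta> 0 = 0" by (simp_all add: \<alpha>_def \<beta>_def coef_def)
  have \<alpha>: "l2 UNIV \<alpha>" "l2n UNIV \<alpha> = nrm p u" and \<beta>: "l2 UNIV \<beta>" "l2n UNIV \<beta> = nrm q v"
    using l2_UNIV[of \<alpha>, OF \<alpha>0] l2_UNIV[of \<beta>, OF \<beta>0] u v by (simp_all add: hs_def nrm_def \<alpha>_def \<beta>_def)
  define S where "S = (\<Sum>\<^sub>\<infinity>k\<in>UNIV. lam k powr (- 4))"
  have sS: "(\<lambda>k. lam k powr (- 4)) summable_on UNIV"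
    using summable_lam4 by (rule summable_on_cong_neutral[THEN iffD1, rotated -1]) auto
  have S: "S = (\<Sum>\<^sub>\<infinity>k\<in>- {0}. lam k powr (- 4))"
    unfolding S_def by (rule infsum_cong_neutral) auto
  \<comment> \<open>The zero values cover the two indices at which a frequency vanishes and the
    inverse weights make no sense; there the summand is 0 as well, since u and v have mean
    zero.\<close>
  define \<omega> where "\<omega> k l = (if l = 0 \<or> k = l then 0 else lam (k - l) powr (- p) * lam l powr (- q))" for k l
  have \<omega>sq: "(\<omega> k l)\<^sup>2 \<le> lam (k - l) powr (- 4) + lam l powr (- 4)" for k l
  proof (cases "l = 0 \<or> k = l")
    case False
    then have "(\<omega> k l)\<^sup>2 = lam (k - l) powr (- (2 * p)) * lam l powr (- (2 * q))"
      by (simp add: \<omega>_def power_mult_distrib powr_sq)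
    also have "\<dots> \<le> lam (k - l) powr (- 4) + lam l powr (- 4)"
      using False p by (intro powr_mult_le_powr4 lam_pos) auto
    finally show ?thesis .
  qed (auto simp: \<omega>_def)
  have b: "bij (\<lambda>l. k - l)" for k :: "int ^ 3" by (rule bij_betw_byWitness[of _ "\<lambda>l. k - l"]) auto
  have s1: "(\<lambda>l. lam (k - l) powr (- 4)) summable_on UNIV" and S1: "(\<Sum>\<^sub>\<infinity>l\<in>UNIV. lam (k - l) powr (- 4)) = S" for k
    using summable_on_reindex_bij_betw[OF b[of k], of "\<lambda>k. lam k powr (- 4)"]
      infsum_reindex_bij_betw[OF b[of k], of "\<lambda>k. lam k powr (- 4)"] sS by (simp_all add: S_def)
  have \<omega>: "l2 UNIV (\<omega> k)" "l2n UNIV (\<omega> k) \<le> KB" for k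
  proof -
    have s: "(\<lambda>l. lam (k - l) powr (- 4) + lam l powr (- 4)) summable_on UNIV"
      by (intro summable_on_add s1 sS)
    have "norm ((\<omega> k l)\<^sup>2) \<le> lam (k - l) powr (- 4) + lam l powr (- 4)" for l using \<omega>sq[of k l] by simp
    note l = infsum_norm_le[OF s this]
    show "l2 UNIV (\<omega> k)" using l(1) by (simp add: l2_def)
    have "(\<Sum>\<^sub>\<infinity>l\<in>UNIV. (\<omega> k l)\<^sup>2) \<le> S + S"
      using l(2) infsum_add[OF s1[of k] sS] by (simp add: S1 S_def[symmetric] infsum_nonneg)
    then show "l2n UNIV (\<omega> k) \<le> KB" unfolding l2n_def KB_def S[symmetric] by simp
  qed
  define \<gamma> where "\<gamma> k l = \<alpha> (k - l) * \<beta> l" for k l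
  have \<alpha>le: "\<bar>\<alpha> k\<bar> \<le> l2n UNIV \<alpha>" for k using L2_set_le_l2n[OF \<alpha>(1), of "{k}"] by simp
  have \<gamma>: "l2 UNIV (\<gamma> k)" for k
  proof (rule l2_le(1)[OF l2_cmult(1)[OF \<beta>(1), of "l2n UNIV \<alpha>"]])
    show "\<bar>\<gamma> k l\<bar> \<le> \<bar>l2n UNIV \<alpha> * \<beta> l\<bar>" for l
      using \<alpha>le[of "k - l"] by (simp add: \<gamma>_def abs_mult mult_right_mono)
  qed
  have eq: "norm (u (k - l)) * norm (v l) = \<bar>\<gamma> k l * \<omega> k l\<bar>" for k l
  proof (cases "l = 0 \<or> k = l")
    case False
    then have "lam (k - l) > 0" "lam l > 0" using lam_pos by auto
    then show ?thesis using False by (simp add: \<gamma>_def \<omega>_def \<alpha>_def \<beta>_def coef_def powr_minus abs_mult field_simps)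
  qed (use u v in \<open>auto simp: \<omega>_def\<close>)
  have ck: "\<bar>c k\<bar> \<le> l2n UNIV (\<gamma> k) * KB" for k
  proof -
    have "c k \<le> l2n UNIV (\<gamma> k) * l2n UNIV (\<omega> k)"
      unfolding c_def eq by (rule l2_mult[OF \<gamma> \<omega>(1)])
    also have "\<dots> \<le> l2n UNIV (\<gamma> k) * KB" using \<omega>(2) by (rule mult_left_mono) simp
    finally show ?thesis by (simp add: c_def infsum_nonneg)
  qed
  have bound: "L2_set c F \<le> KB * (nrm p u * nrm q v)" if F: "finite F" for F
  proof -
    \<comment> \<open>Summing over k inside the sum over l: for each l the values of \<alpha> are
      only translated, so the double sum is bounded by the product of the two squared norms.\<close>
    have "(\<Sum>k\<in>F. (l2n UNIV (\<gamma> k))\<^sup>2) = (\<Sum>k\<in>F. \<Sum>\<^sub>\<infinity>l\<in>UNIV. (\<gamma> k l)\<^sup>2)" by (simp add: l2n_sq)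
    also have "\<dots> = (\<Sum>\<^sub>\<infinity>l\<in>UNIV. \<Sum>k\<in>F. (\<gamma> k l)\<^sup>2)"
      by (rule infsumI[symmetric], rule has_sum_sum) (use \<gamma> in \<open>auto simp: l2_def F\<close>)
    also have "\<dots> \<le> (\<Sum>\<^sub>\<infinity>l\<in>UNIV. (nrm p u)\<^sup>2 * (\<beta> l)\<^sup>2)"
    proof (rule infsum_mono)
      show "(\<lambda>l. \<Sum>k\<in>F. (\<gamma> k l)\<^sup>2) summable_on UNIV"
        by (rule has_sum_imp_summable, rule has_sum_sum[OF F has_sum_infsum[OF \<gamma>[unfolded l2_def]]])
      show "(\<lambda>l. (nrm p u)\<^sup>2 * (\<beta> l)\<^sup>2) summable_on UNIV"
        by (rule summable_on_cmult_right) (use \<beta> in \<open>auto simp: l2_def\<close>)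
      show "(\<Sum>k\<in>F. (\<gamma> k l)\<^sup>2) \<le> (nrm p u)\<^sup>2 * (\<beta> l)\<^sup>2" for l
      proof -
        have "(\<Sum>k\<in>F. (\<alpha> (k - l))\<^sup>2) = (\<Sum>k\<in>(\<lambda>k. k - l) ` F. (\<alpha> k)\<^sup>2)"
          by (subst sum.reindex) (auto simp: inj_on_def)
        also have "\<dots> = (L2_set \<alpha> ((\<lambda>k. k - l) ` F))\<^sup>2" by (simp add: L2_set_sq)
        also have "\<dots> \<le> (nrm p u)\<^sup>2"
          unfolding \<alpha>(2)[symmetric] by (intro power_mono L2_set_le_l2n \<alpha>) (use F in auto)
        finally have "(\<Sum>k\<in>F. (\<alpha> (k - l))\<^sup>2) * (\<beta> l)\<^sup>2 \<le> (nrm p u)\<^sup>2 * (\<beta> l)\<^sup>2"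
          by (rule mult_right_mono) simp
        then show ?thesis by (simp add: \<gamma>_def power_mult_distrib sum_distrib_right)
      qed
    qed
    also have "\<dots> = (nrm p u)\<^sup>2 * (nrm q v)\<^sup>2"
      by (simp add: infsum_cmult_right' l2n_sq flip: \<beta>(2))
    finally have G: "(\<Sum>k\<in>F. (l2n UNIV (\<gamma> k))\<^sup>2) \<le> (nrm p u)\<^sup>2 * (nrm q v)\<^sup>2" .
    have "(\<Sum>k\<in>F. (c k)\<^sup>2) \<le> (\<Sum>k\<in>F. (l2n UNIV (\<gamma> k))\<^sup>2 * KB\<^sup>2)"
      using power_mono[OF ck abs_ge_zero, where n=2] by (intro sum_mono) (simp add: power_mult_distrib)
    also have "\<dots> \<le> ((nrm p u)\<^sup>2 * (nrm q v)\<^sup>2) * KB\<^sup>2"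
      unfolding sum_distrib_right[symmetric] using G by (rule mult_right_mono) simp
    also have "\<dots> = (KB * (nrm p u * nrm q v))\<^sup>2" by (simp add: power_mult_distrib mult_ac)
    finally show ?thesis unfolding L2_set_def by (intro real_le_lsqrt) auto
  qed
  show "l2 UNIV c" "l2n UNIV c \<le> KB * (nrm p u * nrm q v)"
    using l2_bound[of UNIV c, OF bound] by auto
qed

text \<open>The weight of V^-1 cancels the factor \<open>lam k\<close> that the derivative
  contributes, and what remains is the convolution bounded in \<open>conv_pq\<close>.\<close>

lemma Bf_pq:
  assumes p: "p \<ge> 0" "q \<ge> 0" "p + q = 2"
    and u: "hs p u" "u 0 = 0" and v: "hs q v" "v 0 = 0"
  shows "hs (- 1) (Bf u v)" "nrm (- 1) (Bf u v) \<le> KB * (nrm p u * nrm q v)"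
proof -
  define c where "c = (\<lambda>k. \<Sum>\<^sub>\<infinity>l\<in>UNIV. norm (u (k - l)) * norm (v l))"
  have h0: "hs 0 u" "hs 0 v" using hs_mono u v p by blast+
  note C = conv_pq[OF assms, folded c_def]
  have c0: "c k \<ge> 0" for k by (simp add: c_def infsum_nonneg)
  have C': "l2 (- {0}) c" "l2n (- {0}) c \<le> l2n UNIV c"
  proof -
    show s: "l2 (- {0}) c" using C(1) unfolding l2_def by (rule summable_on_subset_banach) auto
    have "(\<Sum>\<^sub>\<infinity>x\<in>- {0}. (c x)\<^sup>2) \<le> (\<Sum>\<^sub>\<infinity>x\<in>UNIV. (c x)\<^sup>2)"
      by (rule infsum_mono_neutral) (use C(1) s in \<open>auto simp: l2_def\<close>)
    then show "l2n (- {0}) c \<le> l2n UNIV c" by (simp add: l2n_def)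
  qed
  have *: "\<bar>coef (- 1) (Bf u v) k\<bar> \<le> \<bar>c k\<bar>" if "k \<in> - {0}" for k
  proof -
    have l: "lam k > 0" using lam_pos that by simp
    have "norm (Bf u v k) \<le> lam k * c k"
      unfolding c_def by (rule norm_Bf_le) (use u v h0 in auto)
    then show ?thesis using l c0[of k] by (simp add: coef_def powr_minus field_simps)
  qed
  from l2_le[OF C'(1) *] C(2) C'(2) show "hs (- 1) (Bf u v)" "nrm (- 1) (Bf u v) \<le> KB * (nrm p u * nrm q v)"
    by (auto simp: hs_def nrm_def)
qed

lemma Bf_diff_left:
  assumes "hs 0 u" "u 0 = 0" "hs 0 u'" "u' 0 = 0" "hs 0 v" "v 0 = 0"
  shows "Bf (u - u') v = Bf u v - Bf u' v"
proof
  fix k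
  have "(\<Sum>\<^sub>\<infinity>l\<in>- {0}. Bsym (u - u') v k l) = (\<Sum>\<^sub>\<infinity>l\<in>- {0}. Bsym u v k l - Bsym u' v k l)"
    by (simp add: Bsym_def cdot_diff vec_eq_iff left_diff_distrib vector_sub_rdistrib)
  also have "\<dots> = (\<Sum>\<^sub>\<infinity>l\<in>- {0}. Bsym u v k l) - (\<Sum>\<^sub>\<infinity>l\<in>- {0}. Bsym u' v k l)"
    by (rule infsum_diff) (use Bsym_summable assms in auto)
  finally show "Bf (u - u') v k = (Bf u v - Bf u' v) k"
    by (simp add: Bf_def vector_ssub_ldistrib leray_diff)
qed

lemma Bf_diff_right:
  assumes "hs 0 u" "u 0 = 0" "hs 0 v'" "v' 0 = 0" "hs 0 v" "v 0 = 0"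
  shows "Bf u (v - v') = Bf u v - Bf u v'"
proof
  fix k
  have "(\<Sum>\<^sub>\<infinity>l\<in>- {0}. Bsym u (v - v') k l) = (\<Sum>\<^sub>\<infinity>l\<in>- {0}. Bsym u v k l - Bsym u v' k l)"
    by (simp add: Bsym_def vector_ssub_ldistrib)
  also have "\<dots> = (\<Sum>\<^sub>\<infinity>l\<in>- {0}. Bsym u v k l) - (\<Sum>\<^sub>\<infinity>l\<in>- {0}. Bsym u v' k l)"
    by (rule infsum_diff) (use Bsym_summable assms in auto)
  finally show "Bf u (v - v') k = (Bf u v - Bf u v') k"
    by (simp add: Bf_def vector_ssub_ldistrib leray_diff)
qed

lemma solenoidal_Bf:
  assumes u: "hs 0 u" "solenoidal L u" and v: "hs 0 v" "solenoidal L v"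
  shows "solenoidal L (Bf u v)"
proof (rule solenoidalI)
  show "Bf u v 0 = 0" by (simp add: Bf_def)
  show "cdot (freq L k) (Bf u v k) = 0" for k
    using cdot_leray[of "freq L k"] lam_pos[of k] by (auto simp: Bf_def lam_def)
  show "Bf u v (- k) = cnjv (Bf u v k)" for k
  proof -
    have B: "Bsym u v (- k) l = - cnjv (Bsym u v k (- l))" for l
    proof -
      have "u (- k - l) = cnjv (u (k - (- l)))" using solenoidalD(2)[OF u(2), of "k + l"] by simp
      moreover have "v l = cnjv (v (- l))" using solenoidalD(2)[OF v(2), of l] by simp
      ultimately show ?thesis
        by (simp add: Bsym_def freq_minus cdot_minus_left cdot_cnjv) (simp add: cnjv_def vec_eq_iff)
    qed
    have "(\<Sum>\<^sub>\<infinity>l\<in>- {0}. Bsym u v (- k) l) = (\<Sum>\<^sub>\<infinity>l\<in>- {0}. - cnjv (Bsym u v k l))"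
      by (rule infsum_reindex_bij_witness[of _ uminus uminus]) (auto simp: B)
    also have "\<dots> = - cnjv (\<Sum>\<^sub>\<infinity>l\<in>- {0}. Bsym u v k l)"
      unfolding infsum_uminus
      using infsumI[OF has_sum_bounded_linear[OF bounded_linear_cnjv has_sum_infsum[OF Bsym_summable(1)[of u v k]]]] u v
      by (simp add: solenoidalD)
    finally have *: "(\<Sum>\<^sub>\<infinity>l\<in>- {0}. Bsym u v (- k) l) = - cnjv (\<Sum>\<^sub>\<infinity>l\<in>- {0}. Bsym u v k l)" .
    \<comment> \<open>Reversing the frequency and conjugating \<i> each produce a minus sign, and
      the two cancel.\<close>
    have i: "- (\<i> *s cnjv z) = cnjv (\<i> *s z)" for z :: "complex ^ 3" by (simp add: cnjv_def vec_eq_iff)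
    show ?thesis by (simp add: Bf_def * i freq_minus leray_minus_freq leray_cnjv)
  qed
qed

lemma Bf_V:
  assumes "u \<in> V L 1" "v \<in> V L 1"
  shows "Bf u v \<in> V L (- 1)"
  using assms Bf_pq(1)[of 1 1 u v] solenoidal_Bf[of u v] hs_mono(1)[of 1 _ 0]
  by (auto simp: V_iff solenoidalD)

lemma Bf_proj:
  assumes "k \<noteq> 0"
  shows "Bf u (proj N v) k = leray (freq L k) (\<i> *s (\<Sum>l\<in>modes N. Bsym u v k l))"
proof -
  have "((\<lambda>l. Bsym u (proj N v) k l) has_sum (\<Sum>l\<in>modes N. Bsym u (proj N v) k l)) (- {0})"
    by (rule has_sum_finite_neutralI[of "modes N"]) (auto simp: Bsym_def proj_def)
  then have "(\<Sum>\<^sub>\<infinity>l\<in>- {0}. Bsym u (proj N v) k l) = (\<Sum>l\<in>modes N. Bsym u v k l)"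
    by (simp add: infsumI) (simp add: Bsym_def proj_def)
  then show ?thesis using assms by (simp add: Bf_def)
qed

text \<open>The pairing is a finite double sum of a matrix \<open>t\<close> that is antisymmetric in
  the two frequencies: divergence-freeness of u makes the advecting factor symmetric, and
  conjugating \<i> changes the sign.\<close>

lemma trilinear_antisym:
  assumes u: "solenoidal L u" and v: "solenoidal L v"
  shows "pairing L (Bf u (proj N v)) (proj N v) = 0"
proof -
  define t where "t k l = inner (\<i> *s Bsym u v k l) (v k)" for k l
  have t: "t l k = - t k l" for k l
  proof -
    have "cdot (freq L l) (u (l - k)) = cnj (cdot (freq L k) (u (k - l)))"
    proof -
      \<comment> \<open>Divergence-freeness at the frequency difference lets the frequency
        \<open>k\<close> be exchanged for \<open>l\<close>.\<close>
      have "cdot (freq L (k - l)) (u (k - l)) = 0" using u by (simp add: solenoidalD)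
      then have "cdot (freq L k) (u (k - l)) = cdot (freq L l) (u (k - l))"
        by (simp add: freq_diff cdot_diff_left)
      moreover have "u (l - k) = cnjv (u (k - l))" using solenoidalD(2)[OF u, of "k - l"] by simp
      ultimately show ?thesis by (simp add: cdot_cnjv)
    qed
    then have "t l k = Re (\<Sum>i\<in>UNIV. \<i> * (cnj (cdot (freq L k) (u (k - l))) * v k $ i) * cnj (v l $ i))"
      by (simp add: t_def inner_cvec Bsym_def algebra_simps)
    also have "\<dots> = Re (cnj (\<Sum>i\<in>UNIV. - (\<i> * (cdot (freq L k) (u (k - l)) * v l $ i) * cnj (v k $ i))))"
      by (simp add: algebra_simps)
    also have "\<dots> = - t k l" by (simp add: t_def inner_cvec Bsym_def flip: sum_negf) (simp add: algebra_simps)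
    finally show ?thesis .
  qed
  have "pairing L (Bf u (proj N v)) (proj N v) = L ^ 3 * (\<Sum>k\<in>modes N. inner (Bf u (proj N v) k) (proj N v k))"
    by (rule pairing_finite) (auto simp: proj_def)
  also have "(\<Sum>k\<in>modes N. inner (Bf u (proj N v) k) (proj N v k)) = (\<Sum>k\<in>modes N. \<Sum>l\<in>modes N. t k l)"
  proof (rule sum.cong)
    fix k assume k: "k \<in> modes N"
    then have "k \<noteq> 0" by auto
    have "inner (Bf u (proj N v) k) (proj N v k) = inner (\<i> *s (\<Sum>l\<in>modes N. Bsym u v k l)) (v k)"
      using k v by (subst Bf_proj[OF \<open>k \<noteq> 0\<close>]) (simp add: proj_def inner_leray solenoidalD)
    also have "\<dots> = (\<Sum>l\<in>modes N. t k l)"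
      unfolding t_def by (simp add: linear_sum[OF linear_cscale] inner_sum_left)
    finally show "inner (Bf u (proj N v) k) (proj N v k) = (\<Sum>l\<in>modes N. t k l)" .
  qed simp
  also have "(\<Sum>k\<in>modes N. \<Sum>l\<in>modes N. t k l) = 0"
  proof -
    have "(\<Sum>k\<in>modes N. \<Sum>l\<in>modes N. t k l) = (\<Sum>l\<in>modes N. \<Sum>k\<in>modes N. t k l)" by (rule sum.swap)
    also have "\<dots> = - (\<Sum>k\<in>modes N. \<Sum>l\<in>modes N. t k l)"
      by (subst t) (simp add: sum_negf)
    finally show ?thesis by simp
  qed
  finally show ?thesis by simp
qed

lemma trilinear_bound:
  assumes "u \<in> V L 1" "v \<in> V L 1" "w \<in> V L 1"
  shows "\<bar>pairing L (Bf u v) w\<bar> \<le> L ^ 3 * KB * (nrm 1 u * nrm 1 v * nrm 1 w)"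
proof -
  have B: "hs (- 1) (Bf u v)" "nrm (- 1) (Bf u v) \<le> KB * (nrm 1 u * nrm 1 v)"
    using Bf_pq[of 1 1 u v] assms by (auto simp: V_iff solenoidalD)
  have "\<bar>pairing L (Bf u v) w\<bar> \<le> L ^ 3 * (nrm (- 1) (Bf u v) * nrm 1 w)"
    by (rule pairing_le) (use B assms in \<open>auto simp: V_iff\<close>)
  also have "\<dots> \<le> L ^ 3 * ((KB * (nrm 1 u * nrm 1 v)) * nrm 1 w)"
    using B(2) L_pos by (intro mult_left_mono mult_right_mono) auto
  finally show ?thesis by (simp add: mult_ac)
qed

lemma V_diff: "u \<in> V L s \<Longrightarrow> v \<in> V L s \<Longrightarrow> u - v \<in> V L s"
  by (auto simp: V_iff hs_diff solenoidal_diff)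

lemma trilinear_diff:
  assumes "u \<in> V L 1" "v \<in> V L 1" "w \<in> V L 1" "u' \<in> V L 1" "v' \<in> V L 1" "w' \<in> V L 1"
  shows "pairing L (Bf u' v') w' - pairing L (Bf u v) w
    = pairing L (Bf (u' - u) v') w' + pairing L (Bf u (v' - v)) w' + pairing L (Bf u v) (w' - w)"
proof -
  have h: "hs 0 x" "x 0 = 0" if "x \<in> V L 1" for x
    using that hs_mono(1)[of 1 x 0] by (auto simp: V_iff solenoidalD)
  have B: "hs (- 1) (Bf x y)" if "x \<in> V L 1" "y \<in> V L 1" for x y
    using Bf_V[OF that] by (simp add: V_iff)
  have "pairing L (Bf (u' - u) v') w' = pairing L (Bf u' v') w' - pairing L (Bf u v') w'"
    unfolding Bf_diff_left[OF h[OF assms(4)] h[OF assms(1)] h[OF assms(5)]]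
    by (rule pairing_diff_left[where s=1]) (use B assms in \<open>auto simp: V_iff\<close>)
  moreover have "pairing L (Bf u (v' - v)) w' = pairing L (Bf u v') w' - pairing L (Bf u v) w'"
    unfolding Bf_diff_right[OF h[OF assms(1)] h[OF assms(2)] h[OF assms(5)]]
    by (rule pairing_diff_left[where s=1]) (use B assms in \<open>auto simp: V_iff\<close>)
  moreover have "pairing L (Bf u v) (w' - w) = pairing L (Bf u v) w' - pairing L (Bf u v) w"
    by (rule pairing_diff_right[where s=1]) (use B assms in \<open>auto simp: V_iff\<close>)
  ultimately show ?thesis by simp
qed

text \<open>Joint continuity on V^1, from telescoping the difference into three terms with one small
  factor each. It serves both the cancellation B(u,v) against v and the identification of the
  extension by continuity.\<close>

lemma trilinear_tendsto:
  assumes "\<And>n::nat. un n \<in> V L 1" "\<And>n. vn n \<in> V L 1" "\<And>n. wn n \<in> V L 1"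
    and "u \<in> V L 1" "v \<in> V L 1" "w \<in> V L 1"
    and lim: "(\<lambda>n. nrm 1 (un n - u)) \<longlonglongrightarrow> 0" "(\<lambda>n. nrm 1 (vn n - v)) \<longlonglongrightarrow> 0" "(\<lambda>n. nrm 1 (wn n - w)) \<longlonglongrightarrow> 0"
  shows "(\<lambda>n. pairing L (Bf (un n) (vn n)) (wn n)) \<longlonglongrightarrow> pairing L (Bf u v) w"
proof (rule LIM_zero_cancel, rule tendsto_rabs_zero_cancel, rule tendsto_sandwich[OF always_eventually always_eventually tendsto_const])
  define g where "g n = L ^ 3 * KB * (nrm 1 (un n - u) * (nrm 1 (vn n - v) + nrm 1 v) * (nrm 1 (wn n - w) + nrm 1 w)
    + nrm 1 u * nrm 1 (vn n - v) * (nrm 1 (wn n - w) + nrm 1 w) + nrm 1 u * nrm 1 v * nrm 1 (wn n - w))" for n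
  have "g \<longlonglongrightarrow> L ^ 3 * KB * (0 * (0 + nrm 1 v) * (0 + nrm 1 w) + nrm 1 u * 0 * (0 + nrm 1 w) + nrm 1 u * nrm 1 v * 0)"
    unfolding g_def by (intro tendsto_intros lim)
  then show "g \<longlonglongrightarrow> 0" by simp
  show "\<forall>n. \<bar>pairing L (Bf (un n) (vn n)) (wn n) - pairing L (Bf u v) w\<bar> \<le> g n"
  proof
    fix n
    have a: "nrm 1 (vn n) \<le> nrm 1 (vn n - v) + nrm 1 v" "nrm 1 (wn n) \<le> nrm 1 (wn n - w) + nrm 1 w"
      by (rule nrm_triangle; use assms V_diff in \<open>auto simp: V_iff hs_diff\<close>)+
    have "\<bar>pairing L (Bf (un n) (vn n)) (wn n) - pairing L (Bf u v) w\<bar>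
      \<le> \<bar>pairing L (Bf (un n - u) (vn n)) (wn n)\<bar> + \<bar>pairing L (Bf u (vn n - v)) (wn n)\<bar> + \<bar>pairing L (Bf u v) (wn n - w)\<bar>"
      using trilinear_diff[OF assms(4-6) assms(1-3)] by (smt (verit))
    also have "\<dots> \<le> L ^ 3 * KB * (nrm 1 (un n - u) * nrm 1 (vn n) * nrm 1 (wn n))
      + L ^ 3 * KB * (nrm 1 u * nrm 1 (vn n - v) * nrm 1 (wn n)) + L ^ 3 * KB * (nrm 1 u * nrm 1 v * nrm 1 (wn n - w))"
      by (intro add_mono trilinear_bound V_diff assms)
    also have "\<dots> \<le> g n"
      unfolding g_def distrib_left[of "L ^ 3 * KB"] using L_pos a
      by (intro add_mono mult_left_mono mult_mono) auto
    finally show "\<bar>pairing L (Bf (un n) (vn n)) (wn n) - pairing L (Bf u v) w\<bar> \<le> g n" .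
  qed
qed auto

lemma proj_tendsto: "u \<in> V L s \<Longrightarrow> (\<lambda>N. nrm s (proj N u - u)) \<longlonglongrightarrow> 0"
  using nrm_tail[of s u] by (simp add: V_iff nrm_minus)

lemma proj_V: "u \<in> V L s \<Longrightarrow> proj N u \<in> V L t"
  by (auto simp: V_iff intro: trig_poly_proj hs_proj solenoidal_proj)

lemma nrm_self: "nrm s (u - u) = 0"
  by (simp add: nrm_def coef_def l2n_def)

text \<open>The cancellation is exact for truncations of v and passes to the limit by continuity on
  V^1.\<close>

lemma trilinear_zero:
  assumes "u \<in> V L 1" "v \<in> V L 1"
  shows "pairing L (Bf u v) v = 0"
proof -
  have "(\<lambda>N. pairing L (Bf u (proj N v)) (proj N v)) \<longlonglongrightarrow> pairing L (Bf u v) v"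
    by (rule trilinear_tendsto) (use assms in \<open>auto intro: proj_V proj_tendsto simp: nrm_self\<close>)
  moreover have "pairing L (Bf u (proj N v)) (proj N v) = 0" for N
    by (rule trilinear_antisym) (use assms in \<open>auto simp: V_iff\<close>)
  ultimately show ?thesis by (simp add: LIMSEQ_const_iff)
qed

end

section \<open>Identification of the nonlinearity\<close>

lemma cis_sum: "cis (\<Sum>b\<in>B. f b) = (\<Prod>b\<in>B. cis (f b))"
  by (induction B rule: infinite_finite_induct) (simp_all add: cis_mult[symmetric])

lemma has_derivative_cis_compose:
  assumes "(g has_derivative g') (at x within S)"
  shows "((\<lambda>y. cis (g y)) has_derivative (\<lambda>h. \<i> * complex_of_real (g' h) * cis (g x))) (at x within S)"
proof -
  have "((\<lambda>y. \<i> * complex_of_real (g y)) has_derivative (\<lambda>h. \<i> * complex_of_real (g' h))) (at x within S)"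
    by (intro derivative_intros assms)
  from has_derivative_compose[OF this DERIV_exp[THEN has_field_derivative_imp_has_derivative]]
  show ?thesis by (simp add: cis_conv_exp mult_ac)
qed

text \<open>An exponential of an inner product is a product of exponentials in the coordinates.
  Writing Lebesgue measure as the image of a product measure turns the box integral into a product
  of one-dimensional integrals.\<close>

lemma integral_cis_cbox:
  fixes \<xi> c :: "'a::euclidean_space"
  shows "(LINT x:cbox 0 c|lborel. cis (x \<bullet> \<xi>)) = (\<Prod>b\<in>Basis. LINT y:{0..c \<bullet> b}|lborel. cis (y * (\<xi> \<bullet> b)))"
proof -
  interpret product_sigma_finite "\<lambda>_::'a. lborel :: real measure"
    by standard
  define g where "g b y = indicator {0..c \<bullet> b} y *\<^sub>R cis (y * (\<xi> \<bullet> b))" for b :: 'a and y :: real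
  have "continuous_on {0..c \<bullet> b} (\<lambda>y. cis (y * (\<xi> \<bullet> b)))" for b by (intro continuous_intros)
  then have int: "integrable lborel (g b)" for b
    unfolding g_def by (intro borel_integrable_compact) auto
  have "(LINT x:cbox 0 c|lborel. cis (x \<bullet> \<xi>)) =
     (LINT x|distr (Pi\<^sub>M Basis (\<lambda>_. lborel)) borel (\<lambda>f. \<Sum>b\<in>Basis. f b *\<^sub>R b). indicator (cbox 0 c) x *\<^sub>R cis (x \<bullet> \<xi>))"
    unfolding set_lebesgue_integral_def by (subst lborel_eq) simp
  also have "\<dots> = (LINT f|(Pi\<^sub>M Basis (\<lambda>_. lborel)). indicator (cbox 0 c) (\<Sum>b\<in>Basis. f b *\<^sub>R b) *\<^sub>R cis ((\<Sum>b\<in>Basis. f b *\<^sub>R b) \<bullet> \<xi>))"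
  proof (rule integral_distr)
    have "(\<lambda>x. cis (x \<bullet> \<xi>)) \<in> borel_measurable borel"
      by (intro borel_measurable_continuous_onI continuous_intros)
    then show "(\<lambda>x. indicator (cbox 0 c) x *\<^sub>R cis (x \<bullet> \<xi>)) \<in> borel_measurable borel" by measurable
  qed measurable
  also have "\<dots> = (LINT f|(Pi\<^sub>M Basis (\<lambda>_. lborel)). (\<Prod>b\<in>Basis. g b (f b)))"
  proof (rule Bochner_Integration.integral_cong[OF refl])
    fix f :: "'a \<Rightarrow> real"
    have c: "cis ((\<Sum>b\<in>Basis. f b *\<^sub>R b) \<bullet> \<xi>) = (\<Prod>b\<in>Basis. cis (f b * (\<xi> \<bullet> b)))"
      by (simp add: inner_sum_left cis_sum[symmetric] inner_commute[of \<xi>])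
    have m: "(\<Sum>b\<in>Basis. f b *\<^sub>R b) \<in> cbox 0 c \<longleftrightarrow> (\<forall>b\<in>Basis. f b \<in> {0..c \<bullet> b})"
      by (simp add: mem_box)
    show "indicator (cbox 0 c) (\<Sum>b\<in>Basis. f b *\<^sub>R b) *\<^sub>R cis ((\<Sum>b\<in>Basis. f b *\<^sub>R b) \<bullet> \<xi>) = (\<Prod>b\<in>Basis. g b (f b))"
    proof (cases "\<forall>b\<in>Basis. f b \<in> {0..c \<bullet> b}")
      case True
      then have "(\<Prod>b\<in>Basis. g b (f b)) = (\<Prod>b\<in>Basis. cis (f b * (\<xi> \<bullet> b)))"
        by (intro prod.cong) (auto simp: g_def)
      then show ?thesis using True m c by simp
    next
      case False
      then obtain b where "b \<in> Basis" "g b (f b) = 0" by (auto simp: g_def)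
      then have "(\<Prod>b\<in>Basis. g b (f b)) = 0" by (intro prod_zero) auto
      then show ?thesis using False m by auto
    qed
  qed
  also have "\<dots> = (\<Prod>b\<in>Basis. LINT y|lborel. g b y)"
    by (rule product_integral_prod) (use int in auto)
  finally show ?thesis by (simp add: g_def set_lebesgue_integral_def)
qed

lemma integral_cis_interval:
  assumes "L > 0"
  shows "(LINT y:{0..L}|lborel. cis (y * (2 * pi / L * real_of_int m))) = (if m = 0 then complex_of_real L else 0)"
proof (cases "m = 0")
  case True
  have "(LINT y:{0..L}|lborel. 1) = complex_of_real L"
    using assms by (simp add: set_lebesgue_integral_def scaleR_conv_of_real)
  then show ?thesis using True by simp
next
  case False
  define c where "c = 2 * pi / L * real_of_int m"
  have c: "c \<noteq> 0" using False assms by (simp add: c_def)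
  define F where "F y = cis (y * c) / (\<i> * complex_of_real c)" for y
  have "(LINT y|lborel. indicator {0..L} y *\<^sub>R cis (y * c)) = F L - F 0"
  proof (rule integral_FTC_Icc)
    show "(F has_vector_derivative cis (x * c)) (at x within {0..L})" for x
    proof -
      have "((\<lambda>y. y * c) has_derivative (\<lambda>h. h * c)) (at x within {0..L})"
        by (auto intro!: derivative_eq_intros)
      from has_derivative_divide'[OF has_derivative_cis_compose[OF this] has_derivative_const, of "\<i> * complex_of_real c"]
      show ?thesis using c unfolding F_def[abs_def] has_vector_derivative_def
        by (simp add: scaleR_conv_of_real field_simps power2_eq_square)
    qed
  qed (use assms in \<open>auto intro!: continuous_intros\<close>)
  also have "F L = F 0"
  proof -
    have "cis (L * c) = cis (2 * pi * real_of_int m)" using assms by (simp add: c_def)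
    also have "\<dots> = 1" by (rule cis_multiple_2pi) simp
    finally show ?thesis by (simp add: F_def)
  qed
  finally show ?thesis using False by (simp add: set_lebesgue_integral_def c_def)
qed

section \<open>Orthogonality of exponentials and the trilinear form of trigonometric
  polynomials\<close>

context torus
begin

lemma freq_inj: "freq L k = 0 \<longleftrightarrow> k = 0"
  using lam_pos[of k] by (auto simp: lam_def)

lemma integral_cis_freq:
  "(LINT x:cbox 0 (\<chi> _. L)|lborel. cis (x \<bullet> freq L k)) = (if k = 0 then complex_of_real (L ^ 3) else 0)"
proof -
  have B: "(Basis :: (real ^ 3) set) = (\<lambda>i. axis i 1) ` UNIV" by (auto simp: Basis_vec_def)
  have inj: "inj (\<lambda>i. axis i (1::real) :: real ^ 3)" by (auto simp: inj_on_def axis_eq_axis)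
  have "(LINT x:cbox 0 (\<chi> _. L)|lborel. cis (x \<bullet> freq L k)) = (\<Prod>i\<in>UNIV. LINT y:{0..L}|lborel. cis (y * (2 * pi / L * real_of_int (k $ i))))"
    unfolding integral_cis_cbox B by (subst prod.reindex[OF inj]) (simp add: inner_axis freq_def)
  also have "\<dots> = (\<Prod>i\<in>UNIV. if k $ i = 0 then complex_of_real L else 0)"
    by (intro prod.cong refl integral_cis_interval L_pos)
  also have "\<dots> = (if k = 0 then complex_of_real (L ^ 3) else 0)"
  proof (cases "k = 0")
    case False
    then obtain i where "k $ i \<noteq> 0" by (auto simp: vec_eq_iff)
    then have "(\<Prod>i\<in>UNIV. if k $ i = 0 then complex_of_real L else 0) = 0"
      by (intro prod_zero) auto
    then show ?thesis using False by simp
  qed simp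
  finally show ?thesis .
qed

text \<open>Reversing all frequencies shows that the sum equals its own conjugate. The real parts in
  the fields can then be dropped, so that products of fields expand into complex exponential
  sums.\<close>

lemma real_trig_sum:
  assumes F: "finite F" "\<And>k. k \<in> F \<Longrightarrow> - k \<in> F" and c: "\<And>k. c (- k) = cnj (c k)"
  shows "complex_of_real (Re (\<Sum>k\<in>F. cis (x \<bullet> freq L k) * c k)) = (\<Sum>k\<in>F. cis (x \<bullet> freq L k) * c k)" (is "_ = ?S")
proof -
  have "cnj ?S = (\<Sum>k\<in>F. cis (x \<bullet> freq L (- k)) * c (- k))"
    by (simp add: c freq_minus cis_cnj)
  also have "\<dots> = ?S"
    by (rule sum.reindex_bij_witness[of _ uminus uminus]) (use F in auto)
  finally show ?thesis by (metis Reals_cnj_iff of_real_Re)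
qed

lemma field_of_eq:
  assumes u: "solenoidal L u" and F: "finite F" "\<And>k. k \<in> F \<Longrightarrow> - k \<in> F" "{k. u k \<noteq> 0} \<subseteq> F"
  shows "field_of L u x $ i = Re (\<Sum>k\<in>F. cis (x \<bullet> freq L k) * u k $ i)"
    "complex_of_real (field_of L u x $ i) = (\<Sum>k\<in>F. cis (x \<bullet> freq L k) * u k $ i)"
proof -
  have "(\<Sum>k | u k \<noteq> 0. cis (x \<bullet> freq L k) * u k $ i) = (\<Sum>k\<in>F. cis (x \<bullet> freq L k) * u k $ i)"
    by (rule sum.mono_neutral_left) (use F in auto)
  then show *: "field_of L u x $ i = Re (\<Sum>k\<in>F. cis (x \<bullet> freq L k) * u k $ i)"
    by (simp only: field_of_def vec_lambda_beta)
  show "complex_of_real (field_of L u x $ i) = (\<Sum>k\<in>F. cis (x \<bullet> freq L k) * u k $ i)"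
    unfolding * by (rule real_trig_sum[OF F(1,2)]) (use solenoidalD(2)[OF u] in \<open>simp_all add: cnjv_def\<close>)
qed

lemma partial_deriv_eq:
  assumes u: "solenoidal L u" and F: "finite F" "\<And>k. k \<in> F \<Longrightarrow> - k \<in> F" "{k. u k \<noteq> 0} \<subseteq> F"
  shows "complex_of_real (partial_deriv j (\<lambda>y. field_of L u y $ i) x)
    = (\<Sum>k\<in>F. cis (x \<bullet> freq L k) * (\<i> * complex_of_real (freq L k $ j) * u k $ i))"
proof -
  define D where "D h = Re (\<Sum>k\<in>F. (\<i> * complex_of_real (h \<bullet> freq L k)) * cis (x \<bullet> freq L k) * u k $ i)" for h
  have "((\<lambda>y. Re (\<Sum>k\<in>F. cis (y \<bullet> freq L k) * u k $ i)) has_derivative D) (at x)"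
    unfolding D_def
    by (intro has_derivative_Re has_derivative_sum has_derivative_mult_left has_derivative_cis_compose has_derivative_inner_left has_derivative_ident)
  then have "((\<lambda>y. field_of L u y $ i) has_derivative D) (at x)"
    by (simp add: field_of_eq(1)[OF assms])
  then have "partial_deriv j (\<lambda>y. field_of L u y $ i) x = D (axis j 1)"
    unfolding partial_deriv_def using frechet_derivative_at by metis
  also have "\<dots> = Re (\<Sum>k\<in>F. cis (x \<bullet> freq L k) * (\<i> * complex_of_real (freq L k $ j) * u k $ i))"
    by (simp add: D_def inner_axis' mult_ac)
  finally have *: "partial_deriv j (\<lambda>y. field_of L u y $ i) x
     = Re (\<Sum>k\<in>F. cis (x \<bullet> freq L k) * (\<i> * complex_of_real (freq L k $ j) * u k $ i))" .
  show ?thesis unfolding *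
    by (rule real_trig_sum[OF F(1,2)]) (use solenoidalD(2)[OF u] in \<open>simp_all add: cnjv_def freq_minus\<close>)
qed

text \<open>Expanding the triple product, orthogonality keeps only frequencies with sum zero.
  Reversing the frequency of w turns its coefficient into a conjugate and the sum into a convolution
  tested against w; divergence-freeness moves the derivative, and the Leray projection is invisible
  to w.\<close>

lemma b_trig_eq:
  assumes u: "u \<in> trig_poly L" and v: "v \<in> trig_poly L" and w: "w \<in> trig_poly L"
  shows "b_trig L u v w = pairing L (Bf u v) w"
proof -
  have su: "solenoidal L u" and sv: "solenoidal L v" and sw: "solenoidal L w"
    using u v w by (auto simp: trig_poly_def)
  define F where "F = {k. u k \<noteq> 0} \<union> {k. v k \<noteq> 0} \<union> {k. w k \<noteq> 0}"
  have sym: "x (- k) \<noteq> 0 \<longleftrightarrow> x k \<noteq> 0" if "solenoidal L x" for x k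
    using solenoidalD(2)[OF that, of k] by (metis cnjv_0 cnjv_cnjv)
  have F: "finite F" "\<And>k. k \<in> F \<Longrightarrow> - k \<in> F" and Fs: "{k. u k \<noteq> 0} \<subseteq> F" "{k. v k \<noteq> 0} \<subseteq> F" "{k. w k \<noteq> 0} \<subseteq> F"
    and F0: "0 \<notin> F"
    using u v w sym[OF su] sym[OF sv] sym[OF sw] solenoidalD(1)[OF su] solenoidalD(1)[OF sv] solenoidalD(1)[OF sw]
    by (auto simp: F_def trig_poly_def)
  define C where "C = cbox 0 (\<chi> _::3. L)"
  define c where "c i j = (\<lambda>(k, l, m). u k $ j * (\<i> * complex_of_real (freq L l $ j) * v l $ i) * w m $ i)" for i j
  have triple: "(\<Sum>k\<in>F. a k) * (\<Sum>l\<in>F. b l) * (\<Sum>m\<in>F. d m) = (\<Sum>(k, l, m)\<in>F \<times> F \<times> F. a k * b l * d m)"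
    for a b d :: "int ^ 3 \<Rightarrow> complex"
  proof -
    have "(\<Sum>k\<in>F. a k) * (\<Sum>l\<in>F. b l) * (\<Sum>m\<in>F. d m) = (\<Sum>k\<in>F. \<Sum>l\<in>F. \<Sum>m\<in>F. a k * b l * d m)"
      by (simp only: sum_product[of a F b F] sum_distrib_right[of "\<lambda>k. \<Sum>l\<in>F. a k * b l"]
          sum_distrib_right[of "\<lambda>l. _ * b l"] sum_distrib_left[of "_ * _" d])
    then show ?thesis by (simp add: sum.cartesian_product)
  qed
  have int: "integrable lborel (\<lambda>x. indicator C x *\<^sub>R cis (x \<bullet> freq L k))" for k
    unfolding C_def by (intro borel_integrable_compact continuous_intros) auto
  have trm: "complex_of_real (LINT x:C|lborel. field_of L u x $ j * partial_deriv j (\<lambda>y. field_of L v y $ i) x * field_of L w x $ i)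
    = (\<Sum>(k, l, m)\<in>F \<times> F \<times> F. c i j (k, l, m) * (if k + l + m = 0 then complex_of_real (L ^ 3) else 0))" for i j
  proof -
    have "complex_of_real (field_of L u x $ j * partial_deriv j (\<lambda>y. field_of L v y $ i) x * field_of L w x $ i)
       = (\<Sum>(k, l, m)\<in>F \<times> F \<times> F. cis (x \<bullet> freq L (k + l + m)) * c i j (k, l, m))" for x
    proof -
      have "complex_of_real (field_of L u x $ j * partial_deriv j (\<lambda>y. field_of L v y $ i) x * field_of L w x $ i)
         = (\<Sum>k\<in>F. cis (x \<bullet> freq L k) * u k $ j)
           * (\<Sum>l\<in>F. cis (x \<bullet> freq L l) * (\<i> * complex_of_real (freq L l $ j) * v l $ i))
           * (\<Sum>m\<in>F. cis (x \<bullet> freq L m) * w m $ i)"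
        using field_of_eq(2)[OF su F Fs(1), where x=x and i=j] field_of_eq(2)[OF sw F Fs(3), where x=x and i=i]
          partial_deriv_eq[OF sv F Fs(2), where x=x and i=i and j=j]
        by (simp only: of_real_mult)
      also have "\<dots> = (\<Sum>(k, l, m)\<in>F \<times> F \<times> F. cis (x \<bullet> freq L (k + l + m)) * c i j (k, l, m))"
        unfolding triple by (intro sum.cong refl) (auto simp: c_def freq_add inner_add_right cis_mult[symmetric] mult_ac)
      finally show ?thesis .
    qed
    then have "complex_of_real (LINT x:C|lborel. field_of L u x $ j * partial_deriv j (\<lambda>y. field_of L v y $ i) x * field_of L w x $ i)
      = (LINT x:C|lborel. (\<Sum>(k, l, m)\<in>F \<times> F \<times> F. cis (x \<bullet> freq L (k + l + m)) * c i j (k, l, m)))"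
      by (simp flip: set_integral_complex_of_real)
    also have "\<dots> = (\<Sum>(k, l, m)\<in>F \<times> F \<times> F. LINT x|lborel. (indicator C x *\<^sub>R cis (x \<bullet> freq L (k + l + m))) * c i j (k, l, m))"
      unfolding set_lebesgue_integral_def scaleR_sum_right case_prod_unfold
    proof (subst Bochner_Integration.integral_sum)
      show "integrable lborel (\<lambda>x. indicat_real C x *\<^sub>R (cis (x \<bullet> freq L (fst q + fst (snd q) + snd (snd q))) * c i j (fst q, fst (snd q), snd (snd q))))" for q
        using integrable_mult_left[OF int] by (simp only: mult_scaleR_left)
    qed (simp only: mult_scaleR_left)
    also have "\<dots> = (\<Sum>(k, l, m)\<in>F \<times> F \<times> F. (LINT x:C|lborel. cis (x \<bullet> freq L (k + l + m))) * c i j (k, l, m))"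
      by (simp add: set_lebesgue_integral_def flip: mult_scaleR_left)
    finally show ?thesis unfolding C_def integral_cis_freq by (simp add: mult.commute)
  qed
  have "complex_of_real (b_trig L u v w) = (\<Sum>i\<in>UNIV. \<Sum>j\<in>UNIV. \<Sum>(k, l, m)\<in>F \<times> F \<times> F. c i j (k, l, m) * (if k + l + m = 0 then complex_of_real (L ^ 3) else 0))"
    unfolding b_trig_def of_real_sum trm[unfolded C_def] ..
  also have "\<dots> = (\<Sum>i\<in>UNIV. \<Sum>j\<in>UNIV. \<Sum>m\<in>F. \<Sum>l\<in>F. complex_of_real (L ^ 3) * c i j (m - l, l, - m))"
  proof (intro sum.cong refl)
    fix i j
    define X where "X k l m = c i j (k, l, m) * (if k + l + m = 0 then complex_of_real (L ^ 3) else 0)" for k l m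
    have "(\<Sum>(k, l, m)\<in>F \<times> F \<times> F. X k l m) = (\<Sum>k\<in>F. \<Sum>l\<in>F. \<Sum>m\<in>F. X k l m)"
      by (simp add: sum.cartesian_product)
    also have "\<dots> = (\<Sum>m\<in>F. \<Sum>l\<in>F. \<Sum>k\<in>F. X k l m)"
      by (subst sum.swap, subst (2) sum.swap, subst sum.swap) (rule refl)
    \<comment> \<open>The symmetric set F allows \<open>m\<close> to be replaced by
      \<open>- m\<close>, after which the constraint reads k = m - l.\<close>
    also have "\<dots> = (\<Sum>m\<in>F. \<Sum>l\<in>F. \<Sum>k\<in>F. X k l (- m))"
      by (rule sum.reindex_bij_witness[of _ uminus uminus]) (use F in auto)
    also have "\<dots> = (\<Sum>m\<in>F. \<Sum>l\<in>F. complex_of_real (L ^ 3) * c i j (m - l, l, - m))"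
    proof (intro sum.cong refl)
      fix m l
      have "(\<Sum>k\<in>F. X k l (- m)) = (\<Sum>k\<in>F. if k = m - l then complex_of_real (L ^ 3) * c i j (m - l, l, - m) else 0)"
        by (intro sum.cong refl) (auto simp: X_def algebra_simps)
      also have "\<dots> = complex_of_real (L ^ 3) * c i j (m - l, l, - m)"
      proof (cases "m - l \<in> F")
        \<comment> \<open>If the frequency determined by the constraint lies outside F, the sum over
          k is empty of it, but then its coefficient of u vanishes too.\<close>
        case False
        then have "u (m - l) = 0" using Fs(1) by auto
        then show ?thesis using F(1) by (simp add: c_def)
      qed (use F(1) in simp)
      finally show "(\<Sum>k\<in>F. X k l (- m)) = complex_of_real (L ^ 3) * c i j (m - l, l, - m)" .
    qed
    finally show "(\<Sum>(k, l, m)\<in>F \<times> F \<times> F. c i j (k, l, m) * (if k + l + m = 0 then complex_of_real (L ^ 3) else 0))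
      = (\<Sum>m\<in>F. \<Sum>l\<in>F. complex_of_real (L ^ 3) * c i j (m - l, l, - m))" by (simp add: X_def)
  qed
  also have "\<dots> = complex_of_real (L ^ 3) * (\<Sum>m\<in>F. \<Sum>l\<in>F. \<Sum>i\<in>UNIV. \<Sum>j\<in>UNIV. c i j (m - l, l, - m))"
  proof -
    have "(\<Sum>i\<in>UNIV. \<Sum>j\<in>UNIV. \<Sum>m\<in>F. \<Sum>l\<in>F. Y i j m l) = (\<Sum>m\<in>F. \<Sum>l\<in>F. \<Sum>i\<in>UNIV. \<Sum>j\<in>UNIV. Y i j m l)"
      for Y :: "3 \<Rightarrow> 3 \<Rightarrow> int ^ 3 \<Rightarrow> int ^ 3 \<Rightarrow> complex"
    proof -
      have "(\<Sum>i\<in>UNIV. \<Sum>j\<in>UNIV. \<Sum>m\<in>F. \<Sum>l\<in>F. Y i j m l) = (\<Sum>i\<in>UNIV. \<Sum>m\<in>F. \<Sum>l\<in>F. \<Sum>j\<in>UNIV. Y i j m l)"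
        by (intro sum.cong refl, subst sum.swap, intro sum.cong refl, rule sum.swap)
      also have "\<dots> = (\<Sum>m\<in>F. \<Sum>i\<in>UNIV. \<Sum>l\<in>F. \<Sum>j\<in>UNIV. Y i j m l)" by (rule sum.swap)
      also have "\<dots> = (\<Sum>m\<in>F. \<Sum>l\<in>F. \<Sum>i\<in>UNIV. \<Sum>j\<in>UNIV. Y i j m l)"
        by (intro sum.cong refl, rule sum.swap)
      finally show ?thesis .
    qed
    then show ?thesis by (simp add: sum_distrib_left)
  qed
  also have "(\<Sum>m\<in>F. \<Sum>l\<in>F. \<Sum>i\<in>UNIV. \<Sum>j\<in>UNIV. c i j (m - l, l, - m))
      = (\<Sum>m\<in>F. \<Sum>l\<in>F. \<Sum>i\<in>UNIV. (\<i> *s Bsym u v m l) $ i * cnj (w m $ i))"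
  proof (intro sum.cong refl)
    fix m l i
    have d: "cdot (freq L m) (u (m - l)) = cdot (freq L l) (u (m - l))"
      using solenoidalD(3)[OF su, of "m - l"] by (simp add: freq_diff cdot_diff_left)
    have wm: "w (- m) $ i = cnj (w m $ i)" using solenoidalD(2)[OF sw, of m] by (simp add: cnjv_def)
    have "(\<Sum>j\<in>UNIV. c i j (m - l, l, - m)) = \<i> * cdot (freq L l) (u (m - l)) * v l $ i * cnj (w m $ i)"
      by (simp add: c_def wm cdot_def sum_distrib_left sum_distrib_right mult_ac)
    then show "(\<Sum>j\<in>UNIV. c i j (m - l, l, - m)) = (\<i> *s Bsym u v m l) $ i * cnj (w m $ i)"
      by (simp add: Bsym_def d mult_ac)
  qed
  finally have "b_trig L u v w = Re (complex_of_real (L ^ 3) * (\<Sum>m\<in>F. \<Sum>l\<in>F. \<Sum>i\<in>UNIV. (\<i> *s Bsym u v m l) $ i * cnj (w m $ i)))"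
    by (metis Re_complex_of_real)
  also have "\<dots> = L ^ 3 * (\<Sum>m\<in>F. \<Sum>l\<in>F. inner (\<i> *s Bsym u v m l) (w m))"
  proof -
    have "Re (complex_of_real a * z) = a * Re z" for a z by simp
    then show ?thesis by (simp only: Re_sum inner_cvec)
  qed
  also have "\<dots> = L ^ 3 * (\<Sum>m\<in>F. inner (Bf u v m) (w m))"
  proof (rule arg_cong[where f="\<lambda>x. L ^ 3 * x"], intro sum.cong refl)
    fix m assume m: "m \<in> F"
    have "((\<lambda>l. Bsym u v m l) has_sum (\<Sum>l\<in>F. Bsym u v m l)) (- {0})"
      by (rule has_sum_finite_neutralI[of F]) (use F F0 Fs in \<open>auto simp: Bsym_def\<close>)
    then have "Bf u v m = leray (freq L m) (\<i> *s (\<Sum>l\<in>F. Bsym u v m l))"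
      using m F0 by (auto simp: Bf_def infsumI)
    then show "(\<Sum>l\<in>F. inner (\<i> *s Bsym u v m l) (w m)) = inner (Bf u v m) (w m)"
      using solenoidalD(3)[OF sw, of m] by (simp add: inner_leray linear_sum[OF linear_cscale] inner_sum_left)
  qed
  also have "\<dots> = pairing L (Bf u v) w"
    by (rule pairing_finite[symmetric]) (use F F0 Fs in auto)
  finally show ?thesis .
qed

lemma nrm1_tendsto:
  assumes "\<And>n::nat. un n \<in> V L s" "u \<in> V L s" "s \<ge> 1" "(\<lambda>n. Vnorm L s (un n - u)) \<longlonglongrightarrow> 0"
  shows "(\<lambda>n. nrm 1 (un n - u)) \<longlonglongrightarrow> 0"
proof (rule tendsto_sandwich[OF always_eventually always_eventually tendsto_const])
  define C where "C = lam0 powr (1 - s) / sqrt (L ^ 3)"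
  have "sqrt (L ^ 3) > 0" using L_pos by simp
  then have "nrm 1 (un n - u) \<le> C * Vnorm L s (un n - u)" for n
    using hs_mono(2)[of s "un n - u" 1] assms V_diff[OF assms(1,2)] by (simp add: C_def Vnorm_eq V_iff)
  then show "\<forall>n. nrm 1 (un n - u) \<le> C * Vnorm L s (un n - u)" by simp
  show "(\<lambda>n. C * Vnorm L s (un n - u)) \<longlonglongrightarrow> 0" using tendsto_mult_left[OF assms(4), of C] by simp
qed simp

lemma Vnorm_proj: "u \<in> V L s \<Longrightarrow> (\<lambda>N. Vnorm L s (proj N u - u)) \<longlonglongrightarrow> 0"
  using tendsto_mult_left[OF proj_tendsto, of u s "sqrt (L ^ 3)"] by (simp add: Vnorm_eq)

text \<open>Continuity shows that the value of the formula meets the description for all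
  approximating sequences. Uniqueness holds because the truncations are such a sequence, so any
  other value would be a second limit.\<close>

lemma b_ext_eq:
  assumes s: "s1 \<ge> 1" "s2 \<ge> 0" "s3 \<ge> 1" and u: "u \<in> V L s1" and v: "v \<in> V L (s2 + 1)" and w: "w \<in> V L s3"
  shows "b_ext L s1 s2 s3 u v w = pairing L (Bf u v) w"
  unfolding b_ext_def
proof (rule the_equality)
  show *: "\<forall>un vn wn. (\<forall>n::nat. un n \<in> trig_poly L \<and> vn n \<in> trig_poly L \<and> wn n \<in> trig_poly L) \<longrightarrow>
       (\<lambda>n. Vnorm L s1 (un n - u)) \<longlonglongrightarrow> 0 \<longrightarrow> (\<lambda>n. Vnorm L (s2 + 1) (vn n - v)) \<longlonglongrightarrow> 0 \<longrightarrow>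
       (\<lambda>n. Vnorm L s3 (wn n - w)) \<longlonglongrightarrow> 0 \<longrightarrow> (\<lambda>n. b_trig L (un n) (vn n) (wn n)) \<longlonglongrightarrow> pairing L (Bf u v) w"
  proof (intro allI impI)
    fix un vn wn :: "nat \<Rightarrow> coeffs"
    assume t: "\<forall>n. un n \<in> trig_poly L \<and> vn n \<in> trig_poly L \<and> wn n \<in> trig_poly L"
      and l: "(\<lambda>n. Vnorm L s1 (un n - u)) \<longlonglongrightarrow> 0" "(\<lambda>n. Vnorm L (s2 + 1) (vn n - v)) \<longlonglongrightarrow> 0" "(\<lambda>n. Vnorm L s3 (wn n - w)) \<longlonglongrightarrow> 0"
    have "(\<lambda>n. pairing L (Bf (un n) (vn n)) (wn n)) \<longlonglongrightarrow> pairing L (Bf u v) w"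
      using t trig_V V_mono[OF u, of 1] V_mono[OF v, of 1] V_mono[OF w, of 1] s
      by (intro trilinear_tendsto nrm1_tendsto[OF _ u _ l(1)] nrm1_tendsto[OF _ v _ l(2)] nrm1_tendsto[OF _ w _ l(3)]) auto
    then show "(\<lambda>n. b_trig L (un n) (vn n) (wn n)) \<longlonglongrightarrow> pairing L (Bf u v) w"
      using t by (simp add: b_trig_eq)
  qed
  have pt: "proj n x \<in> trig_poly L" if "x \<in> V L s" for x n s
    using that by (auto simp: V_iff intro: trig_poly_proj)
  fix c assume c: "\<forall>un vn wn. (\<forall>n::nat. un n \<in> trig_poly L \<and> vn n \<in> trig_poly L \<and> wn n \<in> trig_poly L) \<longrightarrow>
       (\<lambda>n. Vnorm L s1 (un n - u)) \<longlonglongrightarrow> 0 \<longrightarrow> (\<lambda>n. Vnorm L (s2 + 1) (vn n - v)) \<longlonglongrightarrow> 0 \<longrightarrow>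
       (\<lambda>n. Vnorm L s3 (wn n - w)) \<longlonglongrightarrow> 0 \<longrightarrow> (\<lambda>n. b_trig L (un n) (vn n) (wn n)) \<longlonglongrightarrow> c"
  have "(\<lambda>n. b_trig L (proj n u) (proj n v) (proj n w)) \<longlonglongrightarrow> c"
    using c[rule_format, of "\<lambda>n. proj n u" "\<lambda>n. proj n v" "\<lambda>n. proj n w"] pt[OF u] pt[OF v] pt[OF w] Vnorm_proj[OF u] Vnorm_proj[OF v] Vnorm_proj[OF w]
    by simp
  moreover have "(\<lambda>n. b_trig L (proj n u) (proj n v) (proj n w)) \<longlonglongrightarrow> pairing L (Bf u v) w"
    using *[rule_format, of "\<lambda>n. proj n u" "\<lambda>n. proj n v" "\<lambda>n. proj n w"] pt[OF u] pt[OF v] pt[OF w] Vnorm_proj[OF u] Vnorm_proj[OF v] Vnorm_proj[OF w]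
    by simp
  ultimately show "c = pairing L (Bf u v) w" by (rule LIMSEQ_unique)
qed

text \<open>Testing with the single-mode field whose amplitude is the difference of the two
  coefficients gives the squared norm of that difference; solenoidality makes this amplitude
  admissible.\<close>

lemma pairing_unique:
  assumes "solenoidal L u" "solenoidal L v" "\<And>w. w \<in> trig_poly L \<Longrightarrow> pairing L u w = pairing L v w"
  shows "u = v"
proof
  fix k
  show "u k = v k"
  proof (cases "k = 0")
    case False
    define z where "z = u k - v k"
    have "cdot (freq L k) z = 0" using assms(1,2) by (simp add: z_def cdot_diff solenoidalD)
    from assms(3)[OF single_trig[OF False this]] have "u k \<bullet> z = v k \<bullet> z"
      using L_pos by (simp add: pairing_single[OF False] assms(1,2))
    then have "z \<bullet> z = 0" by (simp add: z_def inner_diff_left)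
    then show ?thesis by (simp add: z_def)
  qed (use assms in \<open>simp add: solenoidalD\<close>)
qed

text \<open>Covers the exponents of the delay equation as well as those of the limit equation, so
  both nonlinear terms become the same expression \<open>Bf\<close>.\<close>

lemma B_op_eq:
  assumes s: "s1 \<ge> 1" "s2 \<ge> 0" "s3 \<ge> 1" and u: "u \<in> V L s1" and v: "v \<in> V L (s2 + 1)"
  shows "B_op L s1 s2 s3 u v = Bf u v"
  unfolding B_op_def
proof (rule the_equality)
  have B: "Bf u v \<in> V L (- 1)" by (rule Bf_V) (use V_mono[OF u] V_mono[OF v] s in auto)
  then show "Bf u v \<in> V L (- s3) \<and> (\<forall>w\<in>V L s3. pairing L (Bf u v) w = b_ext L s1 s2 s3 u v w)"
    using V_mono[of "Bf u v" "-1" "- s3"] s b_ext_eq[OF s u v] by auto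
  fix g assume g: "g \<in> V L (- s3) \<and> (\<forall>w\<in>V L s3. pairing L g w = b_ext L s1 s2 s3 u v w)"
  show "g = Bf u v"
  proof (rule pairing_unique)
    show "pairing L g w = pairing L (Bf u v) w" if "w \<in> trig_poly L" for w
      using g b_ext_eq[OF s u v, of w] trig_V[OF that, of s3] by auto
  qed (use g B in \<open>auto simp: V_iff\<close>)
qed

end

section \<open>The du Bois-Reymond lemma and integral identities\<close>

text \<open>Differentiability to a given finite order, recursive in the derivative: closure under
  sums, products, reciprocals and affine substitutions then follows by induction. Iterated
  derivatives for test functions are recovered in \<open>diffs_funpow\<close>.\<close>

primrec diffs :: "nat \<Rightarrow> (real \<Rightarrow> real) \<Rightarrow> bool" where
  "diffs 0 f \<longleftrightarrow> (\<forall>x. f differentiable (at x))"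
| "diffs (Suc n) f \<longleftrightarrow> (\<forall>x. f differentiable (at x)) \<and> diffs n (deriv f)"

lemma diffs_diff: "diffs n f \<Longrightarrow> f differentiable (at x)"
  by (cases n) auto

lemma diffs_deriv: "diffs n f \<Longrightarrow> (f has_real_derivative deriv f x) (at x)"
  using diffs_diff[of n f x] DERIV_deriv_iff_real_differentiable by blast

lemma diffs_SucD: "diffs (Suc n) f \<Longrightarrow> diffs n f"
  by (induction n arbitrary: f) auto

lemma diffs_SucI:
  assumes "\<And>x. (f has_real_derivative f' x) (at x)" "diffs n f'"
  shows "diffs (Suc n) f"
proof -
  have "deriv f = f'" using assms(1) DERIV_imp_deriv by blast
  then show ?thesis using assms by (auto simp: real_differentiable_def)
qed

lemma diffs_0I: "(\<And>x. (f has_real_derivative f' x) (at x)) \<Longrightarrow> diffs 0 f"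
  by (auto simp: real_differentiable_def)

lemma diffs_funpow: "diffs n f \<Longrightarrow> m \<le> n \<Longrightarrow> (deriv ^^ m) f differentiable (at x)"
proof (induction n arbitrary: f m)
  case (Suc n)
  show ?case
  proof (cases m)
    case 0
    then show ?thesis using Suc.prems diffs_diff by simp
  next
    case (Suc m')
    have "(deriv ^^ m') (deriv f) differentiable (at x)"
      using Suc.IH[of "deriv f" m'] Suc.prems \<open>m = Suc m'\<close> by simp
    then show ?thesis using \<open>m = Suc m'\<close> by (simp add: funpow_swap1)
  qed
qed simp

lemma diffs_const: "diffs n (\<lambda>x. c)"
proof (induction n arbitrary: c)
  case 0 show ?case by (rule diffs_0I[of _ "\<lambda>_. 0"]) simp
next
  case (Suc n) show ?case by (rule diffs_SucI[of _ "\<lambda>_. 0"]) (simp_all add: Suc)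
qed

lemma diffs_add: "diffs n f \<Longrightarrow> diffs n g \<Longrightarrow> diffs n (\<lambda>x. f x + g x)"
proof (induction n arbitrary: f g)
  case 0 then show ?case by simp
next
  case (Suc n)
  show ?case
    by (rule diffs_SucI[of _ "\<lambda>x. deriv f x + deriv g x"])
       (use Suc.prems diffs_deriv[OF Suc.prems(1)] diffs_deriv[OF Suc.prems(2)] in \<open>auto intro!: derivative_intros Suc.IH\<close>)
qed

lemma diffs_mult: "diffs n f \<Longrightarrow> diffs n g \<Longrightarrow> diffs n (\<lambda>x. f x * g x)"
proof (induction n arbitrary: f g)
  case 0 then show ?case by simp
next
  case (Suc n)
  show ?case
  proof (rule diffs_SucI)
    show "((\<lambda>x. f x * g x) has_real_derivative deriv f x * g x + deriv g x * f x) (at x)" for x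
      by (rule DERIV_mult[OF diffs_deriv[OF Suc.prems(1)] diffs_deriv[OF Suc.prems(2)]])
    show "diffs n (\<lambda>x. deriv f x * g x + deriv g x * f x)"
      by (intro diffs_add Suc.IH) (use Suc.prems diffs_SucD in auto)
  qed
qed

lemma diffs_inverse: "diffs n f \<Longrightarrow> (\<And>x. f x \<noteq> 0) \<Longrightarrow> diffs n (\<lambda>x. inverse (f x))"
proof (induction n)
  case 0
  show ?case
    by (rule diffs_0I[where f'="\<lambda>x. - (inverse (f x) * deriv f x * inverse (f x))"])
       (rule DERIV_inverse'[OF diffs_deriv[OF 0(1)] 0(2)])
next
  case (Suc n)
  show ?case
  proof (rule diffs_SucI)
    show "((\<lambda>x. inverse (f x)) has_real_derivative (-1) * (inverse (f x) * deriv f x * inverse (f x))) (at x)" for x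
      using DERIV_inverse'[OF diffs_deriv[OF Suc(2)] Suc(3)] by simp
    have "diffs n (\<lambda>x. inverse (f x))" using Suc diffs_SucD by blast
    then show "diffs n (\<lambda>x. (-1) * (inverse (f x) * deriv f x * inverse (f x)))"
      by (intro diffs_mult diffs_const) (use Suc.prems in auto)
  qed
qed

lemma diffs_affine: "diffs n f \<Longrightarrow> diffs n (\<lambda>x. f (c * x + d))"
proof (induction n arbitrary: f)
  case 0
  have "((\<lambda>x. f (c * x + d)) has_real_derivative deriv f (c * x + d) * c) (at x)" for x
    by (rule DERIV_chain2[OF diffs_deriv[OF 0]]) (auto intro!: derivative_eq_intros)
  then show ?case by (rule diffs_0I)
next
  case (Suc n)
  show ?case
  proof (rule diffs_SucI)
    show "((\<lambda>x. f (c * x + d)) has_real_derivative deriv f (c * x + d) * c) (at x)" for x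
      by (rule DERIV_chain2[OF diffs_deriv[OF Suc.prems]]) (auto intro!: derivative_eq_intros)
    show "diffs n (\<lambda>x. deriv f (c * x + d) * c)"
      by (intro diffs_mult diffs_const Suc.IH) (use Suc.prems in auto)
  qed
qed

text \<open>The family p(1/x) exp(-1/x), extended by 0, contains the standard smooth non-analytic
  function and is closed under differentiation. Carrying the polynomial along makes smoothness a
  one-line induction.\<close>

definition flat :: "real poly \<Rightarrow> real \<Rightarrow> real" where
  "flat p x = (if x > 0 then poly p (1 / x) * exp (- (1 / x)) else 0)"

lemma flat_tendsto_0: "(flat p \<longlongrightarrow> 0) (at 0)"
proof -
  have "((\<lambda>y. \<Sum>i\<le>degree p. coeff p i * (y ^ i / exp y)) \<longlongrightarrow> (\<Sum>i\<le>degree p. coeff p i * 0)) at_top"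
    by (intro tendsto_intros tendsto_power_div_exp_0)
  then have "((\<lambda>y. poly p y * exp (- y)) \<longlongrightarrow> 0) at_top"
    by (simp add: poly_altdef exp_minus divide_inverse sum_distrib_right sum_distrib_left mult_ac)
  from filterlim_compose[OF this filterlim_inverse_at_top_right]
  have "((\<lambda>x. poly p (inverse x) * exp (- inverse x)) \<longlongrightarrow> 0) (at_right 0)" by simp
  then have r: "(flat p \<longlongrightarrow> 0) (at_right 0)"
    by (rule Lim_transform_eventually)
       (auto simp: flat_def eventually_at_filter inverse_eq_divide)
  have "(flat p \<longlongrightarrow> 0) (at_left 0)"
    by (rule tendsto_eventually) (auto simp: flat_def eventually_at_filter)
  with r show ?thesis using filterlim_split_at by blast
qed

text \<open>With y = 1/x, differentiation in x is -y^2 times differentiation in y; applied to p(y)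
  exp(-y) this gives the polynomial y^2 (p - p').\<close>

lemma flat_deriv:
  "(flat p has_real_derivative flat ([:0, 0, 1:] * (p - pderiv p)) x) (at x)"
proof (cases x "0 :: real" rule: linorder_cases)
  case less
  have "(flat p has_real_derivative 0) (at x)"
    by (rule has_field_derivative_transform_within_open[of "\<lambda>_. 0" _ _ "{..<0}"])
       (use less in \<open>auto simp: flat_def\<close>)
  then show ?thesis using less by (simp add: flat_def)
next
  case equal
  have "((\<lambda>h. (flat p h - flat p 0) / h) \<longlongrightarrow> 0) (at 0)"
    \<comment> \<open>Dividing by h multiplies the polynomial by its variable, so the difference
      quotient at 0 is again a member of the family.\<close>
    by (rule Lim_transform_eventually[OF flat_tendsto_0[of "pCons 0 p"]])
       (auto simp: flat_def eventually_at_filter)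
  then show ?thesis using equal by (simp add: has_field_derivative_iff) (simp add: flat_def)
next
  case greater
  have "((\<lambda>x. poly p (1 / x) * exp (- (1 / x))) has_real_derivative flat ([:0, 0, 1:] * (p - pderiv p)) x) (at x)"
    using greater
    by (auto intro!: derivative_eq_intros DERIV_chain2[OF poly_DERIV] simp: flat_def power2_eq_square field_simps)
  then show ?thesis
    by (rule has_field_derivative_transform_within_open[of _ _ _ "{0<..}"])
       (use greater in \<open>auto simp: flat_def\<close>)
qed

lemma diffs_flat: "diffs n (flat p)"
proof (induction n arbitrary: p)
  case 0 show ?case by (rule diffs_0I[OF flat_deriv])
next
  case (Suc n) show ?case by (rule diffs_SucI[OF flat_deriv Suc])
qed

text \<open>A smooth transition from 0 on the negative axis to 1 beyond 1. The denominator is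
  positive because x and 1 - x cannot both be nonpositive.\<close>

definition step_fun :: "real \<Rightarrow> real" where
  "step_fun x = flat 1 x * inverse (flat 1 x + flat 1 (1 - x))"

lemma flat_1: "flat 1 x \<ge> 0" "x > 0 \<Longrightarrow> flat 1 x > 0" "x \<le> 0 \<Longrightarrow> flat 1 x = 0"
  by (auto simp: flat_def)

lemma step_fun_denom: "flat 1 x + flat 1 (1 - x) > 0"
  using flat_1(1)[of x] flat_1(1)[of "1 - x"] flat_1(2)[of x] flat_1(2)[of "1 - x"] by (cases "x > 0") linarith+

lemma diffs_step_fun: "diffs n step_fun"
proof -
  have "diffs n (\<lambda>x. flat 1 ((-1) * x + 1))" by (rule diffs_affine[OF diffs_flat])
  then have "diffs n (\<lambda>x. flat 1 x + flat 1 (1 - x))" by (intro diffs_add diffs_flat) simp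
  then show ?thesis unfolding step_fun_def[abs_def]
    by (intro diffs_mult diffs_flat diffs_inverse) (use step_fun_denom in \<open>auto simp: less_imp_neq[THEN not_sym]\<close>)
qed

lemma step_fun_0: "x \<le> 0 \<Longrightarrow> step_fun x = 0"
  and step_fun_1: "x \<ge> 1 \<Longrightarrow> step_fun x = 1"
  using flat_1(2)[of x] by (auto simp: step_fun_def flat_1(3))

lemma step_fun_bounds: "0 \<le> step_fun x" "step_fun x \<le> 1"
  using step_fun_denom[of x] flat_1(1)[of x] flat_1(1)[of "1 - x"]
  by (auto simp: step_fun_def field_simps)

lemma step_fun_deriv: "(step_fun has_real_derivative deriv step_fun x) (at x)"
  by (rule diffs_deriv[OF diffs_step_fun[of 0]])

lemma continuous_deriv_step: "continuous_on S (deriv step_fun)"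
proof -
  have "diffs 1 step_fun" by (rule diffs_step_fun)
  then have "deriv step_fun differentiable (at x)" for x by simp
  then show ?thesis
    by (intro continuous_at_imp_continuous_on ballI differentiable_imp_continuous_within)
qed

lemma deriv_step_outside: "x < 0 \<or> x > 1 \<Longrightarrow> deriv step_fun x = 0"
proof (rule DERIV_imp_deriv, elim disjE)
  assume "x < 0"
  show "(step_fun has_real_derivative 0) (at x)"
    by (rule has_field_derivative_transform_within_open[of "\<lambda>_. 0" _ _ "{..<0}"]) (use \<open>x < 0\<close> in \<open>auto simp: step_fun_0\<close>)
next
  assume "x > 1"
  show "(step_fun has_real_derivative 0) (at x)"
    by (rule has_field_derivative_transform_within_open[of "\<lambda>_. 1" _ _ "{1<..}"]) (use \<open>x > 1\<close> in \<open>auto simp: step_fun_1\<close>)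
qed

lemma deriv_step_bounded: obtains M where "M > 0" "\<And>x. \<bar>deriv step_fun x\<bar> \<le> M"
proof -
  have "compact (deriv step_fun ` {0..1})" by (intro compact_continuous_image continuous_deriv_step) simp
  then obtain M where M: "M > 0" "\<And>y. y \<in> deriv step_fun ` {0..1} \<Longrightarrow> norm y \<le> M"
    using compact_imp_bounded bounded_pos by metis
  have "\<bar>deriv step_fun x\<bar> \<le> M" for x
    using M(1) M(2)[OF imageI, of x] deriv_step_outside[of x] by (cases "x < 0 \<or> x > 1") auto
  with M(1) show ?thesis by (rule that)
qed

section \<open>Approximate identities and integral identities for the mode equations\<close>

lemma abs_integral_le:
  fixes f g :: "real \<Rightarrow> real"
  assumes "f integrable_on S" "g integrable_on S" "\<And>x. x \<in> S \<Longrightarrow> \<bar>f x\<bar> \<le> g x"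
  shows "\<bar>integral S f\<bar> \<le> integral S g"
  using integral_norm_bound_integral[of f S g] assms by simp

text \<open>The rescaled derivative of the step has integral 1, lives on an interval of length e and
  is at most M / e in absolute value. Integrating the oscillation of h against it costs at most
  \<omega> times M.\<close>

lemma concentrate:
  assumes M: "\<And>x. \<bar>deriv step_fun x\<bar> \<le> M" and h: "continuous_on {0..T} h"
    and p: "0 \<le> p" "e > 0" "p + e \<le> T" and w: "\<And>x. x \<in> {p..p + e} \<Longrightarrow> \<bar>h x - h p\<bar> \<le> \<omega>"
  shows "\<bar>integral {0..T} (\<lambda>x. h x * (deriv step_fun ((x - p) / e) / e)) - h p\<bar> \<le> \<omega> * M"
proof -
  define \<rho> where "\<rho> x = deriv step_fun ((x - p) / e) / e" for x
  have cont: "continuous_on {0..T} \<rho>" unfolding \<rho>_def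
    by (intro continuous_intros continuous_on_compose2[OF continuous_deriv_step[of UNIV]]) (use p in auto)
  have "(\<rho> has_integral step_fun ((T - p) / e) - step_fun ((0 - p) / e)) {0..T}"
  proof (rule fundamental_theorem_of_calculus)
    fix x assume "x \<in> {0..T}"
    have "((\<lambda>x. step_fun ((x - p) / e)) has_real_derivative deriv step_fun ((x - p) / e) * (1 / e)) (at x within {0..T})"
      by (rule DERIV_chain2[OF step_fun_deriv]) (use p in \<open>auto intro!: derivative_eq_intros\<close>)
    then show "((\<lambda>x. step_fun ((x - p) / e)) has_vector_derivative \<rho> x) (at x within {0..T})"
      by (simp add: has_real_derivative_iff_has_vector_derivative \<rho>_def)
  qed (use p in auto)
  moreover have "step_fun ((T - p) / e) = 1" using p by (intro step_fun_1) (simp add: field_simps)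
  moreover have "step_fun ((0 - p) / e) = 0" using p by (intro step_fun_0) (simp add: field_simps)
  ultimately have \<rho>1: "(\<rho> has_integral 1) {0..T}" by simp
  have "integral {0..T} (\<lambda>x. h x * \<rho> x) - h p = integral {0..T} (\<lambda>x. (h x - h p) * \<rho> x)"
  proof -
    have "integral {0..T} (\<lambda>x. (h x - h p) * \<rho> x) = integral {0..T} (\<lambda>x. h x * \<rho> x - h p * \<rho> x)"
      by (simp add: left_diff_distrib)
    also have "\<dots> = integral {0..T} (\<lambda>x. h x * \<rho> x) - integral {0..T} (\<lambda>x. h p * \<rho> x)"
      by (intro Henstock_Kurzweil_Integration.integral_diff integrable_continuous_real continuous_intros h cont)
    finally show ?thesis using \<rho>1 by (simp add: integral_unique)
  qed
  also have "\<bar>\<dots>\<bar> \<le> integral {0..T} (\<lambda>x. if x \<in> {p..p + e} then \<omega> * M / e else 0)"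
  proof (rule abs_integral_le)
    show "(\<lambda>x. (h x - h p) * \<rho> x) integrable_on {0..T}"
      by (intro integrable_continuous_real continuous_intros h cont)
    show "(\<lambda>x. if x \<in> {p..p + e} then \<omega> * M / e else 0) integrable_on {0..T}"
      unfolding integrable_on_def using p has_integral_restrict[of "{p..p + e}" "{0..T}" "\<lambda>x. \<omega> * M / e"] by fastforce
    fix x assume "x \<in> {0..T}"
    show "\<bar>(h x - h p) * \<rho> x\<bar> \<le> (if x \<in> {p..p + e} then \<omega> * M / e else 0)"
    proof (cases "x \<in> {p..p + e}")
      case True
      have "\<bar>\<rho> x\<bar> \<le> M / e" unfolding \<rho>_def using M p by (simp add: divide_right_mono)
      then have "\<bar>h x - h p\<bar> * \<bar>\<rho> x\<bar> \<le> \<omega> * (M / e)" using w[OF True] by (intro mult_mono) auto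
      then show ?thesis using True by (simp add: abs_mult)
    next
      case False
      then have "\<rho> x = 0" unfolding \<rho>_def using deriv_step_outside[of "(x - p) / e"] p by (auto simp: field_simps)
      then show ?thesis using False by auto
    qed
  qed
  also have "\<dots> = integral {p..p + e} (\<lambda>x. \<omega> * M / e)"
    using p has_integral_restrict[of "{p..p + e}" "{0..T}" "\<lambda>x. \<omega> * M / e" "\<omega> * M"]
      has_integral_const_real[of "\<omega> * M / e" p "p + e"] by (simp add: integral_unique)
  also have "\<dots> = \<omega> * M" using p by simp
  finally show ?thesis by (simp add: \<rho>_def)
qed

text \<open>Test with smoothed indicator functions of \<open>{a..b}\<close>.\<close>

lemma du_Bois_Reymond:
  fixes h g :: "real \<Rightarrow> real"
  assumes T: "T > 0" and h: "continuous_on {0..T} h" and g: "integrable (lebesgue_on {0..T}) g"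
    and weak: "\<And>\<psi>. \<psi> \<in> test_functions T \<Longrightarrow>
      (LINT r|lebesgue_on {0..T}. h r * deriv \<psi> r) = - (LINT r|lebesgue_on {0..T}. g r * \<psi> r)"
    and t: "t \<in> {0..T}"
  shows "h t = h 0 + integral {0..t} g"
proof -
  obtain M where M: "M > 0" "\<And>x. \<bar>deriv step_fun x\<bar> \<le> M" using deriv_step_bounded by blast
  have gi: "g integrable_on {0..T}" using g by (intro integrable_on_lebesgue_on) auto
  have key: "h b - h a = integral {a..b} g" if ab: "0 < a" "a < b" "b < T" for a b
  proof -
    \<comment> \<open>The ramps become steeper with n; the bound by half of both gaps ends the
      second one before T, so the support stays in the open interval.\<close>
    define e where "e n = (min (b - a) (T - b) / 2) / real (Suc n)" for n
    have e0: "e n > 0" for n using ab by (simp add: e_def)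
    have ele: "e n \<le> min (b - a) (T - b) / 2" for n
    proof -
      have "e n \<le> (min (b - a) (T - b) / 2) / 1" unfolding e_def using ab by (intro divide_left_mono) auto
      then show ?thesis by simp
    qed
    have e_lim: "e \<longlonglongrightarrow> 0"
      unfolding e_def using LIMSEQ_Suc[OF lim_const_over_n[of "min (b - a) (T - b) / 2"]] by simp
    have e_lt: "a + e n < b" "b + e n < T" for n using ele[of n] ab by (auto simp: min_def split: if_splits)
    define \<psi> where "\<psi> n x = step_fun ((x - a) / e n) - step_fun ((x - b) / e n)" for n x
    have \<psi>D: "(\<psi> n has_real_derivative deriv step_fun ((x - a) / e n) / e n - deriv step_fun ((x - b) / e n) / e n) (at x)" for n x
    proof -
      have "((\<lambda>x. step_fun ((x - p) / e n)) has_real_derivative deriv step_fun ((x - p) / e n) * (1 / e n)) (at x)" for p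
        by (rule DERIV_chain2[OF step_fun_deriv]) (use e0[of n] in \<open>auto intro!: derivative_eq_intros\<close>)
      from DERIV_diff[OF this[of a] this[of b]] show ?thesis by (simp add: \<psi>_def[abs_def])
    qed
    have \<psi>t: "\<psi> n \<in> test_functions T" for n
    proof -
      have "diffs m (\<lambda>x. step_fun ((1 / e n) * x + (- p / e n)))" for m p
        by (rule diffs_affine[OF diffs_step_fun])
      then have *: "diffs m (\<lambda>x. step_fun ((x - p) / e n))" for m p
        by (simp add: diff_divide_distrib)
      have "diffs m (\<lambda>x. step_fun ((x - a) / e n) + (-1) * step_fun ((x - b) / e n))" for m
        by (intro diffs_add diffs_mult diffs_const *)
      then have "diffs m (\<psi> n)" for m by (simp add: \<psi>_def[abs_def])
      then have d: "(deriv ^^ m) (\<psi> n) differentiable (at x)" for m x using diffs_funpow by blast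
      have "{x. \<psi> n x \<noteq> 0} \<subseteq> {a..b + e n}"
      proof
        fix x assume x: "x \<in> {x. \<psi> n x \<noteq> 0}"
        show "x \<in> {a..b + e n}"
        proof (rule ccontr)
          assume "x \<notin> {a..b + e n}"
          then consider "x < a" | "x > b + e n" by force
          then show False
          proof cases
            case 1
            then have "step_fun ((x - a) / e n) = 0" "step_fun ((x - b) / e n) = 0"
              using ab e0[of n] by (auto intro!: step_fun_0 simp: divide_nonpos_pos)
            then show False using x by (simp add: \<psi>_def)
          next
            case 2
            then have "step_fun ((x - a) / e n) = 1" "step_fun ((x - b) / e n) = 1"
              using ab e0[of n] by (auto intro!: step_fun_1 simp: field_simps)
            then show False using x by (simp add: \<psi>_def)
          qed
        qed
      qed
      then have "closure {x. \<psi> n x \<noteq> 0} \<subseteq> {a..b + e n}" by (intro closure_minimal) auto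
      also have "\<dots> \<subseteq> {0<..<T}" using ab e_lt[of n] by auto
      finally show ?thesis using d by (simp add: test_functions_def)
    qed
    have d\<psi>: "deriv (\<psi> n) x = deriv step_fun ((x - a) / e n) / e n - deriv step_fun ((x - b) / e n) / e n" for n x
      by (rule DERIV_imp_deriv[OF \<psi>D])
    have conc: "(\<lambda>n. integral {0..T} (\<lambda>x. h x * (deriv step_fun ((x - p) / e n) / e n))) \<longlonglongrightarrow> h p" if p: "0 < p" "p \<le> b" for p
    proof (rule LIMSEQ_I)
      fix r :: real assume r: "r > 0"
      have "isCont h p" using h p ab by (intro continuous_on_interior[OF h]) auto
      then obtain d where d: "d > 0" "\<And>x. dist x p < d \<Longrightarrow> dist (h x) (h p) < r / (2 * M)"
        unfolding continuous_at_eps_delta using r M(1) by (metis divide_pos_pos mult_pos_pos zero_less_numeral)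
      obtain N where N: "\<And>n. n \<ge> N \<Longrightarrow> e n < d"
        using order_tendstoD(2)[OF e_lim d(1)] by (auto simp: eventually_sequentially)
      have "norm (integral {0..T} (\<lambda>x. h x * (deriv step_fun ((x - p) / e n) / e n)) - h p) < r" if n: "n \<ge> N" for n
      proof -
        have "\<bar>integral {0..T} (\<lambda>x. h x * (deriv step_fun ((x - p) / e n) / e n)) - h p\<bar> \<le> r / (2 * M) * M"
        proof (rule concentrate[OF M(2) h])
          show "p + e n \<le> T" using e_lt[of n] p by simp
          show "\<bar>h x - h p\<bar> \<le> r / (2 * M)" if "x \<in> {p..p + e n}" for x
            using d(2)[of x] that N[OF n] by (auto simp: dist_real_def)
        qed (use p e0 in auto)
        also have "\<dots> < r" using M(1) r by simp
        finally show ?thesis by simp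
      qed
      then show "\<exists>no. \<forall>n\<ge>no. norm (integral {0..T} (\<lambda>x. h x * (deriv step_fun ((x - p) / e n) / e n)) - h p) < r" by blast
    qed
    have cont: "continuous_on {0..T} (\<lambda>x. h x * (deriv step_fun ((x - p) / e n) / e n))" for p n
      by (intro continuous_intros h continuous_on_compose2[OF continuous_deriv_step[of UNIV]]) (use e0[of n] in auto)
    have lhs: "(LINT r|lebesgue_on {0..T}. h r * deriv (\<psi> n) r)
       = integral {0..T} (\<lambda>x. h x * (deriv step_fun ((x - a) / e n) / e n)) - integral {0..T} (\<lambda>x. h x * (deriv step_fun ((x - b) / e n) / e n))" for n
    proof -
      have c: "continuous_on {0..T} (\<lambda>x. h x * (deriv step_fun ((x - a) / e n) / e n) - h x * (deriv step_fun ((x - b) / e n) / e n))"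
        by (intro continuous_on_diff cont)
      have "(LINT r|lebesgue_on {0..T}. h r * deriv (\<psi> n) r) = integral {0..T} (\<lambda>x. h x * deriv (\<psi> n) x)"
        using absolutely_integrable_continuous_real[OF c]
        by (intro lebesgue_integral_eq_integral) (auto simp: d\<psi> right_diff_distrib set_integrable_def integrable_restrict_space)
      also have "\<dots> = integral {0..T} (\<lambda>x. h x * (deriv step_fun ((x - a) / e n) / e n) - h x * (deriv step_fun ((x - b) / e n) / e n))"
        by (simp add: d\<psi> right_diff_distrib)
      also have "\<dots> = integral {0..T} (\<lambda>x. h x * (deriv step_fun ((x - a) / e n) / e n)) - integral {0..T} (\<lambda>x. h x * (deriv step_fun ((x - b) / e n) / e n))"
        by (intro Henstock_Kurzweil_Integration.integral_diff integrable_continuous_real cont)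
      finally show ?thesis .
    qed
    have l1: "(\<lambda>n. LINT r|lebesgue_on {0..T}. h r * deriv (\<psi> n) r) \<longlonglongrightarrow> h a - h b"
      unfolding lhs by (intro tendsto_diff conc) (use ab in auto)
    have l2: "(\<lambda>n. LINT r|lebesgue_on {0..T}. g r * \<psi> n r) \<longlonglongrightarrow> (LINT r|lebesgue_on {0..T}. g r * indicator {a<..b} r)"
    proof (rule integral_dominated_convergence[where w="\<lambda>r. norm (g r)"])
      have "continuous_on {0..T} (\<psi> n)" for n
        by (rule DERIV_continuous_on[OF has_field_derivative_at_within[OF \<psi>D]])
      then have "\<psi> n \<in> borel_measurable (lebesgue_on {0..T})" for n
        by (rule continuous_imp_measurable_on_sets_lebesgue) auto
      then show "(\<lambda>r. g r * \<psi> n r) \<in> borel_measurable (lebesgue_on {0..T})" for n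
        by (intro borel_measurable_times borel_measurable_integrable[OF g])
      show "(\<lambda>r. g r * indicator {a<..b} r) \<in> borel_measurable (lebesgue_on {0..T})"
        by (intro borel_measurable_times borel_measurable_integrable[OF g] borel_measurable_indicator)
           (use ab in \<open>auto simp: sets_restrict_space_iff\<close>)
      show "AE r in lebesgue_on {0..T}. (\<lambda>n. g r * \<psi> n r) \<longlonglongrightarrow> g r * indicator {a<..b} r"
      proof (intro AE_I2 tendsto_mult_left)
        fix r
        have one: "(\<lambda>n. step_fun ((r - p) / e n)) \<longlonglongrightarrow> (if p < r then 1 else 0)" for p
        proof (cases "p < r")
          case True
          then have "\<forall>\<^sub>F n in sequentially. e n < r - p" using order_tendstoD(2)[OF e_lim, of "r - p"] by simp
          then have "\<forall>\<^sub>F n in sequentially. step_fun ((r - p) / e n) = 1"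
          proof eventually_elim
            case (elim n)
            show ?case by (rule step_fun_1) (use elim e0[of n] in \<open>simp add: field_simps\<close>)
          qed
          then show ?thesis using True by (simp add: tendsto_eventually)
        next
          case False
          then have "step_fun ((r - p) / e n) = 0" for n
            by (intro step_fun_0) (use e0[of n] in \<open>simp add: divide_nonpos_pos\<close>)
          then show ?thesis using False by simp
        qed
        \<comment> \<open>The ramps start to the right of their base points, so the limit is the
          indicator of an interval open on the left and closed on the right.\<close>
        have "(\<lambda>n. \<psi> n r) \<longlonglongrightarrow> (if a < r then 1 else 0) - (if b < r then 1 else 0)"
          unfolding \<psi>_def by (intro tendsto_diff one)
        also have "(if a < r then 1 else 0) - (if b < r then 1 else 0) = (indicator {a<..b} r :: real)"
          using ab by (auto simp: indicator_def)
        finally show "(\<lambda>n. \<psi> n r) \<longlonglongrightarrow> indicator {a<..b} r" .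
      qed
      show "AE r in lebesgue_on {0..T}. norm (g r * \<psi> n r) \<le> norm (g r)" for n
      proof (rule AE_I2)
        fix r
        have "\<bar>\<psi> n r\<bar> \<le> 1" using step_fun_bounds[of "(r - a) / e n"] step_fun_bounds[of "(r - b) / e n"]
          by (auto simp: \<psi>_def)
        then show "norm (g r * \<psi> n r) \<le> norm (g r)" by (simp add: abs_mult mult_left_le)
      qed
    qed (use g in auto)
    have "(LINT r|lebesgue_on {0..T}. g r * indicator {a<..b} r) = integral {0..T} (\<lambda>r. g r * indicator {a<..b} r)"
    proof (rule lebesgue_integral_eq_integral)
      show "integrable (lebesgue_on {0..T}) (\<lambda>r. g r * indicator {a<..b} r)"
        by (rule integrable_real_mult_indicator[OF _ g]) (use ab in \<open>auto simp: sets_restrict_space_iff\<close>)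
    qed simp
    also have "\<dots> = integral {0..T} (\<lambda>r. if r \<in> {a<..b} then g r else 0)"
      by (intro Henstock_Kurzweil_Integration.integral_cong) (auto simp: indicator_def)
    also have "\<dots> = integral {a<..b} g" unfolding integral_restrict_Int using ab by (intro arg_cong[where f="\<lambda>S. integral S g"]) auto
    also have "\<dots> = integral {a..b} g"
      by (rule integral_spike_set) (auto intro: negligible_subset[of "{a}"])
    finally have "(\<lambda>n. - (LINT r|lebesgue_on {0..T}. g r * \<psi> n r)) \<longlonglongrightarrow> - integral {a..b} g"
      using l2 by (intro tendsto_minus) simp
    then have "(\<lambda>n. LINT r|lebesgue_on {0..T}. h r * deriv (\<psi> n) r) \<longlonglongrightarrow> - integral {a..b} g"
      by (simp add: weak[OF \<psi>t])
    from LIMSEQ_unique[OF l1 this] show ?thesis by simp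
  qed
  \<comment> \<open>Test functions only reach interior times. Constancy of \<Phi> on the open
    interval is extended by continuity, which brings in the initial value.\<close>
  define \<Phi> where "\<Phi> t = h t - integral {0..t} g" for t
  have cont: "continuous_on (closure {0<..<T}) \<Phi>"
    unfolding \<Phi>_def using T by (auto intro!: continuous_intros h indefinite_integral_continuous_1 gi)
  have const: "\<Phi> x = \<Phi> (T / 2)" if "x \<in> {0<..<T}" for x
  proof -
    have *: "\<Phi> a = \<Phi> b" if "0 < a" "a < b" "b < T" for a b
    proof -
      have "integral {0..b} g = integral {0..a} g + integral {a..b} g"
        by (rule Henstock_Kurzweil_Integration.integral_combine[symmetric])
           (use that integrable_subinterval_real[OF gi, of 0 b] in auto)
      then show ?thesis using key[OF that] by (simp add: \<Phi>_def)
    qed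
    show ?thesis
    proof (cases x "T / 2" rule: linorder_cases)
      case less
      show ?thesis by (rule *) (use less that T in auto)
    next
      case greater
      show ?thesis by (rule *[symmetric]) (use greater that T in auto)
    next
      case equal
      show ?thesis by (rule arg_cong[OF equal])
    qed
  qed
  have "\<Phi> x = \<Phi> (T / 2)" if "x \<in> {0..T}" for x
    by (rule continuous_constant_on_closure[OF cont const]) (use that T in auto)
  from this[OF t] this[of 0] have "\<Phi> t = \<Phi> 0" using T by simp
  then show ?thesis by (simp add: \<Phi>_def)
qed

text \<open>The chain rule for the squared norm of an absolutely continuous function, avoiding
  pointwise derivatives. The defect E changes over a subinterval by at most the oscillation of h
  times the integral of norm g there; summing over fine partitions shows that it does not change at
  all.\<close>

lemma norm_sq_integral:
  fixes g h :: "real \<Rightarrow> 'a::euclidean_space"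
  assumes g: "g absolutely_integrable_on {0..T}"
    and h: "\<And>t. t \<in> {0..T} \<Longrightarrow> h t = h 0 + integral {0..t} g"
    and t: "t \<in> {0..T}"
  shows "(\<lambda>r. g r \<bullet> h r) absolutely_integrable_on {0..T}"
    "(norm (h t))\<^sup>2 = (norm (h 0))\<^sup>2 + 2 * integral {0..t} (\<lambda>r. g r \<bullet> h r)"
proof -
  have gi: "g integrable_on {0..T}" using g absolutely_integrable_on_def by blast
  have ch: "continuous_on {0..T} h"
    using continuous_on_add[OF continuous_on_const indefinite_integral_continuous_1[OF gi], of "h 0"]
    by (rule continuous_on_eq) (rule h[symmetric])
  have bd: "bounded (h ` {0..T})" by (intro compact_imp_bounded compact_continuous_image ch) simp
  have hm: "h \<in> borel_measurable (lebesgue_on {0..T})"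
    by (intro continuous_imp_measurable_on_sets_lebesgue ch) simp
  show gh: "(\<lambda>r. g r \<bullet> h r) absolutely_integrable_on {0..T}"
    using absolutely_integrable_bounded_measurable_product[OF bilinear_conv_bounded_bilinear[THEN iffD2, OF bounded_bilinear_inner] hm _ bd g]
    by (simp add: inner_commute)
  have ghi: "(\<lambda>r. g r \<bullet> h r) integrable_on {0..T}" using gh absolutely_integrable_on_def by blast
  have ng: "(\<lambda>r. norm (g r)) integrable_on {0..T}" using g absolutely_integrable_on_def by blast
  define E where "E t = (norm (h t))\<^sup>2 - 2 * integral {0..t} (\<lambda>r. g r \<bullet> h r)" for t
  define G where "G t = integral {0..t} (\<lambda>r. norm (g r))" for t
  have sub: "f integrable_on {a..b}" if "f integrable_on {0..T}" "0 \<le> a" "b \<le> T" for f :: "real \<Rightarrow> 'b::euclidean_space" and a b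
    using integrable_subinterval_real[OF that(1)] that by auto
  have comb: "integral {0..b} f - integral {0..a} f = integral {a..b} f"
    if "f integrable_on {0..T}" "0 \<le> a" "a \<le> b" "b \<le> T" for f :: "real \<Rightarrow> 'b::euclidean_space" and a b
    using Henstock_Kurzweil_Integration.integral_combine[of 0 a b f] sub[OF that(1), of 0 b] that by (simp add: algebra_simps)
  have inc: "\<bar>E b - E a\<bar> \<le> 2 * \<omega> * (G b - G a)"
    if ab: "0 \<le> a" "a \<le> b" "b \<le> T" and w: "\<And>r. r \<in> {a..b} \<Longrightarrow> norm (h r - h a) \<le> \<omega> \<and> norm (h r - h b) \<le> \<omega>" for a b \<omega>
  proof -
    have I: "g integrable_on {a..b}" "(\<lambda>r. g r \<bullet> h r) integrable_on {a..b}" "(\<lambda>r. norm (g r)) integrable_on {a..b}"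
      using sub gi ghi ng ab by auto
    have gc: "(\<lambda>r. g r \<bullet> c) integrable_on {a..b}" "integral {a..b} (\<lambda>r. g r \<bullet> c) = integral {a..b} g \<bullet> c" for c
      using has_integral_linear[OF integrable_integral[OF I(1)] bounded_linear_inner_left[of c]]
      by (auto simp: has_integral_iff o_def)
    have "h b - h a = integral {a..b} g" using h[of a] h[of b] comb[OF gi ab] ab by (simp add: algebra_simps)
    \<comment> \<open>The difference of squares factors as (h b - h a) against (h a + h b), and the
      first factor is the integral of g.\<close>
    then have "(norm (h b))\<^sup>2 - (norm (h a))\<^sup>2 = integral {a..b} g \<bullet> (h a + h b)"
      by (simp add: power2_norm_eq_inner inner_diff_left inner_diff_right inner_add_right inner_commute flip: \<open>h b - h a = _\<close>)
    then have "E b - E a = integral {a..b} (\<lambda>r. g r \<bullet> (h a + h b)) - 2 * integral {a..b} (\<lambda>r. g r \<bullet> h r)"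
      using comb[OF ghi ab] gc(2)[of "h a + h b"] unfolding E_def by linarith
    also have "\<dots> = integral {a..b} (\<lambda>r. g r \<bullet> (h a + h b) - 2 * (g r \<bullet> h r))"
      using I gc by (subst Henstock_Kurzweil_Integration.integral_diff) auto
    also have "\<bar>\<dots>\<bar> \<le> integral {a..b} (\<lambda>r. 2 * \<omega> * norm (g r))"
    proof (rule abs_integral_le)
      show "(\<lambda>r. g r \<bullet> (h a + h b) - 2 * (g r \<bullet> h r)) integrable_on {a..b}"
        by (intro Henstock_Kurzweil_Integration.integrable_diff gc integrable_on_mult_right I)
      show "(\<lambda>r. 2 * \<omega> * norm (g r)) integrable_on {a..b}" by (intro integrable_on_mult_right I)
      fix r assume r: "r \<in> {a..b}"
      have "g r \<bullet> (h a + h b) - 2 * (g r \<bullet> h r) = - (g r \<bullet> ((h r - h a) + (h r - h b)))"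
        by (simp add: inner_diff_right inner_add_right)
      also have "\<bar>\<dots>\<bar> \<le> norm (g r) * norm ((h r - h a) + (h r - h b))" by (simp add: Cauchy_Schwarz_ineq2)
      also have "\<dots> \<le> norm (g r) * (\<omega> + \<omega>)"
        using w[OF r] by (intro mult_left_mono order_trans[OF norm_triangle_ineq] add_mono) auto
      finally show "\<bar>g r \<bullet> (h a + h b) - 2 * (g r \<bullet> h r)\<bar> \<le> 2 * \<omega> * norm (g r)" by (simp add: mult_ac)
    qed
    also have "\<dots> = 2 * \<omega> * (G b - G a)" using comb[OF ng ab] by (simp add: G_def)
    finally show ?thesis .
  qed
  have small: "\<bar>E t - E 0\<bar> \<le> 2 * \<omega> * G t" if w: "\<omega> > 0" for \<omega>
  proof -
    obtain d where d: "d > 0" "\<And>x y. x \<in> {0..T} \<Longrightarrow> y \<in> {0..T} \<Longrightarrow> dist x y < d \<Longrightarrow> dist (h x) (h y) < \<omega>"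
      using compact_uniformly_continuous[OF ch] w unfolding uniformly_continuous_on_def by (metis compact_Icc)
    \<comment> \<open>So many equal parts that the mesh is below the modulus of uniform continuity
      for \<omega>.\<close>
    obtain n where n: "t / d < real n" using reals_Archimedean2 by blast
    have n0: "n > 0" using n t d(1) by (cases n) (auto simp: divide_less_0_iff)
    define p where "p i = t * (real i / real n)" for i
    have p: "0 \<le> p i" "p i \<le> p (Suc i)" "p (Suc i) \<le> T" "p (Suc i) - p i < d" if "i < n" for i
    proof -
      show "0 \<le> p i" using t by (simp add: p_def)
      show "p i \<le> p (Suc i)" using t by (auto simp: p_def intro!: mult_left_mono divide_right_mono)
      have "p (Suc i) \<le> t * 1" unfolding p_def using t that by (intro mult_left_mono) auto
      then show "p (Suc i) \<le> T" using t by simp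
      have "p (Suc i) - p i = t / real n" by (simp add: p_def field_simps add_divide_distrib)
      also have "\<dots> < d" using n n0 d(1) by (simp add: field_simps)
      finally show "p (Suc i) - p i < d" .
    qed
    have "\<bar>E (p (Suc i)) - E (p i)\<bar> \<le> 2 * \<omega> * (G (p (Suc i)) - G (p i))" if "i < n" for i
    proof (rule inc[OF p(1-3)[OF that]])
      fix r assume r: "r \<in> {p i..p (Suc i)}"
      then have "dist (h r) (h (p i)) < \<omega>" "dist (h r) (h (p (Suc i))) < \<omega>"
        using p[OF that] by (auto intro!: d(2) simp: dist_real_def)
      then show "norm (h r - h (p i)) \<le> \<omega> \<and> norm (h r - h (p (Suc i))) \<le> \<omega>" by (simp add: dist_norm)
    qed
    then have "(\<Sum>i<n. \<bar>E (p (Suc i)) - E (p i)\<bar>) \<le> (\<Sum>i<n. 2 * \<omega> * (G (p (Suc i)) - G (p i)))"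
      by (intro sum_mono) auto
    also have "\<dots> = 2 * \<omega> * (G (p n) - G (p 0))"
      using sum_lessThan_telescope[of "\<lambda>i. G (p i)" n] by (simp only: sum_distrib_left[symmetric])
    finally have "(\<Sum>i<n. \<bar>E (p (Suc i)) - E (p i)\<bar>) \<le> 2 * \<omega> * (G (p n) - G (p 0))" .
    moreover have "\<bar>E (p n) - E (p 0)\<bar> \<le> (\<Sum>i<n. \<bar>E (p (Suc i)) - E (p i)\<bar>)"
      using sum_abs[of "\<lambda>i. E (p (Suc i)) - E (p i)" "{..<n}"] sum_lessThan_telescope[of "\<lambda>i. E (p i)" n] by simp
    moreover have "p n = t" "p 0 = 0" using n0 by (auto simp: p_def)
    ultimately show ?thesis by (simp add: G_def)
  qed
  have "E t = E 0"
  proof (rule ccontr)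
    assume "E t \<noteq> E 0"
    \<comment> \<open>Chosen so that the bound just proved is at most half of the difference it
      bounds.\<close>
    define \<omega> where "\<omega> = \<bar>E t - E 0\<bar> / (4 * (\<bar>G t\<bar> + 1))"
    have \<omega>: "\<omega> > 0" using \<open>E t \<noteq> E 0\<close> by (simp add: \<omega>_def)
    have "\<bar>E t - E 0\<bar> \<le> 2 * \<omega> * (\<bar>G t\<bar> + 1)"
      using small[OF \<omega>] \<omega> by (smt (verit, best) mult_left_mono)
    also have "\<dots> = \<bar>E t - E 0\<bar> / 2" by (simp add: \<omega>_def field_simps)
    finally show False using \<open>E t \<noteq> E 0\<close> by simp
  qed
  then show "(norm (h t))\<^sup>2 = (norm (h 0))\<^sup>2 + 2 * integral {0..t} (\<lambda>r. g r \<bullet> h r)"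
    by (simp add: E_def)
qed

text \<open>Completeness of Lebesgue measure: a change on a null set cannot destroy
  measurability.\<close>

lemma borel_measurable_lebesgue_on_AE:
  fixes f g :: "real \<Rightarrow> 'b::euclidean_space"
  assumes S: "S \<in> sets lebesgue" and f: "f \<in> borel_measurable (lebesgue_on S)" and ae: "AE x in lebesgue_on S. f x = g x"
  shows "g \<in> borel_measurable (lebesgue_on S)"
proof -
  have "(\<lambda>x. if x \<in> S then f x else 0) \<in> borel_measurable lebesgue"
    using f S by (simp add: borel_measurable_if)
  moreover have "AE x in lebesgue. (if x \<in> S then f x else 0) = (if x \<in> S then g x else 0)"
    using ae S by (auto simp: AE_restrict_space_iff elim: eventually_mono)
  ultimately have "(\<lambda>x. if x \<in> S then g x else 0) \<in> borel_measurable lebesgue"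
    by (rule borel_measurable_AE)
  then show ?thesis using S by (simp add: borel_measurable_if)
qed

lemma borel_measurable_LIMSEQ_AE:
  fixes f :: "nat \<Rightarrow> real \<Rightarrow> 'b::euclidean_space"
  assumes S: "S \<in> sets lebesgue" and f: "\<And>n. f n \<in> borel_measurable (lebesgue_on S)"
    and ae: "AE x in lebesgue_on S. (\<lambda>n. f n x) \<longlonglongrightarrow> g x"
  shows "g \<in> borel_measurable (lebesgue_on S)"
proof (rule borel_measurable_lebesgue_on_AE[OF S])
  show "(\<lambda>x. lim (\<lambda>n. f n x)) \<in> borel_measurable (lebesgue_on S)"
    by (rule borel_measurable_lim_metric[OF f])
  show "AE x in lebesgue_on S. lim (\<lambda>n. f n x) = g x"
    using ae by eventually_elim (rule limI)
qed

section \<open>Measurability in time\<close>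

lemma integrable_lebesgue_on_iff:
  "S \<in> sets lebesgue \<Longrightarrow> integrable (lebesgue_on S) f \<longleftrightarrow> f absolutely_integrable_on S"
  by (simp add: set_integrable_def integrable_restrict_space)

text \<open>Measurability is asked of \<open>g\<close> only. The typical \<open>f\<close> is a
  pairing with the definite description \<open>B_op\<close>, whose value is known just at almost
  every time.\<close>

lemma lint_cong_AE:
  fixes f g :: "real \<Rightarrow> real"
  assumes "S \<in> sets lebesgue" "g \<in> borel_measurable (lebesgue_on S)" "AE x in lebesgue_on S. f x = g x"
  shows "integral\<^sup>L (lebesgue_on S) f = integral\<^sup>L (lebesgue_on S) g"
proof -
  have "AE x in lebesgue_on S. g x = f x" using assms(3) by eventually_elim simp
  then have "f \<in> borel_measurable (lebesgue_on S)" by (rule borel_measurable_lebesgue_on_AE[OF assms(1,2)])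
  then show ?thesis by (intro integral_cong_AE assms)
qed

lemma integrable_cong_lebesgue_AE:
  fixes f g :: "real \<Rightarrow> real"
  assumes "S \<in> sets lebesgue" "integrable (lebesgue_on S) g" "AE x in lebesgue_on S. g x = f x"
  shows "integrable (lebesgue_on S) f"
  by (rule integrable_cong_AE_imp[OF assms(2) borel_measurable_lebesgue_on_AE[OF assms(1) borel_measurable_integrable[OF assms(2)] assms(3)] assms(3)])

lemma integrable_times_cont:
  fixes g \<psi> :: "real \<Rightarrow> real"
  assumes "integrable (lebesgue_on {a..b}) g" "continuous_on {a..b} \<psi>"
  shows "integrable (lebesgue_on {a..b}) (\<lambda>r. g r * \<psi> r)"
proof -
  have "(\<lambda>r. \<psi> r * g r) absolutely_integrable_on {a..b}"
    by (rule absolutely_integrable_bounded_measurable_product_real)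
       (use assms in \<open>auto simp: integrable_lebesgue_on_iff intro!: continuous_imp_measurable_on_sets_lebesgue compact_imp_bounded compact_continuous_image\<close>)
  then show ?thesis by (simp add: integrable_lebesgue_on_iff mult.commute)
qed

lemma cont_integrable:
  fixes f :: "real \<Rightarrow> 'a::euclidean_space"
  assumes "continuous_on {a..b} f" shows "integrable (lebesgue_on {a..b}) f"
  using absolutely_integrable_continuous_real[OF assms] by (simp add: integrable_lebesgue_on_iff)

lemma AE_lebesgue_shift:
  assumes "AE t in lebesgue_on {- \<mu>..T}. P t" "\<mu> \<ge> 0"
  shows "AE r in lebesgue_on {0..T :: real}. P (r - \<mu>)"
proof -
  have "AE t in lebesgue. t \<in> {- \<mu>..T} \<longrightarrow> P t"
    using assms(1) by (simp add: AE_restrict_space_iff)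
  then have "{t. \<not> (t \<in> {- \<mu>..T} \<longrightarrow> P t)} \<in> null_sets lebesgue"
    unfolding completion.AE_iff_null_sets by simp
  then have "negligible ((+) \<mu> ` {t. \<not> (t \<in> {- \<mu>..T} \<longrightarrow> P t)})"
    by (intro negligible_translation) (simp add: negligible_iff_null_sets)
  then have n: "(+) \<mu> ` {t. \<not> (t \<in> {- \<mu>..T} \<longrightarrow> P t)} \<in> null_sets lebesgue"
    by (simp add: negligible_iff_null_sets)
  have "AE r in lebesgue. r \<in> {0..T} \<longrightarrow> P (r - \<mu>)"
  proof (rule AE_I'[OF n])
    show "{x \<in> space lebesgue. \<not> (x \<in> {0..T} \<longrightarrow> P (x - \<mu>))} \<subseteq> (+) \<mu> ` {t. \<not> (t \<in> {- \<mu>..T} \<longrightarrow> P t)}"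
    proof
      fix x assume "x \<in> {x \<in> space lebesgue. \<not> (x \<in> {0..T} \<longrightarrow> P (x - \<mu>))}"
      then show "x \<in> (+) \<mu> ` {t. \<not> (t \<in> {- \<mu>..T} \<longrightarrow> P t)}"
        using assms(2) by (intro image_eqI[of _ _ "x - \<mu>"]) auto
    qed
  qed
  then show ?thesis by (simp add: AE_restrict_space_iff)
qed

lemma measurable_shift_lebesgue: "(\<lambda>x::real. x - \<mu>) \<in> lebesgue \<rightarrow>\<^sub>M lebesgue"
  using lebesgue_affine_measurable[of "\<lambda>_. 1" "- \<mu>"] by simp

lemma borel_measurable_shift:
  fixes f :: "real \<Rightarrow> 'b::euclidean_space"
  assumes "f \<in> borel_measurable (lebesgue_on {- \<mu>..T})" "\<mu> \<ge> 0"
  shows "(\<lambda>r. f (r - \<mu>)) \<in> borel_measurable (lebesgue_on {0..T})"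
proof -
  have "(\<lambda>x. if x \<in> {- \<mu>..T} then f x else 0) \<in> borel_measurable lebesgue"
    using assms(1) by (subst borel_measurable_if) auto
  from measurable_compose[OF measurable_shift_lebesgue this]
  have "(\<lambda>x. if x - \<mu> \<in> {- \<mu>..T} then f (x - \<mu>) else 0) \<in> borel_measurable (lebesgue_on {0..T})"
    by (rule measurable_restrict_space1)
  then show ?thesis
    by (rule measurable_cong[THEN iffD1, rotated]) (use assms(2) in auto)
qed

lemma integrable_shift:
  fixes f :: "real \<Rightarrow> real"
  assumes "integrable (lebesgue_on {- \<mu>..T}) f" "\<mu> \<ge> 0"
  shows "integrable (lebesgue_on {0..T}) (\<lambda>r. f (r - \<mu>))"
proof -
  have eq: "- \<mu> + 1 * x = x - \<mu>" for x by simp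
  have "integrable lebesgue (\<lambda>x. indicator {- \<mu>..T} x *\<^sub>R f x)"
    by (rule integrable_restrict_space[THEN iffD1]) (use assms(1) in simp_all)
  from lebesgue_integrable_real_affine[OF this, of 1 "- \<mu>"]
  have "integrable lebesgue (\<lambda>x. indicator {- \<mu>..T} (x - \<mu>) *\<^sub>R f (x - \<mu>))" by (simp only: eq)
  then have "integrable lebesgue (\<lambda>x. indicator {0..T} x *\<^sub>R (indicator {- \<mu>..T} (x - \<mu>) *\<^sub>R f (x - \<mu>)))"
    by (intro integrable_mult_indicator) auto
  also have "(\<lambda>x. indicator {0..T} x *\<^sub>R (indicator {- \<mu>..T} (x - \<mu>) *\<^sub>R f (x - \<mu>))) = (\<lambda>x. indicator {0..T} x *\<^sub>R f (x - \<mu>))"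
    using assms(2) by (auto simp: indicator_def fun_eq_iff)
  finally show ?thesis by (simp add: integrable_restrict_space)
qed

text \<open>Before time \<mu> the shifted function reads the history on the interval from -\<mu> to
  0. It is an inequality because T may be smaller than \<mu>, in which case only part of the history
  is seen.\<close>

lemma integral_shift_le:
  fixes f :: "real \<Rightarrow> real"
  assumes f: "integrable (lebesgue_on {- \<mu>..T}) f" and \<mu>: "\<mu> \<ge> 0" "T \<ge> 0" and f0: "\<And>x. f x \<ge> 0"
  shows "(LINT r|lebesgue_on {0..T}. indicator {0..<\<mu>} r * f (r - \<mu>)) \<le> (LINT r|lebesgue_on {- \<mu>..0}. f r)"
proof -
  have eq: "- \<mu> + 1 * x = x - \<mu>" for x by simp
  have fi: "integrable lebesgue (\<lambda>x. indicator {- \<mu>..T} x *\<^sub>R f x)"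
    by (rule integrable_restrict_space[THEN iffD1]) (use f in simp_all)
  then have "integrable lebesgue (\<lambda>x. indicator {- \<mu>..0} x *\<^sub>R (indicator {- \<mu>..T} x *\<^sub>R f x))"
    by (rule integrable_mult_indicator[rotated]) auto
  also have "(\<lambda>x. indicator {- \<mu>..0} x *\<^sub>R (indicator {- \<mu>..T} x *\<^sub>R f x)) = (\<lambda>x. indicator {- \<mu>..0} x *\<^sub>R f x)"
    using \<mu> by (auto simp: indicator_def fun_eq_iff)
  finally have f2: "integrable lebesgue (\<lambda>x. indicator {- \<mu>..0} x *\<^sub>R f x)" .
  from lebesgue_integrable_real_affine[OF this, of 1 "- \<mu>"]
  have f3: "integrable lebesgue (\<lambda>x. indicator {- \<mu>..0} (x - \<mu>) *\<^sub>R f (x - \<mu>))" by (simp only: eq)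
  have "integrable (lebesgue_on {0..T}) (\<lambda>r. indicator {0..<\<mu>} r * f (r - \<mu>))"
    using integrable_real_mult_indicator[OF _ integrable_shift[OF f \<mu>(1)], of "{0..<\<mu>} \<inter> {0..T}"]
    by (rule Bochner_Integration.integrable_cong[THEN iffD1, rotated -1]) (auto simp: sets_restrict_space_iff indicator_def)
  then have f4: "integrable lebesgue (\<lambda>r. indicator {0..T} r *\<^sub>R (indicator {0..<\<mu>} r * f (r - \<mu>)))"
    by (simp add: integrable_restrict_space)
  have "(LINT r|lebesgue_on {0..T}. indicator {0..<\<mu>} r * f (r - \<mu>)) = (LINT r|lebesgue. indicator {0..T} r *\<^sub>R (indicator {0..<\<mu>} r * f (r - \<mu>)))"
    by (simp add: integral_restrict_space)
  also have "\<dots> \<le> (LINT x|lebesgue. indicator {- \<mu>..0} (x - \<mu>) *\<^sub>R f (x - \<mu>))"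
    by (rule integral_mono[OF f4 f3]) (use f0 in \<open>auto simp: indicator_def\<close>)
  also have "\<dots> = (LINT x|lebesgue. indicator {- \<mu>..0} x *\<^sub>R f x)"
    using lebesgue_integral_real_affine[of 1 "\<lambda>x. indicator {- \<mu>..0} x *\<^sub>R f x" "- \<mu>"] by simp
  also have "\<dots> = (LINT r|lebesgue_on {- \<mu>..0}. f r)" by (simp add: integral_restrict_space)
  finally show ?thesis .
qed

lemma test_functionsD:
  assumes "\<psi> \<in> test_functions T"
  shows "continuous_on S \<psi>" "continuous_on S (deriv \<psi>)"
proof -
  have d: "(deriv ^^ m) \<psi> differentiable (at x)" for m x using assms by (auto simp: test_functions_def)
  have c: "continuous_on S ((deriv ^^ m) \<psi>)" for m
    by (intro continuous_at_imp_continuous_on ballI differentiable_imp_continuous_within d)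
  show "continuous_on S \<psi>" "continuous_on S (deriv \<psi>)" using c[of 0] c[of 1] by simp_all
qed

lemma bounded_bilinear_cscale: "bounded_bilinear (\<lambda>c (z :: complex ^ 'n). c *s z)"
proof
  show "\<exists>K. \<forall>a (b :: complex ^ 'n). norm (a *s b) \<le> norm a * norm b * K"
    by (rule exI[of _ 1]) (simp add: norm_cscale)
qed (simp_all add: vec_eq_iff algebra_simps)

lemma borel_measurable_linear:
  fixes g :: "'a::euclidean_space \<Rightarrow> 'b::euclidean_space"
  assumes "linear g" "f \<in> borel_measurable M"
  shows "(\<lambda>x. g (f x)) \<in> borel_measurable M"
  by (rule borel_measurable_continuous_on[OF linear_continuous_on[OF linear_conv_bounded_linear[THEN iffD1, OF assms(1)]] assms(2)])

section \<open>Measurability and integrability of modes, norms and the bilinear term\<close>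

context torus
begin

lemma borel_measurable_coef:
  assumes "(\<lambda>t. u t k) \<in> borel_measurable M"
  shows "(\<lambda>t. coef s (u t) k) \<in> borel_measurable M"
  unfolding coef_def by (intro borel_measurable_times borel_measurable_const measurable_compose[OF assms borel_measurable_norm])

lemma borel_measurable_nrm_sq:
  fixes S :: "real set"
  assumes S: "S \<in> sets lebesgue" and u: "\<And>k. (\<lambda>t. u t k) \<in> borel_measurable (lebesgue_on S)"
    and h: "AE t in lebesgue_on S. hs s (u t)"
  shows "(\<lambda>t. (nrm s (u t))\<^sup>2) \<in> borel_measurable (lebesgue_on S)"
proof (rule borel_measurable_LIMSEQ_AE[OF S])
  show "(\<lambda>t. \<Sum>k\<in>modes N. (coef s (u t) k)\<^sup>2) \<in> borel_measurable (lebesgue_on S)" for N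
    by (intro borel_measurable_sum borel_measurable_power borel_measurable_coef u)
  show "AE t in lebesgue_on S. (\<lambda>N. \<Sum>k\<in>modes N. (coef s (u t) k)\<^sup>2) \<longlonglongrightarrow> (nrm s (u t))\<^sup>2"
    using h by eventually_elim (rule nrm_sq_modes)
qed

lemma norm_tendsto_0_coef:
  assumes "(\<lambda>n. nrm s (x n - y)) \<longlonglongrightarrow> 0" "\<And>n. x n \<in> V L s" "y \<in> V L s"
  shows "(\<lambda>n. x n k) \<longlonglongrightarrow> y k"
proof (cases "k = 0")
  case True
  have "x n 0 = 0" "y 0 = 0" for n using assms(2)[of n] assms(3) by (auto simp: V_iff dest: solenoidalD(1))
  then show ?thesis using True by simp
next
  case False
  have "norm (x n k - y k) \<le> lam k powr (- s) * nrm s (x n - y)" for n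
  proof -
    have "coef s (x n - y) k \<le> nrm s (x n - y)"
      by (rule norm_le_nrm) (use assms False in \<open>auto simp: V_iff hs_diff\<close>)
    then show ?thesis using lam_pos[OF False] by (simp add: coef_def powr_minus field_simps)
  qed
  moreover have "(\<lambda>n. lam k powr (- s) * nrm s (x n - y)) \<longlonglongrightarrow> 0"
    using tendsto_mult_left[OF assms(1)] by simp
  ultimately have "(\<lambda>n. x n k - y k) \<longlonglongrightarrow> 0"
    using Lim_null_comparison[OF always_eventually, of "\<lambda>n. x n k - y k" "\<lambda>n. lam k powr (- s) * nrm s (x n - y)"] by blast
  then show ?thesis by (rule LIM_zero_cancel)
qed

lemma Vnorm_sq: "(Vnorm L s u)\<^sup>2 = L ^ 3 * (nrm s u)\<^sup>2"
  using L_pos by (simp add: Vnorm_eq power_mult_distrib)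

text \<open>Reduces Bochner measurability to its coordinates: evaluation at a mode is continuous on
  V^s, and simple functions compose with it.\<close>

lemma strongly_measurable_coef:
  assumes S: "S \<in> sets lebesgue" and u: "strongly_measurable L s (lebesgue_on S) u"
  shows "(\<lambda>t. u t k) \<in> borel_measurable (lebesgue_on S)"
proof -
  obtain g where g: "\<And>n::nat. simple_function (lebesgue_on S) (g n)" "\<And>n t. t \<in> S \<Longrightarrow> g n t \<in> V L s"
    and l: "AE t in lebesgue_on S. (\<lambda>n. Vnorm L s (g n t - u t)) \<longlonglongrightarrow> 0" and uV: "AE t in lebesgue_on S. u t \<in> V L s"
    using u unfolding strongly_measurable_def by auto
  show ?thesis
  proof (rule borel_measurable_LIMSEQ_AE[OF S])
    show "(\<lambda>t. g n t k) \<in> borel_measurable (lebesgue_on S)" for n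
      by (rule borel_measurable_simple_function[OF simple_function_compose1[OF g(1)]])
    show "AE t in lebesgue_on S. (\<lambda>n. g n t k) \<longlonglongrightarrow> u t k"
      using l uV AE_space
    proof eventually_elim
      case (elim t)
      have "(\<lambda>n. nrm s (g n t - u t)) \<longlonglongrightarrow> 0"
        using tendsto_mult_left[OF elim(1), of "1 / sqrt (L ^ 3)"] L_pos by (simp add: Vnorm_eq)
      then show ?case by (rule norm_tendsto_0_coef) (use elim g(2) in auto)
    qed
  qed
qed

lemma L2_timeD:
  assumes "u \<in> L2_time L a b s"
  shows "AE t in lebesgue_on {a..b}. u t \<in> V L s"
    "\<And>k. (\<lambda>t. u t k) \<in> borel_measurable (lebesgue_on {a..b})"
    "integrable (lebesgue_on {a..b}) (\<lambda>t. (nrm s (u t))\<^sup>2)"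
proof -
  show "AE t in lebesgue_on {a..b}. u t \<in> V L s"
    using assms by (simp add: L2_time_def strongly_measurable_def)
  show "(\<lambda>t. u t k) \<in> borel_measurable (lebesgue_on {a..b})" for k
    by (rule strongly_measurable_coef) (use assms in \<open>auto simp: L2_time_def\<close>)
  have "integrable (lebesgue_on {a..b}) (\<lambda>t. (Vnorm L s (u t))\<^sup>2)"
    using assms by (simp add: L2_time_def)
  from integrable_mult_right[OF this, of "1 / L ^ 3"] show "integrable (lebesgue_on {a..b}) (\<lambda>t. (nrm s (u t))\<^sup>2)"
    using L_pos by (simp add: Vnorm_sq)
qed

lemma borel_measurable_Bsym:
  assumes "(\<lambda>t. v t (k - l)) \<in> borel_measurable M" "(\<lambda>t. w t l) \<in> borel_measurable M"
  shows "(\<lambda>t. Bsym (v t) (w t) k l) \<in> borel_measurable M"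
proof -
  have "continuous_on UNIV (\<lambda>x :: complex \<times> (complex ^ 3). fst x *s snd x)"
    by (intro bounded_bilinear.continuous_on[OF bounded_bilinear_cscale] continuous_intros)
  from borel_measurable_continuous_Pair[OF borel_measurable_linear[OF linear_cdot assms(1)] assms(2) this]
  show ?thesis by (simp add: Bsym_def)
qed

lemma borel_measurable_Bf:
  fixes S :: "real set"
  assumes S: "S \<in> sets lebesgue"
    and v: "\<And>k. (\<lambda>t. v t k) \<in> borel_measurable (lebesgue_on S)" "AE t in lebesgue_on S. v t \<in> V L 0"
    and w: "\<And>k. (\<lambda>t. w t k) \<in> borel_measurable (lebesgue_on S)" "AE t in lebesgue_on S. w t \<in> V L 0"
  shows "(\<lambda>t. Bf (v t) (w t) k) \<in> borel_measurable (lebesgue_on S)"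
proof (cases "k = 0")
  case False
  show ?thesis
  proof (rule borel_measurable_LIMSEQ_AE[OF S])
    show "(\<lambda>t. leray (freq L k) (\<i> *s (\<Sum>l\<in>modes N. Bsym (v t) (w t) k l))) \<in> borel_measurable (lebesgue_on S)" for N
      by (intro borel_measurable_linear[OF linear_leray] borel_measurable_linear[OF linear_cscale]
          borel_measurable_sum borel_measurable_Bsym v w)
    show "AE t in lebesgue_on S. (\<lambda>N. leray (freq L k) (\<i> *s (\<Sum>l\<in>modes N. Bsym (v t) (w t) k l))) \<longlonglongrightarrow> Bf (v t) (w t) k"
      using v(2) w(2)
    proof eventually_elim
      case (elim t)
      have "(\<lambda>N. \<Sum>l\<in>modes N. Bsym (v t) (w t) k l) \<longlonglongrightarrow> (\<Sum>\<^sub>\<infinity>l\<in>- {0}. Bsym (v t) (w t) k l)"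
        by (intro infsum_modes Bsym_summable) (use elim in \<open>auto simp: V_iff solenoidalD\<close>)
      from bounded_linear.tendsto[OF linear_conv_bounded_linear[THEN iffD1, OF linear_leray]
          bounded_linear.tendsto[OF linear_conv_bounded_linear[THEN iffD1, OF linear_cscale] this]]
      show ?case using False by (simp add: Bf_def)
    qed
  qed
qed (simp add: Bf_def)

lemma cnjv_scaleR: "cnjv (c *\<^sub>R z) = c *\<^sub>R cnjv z"
  by (simp add: cnjv_def vec_eq_iff)

lemma stokes_single:
  assumes "k \<noteq> 0" "solenoidal L u"
  shows "pairing L (stokes_pow L (1/2) u) (stokes_pow L (1/2) (single k z)) = 2 * L ^ 3 * ((lam k)\<^sup>2 * (u k \<bullet> z))"
proof -
  have s: "stokes_pow L (1/2) x = (\<lambda>k. lam k *\<^sub>R x k)" for x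
    by (simp add: stokes_pow_def lam_def)
  have "stokes_pow L (1/2) (single k z) = single k (lam k *\<^sub>R z)"
    unfolding s by (auto simp: single_def fun_eq_iff cnjv_scaleR)
  moreover have "solenoidal L (stokes_pow L (1/2) u)"
    unfolding s using assms(2) by (auto intro!: solenoidalI simp: solenoidalD cdot_scaleR) (auto simp: cnjv_def vec_eq_iff)
  ultimately show ?thesis
    by (simp add: pairing_single[OF assms(1)]) (simp add: s power2_eq_square)
qed

text \<open>The time derivative of mode k of w when w is advected by v; for the delay equation v is
  the delayed field, for the limit equation v = w.\<close>

definition rhs :: "real \<Rightarrow> coeffs \<Rightarrow> coeffs \<Rightarrow> coeffs \<Rightarrow> coeffs" where
  "rhs \<nu> f v w k = f k - (\<nu> * (lam k)\<^sup>2) *\<^sub>R w k - Bf v w k"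

lemma C_time_coef:
  assumes "w \<in> C_time L a b s"
  shows "continuous_on {a..b} (\<lambda>t. w t k)"
  unfolding continuous_on_def
proof
  fix t assume t: "t \<in> {a..b}"
  have wt: "w r \<in> V L s" if "r \<in> {a..b}" for r using assms that by (simp add: C_time_def)
  show "((\<lambda>t. w t k) \<longlongrightarrow> w t k) (at t within {a..b})"
  proof (cases "k = 0")
    case True
    have "w r k = 0" if "r \<in> {a..b}" for r using wt[OF that] True by (auto simp: V_iff dest: solenoidalD(1))
    then have "\<forall>\<^sub>F r in at t within {a..b}. w t k = w r k"
      unfolding eventually_at_filter using t by (intro always_eventually) auto
    then show ?thesis by (rule Lim_transform_eventually[OF tendsto_const])
  next
    case False
    have "((\<lambda>r. Vnorm L s (w r - w t)) \<longlongrightarrow> 0) (at t within {a..b})" using assms t by (simp add: C_time_def)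
    from tendsto_mult_left[OF this, of "lam k powr (- s) / sqrt (L ^ 3)"]
    have l: "((\<lambda>r. lam k powr (- s) * nrm s (w r - w t)) \<longlongrightarrow> 0) (at t within {a..b})"
      using L_pos by (simp add: Vnorm_eq)
    have "\<forall>\<^sub>F r in at t within {a..b}. norm (w r k - w t k) \<le> lam k powr (- s) * nrm s (w r - w t)"
    proof -
      have "norm (w r k - w t k) \<le> lam k powr (- s) * nrm s (w r - w t)" if "r \<in> {a..b}" for r
      proof -
        have "coef s (w r - w t) k \<le> nrm s (w r - w t)"
          by (rule norm_le_nrm) (use wt that t False in \<open>auto simp: V_iff hs_diff\<close>)
        then show ?thesis using lam_pos[OF False] by (simp add: coef_def powr_minus field_simps)
      qed
      then show ?thesis by (auto simp: eventually_at_filter)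
    qed
    from Lim_null_comparison[OF this l] show ?thesis by (rule LIM_zero_cancel)
  qed
qed

lemma C_time_bounded:
  assumes "w \<in> C_time L a b s"
  obtains C where "C > 0" "\<And>t. t \<in> {a..b} \<Longrightarrow> nrm s (w t) \<le> C"
proof -
  have wt: "w r \<in> V L s" if "r \<in> {a..b}" for r using assms that by (simp add: C_time_def)
  have "continuous_on {a..b} (\<lambda>t. nrm s (w t))"
    unfolding continuous_on_def
  proof
    fix t assume t: "t \<in> {a..b}"
    have "((\<lambda>r. Vnorm L s (w r - w t)) \<longlongrightarrow> 0) (at t within {a..b})" using assms t by (simp add: C_time_def)
    from tendsto_mult_left[OF this, of "1 / sqrt (L ^ 3)"]
    have l: "((\<lambda>r. nrm s (w r - w t)) \<longlongrightarrow> 0) (at t within {a..b})" using L_pos by (simp add: Vnorm_eq)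
    have "norm (nrm s (w r) - nrm s (w t)) \<le> nrm s (w r - w t)" if "r \<in> {a..b}" for r
      using nrm_triangle(2)[of s "w r" "w t"] nrm_triangle(2)[of s "w t" "w r"] hs_diff(1)[of s "w r" "w t"] hs_diff(1)[of s "w t" "w r"]
        wt[OF that] wt[OF t] nrm_minus[of s "w t" "w r"] by (simp add: V_iff abs_le_iff)
    then have "\<forall>\<^sub>F r in at t within {a..b}. norm (nrm s (w r) - nrm s (w t)) \<le> nrm s (w r - w t)"
      by (auto simp: eventually_at_filter)
    from Lim_null_comparison[OF this l] show "((\<lambda>r. nrm s (w r)) \<longlongrightarrow> nrm s (w t)) (at t within {a..b})"
      by (rule LIM_zero_cancel)
  qed
  then have "bounded ((\<lambda>t. nrm s (w t)) ` {a..b})" by (intro compact_imp_bounded compact_continuous_image) auto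
  then obtain C where "C > 0" "\<And>x. x \<in> (\<lambda>t. nrm s (w t)) ` {a..b} \<Longrightarrow> norm x \<le> C" using bounded_pos by metis
  then show ?thesis using that[of C] by fastforce
qed

lemma integrable_nrm_mono:
  fixes S :: "real set"
  assumes S: "S \<in> sets lebesgue" and u: "\<And>k. (\<lambda>t. u t k) \<in> borel_measurable (lebesgue_on S)"
    and V: "AE t in lebesgue_on S. u t \<in> V L s'" and i: "integrable (lebesgue_on S) (\<lambda>t. (nrm s' (u t))\<^sup>2)" and s: "s \<le> s'"
  shows "integrable (lebesgue_on S) (\<lambda>t. (nrm s (u t))\<^sup>2)"
proof (rule Bochner_Integration.integrable_bound[OF integrable_mult_right[OF i, of "(lam0 powr (s - s'))\<^sup>2"]])
  show "(\<lambda>t. (nrm s (u t))\<^sup>2) \<in> borel_measurable (lebesgue_on S)"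
  proof (rule borel_measurable_nrm_sq[OF S u])
    show "AE t in lebesgue_on S. hs s (u t)" using V by eventually_elim (use s hs_mono in \<open>auto simp: V_iff\<close>)
  qed
  show "AE t in lebesgue_on S. norm ((nrm s (u t))\<^sup>2) \<le> norm ((lam0 powr (s - s'))\<^sup>2 * (nrm s' (u t))\<^sup>2)"
    using V
  proof eventually_elim
    case (elim t)
    have "nrm s (u t) \<le> lam0 powr (s - s') * nrm s' (u t)" using hs_mono(2)[of s' "u t" s] elim s by (simp add: V_iff)
    from power_mono[OF this, of 2] show ?case by (simp add: power_mult_distrib)
  qed
qed

text \<open>For a fixed mode the V^0 bound is enough, and the product of two square-integrable norms
  is integrable.\<close>

lemma integrable_Bf:
  fixes S :: "real set"
  assumes S: "S \<in> sets lebesgue"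
    and v: "\<And>k. (\<lambda>t. v t k) \<in> borel_measurable (lebesgue_on S)" "AE t in lebesgue_on S. v t \<in> V L 0" "integrable (lebesgue_on S) (\<lambda>t. (nrm 0 (v t))\<^sup>2)"
    and w: "\<And>k. (\<lambda>t. w t k) \<in> borel_measurable (lebesgue_on S)" "AE t in lebesgue_on S. w t \<in> V L 0" "integrable (lebesgue_on S) (\<lambda>t. (nrm 0 (w t))\<^sup>2)"
  shows "integrable (lebesgue_on S) (\<lambda>t. Bf (v t) (w t) k)"
proof (rule Bochner_Integration.integrable_bound[OF integrable_mult_right[OF Bochner_Integration.integrable_add[OF v(3) w(3)], of "lam k"]])
  show "(\<lambda>t. Bf (v t) (w t) k) \<in> borel_measurable (lebesgue_on S)" by (rule borel_measurable_Bf[OF S v(1,2) w(1,2)])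
  show "AE t in lebesgue_on S. norm (Bf (v t) (w t) k) \<le> norm (lam k * ((nrm 0 (v t))\<^sup>2 + (nrm 0 (w t))\<^sup>2))"
    using v(2) w(2)
  proof eventually_elim
    case (elim t)
    have ab: "a * b \<le> a\<^sup>2 + b\<^sup>2" for a b :: real
      using sum_squares_bound[of a b] zero_le_power2[of a] zero_le_power2[of b] by linarith
    have "norm (Bf (v t) (w t) k) \<le> lam k * (nrm 0 (v t) * nrm 0 (w t))"
      by (rule norm_Bf_le0) (use elim in \<open>auto simp: V_iff solenoidalD\<close>)
    also have "\<dots> \<le> lam k * ((nrm 0 (v t))\<^sup>2 + (nrm 0 (w t))\<^sup>2)" using ab by (intro mult_left_mono) auto
    finally show ?case by simp
  qed
qed

end

section \<open>The energy estimate\<close>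

lemma integrable_lebesgue_on_subinterval:
  fixes f :: "real \<Rightarrow> 'a::euclidean_space"
  assumes "integrable (lebesgue_on {a..b}) f" "{c..d} \<subseteq> {a..b}"
  shows "integrable (lebesgue_on {c..d}) f"
proof -
  have "set_integrable lebesgue {c..d} f"
    by (rule set_integrable_subset[of _ "{a..b}"]) (use assms in \<open>auto simp: integrable_lebesgue_on_iff\<close>)
  then show ?thesis by (simp add: integrable_lebesgue_on_iff)
qed

lemma AE_lebesgue_on_subinterval:
  fixes a b :: real
  assumes "AE t in lebesgue_on {a..b}. P t" "{c..d} \<subseteq> {a..b}"
  shows "AE t in lebesgue_on {c..d}. P t"
proof -
  have "AE t in lebesgue. t \<in> {a..b} \<longrightarrow> P t" using assms(1) by (simp add: AE_restrict_space_iff)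
  then have "AE t in lebesgue. t \<in> {c..d} \<longrightarrow> P t" by eventually_elim (use assms(2) in auto)
  then show ?thesis by (simp add: AE_restrict_space_iff)
qed

text \<open>A linear advection problem in which v is a given field; how v arises from w by delay
  plays a part only later. w is the continuous representative and v lies in V^0 at every time, so
  the identities for modes need no exceptional times. \<open>weak\<close> is the equation tested
  with one mode.\<close>

locale delay_solution = torus +
  fixes \<nu> \<alpha> T :: real and f :: coeffs and w v :: "real \<Rightarrow> coeffs"
  assumes \<nu>: "\<nu> > 0" and \<alpha>: "\<alpha> > 1/2" and T: "T > 0"
    and f: "f \<in> V L (\<alpha> - 1)"
    and w: "w \<in> C_time L 0 T \<alpha>"
    and wV: "AE t in lebesgue_on {0..T}. w t \<in> V L (1 + \<alpha>)"
    and wi: "integrable (lebesgue_on {0..T}) (\<lambda>t. (nrm (1 + \<alpha>) (w t))\<^sup>2)"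
    and v0: "\<And>t. t \<in> {0..T} \<Longrightarrow> v t \<in> V L 0"
    and vm: "\<And>k. (\<lambda>t. v t k) \<in> borel_measurable (lebesgue_on {0..T})"
    and vV: "AE t in lebesgue_on {0..T}. v t \<in> V L (1 + \<alpha>)"
    and vi: "integrable (lebesgue_on {0..T}) (\<lambda>t. (nrm (1 + \<alpha>) (v t))\<^sup>2)"
    and weak: "\<And>k z \<psi>. k \<noteq> 0 \<Longrightarrow> cdot (freq L k) z = 0 \<Longrightarrow> \<psi> \<in> test_functions T \<Longrightarrow>
      (LINT r|lebesgue_on {0..T}. (w r k \<bullet> z) * deriv \<psi> r) = - (LINT r|lebesgue_on {0..T}. (rhs \<nu> f (v r) (w r) k \<bullet> z) * \<psi> r)"
begin

lemma w_V: "t \<in> {0..T} \<Longrightarrow> w t \<in> V L \<alpha>"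
  using w by (simp add: C_time_def)

lemma w_V0: "t \<in> {0..T} \<Longrightarrow> w t \<in> V L 0"
  using V_mono[OF w_V] \<alpha> by simp

lemma f_V: "f \<in> V L (- 1)" using V_mono[OF f] \<alpha> by simp

lemma wm: "(\<lambda>t. w t k) \<in> borel_measurable (lebesgue_on {0..T})"
  by (rule continuous_imp_measurable_on_sets_lebesgue[OF C_time_coef[OF w]]) simp

lemma integrable_lower:
  assumes "s \<le> 1 + \<alpha>"
  shows "integrable (lebesgue_on {0..T}) (\<lambda>t. (nrm s (w t))\<^sup>2)" "integrable (lebesgue_on {0..T}) (\<lambda>t. (nrm s (v t))\<^sup>2)"
  using integrable_nrm_mono[OF _ wm wV wi assms] integrable_nrm_mono[OF _ vm vV vi assms] by simp_all

lemma integrable_Bf_vw: "integrable (lebesgue_on {0..T}) (\<lambda>r. Bf (v r) (w r) k)"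
  by (rule integrable_Bf) (use vm wm v0 w_V0 integrable_lower[of 0] \<alpha> in \<open>auto intro!: AE_I2\<close>)

lemma integrable_rhs: "integrable (lebesgue_on {0..T}) (\<lambda>r. rhs \<nu> f (v r) (w r) k)"
  unfolding rhs_def
  by (intro Bochner_Integration.integrable_diff integrable_scaleR_right integrable_Bf_vw cont_integrable continuous_intros C_time_coef[OF w])

lemma cdot_rhs:
  assumes "r \<in> {0..T}"
  shows "cdot (freq L k) (rhs \<nu> f (v r) (w r) k) = 0"
proof -
  have "solenoidal L (Bf (v r) (w r))"
    by (rule solenoidal_Bf) (use v0[OF assms] w_V0[OF assms] in \<open>auto simp: V_iff\<close>)
  then show ?thesis using f w_V0[OF assms]
    by (simp add: rhs_def cdot_diff cdot_scaleR solenoidalD V_iff)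
qed

text \<open>The weak equation only tests directions orthogonal to the frequency. The defect
  \<open>d\<close> is itself such a direction, so testing with \<open>d\<close> gives its own
  square.\<close>

lemma mild:
  assumes t: "t \<in> {0..T}"
  shows "w t k = w 0 k + integral {0..t} (\<lambda>r. rhs \<nu> f (v r) (w r) k)"
proof (cases "k = 0")
  case True
  have z: "w r 0 = 0" if "r \<in> {0..T}" for r using w_V0[OF that] by (auto simp: V_iff dest: solenoidalD(1))
  have "f 0 = 0" using f by (auto simp: V_iff dest: solenoidalD(1))
  then have "integral {0..t} (\<lambda>r. rhs \<nu> f (v r) (w r) k) = integral {0..t} (\<lambda>r. 0)"
    using True z t by (intro Henstock_Kurzweil_Integration.integral_cong) (auto simp: rhs_def Bf_def)
  then show ?thesis using z[OF t] z[of 0] True T by simp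
next
  case False
  define g where "g r = rhs \<nu> f (v r) (w r) k" for r
  have gi: "g integrable_on {0..t}"
    using integrable_on_lebesgue_on[OF integrable_lebesgue_on_subinterval[OF integrable_rhs, of 0 t k]] t by (simp add: g_def[abs_def])
  define d where "d = w t k - w 0 k - integral {0..t} g"
  have key: "d \<bullet> z = 0" if z: "cdot (freq L k) z = 0" for z
  proof -
    have "w t k \<bullet> z = w 0 k \<bullet> z + integral {0..t} (\<lambda>r. g r \<bullet> z)"
    proof (rule du_Bois_Reymond[OF T])
      show "continuous_on {0..T} (\<lambda>t. w t k \<bullet> z)" by (intro continuous_intros C_time_coef[OF w])
      show "integrable (lebesgue_on {0..T}) (\<lambda>r. g r \<bullet> z)"
        unfolding g_def by (intro integrable_inner_left integrable_rhs)
    qed (use weak[OF False z] t in \<open>auto simp: g_def\<close>)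
    also have "integral {0..t} (\<lambda>r. g r \<bullet> z) = integral {0..t} g \<bullet> z"
      using integral_linear[OF gi bounded_linear_inner_left[of z]] by (simp add: o_def)
    finally show ?thesis by (simp add: d_def inner_diff_left)
  qed
  have "cdot (freq L k) (integral {0..t} g) = integral {0..t} (\<lambda>r. cdot (freq L k) (g r))"
    using integral_linear[OF gi linear_conv_bounded_linear[THEN iffD1, OF linear_cdot[of "freq L k"]]] by (simp add: o_def)
  also have "\<dots> = integral {0..t} (\<lambda>r. 0)"
    using t by (intro Henstock_Kurzweil_Integration.integral_cong) (auto simp: g_def cdot_rhs)
  finally have "cdot (freq L k) d = 0"
    using w_V0[OF t] w_V0[of 0] T by (simp add: d_def cdot_diff V_iff solenoidalD)
  from key[OF this] have "d = 0" by simp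
  then show ?thesis by (simp add: d_def g_def[abs_def] algebra_simps)
qed

text \<open>Only the sum of the pairing is truncated, not the fields inside \<open>Bf\<close>. Hence
  it does not vanish for finite N, and its decay has to be proved.\<close>

definition flux :: "nat \<Rightarrow> real \<Rightarrow> real" where
  "flux N r = (\<Sum>k\<in>modes N. Bf (v r) (w r) k \<bullet> w r k)"

definition dissip :: "nat \<Rightarrow> real \<Rightarrow> real" where
  "dissip N r = (\<Sum>k\<in>modes N. (coef 1 (w r) k)\<^sup>2)"

lemma coef1_sq: "(coef 1 u k)\<^sup>2 = (lam k)\<^sup>2 * (u k \<bullet> u k)"
  by (simp add: coef_def power_mult_distrib power2_norm_eq_inner)

lemma dissip_cont: "continuous_on {0..T} (dissip N)"
  unfolding dissip_def[abs_def] coef1_sq by (intro continuous_intros C_time_coef[OF w])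

lemma integrable_rhs_w: "(\<lambda>r. rhs \<nu> f (v r) (w r) k \<bullet> w r k) absolutely_integrable_on {0..T}"
proof (rule norm_sq_integral(1)[where T=T and h="\<lambda>r. w r k" and t=0])
  show "(\<lambda>r. rhs \<nu> f (v r) (w r) k) absolutely_integrable_on {0..T}"
    using integrable_rhs by (simp add: integrable_lebesgue_on_iff)
qed (use T in \<open>auto intro: mild\<close>)

lemma flux_integrable: "integrable (lebesgue_on {0..T}) (flux N)"
proof -
  have "Bf (v r) (w r) k \<bullet> w r k = (f k \<bullet> w r k - \<nu> * (lam k)\<^sup>2 * (w r k \<bullet> w r k)) - rhs \<nu> f (v r) (w r) k \<bullet> w r k" for r k
    by (simp add: rhs_def inner_diff_left)
  moreover have "integrable (lebesgue_on {0..T}) (\<lambda>r. (f k \<bullet> w r k - \<nu> * (lam k)\<^sup>2 * (w r k \<bullet> w r k)) - rhs \<nu> f (v r) (w r) k \<bullet> w r k)" for k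
    by (rule Bochner_Integration.integrable_diff)
       (use integrable_rhs_w in \<open>auto simp: integrable_lebesgue_on_iff intro!: absolutely_integrable_continuous_real continuous_intros C_time_coef[OF w]\<close>)
  ultimately show ?thesis unfolding flux_def[abs_def] by (intro Bochner_Integration.integrable_sum) simp
qed

text \<open>Pointwise in time the limit is the full pairing, which is 0. The majorant multiplies the
  V^(3/2) norm of v, the V^(1/2) norm of w and the V^1 norm of w: the middle factor is bounded in
  time since w is continuous in V^\<alpha> and \<alpha> > 1/2, the outer two are
  square-integrable.\<close>

lemma flux_tendsto:
  assumes t: "t \<in> {0..T}"
  shows "(\<lambda>N. integral {0..t} (flux N)) \<longlonglongrightarrow> 0"
proof -
  have sub: "{0..t} \<subseteq> {0..T}" using t by auto
  obtain C where C: "C > 0" "\<And>t. t \<in> {0..T} \<Longrightarrow> nrm \<alpha> (w t) \<le> C" using C_time_bounded[OF w] by blast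
  \<comment> \<open>\<open>KB\<close>, the three embedding constants into V^(3/2), V^(1/2) and V^1,
    and the bound C on w in V^\<alpha>.\<close>
  define K where "K = KB * lam0 powr (3/2 - (1 + \<alpha>)) * (lam0 powr (1/2 - \<alpha>) * C) * lam0 powr (1 - (1 + \<alpha>))"
  have K0: "K \<ge> 0" using C by (simp add: K_def)
  have "(\<lambda>N. LINT r|lebesgue_on {0..t}. flux N r) \<longlonglongrightarrow> (LINT r|lebesgue_on {0..t}. 0)"
  proof (rule integral_dominated_convergence[where w="\<lambda>r. K * ((nrm (1 + \<alpha>) (v r))\<^sup>2 + (nrm (1 + \<alpha>) (w r))\<^sup>2)"])
    show "flux N \<in> borel_measurable (lebesgue_on {0..t})" for N
      by (rule borel_measurable_integrable[OF integrable_lebesgue_on_subinterval[OF flux_integrable sub]])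
    show "integrable (lebesgue_on {0..t}) (\<lambda>r. K * ((nrm (1 + \<alpha>) (v r))\<^sup>2 + (nrm (1 + \<alpha>) (w r))\<^sup>2))"
      by (intro integrable_mult_right Bochner_Integration.integrable_add integrable_lebesgue_on_subinterval[OF vi sub] integrable_lebesgue_on_subinterval[OF wi sub])
    note ae = AE_lebesgue_on_subinterval[OF vV sub] AE_lebesgue_on_subinterval[OF wV sub] AE_space
    have B: "hs (- 1) (Bf (v r) (w r))" if "v r \<in> V L (1 + \<alpha>)" "w r \<in> V L (1 + \<alpha>)" for r
      using Bf_V[of "v r" "w r"] V_mono[OF that(1), of 1] V_mono[OF that(2), of 1] \<alpha> by (auto simp: V_iff)
    show "AE r in lebesgue_on {0..t}. (\<lambda>N. flux N r) \<longlonglongrightarrow> 0"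
      using ae
    proof eventually_elim
      case (elim r)
      have w1: "w r \<in> V L 1" "v r \<in> V L 1" using V_mono elim \<alpha> by auto
      have "(\<lambda>N. L ^ 3 * flux N r) \<longlonglongrightarrow> pairing L (Bf (v r) (w r)) (w r)"
        unfolding flux_def by (rule pairing_modes[where s=1]) (use B elim w1 in \<open>auto simp: V_iff\<close>)
      then have "(\<lambda>N. L ^ 3 * flux N r) \<longlonglongrightarrow> 0" using trilinear_zero[OF w1(2,1)] by simp
      from tendsto_mult_left[OF this, of "1 / L ^ 3"] show ?case using L_pos by simp
    qed
    show "AE r in lebesgue_on {0..t}. norm (flux N r) \<le> K * ((nrm (1 + \<alpha>) (v r))\<^sup>2 + (nrm (1 + \<alpha>) (w r))\<^sup>2)" for N
      using ae
    proof eventually_elim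
      case (elim r)
      define a where "a = nrm (1 + \<alpha>) (v r)"
      define b where "b = nrm (1 + \<alpha>) (w r)"
      have r: "r \<in> {0..T}" using elim(3) sub by auto
      have hv: "hs (1 + \<alpha>) (v r)" and hw: "hs (1 + \<alpha>) (w r)" and sv: "solenoidal L (v r)" and sw: "solenoidal L (w r)"
        using elim by (auto simp: V_iff)
      have hw1: "hs 1 (w r)" using hs_mono(1)[OF hw] \<alpha> by simp
      have n1: "nrm (3/2) (v r) \<le> lam0 powr (3/2 - (1 + \<alpha>)) * a" unfolding a_def by (rule hs_mono(2)[OF hv]) (use \<alpha> in simp)
      have n2: "nrm 1 (w r) \<le> lam0 powr (1 - (1 + \<alpha>)) * b" unfolding b_def by (rule hs_mono(2)[OF hw]) (use \<alpha> in simp)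
      have "nrm (1/2) (w r) \<le> lam0 powr (1/2 - \<alpha>) * nrm \<alpha> (w r)"
        by (rule hs_mono(2)) (use w_V[OF r] \<alpha> in \<open>auto simp: V_iff\<close>)
      also have "\<dots> \<le> lam0 powr (1/2 - \<alpha>) * C" using C(2)[OF r] by (intro mult_left_mono) auto
      finally have n3: "nrm (1/2) (w r) \<le> lam0 powr (1/2 - \<alpha>) * C" .
      have "norm (flux N r) \<le> (\<Sum>k\<in>modes N. norm (Bf (v r) (w r) k) * norm (w r k))"
        unfolding flux_def by (rule sum_norm_le) (simp add: Cauchy_Schwarz_ineq2)
      also have "\<dots> \<le> (\<Sum>\<^sub>\<infinity>k\<in>- {0}. norm (Bf (v r) (w r) k) * norm (w r k))"
        by (rule finite_sum_le_infsum) (use pairing_sum(1)[of 1] B elim hw1 in auto)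
      also have "\<dots> \<le> nrm (- 1) (Bf (v r) (w r)) * nrm 1 (w r)"
        by (rule pairing_sum(2)) (use B elim hw1 in auto)
      also have "\<dots> \<le> (KB * (nrm (3/2) (v r) * nrm (1/2) (w r))) * nrm 1 (w r)"
        by (intro mult_right_mono Bf_pq(2)) (use hs_mono(1)[OF hv] hs_mono(1)[OF hw] sv sw \<alpha> solenoidalD(1) in auto)
      also have "\<dots> \<le> (KB * ((lam0 powr (3/2 - (1 + \<alpha>)) * a) * (lam0 powr (1/2 - \<alpha>) * C))) * (lam0 powr (1 - (1 + \<alpha>)) * b)"
        using n1 n2 n3 C(1) by (intro mult_mono mult_left_mono) (auto simp: a_def)
      also have "\<dots> = K * (a * b)" by (simp add: K_def)
      also have "\<dots> \<le> K * (a\<^sup>2 + b\<^sup>2)"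
      proof (intro mult_left_mono K0)
        have "0 \<le> a * b" by (simp add: a_def b_def)
        then show "a * b \<le> a\<^sup>2 + b\<^sup>2" using sum_squares_bound[of a b] by linarith
      qed
      finally show ?case by (simp add: a_def b_def)
    qed
  qed simp
  moreover have "(LINT r|lebesgue_on {0..t}. flux N r) = integral {0..t} (flux N)" for N
    by (rule lebesgue_integral_eq_integral[OF integrable_lebesgue_on_subinterval[OF flux_integrable sub]]) simp
  ultimately show ?thesis by simp
qed

text \<open>The a priori bound delivered by Young's inequality for the forcing. It contains nothing
  of v and nothing of the norm of w in V^\<alpha>, hence is uniform in the delay.\<close>

definition E0 :: real where "E0 = (nrm 0 (w 0))\<^sup>2 + T / \<nu> * (nrm (- 1) f)\<^sup>2"

lemma E0_nonneg: "E0 \<ge> 0" using \<nu> T by (simp add: E0_def)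

text \<open>The energy balance of the modes in a cube, up to the transfer term. Half of the
  dissipation absorbs the forcing, so after doubling one full \<nu> remains on the left.\<close>

lemma energy_flux:
  assumes t: "t \<in> {0..T}"
  shows "(\<Sum>k\<in>modes N. (norm (w t k))\<^sup>2) + \<nu> * integral {0..t} (dissip N) \<le> E0 - 2 * integral {0..t} (flux N)"
proof -
  have sub: "{0..t} \<subseteq> {0..T}" using t by auto
  define cf where "cf = (\<Sum>k\<in>modes N. (coef (- 1) f k)\<^sup>2)"
  define Q where "Q r = (\<Sum>k\<in>modes N. rhs \<nu> f (v r) (w r) k \<bullet> w r k)" for r
  have rw: "(\<lambda>r. rhs \<nu> f (v r) (w r) k \<bullet> w r k) integrable_on {0..t}" for k
    using set_integrable_subset[OF integrable_rhs_w[of k], of "{0..t}"] sub absolutely_integrable_on_def by auto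
  have ci: "dissip N integrable_on {0..t}" using continuous_on_subset[OF dissip_cont sub] by (rule integrable_continuous_real)
  have fi: "flux N integrable_on {0..t}"
    by (rule integrable_on_lebesgue_on[OF integrable_lebesgue_on_subinterval[OF flux_integrable sub]]) simp
  have Qi: "Q integrable_on {0..t}" unfolding Q_def by (intro integrable_sum rw) simp
  have "(\<Sum>k\<in>modes N. (norm (w t k))\<^sup>2) = (\<Sum>k\<in>modes N. (norm (w 0 k))\<^sup>2 + 2 * integral {0..t} (\<lambda>r. rhs \<nu> f (v r) (w r) k \<bullet> w r k))"
  proof (rule sum.cong[OF refl])
    fix k
    show "(norm (w t k))\<^sup>2 = (norm (w 0 k))\<^sup>2 + 2 * integral {0..t} (\<lambda>r. rhs \<nu> f (v r) (w r) k \<bullet> w r k)"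
    proof (rule norm_sq_integral(2)[where T=T and h="\<lambda>r. w r k"])
      show "(\<lambda>r. rhs \<nu> f (v r) (w r) k) absolutely_integrable_on {0..T}"
        using integrable_rhs by (simp add: integrable_lebesgue_on_iff)
    qed (use t in \<open>auto intro: mild\<close>)
  qed
  also have "\<dots> = (\<Sum>k\<in>modes N. (norm (w 0 k))\<^sup>2) + 2 * integral {0..t} Q"
    unfolding Q_def sum.distrib using rw by (subst integral_sum) (auto simp: sum_distrib_left)
  finally have 1: "(\<Sum>k\<in>modes N. (norm (w t k))\<^sup>2) = (\<Sum>k\<in>modes N. (norm (w 0 k))\<^sup>2) + 2 * integral {0..t} Q" .
  have "integral {0..t} Q \<le> integral {0..t} (\<lambda>r. cf / (2 * \<nu>) - \<nu> / 2 * dissip N r - flux N r)"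
  proof (rule integral_le[OF Qi])
    show "(\<lambda>r. cf / (2 * \<nu>) - \<nu> / 2 * dissip N r - flux N r) integrable_on {0..t}"
      by (intro Henstock_Kurzweil_Integration.integrable_diff integrable_on_mult_right ci fi integrable_const_ivl)
    fix r assume "r \<in> {0..t}"
    have "Q r + flux N r = (\<Sum>k\<in>modes N. f k \<bullet> w r k - \<nu> * (coef 1 (w r) k)\<^sup>2)"
      unfolding Q_def flux_def sum.distrib[symmetric]
      by (intro sum.cong refl) (simp add: rhs_def inner_diff_left coef1_sq)
    also have "\<dots> \<le> (\<Sum>k\<in>modes N. (coef (- 1) f k)\<^sup>2 / (2 * \<nu>) - \<nu> / 2 * (coef 1 (w r) k)\<^sup>2)"
    proof (rule sum_mono)
      fix k assume k: "k \<in> modes N"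
      then have "k \<noteq> 0" by auto
      then have l: "lam k > 0" by (rule lam_pos)
      define a where "a = coef (- 1) f k"
      define b where "b = coef 1 (w r) k"
      have "f k \<bullet> w r k \<le> norm (f k) * norm (w r k)" by (rule norm_cauchy_schwarz)
      also have "\<dots> = a * b" using l by (simp add: a_def b_def coef_def powr_minus)
      also have "\<dots> \<le> a\<^sup>2 / (2 * \<nu>) + \<nu> / 2 * b\<^sup>2"
      proof -
        have "0 \<le> (a - \<nu> * b)\<^sup>2 / (2 * \<nu>)" using \<nu> by simp
        also have "\<dots> = a\<^sup>2 / (2 * \<nu>) + \<nu> / 2 * b\<^sup>2 - a * b"
          using \<nu> by (simp add: power2_eq_square field_simps)
        finally show ?thesis by simp
      qed
      finally show "f k \<bullet> w r k - \<nu> * (coef 1 (w r) k)\<^sup>2 \<le> (coef (- 1) f k)\<^sup>2 / (2 * \<nu>) - \<nu> / 2 * (coef 1 (w r) k)\<^sup>2"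
        by (simp add: a_def b_def)
    qed
    also have "\<dots> = cf / (2 * \<nu>) - \<nu> / 2 * dissip N r"
      by (simp add: cf_def dissip_def sum_subtractf sum_divide_distrib sum_distrib_left)
    finally show "Q r \<le> cf / (2 * \<nu>) - \<nu> / 2 * dissip N r - flux N r" by simp
  qed
  also have "\<dots> = t * cf / (2 * \<nu>) - \<nu> / 2 * integral {0..t} (dissip N) - integral {0..t} (flux N)"
  proof -
    have "((\<lambda>r. cf / (2 * \<nu>) - \<nu> / 2 * dissip N r - flux N r) has_integral
        t * (cf / (2 * \<nu>)) - \<nu> / 2 * integral {0..t} (dissip N) - integral {0..t} (flux N)) {0..t}"
      using has_integral_const_real[of "cf / (2 * \<nu>)" 0 t] t
      by (intro has_integral_diff has_integral_mult_right integrable_integral ci fi) simp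
    then show ?thesis by (simp add: integral_unique)
  qed
  finally have 2: "2 * integral {0..t} Q \<le> t / \<nu> * cf - \<nu> * integral {0..t} (dissip N) - 2 * integral {0..t} (flux N)"
    using \<nu> by (simp add: field_simps)
  have "(\<Sum>k\<in>modes N. (norm (w 0 k))\<^sup>2) = (\<Sum>k\<in>modes N. (coef 0 (w 0) k)\<^sup>2)"
    by (intro sum.cong refl) (auto simp: coef_0)
  also have "\<dots> \<le> (nrm 0 (w 0))\<^sup>2" by (rule sum_modes_le) (use w_V0[of 0] T in \<open>auto simp: V_iff\<close>)
  finally have 3: "(\<Sum>k\<in>modes N. (norm (w 0 k))\<^sup>2) \<le> (nrm 0 (w 0))\<^sup>2" .
  have "cf \<le> (nrm (- 1) f)\<^sup>2" unfolding cf_def by (rule sum_modes_le) (use f_V in \<open>auto simp: V_iff\<close>)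
  then have "t / \<nu> * cf \<le> T / \<nu> * (nrm (- 1) f)\<^sup>2"
    using t \<nu> by (intro mult_mono divide_right_mono) (auto simp: cf_def sum_nonneg)
  then show ?thesis using 1 2 3 by (simp add: E0_def)
qed

text \<open>Two cutoffs: the left side increases with the cutoff, so it may be frozen at M while N
  tends to infinity and removes the flux.\<close>

lemma energy_modes:
  assumes t: "t \<in> {0..T}"
  shows "(\<Sum>k\<in>modes M. (norm (w t k))\<^sup>2) + \<nu> * integral {0..t} (dissip M) \<le> E0"
proof (rule LIMSEQ_le_const)
  show "(\<lambda>N. E0 - 2 * integral {0..t} (flux N)) \<longlonglongrightarrow> E0"
    using tendsto_diff[OF tendsto_const tendsto_mult_left[OF flux_tendsto[OF t], of 2], of E0] by simp
  have sub: "{0..t} \<subseteq> {0..T}" using t by auto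
  have "(\<Sum>k\<in>modes M. (norm (w t k))\<^sup>2) + \<nu> * integral {0..t} (dissip M) \<le> E0 - 2 * integral {0..t} (flux N)" if "N \<ge> M" for N
  proof -
    have "(\<Sum>k\<in>modes M. (norm (w t k))\<^sup>2) \<le> (\<Sum>k\<in>modes N. (norm (w t k))\<^sup>2)"
      by (rule sum_mono2[OF _ modes_mono[OF that]]) auto
    moreover have "integral {0..t} (dissip M) \<le> integral {0..t} (dissip N)"
      by (rule integral_le; (intro integrable_continuous_real continuous_on_subset[OF dissip_cont sub])?)
         (auto simp: dissip_def intro!: sum_mono2 modes_mono[OF that])
    then have "\<nu> * integral {0..t} (dissip M) \<le> \<nu> * integral {0..t} (dissip N)" using \<nu> by simp
    ultimately show ?thesis using energy_flux[OF t, of N] by linarith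
  qed
  then show "\<exists>N. \<forall>n\<ge>N. (\<Sum>k\<in>modes M. (norm (w t k))\<^sup>2) + \<nu> * integral {0..t} (dissip M) \<le> E0 - 2 * integral {0..t} (flux n)" by blast
qed

lemma energy0:
  assumes t: "t \<in> {0..T}"
  shows "nrm 0 (w t) \<le> sqrt E0"
proof (rule hs_modesI(2))
  fix M
  have "(\<Sum>k\<in>modes M. (coef 0 (w t) k)\<^sup>2) = (\<Sum>k\<in>modes M. (norm (w t k))\<^sup>2)"
    by (intro sum.cong refl) (auto simp: coef_0)
  moreover have "0 \<le> integral {0..t} (dissip M)"
    by (rule integral_nonneg) (use t in \<open>auto simp: dissip_def sum_nonneg intro!: integrable_continuous_real continuous_on_subset[OF dissip_cont]\<close>)
  then have "0 \<le> \<nu> * integral {0..t} (dissip M)" using \<nu> by simp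
  ultimately show "(\<Sum>k\<in>modes M. (coef 0 (w t) k)\<^sup>2) \<le> (sqrt E0)\<^sup>2"
    using energy_modes[OF t, of M] E0_nonneg by simp
qed (simp add: E0_nonneg)

lemma energy1: "(LINT r|lebesgue_on {0..T}. (nrm 1 (w r))\<^sup>2) \<le> E0 / \<nu>"
proof (rule LIMSEQ_le_const2)
  have h: "AE r in lebesgue_on {0..T}. hs 1 (w r)"
    using wV by eventually_elim (use hs_mono(1) \<alpha> in \<open>auto simp: V_iff\<close>)
  have i1: "integrable (lebesgue_on {0..T}) (\<lambda>r. (nrm 1 (w r))\<^sup>2)" by (rule integrable_lower) (use \<alpha> in simp)
  have m: "dissip M \<in> borel_measurable (lebesgue_on {0..T})" for M
    by (rule continuous_imp_measurable_on_sets_lebesgue[OF dissip_cont]) simp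
  show "(\<lambda>M. LINT r|lebesgue_on {0..T}. dissip M r) \<longlonglongrightarrow> (LINT r|lebesgue_on {0..T}. (nrm 1 (w r))\<^sup>2)"
  proof (rule integral_dominated_convergence[OF _ m i1])
    show "AE r in lebesgue_on {0..T}. (\<lambda>M. dissip M r) \<longlonglongrightarrow> (nrm 1 (w r))\<^sup>2"
      using h unfolding dissip_def by eventually_elim (rule nrm_sq_modes)
    show "AE r in lebesgue_on {0..T}. norm (dissip M r) \<le> (nrm 1 (w r))\<^sup>2" for M
      using h unfolding dissip_def by eventually_elim (use sum_modes_le in \<open>auto simp: sum_nonneg\<close>)
  qed (use i1 in simp)
  have "(LINT r|lebesgue_on {0..T}. dissip M r) \<le> E0 / \<nu>" for M
  proof -
    have "(LINT r|lebesgue_on {0..T}. dissip M r) = integral {0..T} (dissip M)"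
      by (rule lebesgue_integral_eq_integral[OF cont_integrable[OF dissip_cont]]) simp
    moreover have "0 \<le> (\<Sum>k\<in>modes M. (norm (w T k))\<^sup>2)" by (simp add: sum_nonneg)
    then have "\<nu> * integral {0..T} (dissip M) \<le> E0" using energy_modes[of T M] T by simp
    ultimately show ?thesis using \<nu> by (simp add: field_simps)
  qed
  then show "\<exists>N. \<forall>M\<ge>N. (LINT r|lebesgue_on {0..T}. dissip M r) \<le> E0 / \<nu>" by blast
qed

end

section \<open>From the weak delay equation to the mode equations\<close>

context torus
begin

lemma delay_weak_solution_imp:
  assumes \<nu>: "\<nu> > 0" and \<alpha>: "\<alpha> > 1/2" and T: "T > 0" and \<mu>: "\<mu> > 0" and f: "f \<in> V L (\<alpha> - 1)"
    and sol: "delay_weak_solution L \<nu> \<alpha> f T \<mu> \<phi> u0 u"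
  obtains w v where "delay_solution L \<nu> \<alpha> T f w v" "C_representative L 0 T \<alpha> u w" "w 0 = u0"
    "\<And>t. t \<in> {\<mu>..T} \<Longrightarrow> v t = w (t - \<mu>)"
    "\<And>t. t \<in> {0..<\<mu>} \<Longrightarrow> v t = u (t - \<mu>) \<or> v t = (\<lambda>_. 0)"
proof -
  have u: "u \<in> L2_time L (- \<mu>) T (1 + \<alpha>)" using sol by (simp add: delay_weak_solution_def)
  obtain w where rep: "C_representative L 0 T \<alpha> u w" and w0: "w 0 = u0"
    using sol by (auto simp: delay_weak_solution_def)
  have w: "w \<in> C_time L 0 T \<alpha>" and uw: "AE t in lebesgue_on {0..T}. u t = w t"
    using rep by (auto simp: C_representative_def)
  have wV: "w t \<in> V L \<alpha>" if "t \<in> {0..T}" for t using w that by (simp add: C_time_def)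
  \<comment> \<open>The delayed field, corrected on a null set: the continuous representative is
    used wherever the delayed time is nonnegative, and exceptional times of the history get the
    value 0, so that \<open>v r\<close> is always in V^0.\<close>
  define v where "v r = (if \<mu> \<le> r then w (r - \<mu>) else if u (r - \<mu>) \<in> V L (1 + \<alpha>) then u (r - \<mu>) else (\<lambda>_. 0))" for r
  note uD = L2_timeD[OF u]
  have sub: "{0..T} \<subseteq> {- \<mu>..T}" using \<mu> by auto
  have uV: "AE t in lebesgue_on {0..T}. u t \<in> V L (1 + \<alpha>)" by (rule AE_lebesgue_on_subinterval[OF uD(1) sub])
  have wV1: "AE t in lebesgue_on {0..T}. w t \<in> V L (1 + \<alpha>)" using uV uw by eventually_elim simp
  have usV: "AE r in lebesgue_on {0..T}. u (r - \<mu>) \<in> V L (1 + \<alpha>)" by (rule AE_lebesgue_shift[OF uD(1)]) (use \<mu> in simp)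
  have "AE t in lebesgue_on {- \<mu>..T}. t \<in> {0..T} \<longrightarrow> u t = w t"
  proof -
    have "AE t in lebesgue. t \<in> {0..T} \<longrightarrow> u t = w t" using uw by (simp add: AE_restrict_space_iff)
    then show ?thesis by (simp add: AE_restrict_space_iff eventually_mono)
  qed
  from AE_lebesgue_shift[OF this] have usw: "AE r in lebesgue_on {0..T}. r - \<mu> \<in> {0..T} \<longrightarrow> u (r - \<mu>) = w (r - \<mu>)"
    using \<mu> by simp
  have vu: "AE r in lebesgue_on {0..T}. u (r - \<mu>) = v r"
    using usV usw AE_space by eventually_elim (use \<mu> in \<open>auto simp: v_def\<close>)
  have vV: "AE r in lebesgue_on {0..T}. v r \<in> V L (1 + \<alpha>)" using usV vu by eventually_elim simp
  have v0: "v t \<in> V L 0" if "t \<in> {0..T}" for t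
  proof -
    have "(\<lambda>_. 0) \<in> trig_poly L" by (simp add: trig_poly_def solenoidal_0)
    then have "(\<lambda>_. 0) \<in> V L 0" by (rule trig_V)
    moreover have "w (t - \<mu>) \<in> V L 0" if "\<mu> \<le> t" using wV[of "t - \<mu>"] V_mono[of _ \<alpha> 0] that \<open>t \<in> {0..T}\<close> \<mu> \<alpha> by auto
    ultimately show ?thesis using V_mono[of _ "1 + \<alpha>" 0] \<alpha> by (auto simp: v_def)
  qed
  have S: "{0..T} \<in> sets lebesgue" by simp
  have vm: "(\<lambda>t. v t k) \<in> borel_measurable (lebesgue_on {0..T})" for k
  proof (rule borel_measurable_lebesgue_on_AE[OF S])
    show "(\<lambda>r. u (r - \<mu>) k) \<in> borel_measurable (lebesgue_on {0..T})"
      by (rule borel_measurable_shift[OF uD(2)]) (use \<mu> in simp)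
    show "AE r in lebesgue_on {0..T}. u (r - \<mu>) k = v r k" using vu by eventually_elim simp
  qed
  have vi: "integrable (lebesgue_on {0..T}) (\<lambda>t. (nrm (1 + \<alpha>) (v t))\<^sup>2)"
  proof (rule integrable_cong_lebesgue_AE[OF S])
    show "integrable (lebesgue_on {0..T}) (\<lambda>r. (nrm (1 + \<alpha>) (u (r - \<mu>)))\<^sup>2)"
      by (rule integrable_shift[OF uD(3)]) (use \<mu> in simp)
    show "AE r in lebesgue_on {0..T}. (nrm (1 + \<alpha>) (u (r - \<mu>)))\<^sup>2 = (nrm (1 + \<alpha>) (v r))\<^sup>2" using vu by eventually_elim simp
  qed
  have wi: "integrable (lebesgue_on {0..T}) (\<lambda>t. (nrm (1 + \<alpha>) (w t))\<^sup>2)"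
  proof (rule integrable_cong_lebesgue_AE[OF S])
    show "integrable (lebesgue_on {0..T}) (\<lambda>r. (nrm (1 + \<alpha>) (u r))\<^sup>2)"
      by (rule integrable_lebesgue_on_subinterval[OF uD(3) sub])
    show "AE r in lebesgue_on {0..T}. (nrm (1 + \<alpha>) (u r))\<^sup>2 = (nrm (1 + \<alpha>) (w r))\<^sup>2" using uw by eventually_elim simp
  qed
  have wm: "(\<lambda>t. w t k) \<in> borel_measurable (lebesgue_on {0..T})" for k
    by (rule continuous_imp_measurable_on_sets_lebesgue[OF C_time_coef[OF w]]) simp
  have w00: "w t \<in> V L 0" if "t \<in> {0..T}" for t using V_mono[OF wV[OF that], of 0] \<alpha> by simp
  have Bi: "integrable (lebesgue_on {0..T}) (\<lambda>r. Bf (v r) (w r) k)" for k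
    by (rule integrable_Bf)
       (use vm wm v0 w00 integrable_nrm_mono[OF S vm vV vi, of 0] integrable_nrm_mono[OF S wm wV1 wi, of 0] \<alpha> in \<open>auto intro!: AE_I2\<close>)
  have "delay_solution L \<nu> \<alpha> T f w v"
  proof
    fix k z \<psi> assume k: "k \<noteq> 0" and z: "cdot (freq L k) z = 0" and \<psi>: "\<psi> \<in> test_functions T"
    define e where "e = single k z"
    have et: "e \<in> trig_poly L" unfolding e_def by (rule single_trig[OF k z])
    have c\<psi>: "continuous_on {0..T} \<psi>" "continuous_on {0..T} (deriv \<psi>)" using test_functionsD[OF \<psi>] by auto
    have iw: "integrable (lebesgue_on {0..T}) (\<lambda>r. (w r k \<bullet> z) * deriv \<psi> r)"
      "integrable (lebesgue_on {0..T}) (\<lambda>r. (w r k \<bullet> z) * \<psi> r)"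
      by (intro cont_integrable continuous_intros C_time_coef[OF w] c\<psi>)+
    have iB: "integrable (lebesgue_on {0..T}) (\<lambda>r. (Bf (v r) (w r) k \<bullet> z) * \<psi> r)"
      by (intro integrable_times_cont integrable_inner_left Bi c\<psi>)
    have if': "integrable (lebesgue_on {0..T}) (\<lambda>r. (f k \<bullet> z) * \<psi> r)"
      by (intro cont_integrable continuous_intros c\<psi>)
    have ps: "pairing L x e = 2 * L ^ 3 * (x k \<bullet> z)" if "solenoidal L x" for x
      unfolding e_def by (rule pairing_single[OF k that])
    have a: "(LINT r|lebesgue_on {0..T}. pairing L (u r) e * deriv \<psi> r) = 2 * L ^ 3 * (LINT r|lebesgue_on {0..T}. (w r k \<bullet> z) * deriv \<psi> r)"
    proof -
      have "(LINT r|lebesgue_on {0..T}. pairing L (u r) e * deriv \<psi> r) = (LINT r|lebesgue_on {0..T}. 2 * L ^ 3 * ((w r k \<bullet> z) * deriv \<psi> r))"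
      proof (rule lint_cong_AE[OF S])
        show "AE r in lebesgue_on {0..T}. pairing L (u r) e * deriv \<psi> r = 2 * L ^ 3 * ((w r k \<bullet> z) * deriv \<psi> r)"
          using uw uV by eventually_elim (auto simp: ps V_iff)
      qed (use iw in \<open>auto intro!: borel_measurable_integrable\<close>)
      then show ?thesis by simp
    qed
    have b: "(LINT r|lebesgue_on {0..T}. pairing L (stokes_pow L (1/2) (u r)) (stokes_pow L (1/2) e) * \<psi> r)
        = 2 * L ^ 3 * (LINT r|lebesgue_on {0..T}. (lam k)\<^sup>2 * (w r k \<bullet> z) * \<psi> r)"
    proof -
      have "(LINT r|lebesgue_on {0..T}. pairing L (stokes_pow L (1/2) (u r)) (stokes_pow L (1/2) e) * \<psi> r)
         = (LINT r|lebesgue_on {0..T}. 2 * L ^ 3 * ((lam k)\<^sup>2 * ((w r k \<bullet> z) * \<psi> r)))"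
      proof (rule lint_cong_AE[OF S])
        show "AE r in lebesgue_on {0..T}. pairing L (stokes_pow L (1/2) (u r)) (stokes_pow L (1/2) e) * \<psi> r = 2 * L ^ 3 * ((lam k)\<^sup>2 * ((w r k \<bullet> z) * \<psi> r))"
          using uw uV by eventually_elim (auto simp: e_def stokes_single[OF k] V_iff)
      qed (use iw in \<open>auto intro!: borel_measurable_integrable integrable_mult_right\<close>)
      then show ?thesis by (simp add: mult.assoc)
    qed
    have c: "(LINT r|lebesgue_on {0..T}. pairing L (B_op L (1 + \<alpha>) \<alpha> (1 + \<alpha>) (u (r - \<mu>)) (u r)) e * \<psi> r)
        = 2 * L ^ 3 * (LINT r|lebesgue_on {0..T}. (Bf (v r) (w r) k \<bullet> z) * \<psi> r)"
    proof -
      have "(LINT r|lebesgue_on {0..T}. pairing L (B_op L (1 + \<alpha>) \<alpha> (1 + \<alpha>) (u (r - \<mu>)) (u r)) e * \<psi> r)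
         = (LINT r|lebesgue_on {0..T}. 2 * L ^ 3 * ((Bf (v r) (w r) k \<bullet> z) * \<psi> r))"
      proof (rule lint_cong_AE[OF S])
        show "AE r in lebesgue_on {0..T}. pairing L (B_op L (1 + \<alpha>) \<alpha> (1 + \<alpha>) (u (r - \<mu>)) (u r)) e * \<psi> r
            = 2 * L ^ 3 * ((Bf (v r) (w r) k \<bullet> z) * \<psi> r)"
          using uw uV vu vV
        proof eventually_elim
          case (elim r)
          have "B_op L (1 + \<alpha>) \<alpha> (1 + \<alpha>) (u (r - \<mu>)) (u r) = Bf (v r) (w r)"
            using B_op_eq[of "1 + \<alpha>" \<alpha> "1 + \<alpha>" "v r" "w r"] elim \<alpha> by (simp add: add.commute)
          moreover have "solenoidal L (Bf (v r) (w r))"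
            by (rule solenoidal_Bf) (use elim \<alpha> hs_mono(1)[of "1 + \<alpha>" _ 0] in \<open>auto simp: V_iff\<close>)
          ultimately show ?case by (simp add: ps)
        qed
      qed (use iB in \<open>auto intro!: borel_measurable_integrable\<close>)
      then show ?thesis by simp
    qed
    have d: "(LINT r|lebesgue_on {0..T}. pairing L f e * \<psi> r) = 2 * L ^ 3 * (LINT r|lebesgue_on {0..T}. (f k \<bullet> z) * \<psi> r)"
      using f by (simp add: ps V_iff mult.assoc)
    have "- (LINT r|lebesgue_on {0..T}. pairing L (u r) e * deriv \<psi> r)
        + \<nu> * (LINT r|lebesgue_on {0..T}. pairing L (stokes_pow L (1/2) (u r)) (stokes_pow L (1/2) e) * \<psi> r)
        + (LINT r|lebesgue_on {0..T}. pairing L (B_op L (1 + \<alpha>) \<alpha> (1 + \<alpha>) (u (r - \<mu>)) (u r)) e * \<psi> r)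
        = (LINT r|lebesgue_on {0..T}. pairing L f e * \<psi> r)"
      using sol trig_V[OF et] \<psi> by (simp add: delay_weak_solution_def)
    \<comment> \<open>Pairing with a single-mode field produces the same factor in all four terms,
      and it is then cancelled.\<close>
    then have "2 * L ^ 3 * (- (LINT r|lebesgue_on {0..T}. (w r k \<bullet> z) * deriv \<psi> r)
        + \<nu> * (LINT r|lebesgue_on {0..T}. (lam k)\<^sup>2 * (w r k \<bullet> z) * \<psi> r)
        + (LINT r|lebesgue_on {0..T}. (Bf (v r) (w r) k \<bullet> z) * \<psi> r) - (LINT r|lebesgue_on {0..T}. (f k \<bullet> z) * \<psi> r)) = 0"
      unfolding a b c d by (simp add: algebra_simps)
    then have e1: "(LINT r|lebesgue_on {0..T}. (w r k \<bullet> z) * deriv \<psi> r)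
       = \<nu> * (LINT r|lebesgue_on {0..T}. (lam k)\<^sup>2 * (w r k \<bullet> z) * \<psi> r)
        + (LINT r|lebesgue_on {0..T}. (Bf (v r) (w r) k \<bullet> z) * \<psi> r) - (LINT r|lebesgue_on {0..T}. (f k \<bullet> z) * \<psi> r)"
      using L_pos by simp
    have "(LINT r|lebesgue_on {0..T}. (rhs \<nu> f (v r) (w r) k \<bullet> z) * \<psi> r)
       = (LINT r|lebesgue_on {0..T}. (f k \<bullet> z) * \<psi> r - \<nu> * ((lam k)\<^sup>2 * (w r k \<bullet> z) * \<psi> r) - (Bf (v r) (w r) k \<bullet> z) * \<psi> r)"
      by (simp add: rhs_def inner_diff_left left_diff_distrib mult.assoc)
    also have "\<dots> = (LINT r|lebesgue_on {0..T}. (f k \<bullet> z) * \<psi> r) - \<nu> * (LINT r|lebesgue_on {0..T}. (lam k)\<^sup>2 * (w r k \<bullet> z) * \<psi> r)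
         - (LINT r|lebesgue_on {0..T}. (Bf (v r) (w r) k \<bullet> z) * \<psi> r)"
    proof -
      have i2: "integrable (lebesgue_on {0..T}) (\<lambda>r. \<nu> * ((lam k)\<^sup>2 * (w r k \<bullet> z) * \<psi> r))"
        using integrable_mult_right[OF iw(2), of "\<nu> * (lam k)\<^sup>2"] by (simp add: mult.assoc)
      show ?thesis
        by (simp only: Bochner_Integration.integral_diff[OF Bochner_Integration.integrable_diff[OF if' i2] iB]
            Bochner_Integration.integral_diff[OF if' i2] integral_mult_right_zero)
    qed
    finally show "(LINT r|lebesgue_on {0..T}. (w r k \<bullet> z) * deriv \<psi> r) = - (LINT r|lebesgue_on {0..T}. (rhs \<nu> f (v r) (w r) k \<bullet> z) * \<psi> r)"
      using e1 by simp
  qed (use \<nu> \<alpha> T f w wV1 wi v0 vm vV vi in auto)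
  then show ?thesis
    using rep w0 by (rule that) (auto simp: v_def)
qed

end

section \<open>Weakly convergent sequences and compactness criteria\<close>

text \<open>By monotone convergence the supremum has a finite integral and so is finite almost
  everywhere. Applied to truncated squared norms, it places the limit in V^1 at almost every
  time.\<close>

lemma AE_bounded_of_integrals:
  fixes S :: "nat \<Rightarrow> 'a \<Rightarrow> real"
  assumes int: "\<And>n. integrable M (S n)" and nonneg: "\<And>n x. 0 \<le> S n x" and mono: "\<And>m n x. m \<le> n \<Longrightarrow> S m x \<le> S n x"
    and C: "\<And>n. integral\<^sup>L M (S n) \<le> C"
  shows "AE x in M. \<exists>B. \<forall>n. S n x \<le> B"
proof -
  have m: "(\<lambda>x. ennreal (S n x)) \<in> borel_measurable M" for n
    using borel_measurable_integrable[OF int] by measurable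
  have "(\<integral>\<^sup>+x. (SUP n. ennreal (S n x)) \<partial>M) = (SUP n. \<integral>\<^sup>+x. ennreal (S n x) \<partial>M)"
    by (rule nn_integral_monotone_convergence_SUP) (auto simp: incseq_def le_fun_def mono m intro!: ennreal_leI)
  also have "\<dots> \<le> ennreal C"
    by (rule SUP_least) (simp add: nn_integral_eq_integral[OF int] nonneg C ennreal_leI)
  finally have "(\<integral>\<^sup>+x. (SUP n. ennreal (S n x)) \<partial>M) \<noteq> \<infinity>" by (auto simp: top_unique)
  then have "AE x in M. (SUP n. ennreal (S n x)) \<noteq> \<infinity>"
    by (intro nn_integral_noteq_infinite borel_measurable_SUP m) auto
  then show ?thesis
  proof eventually_elim
    case (elim x)
    then obtain B where B: "B \<ge> 0" "(SUP n. ennreal (S n x)) = ennreal B"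
      by (metis ennreal_cases infinity_ennreal_def)
    have "ennreal (S n x) \<le> ennreal B" for n unfolding B(2)[symmetric] by (rule SUP_upper) simp
    then show ?case using B(1) by (auto simp: ennreal_le_iff)
  qed
qed

text \<open>Lets a limit be proved by an estimate with a free small parameter, where only linearity
  in c matters; the restriction c \<le> 1 absorbs higher powers.\<close>

lemma LIMSEQ_zero_of_bound:
  fixes X :: "nat \<Rightarrow> real"
  assumes "\<And>n. X n \<ge> 0" and K: "K \<ge> 0" and b: "\<And>c. 0 < c \<Longrightarrow> c \<le> 1 \<Longrightarrow> \<forall>\<^sub>F n in sequentially. X n \<le> K * c"
  shows "X \<longlonglongrightarrow> 0"
proof (rule tendstoI)
  fix e :: real assume e: "e > 0"
  define c where "c = min 1 (e / (2 * (K + 1)))"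
  have c: "0 < c" "c \<le> 1" using e K by (auto simp: c_def)
  have "K * c \<le> K * (e / (2 * (K + 1)))" using K by (intro mult_left_mono) (auto simp: c_def)
  also have "\<dots> \<le> e / 2" using K e by (simp add: field_simps)
  also have "\<dots> < e" using e by simp
  finally have "K * c < e" .
  note Kc = this
  show "\<forall>\<^sub>F n in sequentially. dist (X n) 0 < e"
    using b[OF c]
  proof eventually_elim
    case (elim n)
    then show ?case using assms(1)[of n] Kc by (simp add: dist_real_def)
  qed
qed

lemma lint_const: "T \<ge> 0 \<Longrightarrow> (LINT r|lebesgue_on {0..T :: real}. (c :: real)) = T * c"
  by (simp add: measure_restrict_space)

lemma uniform_imp_L1:
  fixes g :: "nat \<Rightarrow> real \<Rightarrow> 'a::euclidean_space"
  assumes T: "T \<ge> 0" and u: "uniform_limit {0..T} g h sequentially" and c: "\<And>n. continuous_on {0..T} (g n)" "continuous_on {0..T} h"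
  shows "(\<lambda>n. LINT r|lebesgue_on {0..T}. norm (g n r - h r)) \<longlonglongrightarrow> 0"
proof (rule LIMSEQ_zero_of_bound[OF _ T])
  fix e :: real assume e: "0 < e"
  show "\<forall>\<^sub>F n in sequentially. (LINT r|lebesgue_on {0..T}. norm (g n r - h r)) \<le> T * e"
    using uniform_limitD[OF u e]
  proof eventually_elim
    case (elim n)
    have "(LINT r|lebesgue_on {0..T}. norm (g n r - h r)) \<le> (LINT r|lebesgue_on {0..T}. e)"
      by (rule integral_mono)
         (use elim in \<open>auto simp: dist_norm intro!: cont_integrable continuous_intros c less_imp_le\<close>)
    also have "\<dots> = T * e" by (rule lint_const[OF T])
    finally show ?case .
  qed
qed simp

lemma L1_imp_lint_tendsto:
  fixes g :: "nat \<Rightarrow> real \<Rightarrow> 'a::euclidean_space"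
  assumes i: "\<And>n. integrable (lebesgue_on {0..T}) (g n)" "integrable (lebesgue_on {0..T}) h" and \<psi>: "continuous_on {0..T} \<psi>"
    and l: "(\<lambda>n. LINT r|lebesgue_on {0..T}. norm (g n r - h r)) \<longlonglongrightarrow> 0"
  shows "(\<lambda>n. LINT r|lebesgue_on {0..T}. (g n r \<bullet> z) * \<psi> r) \<longlonglongrightarrow> (LINT r|lebesgue_on {0..T}. (h r \<bullet> z) * \<psi> r)"
proof -
  have "bounded (\<psi> ` {0..T})" by (intro compact_imp_bounded compact_continuous_image \<psi>) simp
  then obtain C where C: "C > 0" "\<And>r. r \<in> {0..T} \<Longrightarrow> \<bar>\<psi> r\<bar> \<le> C" using bounded_pos[of "\<psi> ` {0..T}"] by auto
  have "norm ((LINT r|lebesgue_on {0..T}. (g n r \<bullet> z) * \<psi> r) - (LINT r|lebesgue_on {0..T}. (h r \<bullet> z) * \<psi> r))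
     \<le> (norm z * C) * (LINT r|lebesgue_on {0..T}. norm (g n r - h r))" for n
  proof -
    have ig: "integrable (lebesgue_on {0..T}) (\<lambda>r. (g n r \<bullet> z) * \<psi> r)" and ih: "integrable (lebesgue_on {0..T}) (\<lambda>r. (h r \<bullet> z) * \<psi> r)"
      by (intro integrable_times_cont integrable_inner_left i \<psi>)+
    have "(LINT r|lebesgue_on {0..T}. (g n r \<bullet> z) * \<psi> r) - (LINT r|lebesgue_on {0..T}. (h r \<bullet> z) * \<psi> r)
      = (LINT r|lebesgue_on {0..T}. (g n r \<bullet> z) * \<psi> r - (h r \<bullet> z) * \<psi> r)"
      by (rule Bochner_Integration.integral_diff[OF ig ih, symmetric])
    also have "norm \<dots> \<le> (LINT r|lebesgue_on {0..T}. norm ((g n r \<bullet> z) * \<psi> r - (h r \<bullet> z) * \<psi> r))" by (rule integral_norm_bound)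
    also have "\<dots> \<le> (LINT r|lebesgue_on {0..T}. (norm z * C) * norm (g n r - h r))"
    proof (rule integral_mono)
      fix r assume "r \<in> space (lebesgue_on {0..T})"
      then have r: "r \<in> {0..T}" by simp
      have "norm ((g n r \<bullet> z) * \<psi> r - (h r \<bullet> z) * \<psi> r) = \<bar>(g n r - h r) \<bullet> z\<bar> * \<bar>\<psi> r\<bar>"
        by (simp add: inner_diff_left left_diff_distrib flip: abs_mult)
      also have "\<dots> \<le> (norm (g n r - h r) * norm z) * C"
        by (intro mult_mono C(2) r Cauchy_Schwarz_ineq2) auto
      finally show "norm ((g n r \<bullet> z) * \<psi> r - (h r \<bullet> z) * \<psi> r) \<le> (norm z * C) * norm (g n r - h r)" by (simp add: mult_ac)
    qed (intro integrable_norm integrable_mult_right Bochner_Integration.integrable_diff ig ih i)+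
    finally show ?thesis by simp
  qed
  note b = this
  have "(\<lambda>n. (LINT r|lebesgue_on {0..T}. (g n r \<bullet> z) * \<psi> r) - (LINT r|lebesgue_on {0..T}. (h r \<bullet> z) * \<psi> r)) \<longlonglongrightarrow> 0"
  proof (rule Lim_null_comparison[OF always_eventually])
    show "\<forall>n. norm ((LINT r|lebesgue_on {0..T}. (g n r \<bullet> z) * \<psi> r) - (LINT r|lebesgue_on {0..T}. (h r \<bullet> z) * \<psi> r))
     \<le> (norm z * C) * (LINT r|lebesgue_on {0..T}. norm (g n r - h r))" using b by blast
    show "(\<lambda>n. (norm z * C) * (LINT r|lebesgue_on {0..T}. norm (g n r - h r))) \<longlonglongrightarrow> 0"
      using tendsto_mult_left[OF l, of "norm z * C"] by simp
  qed
  then show ?thesis by (rule LIM_zero_cancel)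
qed

text \<open>A bound on \<open>a\<close> by its square, to be integrated in place of the Cauchy-Schwarz inequality.\<close>

lemma le_square_scaled:
  fixes a c :: real assumes "c > 0" shows "a \<le> c * a\<^sup>2 + 1 / c"
proof -
  have "2 * a \<le> c * a\<^sup>2 + 1 / c"
  proof -
    have "0 \<le> (c * a - 1)\<^sup>2 / c" using assms by simp
    also have "\<dots> = c * a\<^sup>2 + 1 / c - 2 * a" using assms by (simp add: power2_eq_square field_simps)
    finally show ?thesis by simp
  qed
  moreover have "0 \<le> c * a\<^sup>2 + 1 / c" using assms by simp
  ultimately show ?thesis by (cases "a \<ge> 0") linarith+
qed

section \<open>Uniform boundedness, negative norms and measurable representatives\<close>

context torus
begin

lemma solenoidal_limit:
  assumes s: "\<And>n::nat. solenoidal L (x n)" and l: "\<And>k. (\<lambda>n. x n k) \<longlonglongrightarrow> y k"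
  shows "solenoidal L y"
proof (rule solenoidalI)
  show "y 0 = 0" using l[of 0] by (simp add: solenoidalD(1)[OF s] LIMSEQ_const_iff)
  show "y (- k) = cnjv (y k)" for k
  proof (rule LIMSEQ_unique[OF l[of "- k"]])
    show "(\<lambda>n. x n (- k)) \<longlonglongrightarrow> cnjv (y k)"
      unfolding solenoidalD(2)[OF s] by (rule bounded_linear.tendsto[OF bounded_linear_cnjv l])
  qed
  show "cdot (freq L k) (y k) = 0" for k
    using bounded_linear.tendsto[OF linear_conv_bounded_linear[THEN iffD1, OF linear_cdot] l[of k], of "freq L k"]
    by (simp add: solenoidalD(3)[OF s] LIMSEQ_const_iff)
qed

text \<open>Lower semicontinuity under convergence of coefficients: every finite truncation of the
  norm is continuous, and the bound survives the supremum over truncations.\<close>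

lemma nrm_le_limit:
  assumes l: "\<And>k. (\<lambda>n. x n k) \<longlonglongrightarrow> y k" and b: "\<And>n::nat. hs s (x n)" "\<And>n. nrm s (x n) \<le> b" 
  shows "hs s y" "nrm s y \<le> b"
proof -
  have b0: "b \<ge> 0" using b(2)[of 0] nrm_nonneg order_trans by blast
  have "(\<Sum>k\<in>modes N. (coef s y k)\<^sup>2) \<le> b\<^sup>2" for N
  proof (rule LIMSEQ_le_const2)
    show "(\<lambda>n. \<Sum>k\<in>modes N. (coef s (x n) k)\<^sup>2) \<longlonglongrightarrow> (\<Sum>k\<in>modes N. (coef s y k)\<^sup>2)"
      unfolding coef_def by (intro tendsto_intros l)
    have "(\<Sum>k\<in>modes N. (coef s (x n) k)\<^sup>2) \<le> b\<^sup>2" for n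
      using sum_modes_le[OF b(1), of n N] power_mono[OF b(2) nrm_nonneg, of n 2] by linarith
    then show "\<exists>M. \<forall>n\<ge>M. (\<Sum>k\<in>modes N. (coef s (x n) k)\<^sup>2) \<le> b\<^sup>2" by blast
  qed
  then show "hs s y" "nrm s y \<le> b" using hs_modesI b0 by blast+
qed

text \<open>Completeness for geometrically convergent sequences. The rate is the tail of the
  geometric series; at index j + 1 it is half of the increment allowed at step j, which is the
  margin the boundedness argument needs.\<close>

lemma V0_complete:
  assumes x: "\<And>j. x j \<in> V L 0" and d: "\<And>j. nrm 0 (x (Suc j) - x j) \<le> (1/3) ^ j"
  obtains y where "y \<in> V L 0" "\<And>j. nrm 0 (y - x j) \<le> 3/2 * (1/3) ^ j"
proof -
  have D: "nrm 0 (x (i + j) - x j) \<le> 3/2 * ((1/3) ^ j - (1/3) ^ (i + j))" for i j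
  proof (induction i)
    case 0 show ?case unfolding add_0 nrm_self by simp
  next
    case (Suc i)
    have "x (Suc i + j) - x j = (\<lambda>k. (x (Suc (i + j)) - x (i + j)) k + (x (i + j) - x j) k)" by (auto simp: fun_eq_iff)
    then have "nrm 0 (x (Suc i + j) - x j) \<le> nrm 0 (x (Suc (i + j)) - x (i + j)) + nrm 0 (x (i + j) - x j)"
      using hs_add(2)[of 0 "x (Suc (i + j)) - x (i + j)" "x (i + j) - x j"] x by (simp add: V_iff hs_diff)
    also have "\<dots> \<le> (1/3) ^ (i + j) + 3/2 * ((1/3) ^ j - (1/3) ^ (i + j))" by (intro add_mono d Suc)
    also have "\<dots> = 3/2 * ((1/3) ^ j - (1/3) ^ (Suc i + j))" by (simp add: diff_divide_distrib)
    finally show ?case .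
  qed
  have D': "nrm 0 (x (i + j) - x j) \<le> 3/2 * (1/3) ^ j" for i j
  proof -
    have *: "n \<le> 3/2 * (A - B) \<Longrightarrow> 0 \<le> B \<Longrightarrow> n \<le> 3/2 * A" for n A B :: real by simp
    show ?thesis by (rule *[OF D[of i j]]) simp
  qed
  have "convergent (\<lambda>j. x j k)" for k
  proof (rule Cauchy_convergent, rule metric_CauchyI)
    fix e :: real assume e: "e > 0"
    obtain J where "(1/3 :: real) ^ J < e / 3"
      using real_arch_pow_inv[of "e / 3" "1/3"] e by auto
    then have J: "3 * (1/3 :: real) ^ J < e" by simp
    have b: "norm (x (J + i) k - x J k) \<le> 3/2 * (1/3) ^ J" for i
      using norm_le_nrm0[of "x (i + J) - x J" k] D'[of i J] x[of "i + J"] x[of J]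
        solenoidalD(1)[of L "x (i + J)"] solenoidalD(1)[of L "x J"]
      by (simp add: V_iff hs_diff add.commute)
    have "dist (x m k) (x n k) < e" if "m \<ge> J" "n \<ge> J" for m n
    proof -
      have "dist (x m k) (x n k) \<le> norm (x m k - x J k) + norm (x n k - x J k)"
        by (metis dist_norm dist_triangle2)
      then show ?thesis using b[of "m - J"] b[of "n - J"] J that by simp
    qed
    then show "\<exists>M. \<forall>m\<ge>M. \<forall>n\<ge>M. dist (x m k) (x n k) < e" by blast
  qed
  then obtain y where y: "\<And>k. (\<lambda>j. x j k) \<longlonglongrightarrow> y k" unfolding convergent_def by metis
  have sol: "solenoidal L y" by (rule solenoidal_limit[OF _ y]) (use x in \<open>auto simp: V_iff\<close>)
  have lim: "hs 0 (y - x j) \<and> nrm 0 (y - x j) \<le> 3/2 * (1/3) ^ j" for j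
  proof -
    have "(\<lambda>i. (x (i + j) - x j) k) \<longlonglongrightarrow> (y - x j) k" for k
      using LIMSEQ_ignore_initial_segment[OF y, of j k] by (auto intro!: tendsto_intros)
    from nrm_le_limit[where y="y - x j", OF this _ D'] show ?thesis using x by (auto simp: V_iff hs_diff)
  qed
  have "hs 0 y" using nrm_triangle(1)[of 0 y "x 0"] lim x by (auto simp: V_iff)
  then show ?thesis using that[of y] sol lim by (auto simp: V_iff)
qed

lemma V_axpy: "x \<in> V L s \<Longrightarrow> a \<in> V L s \<Longrightarrow> (\<lambda>k. x k + c *\<^sub>R a k) \<in> V L s"
  using hs_add(1)[OF _ hs_scaleR(1)] solenoidal_add[OF _ solenoidal_scaleR] by (auto simp: V_iff)

lemma pairing_axpy:
  assumes "b \<in> V L 0" "x \<in> V L 0" "a \<in> V L 0"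
  shows "pairing L b (\<lambda>k. x k + c *\<^sub>R a k) = pairing L b x + c * pairing L b a"
proof -
  have "(\<Sum>\<^sub>\<infinity>k\<in>- {0}. b k \<bullet> (x k + c *\<^sub>R a k)) = (\<Sum>\<^sub>\<infinity>k\<in>- {0}. b k \<bullet> x k + c * (b k \<bullet> a k))"
    by (simp add: inner_add_right)
  also have "\<dots> = (\<Sum>\<^sub>\<infinity>k\<in>- {0}. b k \<bullet> x k) + c * (\<Sum>\<^sub>\<infinity>k\<in>- {0}. b k \<bullet> a k)"
    using pairing_sum(3)[of 0 b x] pairing_sum(3)[of 0 b a] assms
    by (subst infsum_add) (auto simp: V_iff infsum_cmult_right' intro: summable_on_cmult_right)
  finally show ?thesis by (simp add: pairing_def distrib_left)
qed

lemma pairing_self: "pairing L a a = L ^ 3 * (nrm 0 a)\<^sup>2"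
proof -
  have "a k \<bullet> a k = (coef 0 a k)\<^sup>2" if "k \<in> - {0}" for k using that by (simp add: coef_0 power2_norm_eq_inner)
  then have "(\<Sum>\<^sub>\<infinity>k\<in>- {0}. a k \<bullet> a k) = (\<Sum>\<^sub>\<infinity>k\<in>- {0}. (coef 0 a k)\<^sup>2)" by (rule infsum_cong)
  then show ?thesis unfolding pairing_def nrm_def l2n_sq by simp
qed

text \<open>The uniform boundedness principle, by Sokal's argument: an unbounded sequence of functionals allows one to
  choose increments of size \<open>3\<^sup>-\<^sup>j\<close> whose sum is a point where the functionals are unbounded.\<close>

lemma weakly_converges_bounded:
  assumes W: "weakly_converges_V0 L U u"
  obtains C where "C > 0" "\<And>n. nrm 0 (U n) \<le> C"
proof -
  have UV: "U n \<in> V L 0" for n using W by (simp add: weakly_converges_V0_def)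
  have conv: "(\<lambda>n. pairing L (U n) y) \<longlonglongrightarrow> pairing L u y" if "y \<in> V L 0" for y
    using W that by (simp add: weakly_converges_V0_def)
  have "\<exists>C. \<forall>n. nrm 0 (U n) \<le> C"
  proof (rule ccontr)
    assume "\<nexists>C. \<forall>n. nrm 0 (U n) \<le> C"
    \<comment> \<open>Growth by powers of 4 beats the shrinking of the increments by powers of
      1/3.\<close>
    then have "\<forall>j. \<exists>n. nrm 0 (U n) > 4 ^ j" by (meson not_le)
    then obtain n where n: "\<And>j. nrm 0 (U (n j)) > 4 ^ j" by metis
    define a where "a j = U (n j)" for j
    have aV: "a j \<in> V L 0" and a4: "nrm 0 (a j) > 4 ^ j" and apos: "nrm 0 (a j) > 0" for j
      using UV n[of j] by (auto simp: a_def intro: less_trans[of 0 "4 ^ j"])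
    define step where "step j x \<epsilon> = (\<lambda>k. x k + (\<epsilon> * (1/3) ^ j / nrm 0 (a j)) *\<^sub>R a j k)" for j \<epsilon> and x :: coeffs
    define good where "good j x y \<longleftrightarrow> (\<exists>\<epsilon>\<in>{1, -1}. y = step j x \<epsilon>) \<and> \<bar>pairing L (a j) y\<bar> \<ge> L ^ 3 * (1/3) ^ j * nrm 0 (a j)" for j x y
    have ex: "\<exists>y. y \<in> V L 0 \<and> good j x y" if x: "x \<in> V L 0" for j x
    proof -
      define p where "p = pairing L (a j) x"
      define q where "q = L ^ 3 * (1/3) ^ j * nrm 0 (a j)"
      have pq: "pairing L (a j) (step j x \<epsilon>) = p + \<epsilon> * q" for \<epsilon>
        unfolding step_def p_def q_def pairing_axpy[OF aV x aV] using pairing_self[of "a j"] apos[of j]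
        by (simp add: power2_eq_square)
      have q: "q \<ge> 0" using L_pos by (simp add: q_def)
      \<comment> \<open>Of two numbers at distance 2q one has absolute value at least q, so a
        suitable sign makes the new pairing large whatever the old value p was.\<close>
      have "\<bar>p + 1 * q\<bar> \<ge> q \<or> \<bar>p + (-1) * q\<bar> \<ge> q" using q by linarith
      then obtain \<epsilon> where \<epsilon>: "\<epsilon> \<in> {1, -1}" "\<bar>p + \<epsilon> * q\<bar> \<ge> q" by blast
      have "good j x (step j x \<epsilon>)" unfolding good_def pq using \<epsilon> by (auto simp: q_def)
      moreover have "step j x \<epsilon> \<in> V L 0" unfolding step_def by (rule V_axpy[OF x aV])
      ultimately show ?thesis by blast
    qed
    have zV: "(\<lambda>_. 0) \<in> V L 0" by (rule trig_V) (simp add: trig_poly_def solenoidal_0)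
    obtain x where xV: "\<And>j. x j \<in> V L 0" and xg: "\<And>j. good j (x j) (x (Suc j))"
      using dependent_nat_choice[of "\<lambda>_ x. x \<in> V L 0" good] zV ex by metis
    have d: "nrm 0 (x (Suc j) - x j) \<le> (1/3) ^ j" for j
    proof -
      obtain \<epsilon> where \<epsilon>: "\<epsilon> \<in> {1, -1}" "x (Suc j) = step j (x j) \<epsilon>" using xg[of j] by (auto simp: good_def)
      then have "x (Suc j) - x j = (\<lambda>k. (\<epsilon> * (1/3) ^ j / nrm 0 (a j)) *\<^sub>R a j k)" by (auto simp: step_def fun_eq_iff)
      then have "nrm 0 (x (Suc j) - x j) = \<bar>\<epsilon> * (1/3) ^ j / nrm 0 (a j)\<bar> * nrm 0 (a j)"
        using hs_scaleR(2)[of 0 "a j"] aV[of j] by (simp add: V_iff)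
      also have "\<dots> = (1/3) ^ j" using \<epsilon>(1) apos[of j] by (auto simp: abs_mult)
      finally show ?thesis by simp
    qed
    obtain y where y: "y \<in> V L 0" "\<And>j. nrm 0 (y - x j) \<le> 3/2 * (1/3) ^ j"
      using V0_complete[OF xV d] by blast
    \<comment> \<open>All later increments together change the pairing by at most half of what step
      j secured, so half of it survives at y.\<close>
    have big: "\<bar>pairing L (a j) y\<bar> \<ge> L ^ 3 / 2 * (4/3) ^ j" for j
    proof -
      have "pairing L (a j) (y - x (Suc j)) = pairing L (a j) y - pairing L (a j) (x (Suc j))"
        by (rule pairing_diff_right[where s=0]) (use aV y xV in \<open>auto simp: V_iff\<close>)
      moreover have "\<bar>pairing L (a j) (y - x (Suc j))\<bar> \<le> L ^ 3 * (nrm 0 (a j) * nrm 0 (y - x (Suc j)))"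
        using pairing_le[of 0 "a j" "y - x (Suc j)"] aV y xV by (simp add: V_iff hs_diff)
      moreover have "L ^ 3 * (nrm 0 (a j) * nrm 0 (y - x (Suc j))) \<le> L ^ 3 * (nrm 0 (a j) * (3/2 * (1/3) ^ Suc j))"
        using y(2)[of "Suc j"] L_pos by (intro mult_left_mono) auto
      moreover have "\<bar>pairing L (a j) (x (Suc j))\<bar> \<ge> L ^ 3 * (1/3) ^ j * nrm 0 (a j)" using xg[of j] by (simp add: good_def)
      ultimately have "\<bar>pairing L (a j) y\<bar> \<ge> L ^ 3 / 2 * ((1/3) ^ j * nrm 0 (a j))" by (simp add: algebra_simps)
      moreover have "(4/3) ^ j \<le> (1/3) ^ j * nrm 0 (a j)"
        using mult_left_mono[OF less_imp_le[OF a4[of j]], of "(1/3) ^ j"] by (simp flip: power_mult_distrib)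
      then have "L ^ 3 / 2 * (4/3) ^ j \<le> L ^ 3 / 2 * ((1/3) ^ j * nrm 0 (a j))" using L_pos by (intro mult_left_mono) auto
      ultimately show ?thesis by linarith
    qed
    obtain C where C: "\<And>n. \<bar>pairing L (U n) y\<bar> \<le> C"
      using convergent_imp_Bseq[OF convergentI[OF conv[OF y(1)]]] unfolding Bseq_def by auto
    obtain j where "C * 2 / L ^ 3 < (4/3 :: real) ^ j" using real_arch_pow[of "4/3" "C * 2 / L ^ 3"] by auto
    then have "C < L ^ 3 / 2 * (4/3) ^ j" using L_pos by (simp add: field_simps)
    then show False using big[of j] C[of "n j"] by (simp add: a_def)
  qed
  then obtain C where C: "\<And>n. nrm 0 (U n) \<le> C" by blast
  have "nrm 0 (U n) \<le> \<bar>C\<bar> + 1" for n using C[of n] by linarith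
  then show ?thesis using that[of "\<bar>C\<bar> + 1"] by simp
qed

text \<open>High modes are small in the negative norm uniformly on V^0-bounded sets, by the gap;
  finitely many low modes remain. This is how uniform convergence of each mode becomes convergence
  in V^-s.\<close>

lemma nrm_neg_small:
  assumes s: "s > 0" and e: "e > 0" and B: "B > 0"
  shows "\<exists>N d. d > 0 \<and> (\<forall>x. hs 0 x \<longrightarrow> nrm 0 x \<le> B \<longrightarrow> (\<forall>k\<in>modes N. norm (x k) < d) \<longrightarrow> nrm (- s) x < e)"
proof -
  have "filterlim (\<lambda>N. lam0 * real (Suc N)) at_top sequentially"
    by (rule filterlim_tendsto_pos_mult_at_top[OF tendsto_const lam0_pos])
       (rule filterlim_compose[OF filterlim_real_sequentially filterlim_Suc])
  then have "((\<lambda>N. (lam0 * real (Suc N)) powr (- s)) \<longlongrightarrow> 0) sequentially"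
    by (rule tendsto_neg_powr[rotated]) (use s in simp)
  then have "((\<lambda>N. (lam0 * real (Suc N)) powr (- s) * B) \<longlongrightarrow> 0) sequentially"
    by (rule tendsto_mult_left_zero)
  then have "\<forall>\<^sub>F N in sequentially. (lam0 * real (Suc N)) powr (- s) * B < e / 2"
    by (rule order_tendstoD(2)) (use e in simp)
  then obtain N where N: "(lam0 * real (Suc N)) powr (- s) * B < e / 2"
    by (auto simp: eventually_sequentially)
  define S where "S = (\<Sum>k\<in>modes N. lam k powr (- s)) + 1"
  have S: "S > 0" by (simp add: S_def sum_nonneg add_nonneg_pos)
  define d where "d = e / 2 / S"
  have d: "d > 0" using S e by (simp add: d_def)
  show ?thesis
  proof (intro exI[of _ N] exI[of _ d] conjI d allI impI)
    fix x assume x: "hs 0 x" "nrm 0 x \<le> B" "\<forall>k\<in>modes N. norm (x k) < d"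
    have hs: "hs (- s) x" using hs_mono(1)[OF x(1)] s by simp
    have "nrm (- s) (proj N x) \<le> (\<Sum>k\<in>modes N. coef (- s) x k)"
      unfolding nrm_proj by (rule L2_set_le_sum) simp
    also have "\<dots> \<le> (\<Sum>k\<in>modes N. lam k powr (- s) * d)"
      unfolding coef_def by (intro sum_mono mult_left_mono) (use x(3) in \<open>auto intro: less_imp_le\<close>)
    also have "\<dots> < S * d" using d by (simp add: S_def sum_distrib_right distrib_right)
    also have "\<dots> = e / 2" using S by (simp add: d_def)
    finally have 1: "nrm (- s) (proj N x) < e / 2" .
    have "nrm (- s) (x - proj N x) \<le> (lam0 * real (Suc N)) powr (- s - 0) * nrm 0 x"
      by (rule nrm_tail_gap[OF x(1)]) (use s in simp)
    also have "\<dots> \<le> (lam0 * real (Suc N)) powr (- s) * B" using x(2) by (simp add: mult_left_mono)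
    finally show "nrm (- s) x < e" using nrm_split[OF hs, of N] 1 N by linarith
  qed
qed

lemma C_time_neg:
  assumes s: "s > 0" and c: "\<And>k. continuous_on {a..b} (\<lambda>t. w t k)" and w: "\<And>t. t \<in> {a..b} \<Longrightarrow> w t \<in> V L 0"
    and B: "B > 0" "\<And>t. t \<in> {a..b} \<Longrightarrow> nrm 0 (w t) \<le> B"
  shows "w \<in> C_time L a b (- s)"
  unfolding C_time_def
proof (intro CollectI ballI conjI)
  fix t assume t: "t \<in> {a..b}"
  show "w t \<in> V L (- s)" using V_mono[OF w[OF t]] s by simp
  have "((\<lambda>r. nrm (- s) (w r - w t)) \<longlongrightarrow> 0) (at t within {a..b})"
  proof (rule tendstoI)
    fix e :: real assume e: "e > 0"
    obtain N d where d: "d > 0" "\<And>x. hs 0 x \<Longrightarrow> nrm 0 x \<le> 2 * B \<Longrightarrow> \<forall>k\<in>modes N. norm (x k) < d \<Longrightarrow> nrm (- s) x < e"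
      using nrm_neg_small[OF s e, of "2 * B"] B(1) by auto
    have "\<forall>\<^sub>F r in at t within {a..b}. \<forall>k\<in>modes N. dist (w r k) (w t k) < d"
      by (intro eventually_ball_finite finite_modes ballI tendstoD[OF _ d(1)]) (use c t in \<open>auto simp: continuous_on_def\<close>)
    moreover have "\<forall>\<^sub>F r in at t within {a..b}. r \<in> {a..b}" by (simp add: eventually_at_filter)
    ultimately show "\<forall>\<^sub>F r in at t within {a..b}. dist (nrm (- s) (w r - w t)) 0 < e"
    proof eventually_elim
      case (elim r)
      have "nrm (- s) (w r - w t) < e"
      proof (rule d(2))
        show "hs 0 (w r - w t)" using w[OF t] w[OF elim(2)] by (simp add: V_iff hs_diff)
        show "nrm 0 (w r - w t) \<le> 2 * B"
          using hs_diff(2)[of 0 "w r" "w t"] w[OF t] w[OF elim(2)] B(2)[OF t] B(2)[OF elim(2)] by (simp add: V_iff)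
      qed (use elim in \<open>auto simp: dist_norm\<close>)
      then show ?case by simp
    qed
  qed
  from tendsto_mult_left[OF this, of "sqrt (L ^ 3)"]
  show "((\<lambda>r. Vnorm L (- s) (w r - w t)) \<longlongrightarrow> 0) (at t within {a..b})" by (simp add: Vnorm_eq)
qed

text \<open>Explicit simple approximations for a function that is continuous in each mode but only
  almost everywhere in V^s: sample it on a time grid, where values in V^0 are available, and
  truncate, which brings them into V^s. The grid is refined together with the cutoff.\<close>

lemma strongly_measurable_cont:
  fixes T :: real and w :: "real \<Rightarrow> coeffs"
  assumes T: "T > 0" and c: "\<And>k. continuous_on {0..T} (\<lambda>t. w t k)" and w: "\<And>t. t \<in> {0..T} \<Longrightarrow> w t \<in> V L 0"
    and V: "AE t in lebesgue_on {0..T}. w t \<in> V L s"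
  obtains g where "\<And>n::nat. simple_function (lebesgue_on {0..T}) (g n)" "\<And>n t. t \<in> {0..T} \<Longrightarrow> g n t \<in> V L s"
    "AE t in lebesgue_on {0..T}. (\<lambda>n. nrm s (g n t - w t)) \<longlonglongrightarrow> 0"
proof -
  \<comment> \<open>Rounds t down to a grid of m + 1 equal intervals.\<close>
  define \<tau> where "\<tau> m t = T * (real_of_int \<lfloor>t / T * real (Suc m)\<rfloor> / real (Suc m))" for m t
  have \<tau>: "\<tau> m t \<in> {0..T}" "\<bar>\<tau> m t - t\<bar> \<le> T / real (Suc m)" if t: "t \<in> {0..T}" for m t
  proof -
    define q where "q = t / T * real (Suc m)"
    have q: "0 \<le> q" "q \<le> real (Suc m)"
      using t T mult_right_mono[of "t / T" 1 "real (Suc m)"] by (auto simp: q_def)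
    have tq: "t = T * (q / real (Suc m))" using T by (simp add: q_def)
    have \<tau>q: "\<tau> m t = T * (real_of_int \<lfloor>q\<rfloor> / real (Suc m))" by (simp add: \<tau>_def q_def)
    have f: "0 \<le> real_of_int \<lfloor>q\<rfloor>" "real_of_int \<lfloor>q\<rfloor> \<le> q" "q - real_of_int \<lfloor>q\<rfloor> \<le> 1" using q by (auto intro: less_imp_le) linarith
    have "real_of_int \<lfloor>q\<rfloor> \<le> real (Suc m)" using f q by linarith
    then have "real_of_int \<lfloor>q\<rfloor> / real (Suc m) \<le> 1" by simp
    then show "\<tau> m t \<in> {0..T}" using f T mult_left_mono[of "real_of_int \<lfloor>q\<rfloor> / real (Suc m)" 1 T] by (simp add: \<tau>q)
    have a: "t - \<tau> m t = T * (q / real (Suc m)) - T * (real_of_int \<lfloor>q\<rfloor> / real (Suc m))" unfolding \<tau>q using tq by linarith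
    have "t - \<tau> m t = T / real (Suc m) * (q - real_of_int \<lfloor>q\<rfloor>)"
      unfolding a by (simp add: right_diff_distrib diff_divide_distrib)
    moreover have "T / real (Suc m) * (q - real_of_int \<lfloor>q\<rfloor>) \<le> T / real (Suc m) * 1" using f T by (intro mult_left_mono) auto
    moreover have "0 \<le> T / real (Suc m) * (q - real_of_int \<lfloor>q\<rfloor>)" using f T by simp
    ultimately show "\<bar>\<tau> m t - t\<bar> \<le> T / real (Suc m)" by linarith
  qed
  \<comment> \<open>For each cutoff the grid is taken so fine that even with the weights of V^s the
    sampling error of these modes is below 1 / (N + 1).\<close>
  have ex: "\<exists>m. \<forall>t\<in>{0..T}. (\<Sum>k\<in>modes N. lam k powr s * norm (w (\<tau> m t) k - w t k)) \<le> 1 / real (Suc N)" for N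
  proof -
    define S where "S = (\<Sum>k\<in>modes N. lam k powr s) + 1"
    have S: "S > 0" by (simp add: S_def sum_nonneg add_nonneg_pos)
    define e where "e = 1 / real (Suc N) / S"
    have e: "e > 0" using S by (simp add: e_def)
    have "\<forall>\<^sub>F m in sequentially. \<forall>k\<in>modes N. \<forall>t\<in>{0..T}. norm (w (\<tau> m t) k - w t k) \<le> e"
    proof (rule eventually_ball_finite[OF finite_modes], rule ballI)
      fix k
      obtain d where d: "d > 0" "\<And>x y. x \<in> {0..T} \<Longrightarrow> y \<in> {0..T} \<Longrightarrow> dist x y < d \<Longrightarrow> dist (w x k) (w y k) < e"
        using compact_uniformly_continuous[OF c[of k]] e unfolding uniformly_continuous_on_def by (metis compact_Icc)
      have "(\<lambda>m. T / real (Suc m)) \<longlonglongrightarrow> 0" using LIMSEQ_Suc[OF lim_const_over_n[of T]] by simp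
      from order_tendstoD(2)[OF this d(1)]
      show "\<forall>\<^sub>F m in sequentially. \<forall>t\<in>{0..T}. norm (w (\<tau> m t) k - w t k) \<le> e"
      proof eventually_elim
        case (elim m)
        show ?case
        proof
          fix t assume t: "t \<in> {0..T}"
          have "dist (w (\<tau> m t) k) (w t k) < e"
            by (rule d(2)) (use \<tau>[OF t, of m] t elim in \<open>auto simp: dist_real_def\<close>)
          then show "norm (w (\<tau> m t) k - w t k) \<le> e" by (simp add: dist_norm)
        qed
      qed
    qed
    then obtain m where m: "\<And>k t. k \<in> modes N \<Longrightarrow> t \<in> {0..T} \<Longrightarrow> norm (w (\<tau> m t) k - w t k) \<le> e"
      unfolding eventually_sequentially by blast
    have "(\<Sum>k\<in>modes N. lam k powr s * norm (w (\<tau> m t) k - w t k)) \<le> 1 / real (Suc N)" if t: "t \<in> {0..T}" for t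
    proof -
      have "(\<Sum>k\<in>modes N. lam k powr s * norm (w (\<tau> m t) k - w t k)) \<le> (\<Sum>k\<in>modes N. lam k powr s * e)"
        by (intro sum_mono mult_left_mono m t) auto
      also have "\<dots> \<le> S * e" using e by (simp add: S_def sum_distrib_right distrib_right)
      also have "\<dots> = 1 / real (Suc N)" using S by (simp add: e_def)
      finally show ?thesis .
    qed
    then show ?thesis by blast
  qed
  have "\<exists>m. \<forall>N. \<forall>t\<in>{0..T}. (\<Sum>k\<in>modes N. lam k powr s * norm (w (\<tau> (m N) t) k - w t k)) \<le> 1 / real (Suc N)"
    by (rule choice, rule allI, rule ex)
  then obtain m where m0: "\<forall>N. \<forall>t\<in>{0..T}. (\<Sum>k\<in>modes N. lam k powr s * norm (w (\<tau> (m N) t) k - w t k)) \<le> 1 / real (Suc N)" ..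
  have m: "(\<Sum>k\<in>modes N. lam k powr s * norm (w (\<tau> (m N) t) k - w t k)) \<le> 1 / real (Suc N)" if "t \<in> {0..T}" for N t
    using m0 that by blast
  define g where "g N t = proj N (w (\<tau> (m N) t))" for N t
  show ?thesis
  proof (rule that[of g])
    fix N
    show "g N t \<in> V L s" if "t \<in> {0..T}" for t
      unfolding g_def by (rule proj_V[OF w[OF \<tau>(1)[OF that]]])
    \<comment> \<open>\<open>g N\<close> depends on time only through the grid index, which is
      measurable with finitely many values; composition with any map keeps it simple.\<close>
    define j where "j t = real_of_int \<lfloor>t / T * real (Suc (m N))\<rfloor>" for t
    have "simple_function (lebesgue_on {0..T}) j"
    proof (rule simple_function_borel_measurable)
      have "j \<in> borel_measurable borel" unfolding j_def[abs_def] by measurable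
      then have "j \<in> borel_measurable lebesgue" by (simp add: measurable_completion)
      then show "j \<in> borel_measurable (lebesgue_on {0..T})" by (rule measurable_restrict_space1)
      have "j ` space (lebesgue_on {0..T}) \<subseteq> real_of_int ` {0..int (Suc (m N))}"
      proof
        fix y assume "y \<in> j ` space (lebesgue_on {0..T})"
        then obtain t where t: "t \<in> {0..T}" "y = j t" by auto
        have "0 \<le> t / T * real (Suc (m N))" "t / T * real (Suc (m N)) \<le> real (Suc (m N))" using t T mult_right_mono[of "t / T" 1 "real (Suc (m N))"] by auto
        then have "0 \<le> \<lfloor>t / T * real (Suc (m N))\<rfloor>" "\<lfloor>t / T * real (Suc (m N))\<rfloor> \<le> int (Suc (m N))" by linarith+
        then show "y \<in> real_of_int ` {0..int (Suc (m N))}" unfolding t(2) j_def by (intro imageI) (auto simp del: of_nat_Suc)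
      qed
      then show "finite (j ` space (lebesgue_on {0..T}))" by (rule finite_subset) simp
    qed
    from simple_function_compose1[OF this, of "\<lambda>y. proj N (w (T * (y / real (Suc (m N)))))"]
    show "simple_function (lebesgue_on {0..T}) (g N)" by (simp add: g_def[abs_def] \<tau>_def j_def)
  next
    show "AE t in lebesgue_on {0..T}. (\<lambda>N. nrm s (g N t - w t)) \<longlonglongrightarrow> 0"
      using V AE_space
    proof eventually_elim
      case (elim t)
      have t: "t \<in> {0..T}" using elim(2) by simp
      have b: "nrm s (g N t - w t) \<le> 1 / real (Suc N) + nrm s (w t - proj N (w t))" for N
      proof -
        define x where "x = w (\<tau> (m N) t) - w t"
        have eq: "g N t - w t = (\<lambda>k. proj N x k + (proj N (w t) - w t) k)"
          by (auto simp: g_def x_def proj_def fun_eq_iff)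
        have h: "hs s (proj N (w t) - w t)" using elim(1) by (intro hs_diff(1) hs_proj) (simp add: V_iff)
        have "nrm s (g N t - w t) \<le> nrm s (proj N x) + nrm s (proj N (w t) - w t)"
          unfolding eq by (rule hs_add(2)[OF hs_proj h])
        also have "nrm s (proj N (w t) - w t) = nrm s (w t - proj N (w t))" by (rule nrm_minus)
        also have "nrm s (proj N x) \<le> (\<Sum>k\<in>modes N. coef s x k)"
          unfolding nrm_proj by (rule L2_set_le_sum) simp
        also have "\<dots> \<le> 1 / real (Suc N)" using m[OF t, of N] by (simp add: coef_def x_def)
        finally show ?thesis by (simp add: fun_diff_def)
      qed
      have "(\<lambda>N. 1 / real (Suc N) + nrm s (w t - proj N (w t))) \<longlonglongrightarrow> 0 + 0"
        by (intro tendsto_add nrm_tail) (use LIMSEQ_Suc[OF lim_const_over_n[of 1]] elim(1) in \<open>auto simp: V_iff\<close>)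
      then have lim: "(\<lambda>N. 1 / real (Suc N) + nrm s (w t - proj N (w t))) \<longlonglongrightarrow> 0" by simp
      show ?case
        by (rule tendsto_sandwich[OF always_eventually[OF allI] always_eventually[OF allI] tendsto_const lim]) (rule nrm_nonneg, rule b)
    qed
  qed
qed

lemma L2_timeI:
  fixes T :: real and w :: "real \<Rightarrow> coeffs"
  assumes T: "T > 0" and c: "\<And>k. continuous_on {0..T} (\<lambda>t. w t k)" and w: "\<And>t. t \<in> {0..T} \<Longrightarrow> w t \<in> V L 0"
    and V: "AE t in lebesgue_on {0..T}. w t \<in> V L s" and i: "integrable (lebesgue_on {0..T}) (\<lambda>t. (nrm s (w t))\<^sup>2)"
    and u: "AE t in lebesgue_on {0..T}. u t = w t"
  shows "u \<in> L2_time L 0 T s"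
proof -
  obtain g where g: "\<And>n::nat. simple_function (lebesgue_on {0..T}) (g n)" "\<And>n t. t \<in> {0..T} \<Longrightarrow> g n t \<in> V L s"
    and l: "AE t in lebesgue_on {0..T}. (\<lambda>n. nrm s (g n t - w t)) \<longlonglongrightarrow> 0"
    using strongly_measurable_cont[OF T c w V] by blast
  have "AE t in lebesgue_on {0..T}. u t \<in> V L s" using u V by eventually_elim simp
  moreover have "AE t in lebesgue_on {0..T}. (\<lambda>n. Vnorm L s (g n t - u t)) \<longlonglongrightarrow> 0"
    using l u
  proof eventually_elim
    case (elim t)
    show ?case using tendsto_mult_left[OF elim(1), of "sqrt (L ^ 3)"] elim(2) by (simp add: Vnorm_eq)
  qed
  moreover have "integrable (lebesgue_on {0..T}) (\<lambda>t. (Vnorm L s (u t))\<^sup>2)"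
  proof (rule integrable_cong_lebesgue_AE)
    show "integrable (lebesgue_on {0..T}) (\<lambda>t. L ^ 3 * (nrm s (w t))\<^sup>2)" using i by (rule integrable_mult_right)
    show "AE t in lebesgue_on {0..T}. L ^ 3 * (nrm s (w t))\<^sup>2 = (Vnorm L s (u t))\<^sup>2"
      using u by eventually_elim (simp add: Vnorm_sq)
  qed simp
  ultimately show ?thesis using g unfolding L2_time_def strongly_measurable_def by (auto intro!: exI[of _ g])
qed

end

section \<open>Extraction of a convergent subsequence\<close>

lemma integrable_indicator_mult:
  fixes g :: "real \<Rightarrow> real"
  assumes "integrable (lebesgue_on {0..T}) g"
  shows "integrable (lebesgue_on {0..T}) (\<lambda>r. indicator {0..<m} r * g r)"
  using integrable_real_mult_indicator[OF _ assms, of "{0..<m} \<inter> {0..T}"]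
  by (rule Bochner_Integration.integrable_cong[THEN iffD1, rotated -1]) (auto simp: sets_restrict_space_iff indicator_def)

lemma lint_indicator_le:
  assumes "m \<ge> 0"
  shows "(LINT r|lebesgue_on {0..T :: real}. indicator {0..<m} r) \<le> m"
proof -
  have "(LINT r|lebesgue_on {0..T}. indicator {0..<m} r) = measure (lebesgue_on {0..T}) ({0..<m} \<inter> {0..T})"
    by (simp add: Int_commute)
  also have "\<dots> = measure lebesgue ({0..<m} \<inter> {0..T})" by (rule measure_restrict_space) auto
  also have "\<dots> \<le> measure lebesgue {0..m}" by (rule measure_mono_fmeasurable) auto
  also have "\<dots> = m" using assms by simp
  finally show ?thesis .
qed

text \<open>R, E and K are the bounds uniform in n: for w in V^0 at all times, for w in L2(V^1), and
  for the history seen before time \<mu>. All assumptions are inherited by subsequences.\<close>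

locale delay_sequence = torus +
  fixes \<nu> \<alpha> T :: real and f :: coeffs and w v :: "nat \<Rightarrow> real \<Rightarrow> coeffs" and \<mu> :: "nat \<Rightarrow> real" and R E K :: real
  assumes sols: "\<And>n. delay_solution L \<nu> \<alpha> T f (w n) (v n)"
    and \<mu>_pos: "\<And>n. \<mu> n > 0" and \<mu>_lim: "\<mu> \<longlonglongrightarrow> 0"
    and shift: "\<And>n t. t \<in> {\<mu> n..T} \<Longrightarrow> v n t = w n (t - \<mu> n)"
    and R_pos: "R > 0" and w_R: "\<And>n t. t \<in> {0..T} \<Longrightarrow> nrm 0 (w n t) \<le> R"
    and E_nonneg: "E \<ge> 0" and w_E: "\<And>n. (LINT r|lebesgue_on {0..T}. (nrm 1 (w n r))\<^sup>2) \<le> E"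
    and K_nonneg: "K \<ge> 0" and v_K: "\<And>n. (LINT r|lebesgue_on {0..T}. indicator {0..<\<mu> n} r * (nrm 0 (v n r))\<^sup>2) \<le> K"
begin

sublocale S: delay_solution L \<nu> \<alpha> T f "w n" "v n" for n by (rule sols)

lemma T_pos: "T > 0" and nu_pos: "\<nu> > 0" and alpha_gt: "\<alpha> > 1/2" and f_V1: "f \<in> V L (- 1)"
  using S.T S.\<nu> S.\<alpha> S.f_V by auto

lemma hs_w: "t \<in> {0..T} \<Longrightarrow> hs 0 (w n t)" and sol_w: "t \<in> {0..T} \<Longrightarrow> solenoidal L (w n t)"
  and hs_v: "t \<in> {0..T} \<Longrightarrow> hs 0 (v n t)" and sol_v: "t \<in> {0..T} \<Longrightarrow> solenoidal L (v n t)"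
  using S.w_V0[of t n] S.v0[of t n] by (auto simp: V_iff)

lemma w_zero: "t \<in> {0..T} \<Longrightarrow> w n t 0 = 0" and v_zero: "t \<in> {0..T} \<Longrightarrow> v n t 0 = 0"
  using solenoidalD(1)[OF sol_w] solenoidalD(1)[OF sol_v] by auto

lemma w_cont: "continuous_on {0..T} (\<lambda>t. w n t k)" by (rule C_time_coef[OF S.w])

lemma norm_w_le: "t \<in> {0..T} \<Longrightarrow> norm (w n t k) \<le> R"
  using norm_le_nrm0[OF hs_w solenoidalD(1)[OF sol_w], of t n k] w_R[of t n] by simp

lemma J_integrable: "integrable (lebesgue_on {0..T}) (\<lambda>r. indicator {0..<\<mu> n} r * (nrm 0 (v n r))\<^sup>2)"
  by (intro integrable_indicator_mult S.integrable_lower) (use alpha_gt in simp)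

text \<open>From time \<mu> on, v is a value of w and bounded by R. Before that only its square has
  a bounded integral, so its norm is replaced by c times the square plus 1 / c.\<close>

lemma rhs_bound:
  assumes r: "r \<in> {0..T}" and c: "c > 0"
  shows "norm (rhs \<nu> f (v n r) (w n r) k)
    \<le> (norm (f k) + \<nu> * (lam k)\<^sup>2 * R + lam k * R * R) + lam k * R * (c * (indicator {0..<\<mu> n} r * (nrm 0 (v n r))\<^sup>2) + 1 / c)"
proof -
  have v: "nrm 0 (v n r) \<le> R + (c * (indicator {0..<\<mu> n} r * (nrm 0 (v n r))\<^sup>2) + 1 / c)"
  proof (cases "r < \<mu> n")
    case True
    then show ?thesis using le_square_scaled[OF c, of "nrm 0 (v n r)"] r R_pos by simp
  next
    case False
    then have "r - \<mu> n \<in> {0..T}" using r \<mu>_pos[of n] by auto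
    then have "nrm 0 (v n r) \<le> R" using shift[of r n] False r w_R by simp
    moreover have "0 < 1 / c" using c by simp
    ultimately have "nrm 0 (v n r) \<le> R + 1 / c" by linarith
    then show ?thesis using False by simp
  qed
  have B: "norm (Bf (v n r) (w n r) k) \<le> lam k * (nrm 0 (v n r) * R)"
    by (rule order_trans[OF norm_Bf_le0]) (use r hs_w hs_v w_zero v_zero w_R in \<open>auto intro!: mult_left_mono\<close>)
  have "norm (rhs \<nu> f (v n r) (w n r) k) \<le> norm (f k) + norm ((\<nu> * (lam k)\<^sup>2) *\<^sub>R w n r k) + norm (Bf (v n r) (w n r) k)"
    unfolding rhs_def by (meson add_mono norm_triangle_ineq4 order_refl order_trans)
  also have "\<dots> \<le> norm (f k) + \<nu> * (lam k)\<^sup>2 * R + lam k * ((R + (c * (indicator {0..<\<mu> n} r * (nrm 0 (v n r))\<^sup>2) + 1 / c)) * R)"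
  proof (intro add_mono order_refl)
    show "norm ((\<nu> * (lam k)\<^sup>2) *\<^sub>R w n r k) \<le> \<nu> * (lam k)\<^sup>2 * R"
      using norm_w_le[OF r, of n k] nu_pos by (simp add: mult_left_mono)
    show "norm (Bf (v n r) (w n r) k) \<le> lam k * ((R + (c * (indicator {0..<\<mu> n} r * (nrm 0 (v n r))\<^sup>2) + 1 / c)) * R)"
      by (rule order_trans[OF B]) (use v R_pos in \<open>auto intro!: mult_left_mono mult_right_mono\<close>)
  qed
  finally show ?thesis by (simp add: algebra_simps)
qed

text \<open>The derivative of a mode is bounded in L1 but not pointwise, as the history may
  concentrate. First c is fixed so that the history contributes less than e/2 on any interval, then
  the interval is shortened to control the constants.\<close>

lemma equicontinuous:
  assumes e: "e > 0"
  shows "\<exists>d>0. \<forall>n. \<forall>s\<in>{0..T}. \<forall>t\<in>{0..T}. \<bar>s - t\<bar> < d \<longrightarrow> norm (w n s k - w n t k) < e"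
proof -
  define A where "A = norm (f k) + \<nu> * (lam k)\<^sup>2 * R + lam k * R * R"
  define B where "B = lam k * R"
  have A: "A \<ge> 0" and B: "B \<ge> 0" using R_pos nu_pos by (simp_all add: A_def B_def)
  \<comment> \<open>The added 1 keeps the denominator positive when B K = 0 and makes the
    contribution strictly below e/2.\<close>
  define c where "c = e / (2 * (B * K + 1))"
  have BK: "B * K \<ge> 0" using B K_nonneg by simp
  have c: "c > 0" using e BK by (simp add: c_def)
  have cBK: "B * c * K < e / 2"
  proof -
    have "B * c * K = e / 2 * (B * K / (B * K + 1))" by (simp add: c_def)
    also have "\<dots> < e / 2 * 1" using BK e by (intro mult_strict_left_mono) auto
    finally show ?thesis by simp
  qed
  define X where "X = A + B / c + 1"
  define d where "d = e / (2 * X)"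
  have D: "X > 0" "A + B / c \<le> X" "A + B / c \<ge> 0" using A B c by (simp_all add: X_def add_nonneg_pos)
  have d: "d > 0" using e D by (simp add: d_def)
  have main: "norm (w n t k - w n s k) < e" if st: "0 \<le> s" "s \<le> t" "t \<le> T" "t - s < d" for n s t
  proof -
    define g where "g r = rhs \<nu> f (v n r) (w n r) k" for r
    define J where "J r = indicator {0..<\<mu> n} r * (nrm 0 (v n r))\<^sup>2" for r
    have gT: "g integrable_on {0..t}" "g integrable_on {s..t}"
      using integrable_on_lebesgue_on[OF integrable_lebesgue_on_subinterval[OF S.integrable_rhs[of n k], of 0 t]]
        integrable_on_lebesgue_on[OF integrable_lebesgue_on_subinterval[OF S.integrable_rhs[of n k], of s t]] st by (auto simp: g_def[abs_def])
    have JT: "J integrable_on {0..T}" "J integrable_on {s..t}"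
      using integrable_on_lebesgue_on[OF J_integrable[of n]]
        integrable_on_lebesgue_on[OF integrable_lebesgue_on_subinterval[OF J_integrable[of n], of s t]] st by (auto simp: J_def[abs_def])
    have "w n t k - w n s k = integral {s..t} g"
      using S.mild[of t n k] S.mild[of s n k] Henstock_Kurzweil_Integration.integral_combine[of 0 s t g, symmetric] gT(1) st by (simp add: g_def[abs_def])
    moreover have hi: "((\<lambda>r. A + B * (c * J r + 1 / c)) has_integral (t - s) * A + B * (c * integral {s..t} J + (t - s) * (1 / c))) {s..t}"
      using has_integral_const_real[of A s t] has_integral_const_real[of "1 / c" s t] st
      by (intro has_integral_add has_integral_mult_right integrable_integral JT) auto
    moreover have "norm (integral {s..t} g) \<le> integral {s..t} (\<lambda>r. A + B * (c * J r + 1 / c))"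
    proof (rule integral_norm_bound_integral[OF gT(2)])
      show "(\<lambda>r. A + B * (c * J r + 1 / c)) integrable_on {s..t}" using hi by blast
      show "norm (g r) \<le> A + B * (c * J r + 1 / c)" if "r \<in> {s..t}" for r
        using rhs_bound[OF _ c, of r n k] that st by (simp add: g_def J_def A_def B_def)
    qed
    ultimately have "norm (w n t k - w n s k) \<le> (t - s) * A + B * (c * integral {s..t} J + (t - s) * (1 / c))"
      by (simp add: integral_unique)
    also have "integral {s..t} J \<le> integral {0..T} J"
      by (rule integral_subset_le) (use st JT in \<open>auto simp: J_def\<close>)
    also have "integral {0..T} J \<le> K"
      using v_K[of n] lebesgue_integral_eq_integral[OF J_integrable[of n]] by (simp add: J_def[abs_def])
    finally have "norm (w n t k - w n s k) \<le> (t - s) * A + B * (c * K + (t - s) * (1 / c))"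
      using B c by (simp add: mult_left_mono)
    also have "\<dots> = (t - s) * (A + B / c) + B * c * K" by (simp add: algebra_simps)
    also have "(t - s) * (A + B / c) \<le> d * X" using st D by (intro mult_mono) auto
    also have "d * X = e / 2" using D(1) by (simp add: d_def)
    finally show ?thesis using cBK by simp
  qed
  have "norm (w n s k - w n t k) < e" if "s \<in> {0..T}" "t \<in> {0..T}" "\<bar>s - t\<bar> < d" for n s t
    using main[of s t n] main[of t s n] that by (cases "s \<le> t") (auto simp: norm_minus_commute)
  with d show ?thesis by blast
qed

text \<open>Arzela-Ascoli for all modes at once: the diagonal argument runs over the countable set
  of pairs of a mode and a rational time, and equicontinuity of each mode extends convergence to all
  times uniformly.\<close>

lemma convergent_subsequence:
  obtains \<sigma> y where "strict_mono (\<sigma> :: nat \<Rightarrow> nat)"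
    "\<And>k. uniform_limit {0..T} (\<lambda>n t. w (\<sigma> n) t k) (\<lambda>t. y t k) sequentially"
proof -
  define D where "D = (UNIV :: (int ^ 3) set) \<times> (\<rat> \<inter> {0..T})"
  have "countable D" unfolding D_def by (intro countable_SIGMA countable_Int1 countable_rat) auto
  moreover have "norm ((\<lambda>(k, q). w n q k) x) \<le> R" if "x \<in> D" for n x
    using that norm_w_le by (auto simp: D_def)
  ultimately obtain \<sigma> where \<sigma>: "strict_mono (\<sigma> :: nat \<Rightarrow> nat)" "\<And>x. x \<in> D \<Longrightarrow> \<exists>l. (\<lambda>n. (\<lambda>(k, q). w (\<sigma> n) q k) x) \<longlonglongrightarrow> l"
    using function_convergent_subsequence[of D "\<lambda>n (k, q). w n q k" R] by blast
  have "\<exists>l. uniform_limit {0..T} (\<lambda>n t. w (\<sigma> n) t k) l sequentially" for k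
  proof -
    have "uniformly_Cauchy_on {0..T} (\<lambda>n t. w (\<sigma> n) t k)"
    proof (rule uniformly_Cauchy_onI)
      fix e :: real assume e: "e > 0"
      obtain d where d: "d > 0" "\<And>n s t. s \<in> {0..T} \<Longrightarrow> t \<in> {0..T} \<Longrightarrow> \<bar>s - t\<bar> < d \<Longrightarrow> norm (w n s k - w n t k) < e / 3"
        using equicontinuous[of "e / 3" k] e by auto
      have "{0..T} \<subseteq> (\<Union>q\<in>\<rat> \<inter> {0..T}. ball q d)"
      proof
        fix t assume t: "t \<in> {0..T}"
        have "max 0 (t - d) < min T (t + d)" using t d(1) T_pos by auto
        then obtain q where "q \<in> \<rat>" "max 0 (t - d) < q" "q < min T (t + d)" using Rats_dense_in_real by blast
        then show "t \<in> (\<Union>q\<in>\<rat> \<inter> {0..T}. ball q d)" by (intro UN_I[of q]) (auto simp: dist_real_def)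
      qed
      then obtain Q where Q: "Q \<subseteq> \<rat> \<inter> {0..T}" "finite Q" "{0..T} \<subseteq> (\<Union>q\<in>Q. ball q d)"
        using compactE_image[of "{0..T}" "\<rat> \<inter> {0..T}" "\<lambda>q. ball q d"] by (metis compact_Icc open_ball)
      have "\<exists>M. \<forall>m\<ge>M. \<forall>n\<ge>M. dist (w (\<sigma> m) q k) (w (\<sigma> n) q k) < e / 3" if q: "q \<in> Q" for q
      proof -
        have "(k, q) \<in> D" using q Q by (auto simp: D_def)
        from \<sigma>(2)[OF this] have "convergent (\<lambda>n. w (\<sigma> n) q k)" by (auto simp: convergent_def)
        then have "Cauchy (\<lambda>n. w (\<sigma> n) q k)" by (rule convergent_Cauchy)
        then show ?thesis using e by (intro metric_CauchyD) auto
      qed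
      then obtain M where M: "\<And>q m n. q \<in> Q \<Longrightarrow> m \<ge> M q \<Longrightarrow> n \<ge> M q \<Longrightarrow> dist (w (\<sigma> m) q k) (w (\<sigma> n) q k) < e / 3"
        by metis
      \<comment> \<open>The sum of the thresholds over the finite set Q serves as a common
        threshold.\<close>
      have "dist (w (\<sigma> m) t k) (w (\<sigma> n) t k) < e" if t: "t \<in> {0..T}" and mn: "m \<ge> (\<Sum>q\<in>Q. M q)" "n \<ge> (\<Sum>q\<in>Q. M q)" for t m n
      proof -
        obtain q where q: "q \<in> Q" "dist q t < d" using Q(3) t by auto
        have "M q \<le> (\<Sum>q\<in>Q. M q)" by (rule member_le_sum) (use q Q in auto)
        then have mid: "dist (w (\<sigma> m) q k) (w (\<sigma> n) q k) < e / 3" using M[OF q(1), of m n] mn by simp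
        have "dist (w (\<sigma> j) q k) (w (\<sigma> j) t k) < e / 3" for j
          using d(2)[of q t "\<sigma> j"] q Q t by (auto simp: dist_norm)
        from this[of m] this[of n] have "dist (w (\<sigma> m) t k) (w (\<sigma> m) q k) < e / 3" "dist (w (\<sigma> n) q k) (w (\<sigma> n) t k) < e / 3"
          by (simp_all add: dist_commute)
        then show ?thesis
          using mid dist_triangle[of "w (\<sigma> m) t k" "w (\<sigma> n) t k" "w (\<sigma> m) q k"] dist_triangle[of "w (\<sigma> m) q k" "w (\<sigma> n) t k" "w (\<sigma> n) q k"]
          by linarith
      qed
      then show "\<exists>M. \<forall>x\<in>{0..T}. \<forall>m\<ge>M. \<forall>n\<ge>M. dist (w (\<sigma> m) x k) (w (\<sigma> n) x k) < e" by blast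
    qed
    from Cauchy_uniformly_convergent[OF this] show ?thesis by (simp add: uniformly_convergent_on_def)
  qed
  then obtain l where "\<And>k. uniform_limit {0..T} (\<lambda>n t. w (\<sigma> n) t k) (l k) sequentially" by metis
  then show ?thesis using that[of \<sigma> "\<lambda>t k. l k t"] \<sigma>(1) by simp
qed

end

section \<open>The limit: its regularity and the strong convergence towards it\<close>

locale delay_limit = delay_sequence +
  fixes u :: "real \<Rightarrow> coeffs"
  assumes u_lim: "\<And>k. uniform_limit {0..T} (\<lambda>n t. w n t k) (\<lambda>t. u t k) sequentially"
begin

lemma u_cont: "continuous_on {0..T} (\<lambda>t. u t k)"
  by (rule uniform_limit_theorem[OF always_eventually u_lim]) (auto intro: w_cont)

lemma u_pt: "t \<in> {0..T} \<Longrightarrow> (\<lambda>n. w n t k) \<longlonglongrightarrow> u t k"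
  by (rule tendsto_uniform_limitI[OF u_lim])

lemma u_V0: assumes "t \<in> {0..T}" shows "u t \<in> V L 0" "nrm 0 (u t) \<le> R"
  using solenoidal_limit[of "\<lambda>n. w n t" "u t", OF sol_w[OF assms] u_pt[OF assms]]
    nrm_le_limit[of "\<lambda>n. w n t" "u t", OF u_pt[OF assms] hs_w[OF assms] w_R[OF assms]] by (auto simp: V_iff)

lemma u_meas: "(\<lambda>t. u t k) \<in> borel_measurable (lebesgue_on {0..T})"
  by (rule continuous_imp_measurable_on_sets_lebesgue[OF u_cont]) simp

lemma w_V1: "AE t in lebesgue_on {0..T}. w n t \<in> V L 1"
  using S.wV[of n] by eventually_elim (use V_mono alpha_gt in auto)

lemma w_int1: "integrable (lebesgue_on {0..T}) (\<lambda>t. (nrm 1 (w n t))\<^sup>2)"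
  by (rule S.integrable_lower) (use alpha_gt in simp)

text \<open>For each cutoff the dissipation converges, as finitely many modes converge with a
  constant majorant, and stays below E. Monotone convergence in the cutoff then gives regularity and
  bound for the full norm.\<close>

lemma u_V1: "AE t in lebesgue_on {0..T}. u t \<in> V L 1"
  and u_int1: "integrable (lebesgue_on {0..T}) (\<lambda>t. (nrm 1 (u t))\<^sup>2)"
  and u_E: "(LINT r|lebesgue_on {0..T}. (nrm 1 (u r))\<^sup>2) \<le> E"
proof -
  define D where "D x N = (\<Sum>k\<in>modes N. (coef 1 x k)\<^sup>2)" for x N
  have D_nonneg: "D x N \<ge> 0" for x N by (simp add: D_def sum_nonneg)
  have D_mono: "D x M \<le> D x N" if "M \<le> N" for x M N
    unfolding D_def by (rule sum_mono2) (use modes_mono[OF that] in auto)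
  have Dc: "continuous_on {0..T} (\<lambda>r. D (u r) N)" "continuous_on {0..T} (\<lambda>r. D (w n r) N)" for N n
    unfolding D_def coef_def by (intro continuous_intros u_cont w_cont)+
  have DE: "(LINT r|lebesgue_on {0..T}. D (u r) N) \<le> E" for N
  proof (rule LIMSEQ_le_const2)
    define C where "C = (\<Sum>k\<in>modes N. (lam k * R)\<^sup>2)"
    show "(\<lambda>n. LINT r|lebesgue_on {0..T}. D (w n r) N) \<longlonglongrightarrow> (LINT r|lebesgue_on {0..T}. D (u r) N)"
    proof (rule integral_dominated_convergence[where w="\<lambda>_. C"])
      show "AE r in lebesgue_on {0..T}. (\<lambda>n. D (w n r) N) \<longlonglongrightarrow> D (u r) N"
        unfolding D_def coef_def by (intro AE_I2 tendsto_intros u_pt) simp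
      show "AE r in lebesgue_on {0..T}. norm (D (w n r) N) \<le> C" for n
      proof (rule AE_I2)
        fix r assume "r \<in> space (lebesgue_on {0..T})"
        then have "D (w n r) N \<le> C" unfolding D_def C_def coef_def
          by (intro sum_mono power_mono mult_mono) (auto simp: norm_w_le)
        then show "norm (D (w n r) N) \<le> C" using D_nonneg by simp
      qed
    qed (auto intro!: borel_measurable_integrable cont_integrable Dc)
    have "(LINT r|lebesgue_on {0..T}. D (w n r) N) \<le> E" for n
    proof -
      have "(LINT r|lebesgue_on {0..T}. D (w n r) N) \<le> (LINT r|lebesgue_on {0..T}. (nrm 1 (w n r))\<^sup>2)"
      proof (rule integral_mono_AE[OF cont_integrable[OF Dc(2)] w_int1])
        show "AE r in lebesgue_on {0..T}. D (w n r) N \<le> (nrm 1 (w n r))\<^sup>2"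
          using w_V1[of n] unfolding D_def by eventually_elim (rule sum_modes_le, simp add: V_iff)
      qed
      then show ?thesis using w_E[of n] by simp
    qed
    then show "\<exists>M. \<forall>n\<ge>M. (LINT r|lebesgue_on {0..T}. D (w n r) N) \<le> E" by blast
  qed
  have "AE r in lebesgue_on {0..T}. \<exists>B. \<forall>N. D (u r) N \<le> B"
    by (rule AE_bounded_of_integrals[OF cont_integrable[OF Dc(1)] D_nonneg D_mono DE])
  then have h: "AE r in lebesgue_on {0..T}. hs 1 (u r)"
  proof eventually_elim
    case (elim r)
    then obtain B where B: "\<And>N. D (u r) N \<le> B" by blast
    have "B \<ge> 0" using B[of 0] D_nonneg[of "u r" 0] by linarith
    then show ?case using hs_modesI(1)[of 1 "u r" "sqrt B"] B by (simp add: D_def)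
  qed
  then show "AE t in lebesgue_on {0..T}. u t \<in> V L 1"
    using AE_space by eventually_elim (use u_V0(1) in \<open>auto simp: V_iff\<close>)
  have inc: "incseq (\<lambda>N. LINT r|lebesgue_on {0..T}. D (u r) N)"
    unfolding incseq_def by (intro allI impI integral_mono cont_integrable Dc D_mono)
  obtain l where l: "(\<lambda>N. LINT r|lebesgue_on {0..T}. D (u r) N) \<longlonglongrightarrow> l"
    using incseq_convergent[OF inc, of E] DE by blast
  have mono: "AE r in lebesgue_on {0..T}. mono (\<lambda>N. D (u r) N)" by (intro AE_I2) (auto simp: mono_def D_mono)
  have lim: "AE r in lebesgue_on {0..T}. (\<lambda>N. D (u r) N) \<longlonglongrightarrow> (nrm 1 (u r))\<^sup>2"
    using h unfolding D_def by eventually_elim (rule nrm_sq_modes)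
  have m: "(\<lambda>r. (nrm 1 (u r))\<^sup>2) \<in> borel_measurable (lebesgue_on {0..T})"
    by (rule borel_measurable_nrm_sq[OF _ u_meas h]) simp
  note mc = integral_monotone_convergence_nonneg[OF cont_integrable[OF Dc(1)] mono AE_I2[OF D_nonneg] lim l m]
  show "integrable (lebesgue_on {0..T}) (\<lambda>t. (nrm 1 (u t))\<^sup>2)" by (rule mc)
  show "(LINT r|lebesgue_on {0..T}. (nrm 1 (u r))\<^sup>2) \<le> E"
    unfolding mc(2) by (rule LIMSEQ_le_const2[OF l]) (use DE in blast)
qed

lemma modes_small:
  assumes "finite F" "d > 0"
  shows "\<forall>\<^sub>F n in sequentially. \<forall>k\<in>F. \<forall>r\<in>{0..T}. norm (w n r k - u r k) < d"
  by (rule eventually_ball_finite[OF assms(1)]) (use uniform_limitD[OF u_lim assms(2)] in \<open>simp add: dist_norm\<close>)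

lemma diff_V: assumes "t \<in> {0..T}" shows "hs 0 (w n t - u t)" "nrm 0 (w n t - u t) \<le> 2 * R"
  using hs_diff[of 0 "w n t" "u t"] hs_w[OF assms, of n] u_V0[OF assms] w_R[OF assms, of n] by (auto simp: V_iff)

lemma diff_meas: "(\<lambda>t. (w n t - u t) k) \<in> borel_measurable (lebesgue_on {0..T})"
  unfolding minus_apply by (intro borel_measurable_diff S.wm u_meas)

lemma diff_int: "integrable (lebesgue_on {0..T}) (\<lambda>r. (nrm 0 (w n r - u r))\<^sup>2)"
proof (rule Bochner_Integration.integrable_bound[OF cont_integrable[OF continuous_on_const[of _ "(2 * R)\<^sup>2"]]])
  show "(\<lambda>r. (nrm 0 (w n r - u r))\<^sup>2) \<in> borel_measurable (lebesgue_on {0..T})"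
    
  proof (rule borel_measurable_nrm_sq[where u="\<lambda>r. w n r - u r", OF _ diff_meas])
    show "AE t in lebesgue_on {0..T}. hs 0 (w n t - u t)" by (rule AE_I2, rule diff_V) simp
  qed simp
  show "AE r in lebesgue_on {0..T}. norm ((nrm 0 (w n r - u r))\<^sup>2) \<le> norm ((2 * R)\<^sup>2)"
  proof (rule AE_I2)
    fix r assume "r \<in> space (lebesgue_on {0..T})"
    then have "(nrm 0 (w n r - u r))\<^sup>2 \<le> (2 * R)\<^sup>2" by (intro power_mono diff_V) auto
    then show "norm ((nrm 0 (w n r - u r))\<^sup>2) \<le> norm ((2 * R)\<^sup>2)" by simp
  qed
qed

lemma ex_tail: assumes "c > 0" shows "\<exists>N. (lam0 * real (Suc N)) powr (- 1) \<le> c"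
proof -
  obtain N where N: "1 / (lam0 * c) < real N" using reals_Archimedean2 by blast
  have "1 < real N * (lam0 * c)" using N assms lam0_pos by (simp add: field_simps)
  also have "\<dots> \<le> real (Suc N) * (lam0 * c)" using assms lam0_pos by (intro mult_right_mono) auto
  finally have "1 / (lam0 * real (Suc N)) \<le> c"
    using lam0_pos by (simp add: divide_le_eq mult_ac del: of_nat_Suc)
  then show ?thesis using lam0_pos by (auto simp: powr_minus_divide)
qed

text \<open>Low modes converge uniformly in time; the high modes of the difference are at most c
  times its V^1 norm, whose square has a bounded integral. Squaring the two-term split gives 2 T
  from the low and 8 E from the high modes.\<close>

lemma conv_L2: "(\<lambda>n. LINT r|lebesgue_on {0..T}. (nrm 0 (w n r - u r))\<^sup>2) \<longlonglongrightarrow> 0"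
proof (rule LIMSEQ_zero_of_bound[where K="2 * T + 8 * E"])
  show "2 * T + 8 * E \<ge> 0" using T_pos E_nonneg by simp
  fix c :: real assume c: "0 < c" "c \<le> 1"
  obtain N where N: "(lam0 * real (Suc N)) powr (- 1) \<le> c" using ex_tail[OF c(1)] by blast
  \<comment> \<open>With d \<le> 1 the square of a mode is at most d, so all modes in the cube
    together contribute at most c.\<close>
  define d where "d = c / (real (card (modes N)) + 1)"
  have d: "d > 0" "d \<le> 1" "real (card (modes N)) * d \<le> c"
    using c by (auto simp: d_def field_simps intro: add_increasing2)
  show "\<forall>\<^sub>F n in sequentially. (LINT r|lebesgue_on {0..T}. (nrm 0 (w n r - u r))\<^sup>2) \<le> (2 * T + 8 * E) * c"
    using modes_small[OF finite_modes d(1), of N]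
  proof eventually_elim
    case (elim n)
    have i: "integrable (lebesgue_on {0..T}) (\<lambda>r. 2 * c + (4 * c * (nrm 1 (w n r))\<^sup>2 + 4 * c * (nrm 1 (u r))\<^sup>2))"
      by (intro Bochner_Integration.integrable_add integrable_mult_right w_int1 u_int1 cont_integrable continuous_intros)
    have "(LINT r|lebesgue_on {0..T}. (nrm 0 (w n r - u r))\<^sup>2) \<le> (LINT r|lebesgue_on {0..T}. 2 * c + (4 * c * (nrm 1 (w n r))\<^sup>2 + 4 * c * (nrm 1 (u r))\<^sup>2))"
    proof (rule integral_mono_AE[OF diff_int i])
      show "AE r in lebesgue_on {0..T}. (nrm 0 (w n r - u r))\<^sup>2 \<le> 2 * c + (4 * c * (nrm 1 (w n r))\<^sup>2 + 4 * c * (nrm 1 (u r))\<^sup>2)"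
        using w_V1[of n] u_V1 AE_space
      proof eventually_elim
        case (elim r)
        then have r: "r \<in> {0..T}" by simp
        define x where "x = w n r - u r"
        have h1: "hs 1 x" and n1: "nrm 1 x \<le> nrm 1 (w n r) + nrm 1 (u r)"
          using hs_diff[of 1 "w n r" "u r"] elim by (auto simp: x_def V_iff)
        have h0: "hs 0 x" using diff_V[OF r] by (simp add: x_def)
        have "(nrm 0 (proj N x))\<^sup>2 = (\<Sum>k\<in>modes N. (coef 0 x k)\<^sup>2)" by (simp add: nrm_proj L2_set_sq)
        also have "\<dots> \<le> (\<Sum>k\<in>modes N. d)"
        proof (rule sum_mono)
          fix k assume k: "k \<in> modes N"
          have "coef 0 x k \<le> d" using \<open>\<forall>k\<in>modes N. _\<close> k r by (auto simp: coef_0 x_def less_imp_le)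
          then have "(coef 0 x k)\<^sup>2 \<le> d * 1" unfolding power2_eq_square using d by (intro mult_mono) auto
          then show "(coef 0 x k)\<^sup>2 \<le> d" by simp
        qed
        also have "\<dots> \<le> c" using d by simp
        finally have a: "(nrm 0 (proj N x))\<^sup>2 \<le> c" .
        have "nrm 0 (x - proj N x) \<le> (lam0 * real (Suc N)) powr (0 - 1) * nrm 1 x" by (rule nrm_tail_gap[OF h1]) simp
        also have "\<dots> \<le> c * nrm 1 x" using N by (intro mult_right_mono) auto
        finally have "(nrm 0 (x - proj N x))\<^sup>2 \<le> (c * nrm 1 x)\<^sup>2" by (intro power_mono) auto
        also have "\<dots> = c * (c * (nrm 1 x)\<^sup>2)" by (simp add: power2_eq_square)
        also have "\<dots> \<le> c * (1 * (nrm 1 x)\<^sup>2)" using c by (intro mult_left_mono mult_right_mono) auto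
        also have "\<dots> \<le> c * (2 * (nrm 1 (w n r))\<^sup>2 + 2 * (nrm 1 (u r))\<^sup>2)"
        proof -
          have "(nrm 1 x)\<^sup>2 \<le> (nrm 1 (w n r) + nrm 1 (u r))\<^sup>2" using n1 by (intro power_mono) auto
          also have "\<dots> \<le> 2 * (nrm 1 (w n r))\<^sup>2 + 2 * (nrm 1 (u r))\<^sup>2"
            using sum_squares_bound[of "nrm 1 (w n r)" "nrm 1 (u r)"] by (simp add: power2_sum)
          finally show ?thesis using c by simp
        qed
        finally have b: "(nrm 0 (x - proj N x))\<^sup>2 \<le> c * (2 * (nrm 1 (w n r))\<^sup>2 + 2 * (nrm 1 (u r))\<^sup>2)" .
        have "(nrm 0 x)\<^sup>2 \<le> (nrm 0 (proj N x) + nrm 0 (x - proj N x))\<^sup>2"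
          using nrm_split[OF h0, of N] by (intro power_mono) auto
        also have "\<dots> \<le> 2 * (nrm 0 (proj N x))\<^sup>2 + 2 * (nrm 0 (x - proj N x))\<^sup>2"
          using sum_squares_bound[of "nrm 0 (proj N x)" "nrm 0 (x - proj N x)"] by (simp add: power2_sum)
        finally show ?case using a b unfolding x_def by (simp add: algebra_simps)
      qed
    qed
    also have "\<dots> = T * (2 * c) + (4 * c * (LINT r|lebesgue_on {0..T}. (nrm 1 (w n r))\<^sup>2) + 4 * c * (LINT r|lebesgue_on {0..T}. (nrm 1 (u r))\<^sup>2))"
    proof -
      have i1: "integrable (lebesgue_on {0..T}) (\<lambda>r. 2 * c)" by (intro cont_integrable continuous_intros)
      have i2: "integrable (lebesgue_on {0..T}) (\<lambda>r. 4 * c * (nrm 1 (w n r))\<^sup>2)" by (intro integrable_mult_right w_int1)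
      have i3: "integrable (lebesgue_on {0..T}) (\<lambda>r. 4 * c * (nrm 1 (u r))\<^sup>2)" by (intro integrable_mult_right u_int1)
      show ?thesis
        by (simp only: Bochner_Integration.integral_add[OF i1 Bochner_Integration.integrable_add[OF i2 i3]]
            Bochner_Integration.integral_add[OF i2 i3] integral_mult_right_zero lint_const[OF less_imp_le[OF T_pos]])
    qed
    also have "\<dots> \<le> T * (2 * c) + (4 * c * E + 4 * c * E)"
      using c w_E[of n] u_E T_pos by (intro add_mono mult_left_mono) auto
    finally show ?case by (simp add: algebra_simps)
  qed
qed simp

lemma conv_C:
  assumes s: "s > 0"
  shows "uniform_limit {0..T} (\<lambda>n t. Vnorm L (- s) (w n t - u t)) (\<lambda>_. 0) sequentially"
proof (rule uniform_limitI)
  fix e :: real assume e: "e > 0"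
  have e': "e / sqrt (L ^ 3) > 0" using e L_pos by simp
  obtain N d where d: "d > 0" "\<And>x. hs 0 x \<Longrightarrow> nrm 0 x \<le> 2 * R \<Longrightarrow> \<forall>k\<in>modes N. norm (x k) < d \<Longrightarrow> nrm (- s) x < e / sqrt (L ^ 3)"
    using nrm_neg_small[OF s e', of "2 * R"] R_pos by auto
  show "\<forall>\<^sub>F n in sequentially. \<forall>t\<in>{0..T}. dist (Vnorm L (- s) (w n t - u t)) 0 < e"
    using modes_small[OF finite_modes d(1), of N]
  proof eventually_elim
    case (elim n)
    show ?case
    proof
      fix t assume t: "t \<in> {0..T}"
      have "nrm (- s) (w n t - u t) < e / sqrt (L ^ 3)"
        by (rule d(2)) (use diff_V[OF t] elim t in auto)
      then have "sqrt (L ^ 3) * nrm (- s) (w n t - u t) < e" using L_pos by (simp add: field_simps)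
      then show "dist (Vnorm L (- s) (w n t - u t)) 0 < e" using L_pos by (simp add: Vnorm_eq)
    qed
  qed
qed

end

section \<open>The limit equation\<close>

context delay_limit
begin

lemma hs_u: "t \<in> {0..T} \<Longrightarrow> hs 0 (u t)" and sol_u: "t \<in> {0..T} \<Longrightarrow> solenoidal L (u t)"
  using u_V0 by (auto simp: V_iff)

lemma u_zero: "t \<in> {0..T} \<Longrightarrow> u t 0 = 0" by (rule solenoidalD(1)[OF sol_u])

lemma u_int0: "integrable (lebesgue_on {0..T}) (\<lambda>t. (nrm 0 (u t))\<^sup>2)"
  by (rule integrable_nrm_mono[OF _ u_meas u_V1 u_int1]) simp_all

lemma u_Bf_int: "integrable (lebesgue_on {0..T}) (\<lambda>r. Bf (u r) (u r) k)"
proof -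
  have "AE t in lebesgue_on {0..T}. u t \<in> V L 0" by (rule AE_I2) (simp add: u_V0)
  then show ?thesis by (intro integrable_Bf u_meas u_int0) simp_all
qed

lemma ex_tail1: assumes "c > 0" shows "\<exists>N. (lam0 * real (Suc N)) powr (0 - 1) \<le> c"
  using ex_tail[OF assms] by simp

text \<open>The frequency gap between \<open>V\<^sup>1\<close> and \<open>V\<^sup>0\<close> is only used on the second argument of \<open>B\<close>; for the first one it is
  enough that it is bounded in \<open>V\<^sup>0\<close> and tends to \<open>0\<close> mode by mode.\<close>

lemma Bf_split_bound:
  assumes x: "hs 0 x" "x 0 = 0" "nrm 0 x \<le> 2 * R" and y: "hs 1 y" "y 0 = 0" "nrm 0 y \<le> R"
    and N: "(lam0 * real (Suc N)) powr (0 - 1) \<le> c" and d: "\<And>l. l \<in> modes N \<Longrightarrow> norm (x (k - l)) \<le> d"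
  shows "norm (Bf x y k) \<le> lam k * (real (card (modes N)) * (d * R) + 2 * R * (c * nrm 1 y))"
proof (cases "k = 0")
  case True then show ?thesis by (simp add: Bf_def)
next
  case False
  have y0: "hs 0 y" using hs_mono(1)[OF y(1)] by simp
  have p: "hs 0 (proj N y)" "proj N y 0 = 0" using hs_proj by (simp_all add: proj_def)
  have "norm (\<Sum>l\<in>modes N. Bsym x y k l) \<le> (\<Sum>l\<in>modes N. lam k * (d * R))"
  proof (rule sum_norm_le)
    fix l assume l: "l \<in> modes N"
    have "0 \<le> d" using d[OF l] norm_ge_zero order_trans by blast
    then have "lam k * (norm (x (k - l)) * norm (y l)) \<le> lam k * (d * R)"
      using d[OF l] norm_le_nrm0[OF y0 y(2), of l] y(3) by (intro mult_left_mono mult_mono) auto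
    then show "norm (Bsym x y k l) \<le> lam k * (d * R)" using norm_Bsym[of x y k l] by linarith
  qed
  moreover have "freq L k \<noteq> 0" using False freq_inj by simp
  then have "norm (Bf x (proj N y) k) \<le> norm (\<i> *s (\<Sum>l\<in>modes N. Bsym x y k l))"
    unfolding Bf_proj[OF False] by (rule norm_leray)
  ultimately have 1: "norm (Bf x (proj N y) k) \<le> lam k * (real (card (modes N)) * (d * R))"
    by (simp add: norm_cscale mult_ac)
  have "norm (Bf x (y - proj N y) k) \<le> lam k * (nrm 0 x * nrm 0 (y - proj N y))"
    by (rule norm_Bf_le0) (use x y y0 p in \<open>auto simp: hs_diff\<close>)
  also have "nrm 0 x * nrm 0 (y - proj N y) \<le> 2 * R * (c * nrm 1 y)"
  proof (rule mult_mono[OF x(3)])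
    have "nrm 0 (y - proj N y) \<le> (lam0 * real (Suc N)) powr (0 - 1) * nrm 1 y" by (rule nrm_tail_gap[OF y(1)]) simp
    also have "\<dots> \<le> c * nrm 1 y" using N by (rule mult_right_mono) simp
    finally show "nrm 0 (y - proj N y) \<le> c * nrm 1 y" .
  qed (use R_pos in auto)
  finally have 2: "norm (Bf x (y - proj N y) k) \<le> lam k * (2 * R * (c * nrm 1 y))"
    by (simp add: mult_left_mono)
  have "Bf x (y - proj N y) = Bf x y - Bf x (proj N y)" by (rule Bf_diff_right[OF x(1,2) p y0 y(2)])
  then have "Bf x y k = Bf x (proj N y) k + Bf x (y - proj N y) k" by simp
  then have "norm (Bf x y k) \<le> norm (Bf x (proj N y) k) + norm (Bf x (y - proj N y) k)" by (simp add: norm_triangle_ineq)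
  then show ?thesis using 1 2 by (simp add: distrib_left)
qed

text \<open>The shift by the delay is absorbed by equicontinuity, which is uniform in n, once \<mu>
  is below the modulus; the rest is uniform convergence of the mode.\<close>

lemma shift_small:
  assumes "finite F" "d > 0"
  shows "\<forall>\<^sub>F n in sequentially. \<forall>k\<in>F. \<forall>r\<in>{\<mu> n..T}. norm (v n r k - u r k) \<le> d"
proof (rule eventually_ball_finite[OF assms(1)], rule ballI)
  fix k assume "k \<in> F"
  obtain e where e: "e > 0" "\<And>n s t. s \<in> {0..T} \<Longrightarrow> t \<in> {0..T} \<Longrightarrow> \<bar>s - t\<bar> < e \<Longrightarrow> norm (w n s k - w n t k) < d / 2"
    using equicontinuous[of "d / 2" k] assms(2) by auto
  have d2: "d / 2 > 0" using assms(2) by simp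
  show "\<forall>\<^sub>F n in sequentially. \<forall>r\<in>{\<mu> n..T}. norm (v n r k - u r k) \<le> d"
    using order_tendstoD(2)[OF \<mu>_lim e(1)] uniform_limitD[OF u_lim[of k] d2]
  proof eventually_elim
    case (elim n)
    show ?case
    proof
      fix r assume r: "r \<in> {\<mu> n..T}"
      then have r0: "r \<in> {0..T}" "r - \<mu> n \<in> {0..T}" using \<mu>_pos[of n] by auto
      have "norm (w n (r - \<mu> n) k - w n r k) < d / 2"
        by (rule e(2)[OF r0(2,1)]) (use elim(1) \<mu>_pos[of n] in simp)
      moreover have "norm (w n r k - u r k) < d / 2" using elim(2) r0(1) by (simp add: dist_norm)
      ultimately have "norm ((w n (r - \<mu> n) k - w n r k) + (w n r k - u r k)) < d / 2 + d / 2"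
        by (intro norm_add_less)
      then show "norm (v n r k - u r k) \<le> d" using shift[OF r] by simp
    qed
  qed
qed

text \<open>Split as B(v - u, w) + B(u, w - u). The second term is controlled by the L2 distance of
  w and u. For the first, times before \<mu> use the crude V^0 bound with the history, later times
  the low modes of v - u and the gap for w.\<close>

lemma Bf_diff_bound:
  assumes r: "r \<in> {0..T}" and w1: "hs 1 (w n r)" and c: "0 < c"
    and N: "(lam0 * real (Suc N)) powr (0 - 1) \<le> c"
    and small: "\<forall>m\<in>(\<lambda>l. k - l) ` modes N. \<forall>r\<in>{\<mu> n..T}. norm (v n r m - u r m) \<le> c / (real (card (modes N)) + 1)"
  shows "norm (Bf (v n r) (w n r) k - Bf (u r) (u r) k)
    \<le> lam k * R * (c * (indicator {0..<\<mu> n} r * (nrm 0 (v n r))\<^sup>2) + (1 / c + R) * indicator {0..<\<mu> n} r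
        + c + 2 * c * ((nrm 1 (w n r))\<^sup>2 + 1) + ((1 / c) * (nrm 0 (w n r - u r))\<^sup>2 + c))"
proof -
  define P where "P = c * (indicator {0..<\<mu> n} r * (nrm 0 (v n r))\<^sup>2) + (1 / c + R) * indicator {0..<\<mu> n} r"
  define Q where "Q = c + 2 * c * ((nrm 1 (w n r))\<^sup>2 + 1)"
  have P0: "P \<ge> 0" and Q0: "Q \<ge> 0" using c R_pos by (simp_all add: P_def Q_def)
  define x where "x = v n r - u r"
  have xs: "hs 0 x" "x 0 = 0" using r by (auto simp: x_def hs_diff hs_v hs_u v_zero u_zero)
  have nx: "nrm 0 x \<le> nrm 0 (v n r) + R"
    using hs_diff(2)[OF hs_v[OF r, of n] hs_u[OF r]] u_V0(2)[OF r] by (simp add: x_def)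
  have 1: "norm (Bf x (w n r) k) \<le> lam k * R * (P + Q)"
  proof (cases "r < \<mu> n")
    case True
    have "norm (Bf x (w n r) k) \<le> lam k * (nrm 0 x * nrm 0 (w n r))"
      by (rule norm_Bf_le0) (use r xs hs_w w_zero in auto)
    also have "\<dots> \<le> lam k * ((nrm 0 (v n r) + R) * R)"
      using nx w_R[OF r, of n] R_pos by (intro mult_left_mono mult_mono) auto
    also have "nrm 0 (v n r) + R \<le> P"
      using True r le_square_scaled[OF c, of "nrm 0 (v n r)"] by (simp add: P_def)
    finally have "norm (Bf x (w n r) k) \<le> lam k * (P * R)"
      using R_pos by (simp add: mult_left_mono mult_right_mono)
    also have "\<dots> \<le> lam k * ((P + Q) * R)" using Q0 R_pos by (intro mult_left_mono mult_right_mono) auto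
    finally show ?thesis by (simp add: mult_ac)
  next
    case False
    then have r': "r \<in> {\<mu> n..T}" "r - \<mu> n \<in> {0..T}" using r \<mu>_pos[of n] by auto
    have "nrm 0 (v n r) \<le> R" using shift[OF r'(1)] w_R[OF r'(2)] by simp
    then have nx2: "nrm 0 x \<le> 2 * R" using nx by simp
    have "norm (Bf x (w n r) k) \<le> lam k * (real (card (modes N)) * ((c / (real (card (modes N)) + 1)) * R) + 2 * R * (c * nrm 1 (w n r)))"
      by (rule Bf_split_bound[OF xs nx2 w1 w_zero[OF r] w_R[OF r] N]) (use small r'(1) in \<open>auto simp: x_def\<close>)
    also have "\<dots> \<le> lam k * (c * R + 2 * R * (c * ((nrm 1 (w n r))\<^sup>2 + 1)))"
    proof (intro mult_left_mono add_mono)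
      have "real (card (modes N)) * (c / (real (card (modes N)) + 1)) \<le> c" using c by (simp add: field_simps)
      from mult_right_mono[OF this, of R] show "real (card (modes N)) * ((c / (real (card (modes N)) + 1)) * R) \<le> c * R"
        using R_pos by (simp add: mult_ac)
      show "nrm 1 (w n r) \<le> (nrm 1 (w n r))\<^sup>2 + 1" using le_square_scaled[of 1 "nrm 1 (w n r)"] by simp
    qed (use c R_pos in auto)
    also have "\<dots> = lam k * R * Q" by (simp add: Q_def algebra_simps)
    also have "\<dots> \<le> lam k * R * (P + Q)" using P0 R_pos by (intro mult_left_mono) auto
    finally show ?thesis .
  qed
  have "norm (Bf (u r) (w n r - u r) k) \<le> lam k * (nrm 0 (u r) * nrm 0 (w n r - u r))"
    by (rule norm_Bf_le0) (use r hs_u u_zero w_zero diff_V in auto)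
  also have "\<dots> \<le> lam k * (R * nrm 0 (w n r - u r))" using u_V0(2)[OF r] by (intro mult_left_mono mult_right_mono) auto
  also have "\<dots> \<le> lam k * (R * ((1 / c) * (nrm 0 (w n r - u r))\<^sup>2 + c))"
    using le_square_scaled[of "1 / c" "nrm 0 (w n r - u r)"] c R_pos by (intro mult_left_mono) auto
  finally have 2: "norm (Bf (u r) (w n r - u r) k) \<le> lam k * R * ((1 / c) * (nrm 0 (w n r - u r))\<^sup>2 + c)" by (simp add: mult_ac)
  have "Bf x (w n r) = Bf (v n r) (w n r) - Bf (u r) (w n r)"
    unfolding x_def by (rule Bf_diff_left[OF hs_v[OF r] v_zero[OF r] hs_u[OF r] u_zero[OF r] hs_w[OF r] w_zero[OF r]])
  moreover have "Bf (u r) (w n r - u r) = Bf (u r) (w n r) - Bf (u r) (u r)"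
    by (rule Bf_diff_right[OF hs_u[OF r] u_zero[OF r] hs_u[OF r] u_zero[OF r] hs_w[OF r] w_zero[OF r]])
  ultimately have "Bf (v n r) (w n r) k - Bf (u r) (u r) k = Bf x (w n r) k + Bf (u r) (w n r - u r) k" by simp
  then have "norm (Bf (v n r) (w n r) k - Bf (u r) (u r) k) \<le> norm (Bf x (w n r) k) + norm (Bf (u r) (w n r - u r) k)"
    by (simp add: norm_triangle_ineq)
  also have "\<dots> \<le> lam k * R * (P + Q) + lam k * R * ((1 / c) * (nrm 0 (w n r - u r))\<^sup>2 + c)" by (intro add_mono 1 2)
  also have "\<dots> = lam k * R * (P + Q + ((1 / c) * (nrm 0 (w n r - u r))\<^sup>2 + c))" by (simp add: distrib_left)
  finally show ?thesis by (simp add: P_def Q_def add.assoc)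
qed

lemma conv_B: "(\<lambda>n. LINT r|lebesgue_on {0..T}. norm (Bf (v n r) (w n r) k - Bf (u r) (u r) k)) \<longlonglongrightarrow> 0"
proof (rule LIMSEQ_zero_of_bound)
  define K' where "K' = lam k * R * (K + 1 + R + T + 2 * E + 2 * T + 1 + T)"
  show "K' \<ge> 0" using K_nonneg R_pos T_pos E_nonneg by (simp add: K'_def)
  fix c :: real assume c: "0 < c" "c \<le> 1"
  obtain N where N: "(lam0 * real (Suc N)) powr (0 - 1) \<le> c" using ex_tail1[OF c(1)] by blast
  have d: "c / (real (card (modes N)) + 1) > 0" using c by (simp add: add_nonneg_pos)
  \<comment> \<open>Smallness of order c^2 is asked of the delay and of the L2 distance because both
    come with a factor 1 / c from the scaled squares.\<close>
  have c2: "c\<^sup>2 > 0" using c by simp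
  have "finite ((\<lambda>l. k - l) ` modes N)" by simp
  from shift_small[OF this d] order_tendstoD(2)[OF \<mu>_lim c2] order_tendstoD(2)[OF conv_L2 c2]
  show "\<forall>\<^sub>F n in sequentially. (LINT r|lebesgue_on {0..T}. norm (Bf (v n r) (w n r) k - Bf (u r) (u r) k)) \<le> K' * c"
  proof eventually_elim
    case (elim n)
    define I where "I r = (indicator {0..<\<mu> n} r :: real)" for r
    define J where "J r = indicator {0..<\<mu> n} r * (nrm 0 (v n r))\<^sup>2" for r
    define W where "W r = (nrm 1 (w n r))\<^sup>2" for r
    define Y where "Y r = (nrm 0 (w n r - u r))\<^sup>2" for r
    have iI: "integrable (lebesgue_on {0..T}) I"
      using integrable_indicator_mult[OF cont_integrable[OF continuous_on_const[of "{0..T}" 1]], of "\<mu> n"] by (simp add: I_def[abs_def])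
    have iJ: "integrable (lebesgue_on {0..T}) J" unfolding J_def[abs_def] by (rule J_integrable)
    have iW: "integrable (lebesgue_on {0..T}) W" unfolding W_def[abs_def] by (rule w_int1)
    have iY: "integrable (lebesgue_on {0..T}) Y" unfolding Y_def[abs_def] by (rule diff_int)
    have ic: "integrable (lebesgue_on {0..T}) (\<lambda>r. a)" for a :: real by (intro cont_integrable continuous_intros)
    define G where "G r = c * J r + (1 / c + R) * I r + c + 2 * c * (W r + 1) + ((1 / c) * Y r + c)" for r
    have hb: "has_bochner_integral (lebesgue_on {0..T}) G
        (c * integral\<^sup>L (lebesgue_on {0..T}) J + (1 / c + R) * integral\<^sup>L (lebesgue_on {0..T}) I + T * c
          + 2 * c * (integral\<^sup>L (lebesgue_on {0..T}) W + T * 1) + ((1 / c) * integral\<^sup>L (lebesgue_on {0..T}) Y + T * c))"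
      unfolding G_def lint_const[OF less_imp_le[OF T_pos], symmetric]
      by (intro has_bochner_integral_add has_bochner_integral_mult_right has_bochner_integral_integrable iI iJ iW iY ic)
    have "(LINT r|lebesgue_on {0..T}. norm (Bf (v n r) (w n r) k - Bf (u r) (u r) k)) \<le> (LINT r|lebesgue_on {0..T}. lam k * R * G r)"
    proof (rule integral_mono_AE)
      show "integrable (lebesgue_on {0..T}) (\<lambda>r. norm (Bf (v n r) (w n r) k - Bf (u r) (u r) k))"
        by (intro integrable_norm Bochner_Integration.integrable_diff S.integrable_Bf_vw u_Bf_int)
      show "integrable (lebesgue_on {0..T}) (\<lambda>r. lam k * R * G r)"
        using hb by (intro integrable_mult_right) (simp add: has_bochner_integral_iff)
      show "AE r in lebesgue_on {0..T}. norm (Bf (v n r) (w n r) k - Bf (u r) (u r) k) \<le> lam k * R * G r"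
        using w_V1[of n] AE_space
      proof eventually_elim
        case (elim r)
        then have r: "r \<in> {0..T}" and w1: "hs 1 (w n r)" by (simp_all add: V_iff)
        show ?case unfolding G_def I_def J_def W_def Y_def
          by (rule Bf_diff_bound[OF r w1 c(1) N \<open>\<forall>m\<in>(\<lambda>l. k - l) ` modes N. _\<close>])
      qed
    qed
    also have "\<dots> = lam k * R * integral\<^sup>L (lebesgue_on {0..T}) G" by simp
    also have "\<dots> \<le> lam k * R * ((K + 1 + R + T + 2 * E + 2 * T + 1 + T) * c)"
    proof (rule mult_left_mono)
      have jJ: "integral\<^sup>L (lebesgue_on {0..T}) J \<le> K" unfolding J_def[abs_def] by (rule v_K)
      have "integral\<^sup>L (lebesgue_on {0..T}) I \<le> \<mu> n" unfolding I_def[abs_def] by (rule lint_indicator_le) (use \<mu>_pos[of n] in simp)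
      then have jI: "integral\<^sup>L (lebesgue_on {0..T}) I \<le> c\<^sup>2" using elim(2) by simp
      have jW: "integral\<^sup>L (lebesgue_on {0..T}) W \<le> E" unfolding W_def[abs_def] by (rule w_E)
      have jY: "integral\<^sup>L (lebesgue_on {0..T}) Y \<le> c\<^sup>2" using elim(3) by (simp add: Y_def[abs_def])
      have "integral\<^sup>L (lebesgue_on {0..T}) G \<le> c * K + (1 / c + R) * c\<^sup>2 + T * c + 2 * c * (E + T * 1) + ((1 / c) * c\<^sup>2 + T * c)"
        unfolding has_bochner_integral_integral_eq[OF hb]
        using c R_pos by (intro add_mono mult_left_mono jJ jI jW jY order_refl) auto
      also have "\<dots> = c * K + c + R * (c * c) + T * c + 2 * c * (E + T) + (c + T * c)"
        using c(1) by (simp add: power2_eq_square distrib_right)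
      also have "\<dots> \<le> c * K + c + R * (c * 1) + T * c + 2 * c * (E + T) + (c + T * c)"
        using c R_pos by (intro add_mono mult_left_mono order_refl) auto
      also have "\<dots> = (K + 1 + R + T + 2 * E + 2 * T + 1 + T) * c" by (simp add: algebra_simps)
      finally show "integral\<^sup>L (lebesgue_on {0..T}) G \<le> (K + 1 + R + T + 2 * E + 2 * T + 1 + T) * c" .
    qed (use R_pos in simp)
    finally show ?case by (simp add: K'_def mult_ac)
  qed
qed simp

lemma u_rhs_int: "integrable (lebesgue_on {0..T}) (\<lambda>r. rhs \<nu> f (u r) (u r) k)"
  unfolding rhs_def
  by (intro Bochner_Integration.integrable_diff integrable_scaleR_right u_Bf_int cont_integrable continuous_intros u_cont)

text \<open>Each mode of the right-hand side converges in L1 in time: the viscous part by uniform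
  convergence of the mode, the nonlinear part by \<open>conv_B\<close>.\<close>

lemma weak_limit:
  assumes k: "k \<noteq> 0" and z: "cdot (freq L k) z = 0" and \<psi>: "\<psi> \<in> test_functions T"
  shows "(LINT r|lebesgue_on {0..T}. (u r k \<bullet> z) * deriv \<psi> r) = - (LINT r|lebesgue_on {0..T}. (rhs \<nu> f (u r) (u r) k \<bullet> z) * \<psi> r)"
proof (rule LIMSEQ_unique)
  note L1w = uniform_imp_L1[OF less_imp_le[OF T_pos] u_lim w_cont u_cont]
  show "(\<lambda>n. LINT r|lebesgue_on {0..T}. (w n r k \<bullet> z) * deriv \<psi> r) \<longlonglongrightarrow> (LINT r|lebesgue_on {0..T}. (u r k \<bullet> z) * deriv \<psi> r)"
    by (rule L1_imp_lint_tendsto[OF cont_integrable[OF w_cont] cont_integrable[OF u_cont] test_functionsD(2)[OF \<psi>] L1w])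
  have "(\<lambda>n. LINT r|lebesgue_on {0..T}. norm (rhs \<nu> f (v n r) (w n r) k - rhs \<nu> f (u r) (u r) k)) \<longlonglongrightarrow> 0"
  proof (rule tendsto_sandwich[OF always_eventually[OF allI] always_eventually[OF allI] tendsto_const])
    show "0 \<le> (LINT r|lebesgue_on {0..T}. norm (rhs \<nu> f (v n r) (w n r) k - rhs \<nu> f (u r) (u r) k))" for n by simp
    show "(\<lambda>n. \<nu> * (lam k)\<^sup>2 * (LINT r|lebesgue_on {0..T}. norm (w n r k - u r k))
        + (LINT r|lebesgue_on {0..T}. norm (Bf (v n r) (w n r) k - Bf (u r) (u r) k))) \<longlonglongrightarrow> 0"
      using tendsto_add[OF tendsto_mult_left[OF L1w, of "\<nu> * (lam k)\<^sup>2" k] conv_B[of k]] by simp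
    fix n
    have i1: "integrable (lebesgue_on {0..T}) (\<lambda>r. \<nu> * (lam k)\<^sup>2 * norm (w n r k - u r k))"
      by (intro cont_integrable continuous_intros w_cont u_cont)
    have i2: "integrable (lebesgue_on {0..T}) (\<lambda>r. norm (Bf (v n r) (w n r) k - Bf (u r) (u r) k))"
      by (intro integrable_norm Bochner_Integration.integrable_diff S.integrable_Bf_vw u_Bf_int)
    have "(LINT r|lebesgue_on {0..T}. norm (rhs \<nu> f (v n r) (w n r) k - rhs \<nu> f (u r) (u r) k))
       \<le> (LINT r|lebesgue_on {0..T}. \<nu> * (lam k)\<^sup>2 * norm (w n r k - u r k) + norm (Bf (v n r) (w n r) k - Bf (u r) (u r) k))"
    proof (rule integral_mono)
      fix r
      have "rhs \<nu> f (v n r) (w n r) k - rhs \<nu> f (u r) (u r) k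
        = - ((\<nu> * (lam k)\<^sup>2) *\<^sub>R (w n r k - u r k) + (Bf (v n r) (w n r) k - Bf (u r) (u r) k))"
        by (simp add: rhs_def algebra_simps)
      then have "norm (rhs \<nu> f (v n r) (w n r) k - rhs \<nu> f (u r) (u r) k)
        = norm ((\<nu> * (lam k)\<^sup>2) *\<^sub>R (w n r k - u r k) + (Bf (v n r) (w n r) k - Bf (u r) (u r) k))" by (simp only: norm_minus_cancel)
      also have "\<dots> \<le> norm ((\<nu> * (lam k)\<^sup>2) *\<^sub>R (w n r k - u r k)) + norm (Bf (v n r) (w n r) k - Bf (u r) (u r) k)" by (rule norm_triangle_ineq)
      also have "norm ((\<nu> * (lam k)\<^sup>2) *\<^sub>R (w n r k - u r k)) = \<nu> * (lam k)\<^sup>2 * norm (w n r k - u r k)" using nu_pos by simp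
      finally show "norm (rhs \<nu> f (v n r) (w n r) k - rhs \<nu> f (u r) (u r) k)
        \<le> \<nu> * (lam k)\<^sup>2 * norm (w n r k - u r k) + norm (Bf (v n r) (w n r) k - Bf (u r) (u r) k)" .
    qed (intro integrable_norm Bochner_Integration.integrable_diff Bochner_Integration.integrable_add S.integrable_rhs u_rhs_int i1 i2)+
    then show "(LINT r|lebesgue_on {0..T}. norm (rhs \<nu> f (v n r) (w n r) k - rhs \<nu> f (u r) (u r) k))
      \<le> \<nu> * (lam k)\<^sup>2 * (LINT r|lebesgue_on {0..T}. norm (w n r k - u r k))
        + (LINT r|lebesgue_on {0..T}. norm (Bf (v n r) (w n r) k - Bf (u r) (u r) k))"
      by (simp only: Bochner_Integration.integral_add[OF i1 i2] integral_mult_right_zero)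
  qed
  from tendsto_minus[OF L1_imp_lint_tendsto[OF S.integrable_rhs u_rhs_int test_functionsD(1)[OF \<psi>] this, of z]]
  show "(\<lambda>n. LINT r|lebesgue_on {0..T}. (w n r k \<bullet> z) * deriv \<psi> r) \<longlonglongrightarrow> - (LINT r|lebesgue_on {0..T}. (rhs \<nu> f (u r) (u r) k \<bullet> z) * \<psi> r)"
    by (simp add: S.weak[OF k z \<psi>])
qed

lemma L2_time_u: "u \<in> L2_time L 0 T 0" "u \<in> L2_time L 0 T 1"
proof -
  have a: "AE t in lebesgue_on {0..T}. u t \<in> V L 0" by (rule AE_I2) (simp add: u_V0)
  show "u \<in> L2_time L 0 T 0" by (rule L2_timeI[OF T_pos u_cont u_V0(1) a u_int0]) simp_all
  show "u \<in> L2_time L 0 T 1" by (rule L2_timeI[OF T_pos u_cont u_V0(1) u_V1 u_int1]) simp_all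
qed

lemma tendsto_lint_modes:
  fixes g :: "nat \<Rightarrow> real \<Rightarrow> real"
  assumes g: "\<And>N. integrable (lebesgue_on {0..T}) (g N)" and \<psi>: "continuous_on {0..T} \<psi>"
    and lim: "AE r in lebesgue_on {0..T}. (\<lambda>N. g N r) \<longlonglongrightarrow> h r"
    and b: "integrable (lebesgue_on {0..T}) b" "\<And>N. AE r in lebesgue_on {0..T}. \<bar>g N r\<bar> \<le> b r"
  shows "(\<lambda>N. LINT r|lebesgue_on {0..T}. g N r * \<psi> r) \<longlonglongrightarrow> (LINT r|lebesgue_on {0..T}. h r * \<psi> r)"
proof (rule integral_dominated_convergence[where w="\<lambda>r. b r * \<bar>\<psi> r\<bar>"])
  have "h \<in> borel_measurable (lebesgue_on {0..T})"
    by (rule borel_measurable_LIMSEQ_AE[OF _ borel_measurable_integrable[OF g] lim]) simp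
  moreover have "\<psi> \<in> borel_measurable (lebesgue_on {0..T})"
    by (rule continuous_imp_measurable_on_sets_lebesgue[OF \<psi>]) simp
  ultimately show "(\<lambda>r. h r * \<psi> r) \<in> borel_measurable (lebesgue_on {0..T})" by (rule borel_measurable_times)
  show "(\<lambda>r. g N r * \<psi> r) \<in> borel_measurable (lebesgue_on {0..T})" for N
    by (rule borel_measurable_integrable[OF integrable_times_cont[OF g \<psi>]])
  show "integrable (lebesgue_on {0..T}) (\<lambda>r. b r * \<bar>\<psi> r\<bar>)"
    by (rule integrable_times_cont[OF b(1)]) (intro continuous_intros \<psi>)
  show "AE r in lebesgue_on {0..T}. (\<lambda>N. g N r * \<psi> r) \<longlonglongrightarrow> h r * \<psi> r"
    using lim by eventually_elim (intro tendsto_mult_right)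
  show "AE r in lebesgue_on {0..T}. norm (g N r * \<psi> r) \<le> b r * \<bar>\<psi> r\<bar>" for N
    using b(2)[of N] by eventually_elim (simp add: abs_mult mult_right_mono)
qed

lemma sum_modes_pairing_le:
  assumes "hs (- s) x" "hs s y"
  shows "\<bar>\<Sum>k\<in>modes N. x k \<bullet> y k\<bar> \<le> nrm (- s) x * nrm s y"
proof -
  have "\<bar>\<Sum>k\<in>modes N. x k \<bullet> y k\<bar> \<le> (\<Sum>k\<in>modes N. norm (x k) * norm (y k))"
    by (rule order_trans[OF sum_abs]) (intro sum_mono Cauchy_Schwarz_ineq2)
  also have "\<dots> \<le> (\<Sum>\<^sub>\<infinity>k\<in>- {0}. norm (x k) * norm (y k))"
    by (rule finite_sum_le_infsum[OF pairing_sum(1)[OF assms]]) auto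
  also have "\<dots> \<le> nrm (- s) x * nrm s y" by (rule pairing_sum(2)[OF assms])
  finally show ?thesis .
qed

text \<open>Summing the single-mode identities with the coefficients of e as directions gives the
  identity for truncated pairings. The cutoff is then removed by dominated convergence; the
  nonlinear majorant is a multiple of the squared V^1 norm of u, which is integrable.\<close>

lemma ns_identity:
  assumes e: "e \<in> V L 1" and \<psi>: "\<psi> \<in> test_functions T"
  shows "- (LINT r|lebesgue_on {0..T}. pairing L (u r) e * deriv \<psi> r)
        + \<nu> * (LINT r|lebesgue_on {0..T}. pairing L (stokes_pow L (1/2) (u r)) (stokes_pow L (1/2) e) * \<psi> r)
        + (LINT r|lebesgue_on {0..T}. pairing L (B_op L 1 0 1 (u r) (u r)) e * \<psi> r)
        = (LINT r|lebesgue_on {0..T}. pairing L f e * \<psi> r)"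
proof -
  have c\<psi>: "continuous_on {0..T} \<psi>" "continuous_on {0..T} (deriv \<psi>)" using test_functionsD[OF \<psi>] by auto
  have he: "hs 1 e" "hs 0 e" "solenoidal L e" using e V_mono[OF e, of 0] by (auto simp: V_iff)
  define A where "A N r = L ^ 3 * (\<Sum>k\<in>modes N. u r k \<bullet> e k)" for N r
  define S where "S N r = L ^ 3 * (\<Sum>k\<in>modes N. (lam k)\<^sup>2 * (u r k \<bullet> e k))" for N r
  define B where "B N r = L ^ 3 * (\<Sum>k\<in>modes N. Bf (u r) (u r) k \<bullet> e k)" for N r
  define F where "F N = L ^ 3 * (\<Sum>k\<in>modes N. f k \<bullet> e k)" for N
  have iA: "integrable (lebesgue_on {0..T}) (A N)" for N
    unfolding A_def[abs_def] by (intro cont_integrable continuous_intros u_cont)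
  have iS: "integrable (lebesgue_on {0..T}) (S N)" for N
    unfolding S_def[abs_def] by (intro cont_integrable continuous_intros u_cont)
  have iB: "integrable (lebesgue_on {0..T}) (B N)" for N
    unfolding B_def[abs_def] by (intro integrable_mult_right Bochner_Integration.integrable_sum integrable_inner_left u_Bf_int)
  have iF: "integrable (lebesgue_on {0..T}) (\<lambda>r. F N)" for N
    by (intro cont_integrable continuous_intros)
  have st: "stokes_pow L (1/2) x = (\<lambda>k. lam k *\<^sub>R x k)" for x by (simp add: stokes_pow_def lam_def)
  have hst: "hs 0 (stokes_pow L (1/2) x) \<and> nrm 0 (stokes_pow L (1/2) x) = nrm 1 x" if "hs 1 x" for x
  proof -
    have eq: "coef 0 (stokes_pow L (1/2) x) = coef 1 x" by (auto simp: st coef_def fun_eq_iff)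
    show ?thesis using that unfolding hs_def nrm_def eq by simp
  qed
  have fin: "(LINT r|lebesgue_on {0..T}. A N r * deriv \<psi> r)
      = \<nu> * (LINT r|lebesgue_on {0..T}. S N r * \<psi> r) + (LINT r|lebesgue_on {0..T}. B N r * \<psi> r) - (LINT r|lebesgue_on {0..T}. F N * \<psi> r)" for N
  proof -
    have ik: "integrable (lebesgue_on {0..T}) (\<lambda>r. (u r k \<bullet> e k) * deriv \<psi> r)" for k
      by (intro cont_integrable continuous_intros u_cont c\<psi>)
    have ir: "integrable (lebesgue_on {0..T}) (\<lambda>r. (rhs \<nu> f (u r) (u r) k \<bullet> e k) * \<psi> r)" for k
      by (intro integrable_times_cont integrable_inner_left u_rhs_int c\<psi>)
    have "(LINT r|lebesgue_on {0..T}. A N r * deriv \<psi> r) = (LINT r|lebesgue_on {0..T}. L ^ 3 * (\<Sum>k\<in>modes N. (u r k \<bullet> e k) * deriv \<psi> r))"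
      by (simp add: A_def sum_distrib_right mult.assoc)
    also have "\<dots> = L ^ 3 * (\<Sum>k\<in>modes N. LINT r|lebesgue_on {0..T}. (u r k \<bullet> e k) * deriv \<psi> r)"
      by (subst integral_mult_right_zero, subst Bochner_Integration.integral_sum) (auto intro: ik)
    also have "\<dots> = L ^ 3 * (\<Sum>k\<in>modes N. - (LINT r|lebesgue_on {0..T}. (rhs \<nu> f (u r) (u r) k \<bullet> e k) * \<psi> r))"
    proof (intro arg_cong[where f="\<lambda>x. L ^ 3 * x"] sum.cong refl weak_limit[OF _ _ \<psi>])
      show "k \<noteq> 0" if "k \<in> modes N" for k using that by auto
      show "cdot (freq L k) (e k) = 0" for k using he(3) by (rule solenoidalD(3))
    qed
    also have "\<dots> = - (LINT r|lebesgue_on {0..T}. L ^ 3 * (\<Sum>k\<in>modes N. (rhs \<nu> f (u r) (u r) k \<bullet> e k) * \<psi> r))"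
      by (subst integral_mult_right_zero, subst Bochner_Integration.integral_sum) (auto intro: ir simp: sum_negf)
    also have "(LINT r|lebesgue_on {0..T}. L ^ 3 * (\<Sum>k\<in>modes N. (rhs \<nu> f (u r) (u r) k \<bullet> e k) * \<psi> r))
       = (LINT r|lebesgue_on {0..T}. F N * \<psi> r - \<nu> * (S N r * \<psi> r) - B N r * \<psi> r)"
    proof (intro Bochner_Integration.integral_cong refl)
      fix r
      have "L ^ 3 * (\<Sum>k\<in>modes N. rhs \<nu> f (u r) (u r) k \<bullet> e k) = F N - \<nu> * S N r - B N r"
        by (simp add: rhs_def inner_diff_left sum_subtractf F_def S_def B_def right_diff_distrib sum_distrib_left mult_ac)
      then show "L ^ 3 * (\<Sum>k\<in>modes N. (rhs \<nu> f (u r) (u r) k \<bullet> e k) * \<psi> r) = F N * \<psi> r - \<nu> * (S N r * \<psi> r) - B N r * \<psi> r"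
        by (simp add: sum_distrib_right[symmetric] mult.assoc[symmetric] left_diff_distrib)
    qed
    also have "\<dots> = (LINT r|lebesgue_on {0..T}. F N * \<psi> r) - \<nu> * (LINT r|lebesgue_on {0..T}. S N r * \<psi> r) - (LINT r|lebesgue_on {0..T}. B N r * \<psi> r)"
    proof -
      have j1: "integrable (lebesgue_on {0..T}) (\<lambda>r. F N * \<psi> r)" by (intro integrable_times_cont iF c\<psi>)
      have j2: "integrable (lebesgue_on {0..T}) (\<lambda>r. \<nu> * (S N r * \<psi> r))" by (intro integrable_mult_right integrable_times_cont iS c\<psi>)
      have j3: "integrable (lebesgue_on {0..T}) (\<lambda>r. B N r * \<psi> r)" by (intro integrable_times_cont iB c\<psi>)
      show ?thesis
        by (simp only: Bochner_Integration.integral_diff[OF Bochner_Integration.integrable_diff[OF j1 j2] j3]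
            Bochner_Integration.integral_diff[OF j1 j2] integral_mult_right_zero)
    qed
    finally show ?thesis by simp
  qed
  have lA: "(\<lambda>N. LINT r|lebesgue_on {0..T}. A N r * deriv \<psi> r) \<longlonglongrightarrow> (LINT r|lebesgue_on {0..T}. pairing L (u r) e * deriv \<psi> r)"
  proof (rule tendsto_lint_modes[OF iA c\<psi>(2)])
    show "AE r in lebesgue_on {0..T}. (\<lambda>N. A N r) \<longlonglongrightarrow> pairing L (u r) e"
      unfolding A_def by (intro AE_I2 pairing_modes[where s=0]) (use hs_u he in auto)
    show "integrable (lebesgue_on {0..T}) (\<lambda>r. L ^ 3 * (R * nrm 0 e))" by (intro cont_integrable continuous_intros)
    show "AE r in lebesgue_on {0..T}. \<bar>A N r\<bar> \<le> L ^ 3 * (R * nrm 0 e)" for N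
    proof (rule AE_I2)
      fix r assume "r \<in> space (lebesgue_on {0..T})"
      then have r: "r \<in> {0..T}" by simp
      have "\<bar>\<Sum>k\<in>modes N. u r k \<bullet> e k\<bar> \<le> nrm 0 (u r) * nrm 0 e"
        using sum_modes_pairing_le[of 0 "u r" e N] hs_u[OF r] he(2) by simp
      also have "\<dots> \<le> R * nrm 0 e" by (intro mult_right_mono u_V0(2) r) simp
      finally show "\<bar>A N r\<bar> \<le> L ^ 3 * (R * nrm 0 e)" using L_pos by (simp add: A_def abs_mult)
    qed
  qed
  have lS: "(\<lambda>N. LINT r|lebesgue_on {0..T}. S N r * \<psi> r)
      \<longlonglongrightarrow> (LINT r|lebesgue_on {0..T}. pairing L (stokes_pow L (1/2) (u r)) (stokes_pow L (1/2) e) * \<psi> r)"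
  proof (rule tendsto_lint_modes[OF iS c\<psi>(1)])
    have S': "S N r = L ^ 3 * (\<Sum>k\<in>modes N. stokes_pow L (1/2) (u r) k \<bullet> stokes_pow L (1/2) e k)" for N r
      by (simp add: S_def st power2_eq_square mult_ac)
    show "AE r in lebesgue_on {0..T}. (\<lambda>N. S N r) \<longlonglongrightarrow> pairing L (stokes_pow L (1/2) (u r)) (stokes_pow L (1/2) e)"
      using u_V1 unfolding S'
    proof eventually_elim
      case (elim r)
      show ?case by (rule pairing_modes[where s=0]) (use hst elim he in \<open>auto simp: V_iff\<close>)
    qed
    show "integrable (lebesgue_on {0..T}) (\<lambda>r. L ^ 3 * (nrm 1 e * ((nrm 1 (u r))\<^sup>2 + 1)))"
      by (intro integrable_mult_right Bochner_Integration.integrable_add u_int1 cont_integrable continuous_intros)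
    show "AE r in lebesgue_on {0..T}. \<bar>S N r\<bar> \<le> L ^ 3 * (nrm 1 e * ((nrm 1 (u r))\<^sup>2 + 1))" for N
      using u_V1
    proof eventually_elim
      case (elim r)
      then have h: "hs 1 (u r)" by (simp add: V_iff)
      have "\<bar>\<Sum>k\<in>modes N. stokes_pow L (1/2) (u r) k \<bullet> stokes_pow L (1/2) e k\<bar> \<le> nrm 1 (u r) * nrm 1 e"
        using sum_modes_pairing_le[of 0 "stokes_pow L (1/2) (u r)" "stokes_pow L (1/2) e" N] hst[OF h] hst[OF he(1)] by simp
      also have "\<dots> \<le> ((nrm 1 (u r))\<^sup>2 + 1) * nrm 1 e"
        using le_square_scaled[of 1 "nrm 1 (u r)"] by (intro mult_right_mono) auto
      finally show ?case using L_pos by (simp add: S' abs_mult mult_ac)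
    qed
  qed
  have lB: "(\<lambda>N. LINT r|lebesgue_on {0..T}. B N r * \<psi> r) \<longlonglongrightarrow> (LINT r|lebesgue_on {0..T}. pairing L (B_op L 1 0 1 (u r) (u r)) e * \<psi> r)"
  proof (rule tendsto_lint_modes[OF iB c\<psi>(1)])
    show "AE r in lebesgue_on {0..T}. (\<lambda>N. B N r) \<longlonglongrightarrow> pairing L (B_op L 1 0 1 (u r) (u r)) e"
      using u_V1
    proof eventually_elim
      case (elim r)
      have "B_op L 1 0 1 (u r) (u r) = Bf (u r) (u r)" by (rule B_op_eq) (use elim in auto)
      moreover have "hs (- 1) (Bf (u r) (u r))" using Bf_V[OF elim elim] by (simp add: V_iff)
      ultimately show ?case unfolding B_def using pairing_modes[of 1 "Bf (u r) (u r)" e] he(1) by simp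
    qed
    show "integrable (lebesgue_on {0..T}) (\<lambda>r. L ^ 3 * (KB * nrm 1 e * (nrm 1 (u r))\<^sup>2))"
      by (intro integrable_mult_right u_int1)
    show "AE r in lebesgue_on {0..T}. \<bar>B N r\<bar> \<le> L ^ 3 * (KB * nrm 1 e * (nrm 1 (u r))\<^sup>2)" for N
      using u_V1
    proof eventually_elim
      case (elim r)
      have h: "hs (- 1) (Bf (u r) (u r))" "nrm (- 1) (Bf (u r) (u r)) \<le> KB * (nrm 1 (u r) * nrm 1 (u r))"
        using Bf_pq[of 1 1 "u r" "u r"] elim by (auto simp: V_iff dest: solenoidalD(1))
      have "\<bar>\<Sum>k\<in>modes N. Bf (u r) (u r) k \<bullet> e k\<bar> \<le> nrm (- 1) (Bf (u r) (u r)) * nrm 1 e"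
        by (rule sum_modes_pairing_le[OF h(1) he(1)])
      also have "\<dots> \<le> KB * (nrm 1 (u r) * nrm 1 (u r)) * nrm 1 e" by (intro mult_right_mono h(2)) simp
      finally show ?case using L_pos by (simp add: B_def abs_mult power2_eq_square mult_ac)
    qed
  qed
  have lF: "(\<lambda>N. LINT r|lebesgue_on {0..T}. F N * \<psi> r) \<longlonglongrightarrow> (LINT r|lebesgue_on {0..T}. pairing L f e * \<psi> r)"
  proof -
    have "F \<longlonglongrightarrow> pairing L f e" unfolding F_def by (rule pairing_modes[where s=1]) (use f_V1 he in \<open>auto simp: V_iff\<close>)
    then show ?thesis by (simp add: tendsto_mult_right)
  qed
  have "(\<lambda>N. LINT r|lebesgue_on {0..T}. A N r * deriv \<psi> r) \<longlonglongrightarrow>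
      \<nu> * (LINT r|lebesgue_on {0..T}. pairing L (stokes_pow L (1/2) (u r)) (stokes_pow L (1/2) e) * \<psi> r)
        + (LINT r|lebesgue_on {0..T}. pairing L (B_op L 1 0 1 (u r) (u r)) e * \<psi> r) - (LINT r|lebesgue_on {0..T}. pairing L f e * \<psi> r)"
    unfolding fin by (intro tendsto_intros lS lB lF)
  from LIMSEQ_unique[OF lA this] show ?thesis by simp
qed

lemma ns_weak: "ns_weak_solution L \<nu> f T u"
  unfolding ns_weak_solution_def using L2_time_u(2) ns_identity by blast

end

section \<open>The bound on the history and the assembly of the result\<close>

context torus
begin

text \<open>A change of variables carries the integral to the history interval, where the solution
  agrees with the prescribed data almost everywhere; the Poincare inequality then passes from V^0 to
  the norm in which these data are bounded.\<close>

lemma delay_part_bound: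
  assumes \<alpha>: "\<alpha> > 1/2" and T: "T > 0" and \<mu>: "\<mu> > 0"
    and u: "u \<in> L2_time L (- \<mu>) T (1 + \<alpha>)" and \<phi>: "\<phi> \<in> L2_time L (- \<mu>) 0 (1 + \<alpha>)"
    and u\<phi>: "AE t in lebesgue_on {- \<mu>..<0}. u t = \<phi> t"
    and v: "\<And>t. t \<in> {0..<\<mu>} \<Longrightarrow> v t = u (t - \<mu>) \<or> v t = (\<lambda>_. 0)"
    and vi: "integrable (lebesgue_on {0..T}) (\<lambda>t. (nrm 0 (v t))\<^sup>2)"
  shows "(LINT r|lebesgue_on {0..T}. indicator {0..<\<mu>} r * (nrm 0 (v r))\<^sup>2)
    \<le> (lam0 powr (- (1 + \<alpha>)))\<^sup>2 / L ^ 3 * (L2_time_norm L (- \<mu>) 0 (1 + \<alpha>) \<phi>)\<^sup>2"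
proof -
  note uD = L2_timeD[OF u] and \<phi>D = L2_timeD[OF \<phi>]
  have nz: "nrm 0 (\<lambda>_. 0) = 0" by (simp add: nrm_def coef_def l2n_def)
  have ui: "integrable (lebesgue_on {- \<mu>..T}) (\<lambda>t. (nrm 0 (u t))\<^sup>2)"
    by (rule integrable_nrm_mono[OF _ uD(2,1,3)]) (use \<alpha> in auto)
  have "(LINT r|lebesgue_on {0..T}. indicator {0..<\<mu>} r * (nrm 0 (v r))\<^sup>2) \<le> (LINT r|lebesgue_on {0..T}. indicator {0..<\<mu>} r * (nrm 0 (u (r - \<mu>)))\<^sup>2)"
  proof (rule integral_mono)
    show "integrable (lebesgue_on {0..T}) (\<lambda>r. indicator {0..<\<mu>} r * (nrm 0 (v r))\<^sup>2)" by (rule integrable_indicator_mult[OF vi])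
    show "integrable (lebesgue_on {0..T}) (\<lambda>r. indicator {0..<\<mu>} r * (nrm 0 (u (r - \<mu>)))\<^sup>2)"
      by (rule integrable_indicator_mult[OF integrable_shift[OF ui]]) (use \<mu> in simp)
    show "indicator {0..<\<mu>} r * (nrm 0 (v r))\<^sup>2 \<le> indicator {0..<\<mu>} r * (nrm 0 (u (r - \<mu>)))\<^sup>2" for r
    proof (cases "r \<in> {0..<\<mu>}")
      case True
      from v[OF True] have "(nrm 0 (v r))\<^sup>2 \<le> (nrm 0 (u (r - \<mu>)))\<^sup>2" using nz by auto
      then show ?thesis using True by simp
    qed simp
  qed
  also have "\<dots> \<le> (LINT r|lebesgue_on {- \<mu>..0}. (nrm 0 (u r))\<^sup>2)"
    by (rule integral_shift_le[OF ui]) (use \<mu> T in auto)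
  also have "\<dots> = (LINT r|lebesgue_on {- \<mu>..0}. (nrm 0 (\<phi> r))\<^sup>2)"
  proof (rule lint_cong_AE)
    have \<phi>i: "integrable (lebesgue_on {- \<mu>..0}) (\<lambda>t. (nrm 0 (\<phi> t))\<^sup>2)"
      by (rule integrable_nrm_mono[OF _ \<phi>D(2,1,3)]) (use \<alpha> in auto)
    then show "(\<lambda>t. (nrm 0 (\<phi> t))\<^sup>2) \<in> borel_measurable (lebesgue_on {- \<mu>..0})" by (rule borel_measurable_integrable)
    have "AE t in lebesgue. t \<in> {- \<mu>..<0} \<longrightarrow> u t = \<phi> t" using u\<phi> by (simp add: AE_restrict_space_iff)
    moreover have "AE t in lebesgue. t \<noteq> (0 :: real)" by (rule AE_completion[OF AE_lborel_singleton])
    ultimately have "AE t in lebesgue. t \<in> {- \<mu>..0} \<longrightarrow> (nrm 0 (u t))\<^sup>2 = (nrm 0 (\<phi> t))\<^sup>2"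
      by eventually_elim auto
    then show "AE t in lebesgue_on {- \<mu>..0}. (nrm 0 (u t))\<^sup>2 = (nrm 0 (\<phi> t))\<^sup>2" by (simp add: AE_restrict_space_iff)
  qed simp
  also have "\<dots> \<le> (LINT r|lebesgue_on {- \<mu>..0}. (lam0 powr (- (1 + \<alpha>)))\<^sup>2 * (nrm (1 + \<alpha>) (\<phi> r))\<^sup>2)"
  proof (rule integral_mono_AE)
    show "integrable (lebesgue_on {- \<mu>..0}) (\<lambda>t. (nrm 0 (\<phi> t))\<^sup>2)"
      by (rule integrable_nrm_mono[OF _ \<phi>D(2,1,3)]) (use \<alpha> in auto)
    show "integrable (lebesgue_on {- \<mu>..0}) (\<lambda>r. (lam0 powr (- (1 + \<alpha>)))\<^sup>2 * (nrm (1 + \<alpha>) (\<phi> r))\<^sup>2)"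
      by (rule integrable_mult_right[OF \<phi>D(3)])
    show "AE r in lebesgue_on {- \<mu>..0}. (nrm 0 (\<phi> r))\<^sup>2 \<le> (lam0 powr (- (1 + \<alpha>)))\<^sup>2 * (nrm (1 + \<alpha>) (\<phi> r))\<^sup>2"
      using \<phi>D(1)
    proof eventually_elim
      case (elim r)
      have "nrm 0 (\<phi> r) \<le> lam0 powr (0 - (1 + \<alpha>)) * nrm (1 + \<alpha>) (\<phi> r)"
        by (rule hs_mono(2)) (use elim \<alpha> in \<open>auto simp: V_iff\<close>)
      from power_mono[OF this nrm_nonneg, of 2] show ?case by (simp add: power_mult_distrib)
    qed
  qed
  also have "\<dots> = (lam0 powr (- (1 + \<alpha>)))\<^sup>2 / L ^ 3 * (L2_time_norm L (- \<mu>) 0 (1 + \<alpha>) \<phi>)\<^sup>2"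
    using L_pos by (simp add: L2_time_norm_def Vnorm_sq)
  finally show ?thesis .
qed

lemma pairing_tendsto_trig:
  assumes "\<And>k. (\<lambda>n. x n k) \<longlonglongrightarrow> y k" "e \<in> trig_poly L"
  shows "(\<lambda>n. pairing L (x n) e) \<longlonglongrightarrow> pairing L y e"
proof -
  have "pairing L z e = L ^ 3 * (\<Sum>k | e k \<noteq> 0. z k \<bullet> e k)" for z
    by (rule pairing_finite) (use assms(2) in \<open>auto simp: trig_poly_def solenoidal_def\<close>)
  then show ?thesis by (simp only:) (intro tendsto_intros assms(1))
qed

lemma delay_limit_convergence:
  assumes lim: "delay_limit L \<nu> \<alpha> T f w v \<mu> R E K u"
    and rep: "\<And>n. AE t in lebesgue_on {0..T}. U n t = w n t" and s: "s > 0"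
  shows "converges_L2_time L 0 T 0 U u" "converges_C_time L 0 T (- s) U u"
proof -
  interpret D: delay_limit L \<nu> \<alpha> T f w v \<mu> R E K u by (rule lim)
  have "AE t in lebesgue_on {0..T}. w n t \<in> V L 0" for n by (rule AE_I2) (simp add: D.S.w_V0)
  then have UL: "U n \<in> L2_time L 0 T 0" for n
    by (intro L2_timeI[OF D.T_pos D.w_cont _ _ _ rep]) (use D.S.w_V0 D.S.integrable_lower(1)[of 0 n] D.alpha_gt in auto)
  have n: "L2_time_norm L 0 T 0 (\<lambda>t. U n t - u t) = sqrt (L ^ 3 * (LINT r|lebesgue_on {0..T}. (nrm 0 (w n r - u r))\<^sup>2))" for n
  proof -
    have "(LINT t|lebesgue_on {0..T}. (Vnorm L 0 (U n t - u t))\<^sup>2) = (LINT t|lebesgue_on {0..T}. L ^ 3 * (nrm 0 (w n t - u t))\<^sup>2)"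
    proof (rule lint_cong_AE)
      show "(\<lambda>t. L ^ 3 * (nrm 0 (w n t - u t))\<^sup>2) \<in> borel_measurable (lebesgue_on {0..T})"
        by (rule borel_measurable_integrable[OF integrable_mult_right[OF D.diff_int]])
      show "AE t in lebesgue_on {0..T}. (Vnorm L 0 (U n t - u t))\<^sup>2 = L ^ 3 * (nrm 0 (w n t - u t))\<^sup>2"
        using rep[of n] by eventually_elim (simp add: Vnorm_sq)
    qed simp
    then show ?thesis by (simp add: L2_time_norm_def)
  qed
  have "(\<lambda>n. L2_time_norm L 0 T 0 (\<lambda>t. U n t - u t)) \<longlonglongrightarrow> sqrt (L ^ 3 * 0)"
    unfolding n by (intro tendsto_intros D.conv_L2)
  then show "converges_L2_time L 0 T 0 U u"
    using UL D.L2_time_u(1) by (simp add: converges_L2_time_def)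
  have "C_representative L 0 T (- s) (U n) (w n)" for n
    using C_time_neg[OF s D.w_cont D.S.w_V0 D.R_pos D.w_R] rep[of n] by (simp add: C_representative_def)
  moreover have "u \<in> C_time L 0 T (- s)"
    by (rule C_time_neg[OF s D.u_cont D.u_V0(1) D.R_pos D.u_V0(2)])
  ultimately show "converges_C_time L 0 T (- s) U u"
    unfolding converges_C_time_def using D.conv_C[OF s] by blast
qed

end

theorem theorem6p1:
  fixes L \<nu> \<alpha> T s :: real
    and \<mu> :: "nat \<Rightarrow> real"
    and \<phi> :: "nat \<Rightarrow> real \<Rightarrow> coeffs"
    and u0n :: "nat \<Rightarrow> coeffs"
    and u0 f :: coeffs
    and un :: "nat \<Rightarrow> real \<Rightarrow> coeffs"
  assumes "L > 0" and "\<nu> > 0" and "\<alpha> > 1/2" and "T > 0" and "s > 3/2"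
    and "\<And>n. \<mu> n > 0" and "\<mu> \<longlonglongrightarrow> 0"
    and "\<And>n. \<phi> n \<in> L2_time L (- \<mu> n) 0 (1 + \<alpha>)"
    and "bdd_above (range (\<lambda>n. L2_time_norm L (- \<mu> n) 0 (1 + \<alpha>) (\<phi> n)))"
    and "\<And>n. u0n n \<in> V L \<alpha>"
    and "u0 \<in> V L 0"
    and "weakly_converges_V0 L u0n u0"
    and "f \<in> V L (\<alpha> - 1)"
    and "\<And>n. delay_weak_solution L \<nu> \<alpha> f T (\<mu> n) (\<phi> n) (u0n n) (un n)"
  shows "\<exists>(\<sigma> :: nat \<Rightarrow> nat) u.
           strict_mono \<sigma> \<and>
           converges_L2_time L 0 T 0 (\<lambda>n. un (\<sigma> n)) u \<and>
           converges_C_time L 0 T (- s) (\<lambda>n. un (\<sigma> n)) u \<and>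
           ns_weak_solution L \<nu> f T u \<and>
           u 0 = u0"
proof -
  interpret torus L by standard (rule assms(1))
  define P where "P n w v \<longleftrightarrow> delay_solution L \<nu> \<alpha> T f w v \<and> C_representative L 0 T \<alpha> (un n) w \<and> w 0 = u0n n \<and>
    (\<forall>t\<in>{\<mu> n..T}. v t = w (t - \<mu> n)) \<and> (\<forall>t\<in>{0..<\<mu> n}. v t = un n (t - \<mu> n) \<or> v t = (\<lambda>_. 0))" for n w v
  have "\<exists>w v. P n w v" for n
    using delay_weak_solution_imp[OF assms(2,3,4) assms(6)[of n] assms(13) assms(14)[of n]] unfolding P_def by metis
  then obtain w v where P: "\<And>n. P n (w n) (v n)" by metis
  have sol: "delay_solution L \<nu> \<alpha> T f (w n) (v n)" for n using P[of n] by (simp add: P_def)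
  have rep: "AE t in lebesgue_on {0..T}. un n t = w n t" for n using P[of n] by (simp add: P_def C_representative_def)
  have w0: "w n 0 = u0n n" for n using P[of n] by (simp add: P_def)
  \<comment> \<open>The energies of the initial data are bounded although only weak convergence is
    assumed.\<close>
  obtain C where C: "C > 0" "\<And>n. nrm 0 (u0n n) \<le> C" using weakly_converges_bounded[OF assms(12)] by blast
  obtain M where M: "\<And>n. L2_time_norm L (- \<mu> n) 0 (1 + \<alpha>) (\<phi> n) \<le> M" using assms(9) by (auto simp: bdd_above_def)
  define E where "E = C\<^sup>2 + T / \<nu> * (nrm (- 1) f)\<^sup>2"
  have E: "E \<ge> 0" using assms by (simp add: E_def)
  have E0: "delay_solution.E0 L \<nu> T f (w n) \<le> E" for n
    unfolding delay_solution.E0_def[OF sol] E_def w0 using power_mono[OF C(2), of n 2] by simp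
  define K where "K = (lam0 powr (- (1 + \<alpha>)))\<^sup>2 / L ^ 3 * M\<^sup>2"
  \<comment> \<open>The added 1 makes the bound R positive even when E = 0.\<close>
  have seq: "delay_sequence L \<nu> \<alpha> T f w v \<mu> (sqrt E + 1) (E / \<nu>) K"
  proof (intro delay_sequence.intro delay_sequence_axioms.intro)
    fix n
    interpret S: delay_solution L \<nu> \<alpha> T f "w n" "v n" by (rule sol)
    show "v n t = w n (t - \<mu> n)" if "t \<in> {\<mu> n..T}" for t using P[of n] that by (simp add: P_def)
    show "nrm 0 (w n t) \<le> sqrt E + 1" if "t \<in> {0..T}" for t
    proof -
      have "nrm 0 (w n t) \<le> sqrt S.E0" by (rule S.energy0[OF that])
      also have "\<dots> \<le> sqrt E" using E0 by simp
      finally show ?thesis by simp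
    qed
    show "(LINT r|lebesgue_on {0..T}. (nrm 1 (w n r))\<^sup>2) \<le> E / \<nu>"
      by (rule order_trans[OF S.energy1 divide_right_mono[OF E0]]) (use assms(2) in simp)
    have "(LINT r|lebesgue_on {0..T}. indicator {0..<\<mu> n} r * (nrm 0 (v n r))\<^sup>2)
        \<le> (lam0 powr (- (1 + \<alpha>)))\<^sup>2 / L ^ 3 * (L2_time_norm L (- \<mu> n) 0 (1 + \<alpha>) (\<phi> n))\<^sup>2"
    proof (rule delay_part_bound[OF assms(3,4) assms(6)[of n] _ assms(8)[of n]])
      show "un n \<in> L2_time L (- \<mu> n) T (1 + \<alpha>)" "AE t in lebesgue_on {- \<mu> n..<0}. un n t = \<phi> n t"
        using assms(14)[of n] by (simp_all add: delay_weak_solution_def)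
      show "v n t = un n (t - \<mu> n) \<or> v n t = (\<lambda>_. 0)" if "t \<in> {0..<\<mu> n}" for t using P[of n] that by (simp add: P_def)
      show "integrable (lebesgue_on {0..T}) (\<lambda>t. (nrm 0 (v n t))\<^sup>2)" by (rule S.integrable_lower) (use assms(3) in simp)
    qed
    also have "\<dots> \<le> K"
      unfolding K_def using M[of n] L_pos
      by (intro mult_left_mono power_mono) (auto simp: L2_time_norm_def)
    finally show "(LINT r|lebesgue_on {0..T}. indicator {0..<\<mu> n} r * (nrm 0 (v n r))\<^sup>2) \<le> K" .
  next
    show "sqrt E + 1 > 0" using E by (simp add: add_nonneg_pos)
    show "E / \<nu> \<ge> 0" using E assms(2) by simp
    show "K \<ge> 0" using L_pos by (simp add: K_def)
  qed (fact torus_axioms sol assms(6,7))+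
  then obtain \<sigma> u where \<sigma>: "strict_mono (\<sigma> :: nat \<Rightarrow> nat)"
    and lim: "\<And>k. uniform_limit {0..T} (\<lambda>n t. w (\<sigma> n) t k) (\<lambda>t. u t k) sequentially"
    using delay_sequence.convergent_subsequence by blast
  interpret D: delay_sequence L \<nu> \<alpha> T f w v \<mu> "sqrt E + 1" "E / \<nu>" K by (rule seq)
  have dl: "delay_limit L \<nu> \<alpha> T f (\<lambda>n. w (\<sigma> n)) (\<lambda>n. v (\<sigma> n)) (\<lambda>n. \<mu> (\<sigma> n)) (sqrt E + 1) (E / \<nu>) K u"
    by (intro delay_limit.intro delay_sequence.intro delay_sequence_axioms.intro delay_limit_axioms.intro torus_axioms)
       (use D.sols D.\<mu>_pos D.shift D.R_pos D.w_R D.E_nonneg D.w_E D.K_nonneg D.v_K lim LIMSEQ_subseq_LIMSEQ[OF D.\<mu>_lim \<sigma>] in \<open>auto simp: o_def\<close>)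
  interpret N: delay_limit L \<nu> \<alpha> T f "\<lambda>n. w (\<sigma> n)" "\<lambda>n. v (\<sigma> n)" "\<lambda>n. \<mu> (\<sigma> n)" "sqrt E + 1" "E / \<nu>" K u by (rule dl)
  \<comment> \<open>At time 0 the approximations are the initial data: their modes converge to those
    of the limit, while weak convergence gives their pairings with trigonometric polynomials the
    limit belonging to \<open>u0\<close>.\<close>
  have "u 0 = u0"
  proof (rule pairing_unique)
    show "solenoidal L (u 0)" by (rule N.sol_u) (use assms(4) in simp)
    show "solenoidal L u0" using assms(11) by (simp add: V_iff)
    fix e assume e: "e \<in> trig_poly L"
    have z: "0 \<in> {0..T}" using assms(4) by simp
    have "(\<lambda>n. pairing L (w (\<sigma> n) 0) e) \<longlonglongrightarrow> pairing L (u 0) e"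
      by (rule pairing_tendsto_trig[OF N.u_pt[OF z] e])
    moreover have "(\<lambda>n. pairing L (u0n n) e) \<longlonglongrightarrow> pairing L u0 e"
      using assms(12) trig_V[OF e] by (simp add: weakly_converges_V0_def)
    from LIMSEQ_subseq_LIMSEQ[OF this \<sigma>] have "(\<lambda>n. pairing L (w (\<sigma> n) 0) e) \<longlonglongrightarrow> pairing L u0 e"
      by (simp add: o_def w0)
    ultimately show "pairing L (u 0) e = pairing L u0 e" by (rule LIMSEQ_unique)
  qed
  moreover have "converges_L2_time L 0 T 0 (\<lambda>n. un (\<sigma> n)) u" "converges_C_time L 0 T (- s) (\<lambda>n. un (\<sigma> n)) u"
    using delay_limit_convergence[OF dl, of "\<lambda>n. un (\<sigma> n)" s] rep assms(5) by auto
  ultimately show ?thesis using \<sigma> N.ns_weak by blast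
qed

end
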